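(* Let $(X_t)_{t\in\mathbb Z}$ and $(Y_t)_{t\in\mathbb Z}$ be independent functional linear processes $$X_t=\sum_{j\in\mathbb Z}A_j(\varepsilon_{t-j}),\qquad Y_t=\sum_{j\in\mathbb Z}B_j(e_{t-j}),\qquad t\in\mathbb Z,$$ with values in $L^2_{\mathbb R}([0,1],\mu)$, where $(\varepsilon_t)_{t\in\mathbb Z}$ and $(e_t)_{t\in\mathbb Z}$ are two i.i.d. mean zero Gaussian processes with values in $L^2_{\mathbb R}([0,1],\mu)$ and covariance operators $C_\varepsilon$, $C_e$ having continuous covariance kernels $c_\varepsilon$, $c_e$, and where $(A_j)_{j\in\mathbb Z}$, $(B_j)_{j\in\mathbb Z}$ are sequences of bounded linear operators from $L^2_{\mathbb R}([0,1],\mu)$ to $L^2_{\mathbb R}([0,1],\mu)$ with $A_0=B_0$ the identity operator and $\sum_{j\in\mathbb Z}|j|(\|A_j\|_{\mathcal L}+\|B_j\|_{\mathcal L})<\infty$. Suppose that $X_1,\dots,X_T$ and $Y_1,\dots,Y_T$ are observed, and that (i) $b=b_T\sim T^{-\nu}$ for some $\nu\in(1/4,1/2)$; (ii) $W$ is bounded, symmetric, positive and Lipschitz continuous, has bounded support on $(-\pi,\pi]$ and satisfies $\int_{-\pi}^{\pi}W(x)\,dx=2\pi$. Then, under the alternative $\mathcal H_1$: $\mathcal F_{X,\lambda}\neq\mathcal F_{Y,\lambda}$ for all $\lambda\in A$, for some $A\subset[0,\pi]$ with $\mu(A)>0$, as $T\to\infty$, the studentized test statistic $t_{\mathcal U}=(\sqrt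 b\,T\,\mathcal U_T-b^{-1/2}\widehat\mu_0)/\widehat\theta_0$ satisfies $$t_{\mathcal U}=\sqrt b\,T\int_{-\pi}^{\pi}\|\mathcal F_{X,\lambda}-\mathcal F_{Y,\lambda}\|_{HS}^2\,d\lambda+o_P(\sqrt b\,T)\ \rightarrow\ +\infty\quad\text{in probability}.$$
   Context: $\mu$ is Lebesgue measure, $\|\cdot\|_{\mathcal L}$ the operator norm, $\|\cdot\|_{HS}$ the Hilbert-Schmidt norm. The operator induced by right integration with a kernel $f$ on $[0,1]^2$ is $g\mapsto\int_0^1 f(\cdot,\tau)g(\tau)\,d\tau$. "Positive" for $W$ (a function with bounded support) means taking nonnegative values. Spectral density operators: let $r_{X,t}(\sigma,\tau)=\mathrm E[X_t(\sigma)X_0(\tau)]$ be the autocovariance kernel at lag $t$. The spectral density kernel is $f_{X,\lambda}=\frac1{2\pi}\sum_{t\in\mathbb Z}e^{-i\lambda t}r_{X,t}$ (convergent in $L^2([0,1]^2)$), and $\mathcal F_{X,\lambda}$ is the operator induced by right integration of $f_{X,\lambda}$; analogously for $Y$. Estimators: $N=[(T-1)/2]$, $\lambda_t=2\pi t/T$ for $t\in\{-N,\dots,N\}$, $$\widehat p_{X,\lambda}(\sigma,\tau)=\frac1{2\pi T}\sum_{s_1,s_2=1}^T X_{s_1}(\sigma)X_{s_2}(\tau)\exp(-i\lambda(s_1-s_2)),\qquad \widehat f_{X,\lambda}(\sigma,\tau)=\frac1{bT}\sum_{t=-N}^N W\Big(\frac{\lambda-\lambda_t}{b}\Big)\widehat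 p_{X,\lambda_t}(\sigma,\tau),$$ $\widehat{\mathcal F}_{X,\lambda}$ is the operator induced by right integration with $\widehat f_{X,\lambda}$, and $\widehat f_{Y,\lambda}$, $\widehat{\mathcal F}_{Y,\lambda}$ are defined in the same way from $Y_1,\dots,Y_T$. The test statistic is $\mathcal U_T=\int_{-\pi}^{\pi}\|\widehat{\mathcal F}_{X,\lambda}-\widehat{\mathcal F}_{Y,\lambda}\|_{HS}^2\,d\lambda$. With the pooled estimator $\widehat{\mathcal F}_\lambda=\frac12\widehat{\mathcal F}_{X,\lambda}+\frac12\widehat{\mathcal F}_{Y,\lambda}$, $$\widehat\mu_0=\frac1\pi\int_{-\pi}^{\pi}\{\mathrm{trace}(\widehat{\mathcal F}_\lambda)\}^2\,d\lambda\int_{-\pi}^{\pi}W^2(u)\,du,$$ $$\widehat\theta_0^2=\frac4{\pi^2}\int_{-2\pi}^{2\pi}\Big\{\int_{-\pi}^{\pi}W(u)W(u-x)\,du\Big\}^2dx\int_{-\pi}^{\pi}\|\widehat{\mathcal F}_\lambda\|_{HS}^4\,d\lambda,\qquad \widehat\theta_0\ge0 .$$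
   Formalization: The leading term of the expansion is divided by θ₀, the formula for θ̂₀ evaluated at (F_X+F_Y)/2; as printed the expansion fails, since rescaling both innovation sequences leaves t_U unchanged but changes the leading term. The divergence to +∞ in probability is unchanged. *)

theory Defs
  imports "HOL-Probability.Probability"
begin

section \<open>The Hilbert spaces of square integrable functions on the unit cube\<close>

text \<open>For real arguments \<open>unit_cube\<close> is Lebesgue measure on \<open>[0,1]\<close>, for pairs of reals it is
  Lebesgue measure on the unit square. Using Borel instead of Lebesgue measurable functions does
  not change the space of equivalence classes.\<close>

definition unit_cube :: "'d::euclidean_space measure" where
  "unit_cube = restrict_space lborel (cbox 0 One)"

definition square_integrable :: "('d::euclidean_space \<Rightarrow> 'a::euclidean_space) \<Rightarrow> bool" where
  "square_integrable f \<longleftrightarrow>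
     f \<in> borel_measurable unit_cube \<and> integrable unit_cube (\<lambda>x. (norm (f x))\<^sup>2)"

definition L2_eq :: "('d::euclidean_space \<Rightarrow> 'a::euclidean_space) \<Rightarrow> ('d \<Rightarrow> 'a) \<Rightarrow> bool" where
  "L2_eq f g \<longleftrightarrow>
     square_integrable f \<and> square_integrable g \<and> (AE x in unit_cube. f x = g x)"

lemma square_integrable_zero: "square_integrable (\<lambda>_. 0)"
  by (simp add: square_integrable_def)

lemma square_integrable_scaleR:
  "square_integrable f \<Longrightarrow> square_integrable (\<lambda>x. c *\<^sub>R f x)"
  by (auto simp: square_integrable_def power_mult_distrib)

lemma square_integrable_uminus:
  "square_integrable f \<Longrightarrow> square_integrable (\<lambda>x. - f x)"
  using square_integrable_scaleR[of f "-1"] by simp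

lemma square_integrable_add:
  assumes "square_integrable f" "square_integrable g"
  shows "square_integrable (\<lambda>x. f x + g x)"
proof -
  have m [measurable]: "f \<in> borel_measurable unit_cube" "g \<in> borel_measurable unit_cube"
    using assms by (auto simp: square_integrable_def)
  have bound: "(norm (u + v))\<^sup>2 \<le> 2 * (norm u)\<^sup>2 + 2 * (norm v)\<^sup>2" for u v :: 'b
  proof -
    have "(norm (u + v))\<^sup>2 \<le> (norm u + norm v)\<^sup>2"
      by (intro power_mono norm_triangle_ineq) auto
    also have "\<dots> \<le> 2 * (norm u)\<^sup>2 + 2 * (norm v)\<^sup>2"
      using sum_squares_bound[of "norm u" "norm v"] by (simp add: power2_sum)
    finally show ?thesis .
  qed
  have "integrable unit_cube (\<lambda>x. 2 * (norm (f x))\<^sup>2 + 2 * (norm (g x))\<^sup>2)"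
    using assms by (auto simp: square_integrable_def)
  then have "integrable unit_cube (\<lambda>x. (norm (f x + g x))\<^sup>2)"
    by (rule Bochner_Integration.integrable_bound) (auto intro!: AE_I2 simp: bound)
  then show ?thesis
    by (auto simp: square_integrable_def)
qed

lemma square_integrable_diff:
  "square_integrable f \<Longrightarrow> square_integrable g \<Longrightarrow> square_integrable (\<lambda>x. f x - g x)"
  using square_integrable_add[of f "\<lambda>x. - g x"] square_integrable_uminus[of g] by simp

lemma integrable_inner_square_integrable:
  assumes "square_integrable f" "square_integrable g"
  shows "integrable unit_cube (\<lambda>x. f x \<bullet> g x)"
proof -
  have m [measurable]: "f \<in> borel_measurable unit_cube" "g \<in> borel_measurable unit_cube"
    using assms by (auto simp: square_integrable_def)
  have bound: "\<bar>u \<bullet> v\<bar> \<le> (norm u)\<^sup>2 + (norm v)\<^sup>2" for u v :: 'b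
  proof -
    have "\<bar>u \<bullet> v\<bar> \<le> norm u * norm v"
      by (rule Cauchy_Schwarz_ineq2)
    also have "\<dots> \<le> (norm u)\<^sup>2 + (norm v)\<^sup>2"
    proof -
      have "0 \<le> norm u * norm v" by simp
      with sum_squares_bound[of "norm u" "norm v"] show ?thesis by linarith
    qed
    finally show ?thesis .
  qed
  have "integrable unit_cube (\<lambda>x. (norm (f x))\<^sup>2 + (norm (g x))\<^sup>2)"
    using assms by (auto simp: square_integrable_def)
  then show ?thesis
    by (rule Bochner_Integration.integrable_bound) (auto intro!: AE_I2 simp: bound)
qed

quotient_type (overloaded) ('d, 'a) L2 = "'d::euclidean_space \<Rightarrow> 'a::euclidean_space" / partial: L2_eq
proof (rule part_equivpI)
  show "\<exists>f. L2_eq f f"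
    by (rule exI[of _ "\<lambda>_. 0"]) (simp add: L2_eq_def square_integrable_zero)
  show "symp L2_eq"
    by (auto simp: symp_def L2_eq_def)
  show "transp L2_eq"
    by (auto simp: transp_def L2_eq_def)
qed

instantiation L2 :: (euclidean_space, euclidean_space) real_inner
begin

lift_definition zero_L2 :: "('a, 'b) L2" is "\<lambda>_. 0"
  by (simp add: L2_eq_def square_integrable_zero)

lift_definition plus_L2 :: "('a, 'b) L2 \<Rightarrow> ('a, 'b) L2 \<Rightarrow> ('a, 'b) L2" is "\<lambda>f g x. f x + g x"
  by (auto simp: L2_eq_def intro: square_integrable_add)

lift_definition minus_L2 :: "('a, 'b) L2 \<Rightarrow> ('a, 'b) L2 \<Rightarrow> ('a, 'b) L2" is "\<lambda>f g x. f x - g x"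
  by (auto simp: L2_eq_def intro: square_integrable_diff)

lift_definition uminus_L2 :: "('a, 'b) L2 \<Rightarrow> ('a, 'b) L2" is "\<lambda>f x. - f x"
  by (auto simp: L2_eq_def intro: square_integrable_uminus)

lift_definition scaleR_L2 :: "real \<Rightarrow> ('a, 'b) L2 \<Rightarrow> ('a, 'b) L2" is "\<lambda>c f x. c *\<^sub>R f x"
  by (auto simp: L2_eq_def intro: square_integrable_scaleR)

lift_definition inner_L2 :: "('a, 'b) L2 \<Rightarrow> ('a, 'b) L2 \<Rightarrow> real"
  is "\<lambda>f g. LINT x|unit_cube. f x \<bullet> g x"
proof -
  fix f f' g g' :: "'a \<Rightarrow> 'b"
  assume "L2_eq f f'" "L2_eq g g'"
  then show "(LINT x|unit_cube. f x \<bullet> g x) = (LINT x|unit_cube. f' x \<bullet> g' x)"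
    by (intro integral_cong_AE) (auto simp: L2_eq_def square_integrable_def)
qed

definition norm_L2 :: "('a, 'b) L2 \<Rightarrow> real" where
  "norm_L2 f = sqrt (f \<bullet> f)"

definition dist_L2 :: "('a, 'b) L2 \<Rightarrow> ('a, 'b) L2 \<Rightarrow> real" where
  "dist_L2 f g = norm (f - g)"

definition sgn_L2 :: "('a, 'b) L2 \<Rightarrow> ('a, 'b) L2" where
  "sgn_L2 f = inverse (norm f) *\<^sub>R f"

definition uniformity_L2 :: "(('a, 'b) L2 \<times> ('a, 'b) L2) filter" where
  "uniformity_L2 = (INF e\<in>{0<..}. principal {(f, g). dist f g < e})"

definition open_L2 :: "('a, 'b) L2 set \<Rightarrow> bool" where
  "open_L2 S \<longleftrightarrow> (\<forall>f\<in>S. \<forall>\<^sub>F (f', g) in uniformity. f' = f \<longrightarrow> g \<in> S)"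

instance
proof
  fix f g h :: "('a, 'b) L2" and c d :: real and S :: "('a, 'b) L2 set"
  show "f + g + h = f + (g + h)" "f + g = g + f" "0 + f = f" "- f + f = 0" "f - g = f + - g"
    by (transfer; auto simp: L2_eq_def algebra_simps
          intro: square_integrable_add square_integrable_diff square_integrable_zero)+
  show "c *\<^sub>R (f + g) = c *\<^sub>R f + c *\<^sub>R g" "(c + d) *\<^sub>R f = c *\<^sub>R f + d *\<^sub>R f"
    "c *\<^sub>R d *\<^sub>R f = (c * d) *\<^sub>R f" "1 *\<^sub>R f = f"
    by (transfer; auto simp: L2_eq_def algebra_simps
          intro!: square_integrable_add square_integrable_scaleR)+
  show "dist f g = norm (f - g)" by (rule dist_L2_def)
  show "sgn f = inverse (norm f) *\<^sub>R f" by (rule sgn_L2_def)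
  show "uniformity = (INF e\<in>{0<..}. principal {(f, g::('a, 'b) L2). dist f g < e})"
    by (rule uniformity_L2_def)
  show "open S \<longleftrightarrow> (\<forall>f\<in>S. \<forall>\<^sub>F (f', g) in uniformity. f' = f \<longrightarrow> g \<in> S)"
    by (rule open_L2_def)
  show "norm f = sqrt (f \<bullet> f)" by (rule norm_L2_def)
  show "f \<bullet> g = g \<bullet> f"
    by transfer (simp add: inner_commute)
  show "(f + g) \<bullet> h = f \<bullet> h + g \<bullet> h"
    by transfer (simp add: L2_eq_def inner_add_left integrable_inner_square_integrable)
  show "(c *\<^sub>R f) \<bullet> g = c * (f \<bullet> g)"
    by transfer simp
  show "0 \<le> f \<bullet> f"
    by transfer simp
  show "f \<bullet> f = 0 \<longleftrightarrow> f = 0"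
  proof transfer
    fix f :: "'a \<Rightarrow> 'b"
    assume "L2_eq f f"
    then have "square_integrable f"
      by (simp add: L2_eq_def)
    moreover from this have "(LINT x|unit_cube. f x \<bullet> f x) = 0 \<longleftrightarrow> (AE x in unit_cube. f x \<bullet> f x = 0)"
      by (intro integral_nonneg_eq_0_iff_AE integrable_inner_square_integrable) auto
    ultimately show "(LINT x|unit_cube. f x \<bullet> f x) = 0 \<longleftrightarrow> L2_eq f (\<lambda>_. 0)"
      by (simp add: L2_eq_def square_integrable_zero)
  qed
qed

end

type_synonym real_L2 = "(real, real) L2"
type_synonym complex_L2 = "(real, complex) L2"

text \<open>The instance above makes \<open>complex_L2\<close> a real Hilbert space; \<open>cinner\<close> is its Hermitian inner
  product, which induces the same norm.\<close>

definition cinner :: "complex_L2 \<Rightarrow> complex_L2 \<Rightarrow> complex" where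
  "cinner g h = (LINT x|unit_cube. rep_L2 g x * cnj (rep_L2 h x))"


section \<open>Integral operators, Hilbert-Schmidt norm and trace\<close>

definition integral_op ::
  "(real \<times> real \<Rightarrow> 'a::{real_normed_field,euclidean_space}) \<Rightarrow> (real, 'a) L2 \<Rightarrow> (real, 'a) L2" where
  "integral_op k g = abs_L2 (\<lambda>\<sigma>. LINT \<tau>|unit_cube. k (\<sigma>, \<tau>) * rep_L2 g \<tau>)"

definition orthonormal_basis :: "(nat \<Rightarrow> complex_L2) \<Rightarrow> bool" where
  "orthonormal_basis e \<longleftrightarrow>
     (\<forall>m n. cinner (e m) (e n) = (if m = n then 1 else 0)) \<and>
     (\<forall>g. (\<forall>n. cinner g (e n) = 0) \<longrightarrow> g = 0)"

text \<open>The Hilbert-Schmidt norm and the trace do not depend on the orthonormal basis, so an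
  arbitrary one is fixed.\<close>

definition some_basis :: "nat \<Rightarrow> complex_L2" where
  "some_basis = (SOME e. orthonormal_basis e)"

definition hs_norm :: "(complex_L2 \<Rightarrow> complex_L2) \<Rightarrow> real" where
  "hs_norm K = sqrt (\<Sum>\<^sub>\<infinity>n\<in>UNIV. (norm (K (some_basis n)))\<^sup>2)"

definition op_trace :: "(complex_L2 \<Rightarrow> complex_L2) \<Rightarrow> complex" where
  "op_trace K = (\<Sum>\<^sub>\<infinity>n\<in>UNIV. cinner (K (some_basis n)) (some_basis n))"


section \<open>Random elements\<close>

definition normal_law :: "real \<Rightarrow> real \<Rightarrow> real measure" where
  "normal_law m s = (if s = 0 then return borel m else density lborel (normal_density m s))"

definition gaussian_element :: "'w measure \<Rightarrow> ('w \<Rightarrow> real_L2) \<Rightarrow> bool" where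
  "gaussian_element M Z \<longleftrightarrow>
     Z \<in> borel_measurable M \<and>
     (\<forall>g. \<exists>m s. s \<ge> 0 \<and> distr M borel (\<lambda>\<omega>. Z \<omega> \<bullet> g) = normal_law m s)"

definition mean_zero :: "'w measure \<Rightarrow> ('w \<Rightarrow> real_L2) \<Rightarrow> bool" where
  "mean_zero M Z \<longleftrightarrow>
     (\<forall>g. integrable M (\<lambda>\<omega>. Z \<omega> \<bullet> g) \<and> (LINT \<omega>|M. Z \<omega> \<bullet> g) = 0)"

text \<open>Covariance operator of a mean zero element.\<close>

definition covariance_operator ::
  "'w measure \<Rightarrow> ('w \<Rightarrow> real_L2) \<Rightarrow> (real_L2 \<Rightarrow>\<^sub>L real_L2) \<Rightarrow> bool" where
  "covariance_operator M Z C \<longleftrightarrow>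
     (\<forall>g h. integrable M (\<lambda>\<omega>. (Z \<omega> \<bullet> g) * (Z \<omega> \<bullet> h)) \<and>
            blinfun_apply C g \<bullet> h = (LINT \<omega>|M. (Z \<omega> \<bullet> g) * (Z \<omega> \<bullet> h)))"

text \<open>An i.i.d. mean zero Gaussian sequence with covariance operator \<open>C\<close>, which is an integral
  operator with continuous kernel \<open>c\<close>.\<close>

definition gaussian_white_noise ::
  "'w measure \<Rightarrow> (int \<Rightarrow> 'w \<Rightarrow> real_L2) \<Rightarrow> (real_L2 \<Rightarrow>\<^sub>L real_L2) \<Rightarrow> (real \<times> real \<Rightarrow> real) \<Rightarrow> bool" where
  "gaussian_white_noise M \<epsilon> C c \<longleftrightarrow>
     prob_space.indep_vars M (\<lambda>_. borel) \<epsilon> UNIV \<and>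
     (\<forall>s t. distr M borel (\<epsilon> s) = distr M borel (\<epsilon> t)) \<and>
     (\<forall>t. gaussian_element M (\<epsilon> t) \<and> mean_zero M (\<epsilon> t) \<and> covariance_operator M (\<epsilon> t) C) \<and>
     continuous_on ({0..1} \<times> {0..1}) c \<and>
     blinfun_apply C = integral_op c"

text \<open>A process with values in \<open>real_L2\<close> is given by jointly measurable functions
  \<open>(\<omega>, \<sigma>) \<mapsto> X t \<omega> \<sigma>\<close>, so that the point values \<open>X\<^sub>t(\<sigma>)\<close> are random variables; the random element
  itself is \<open>abs_L2 (X t \<omega>)\<close>. Every random element of \<open>real_L2\<close> has such a version, and versions
  only differ on a null set. Choosing representatives of the classes separately for each \<open>\<omega>\<close>
  would not give measurable point values.\<close>

definition L2_process :: "'w measure \<Rightarrow> (int \<Rightarrow> 'w \<Rightarrow> real \<Rightarrow> real) \<Rightarrow> bool" where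
  "L2_process M X \<longleftrightarrow>
     (\<forall>t. (\<lambda>(\<omega>, \<sigma>). X t \<omega> \<sigma>) \<in> borel_measurable (M \<Otimes>\<^sub>M unit_cube) \<and>
          (\<forall>\<omega>\<in>space M. square_integrable (X t \<omega>)))"

definition linear_process ::
  "'w measure \<Rightarrow> (int \<Rightarrow> real_L2 \<Rightarrow>\<^sub>L real_L2) \<Rightarrow> (int \<Rightarrow> 'w \<Rightarrow> real_L2) \<Rightarrow>
   (int \<Rightarrow> 'w \<Rightarrow> real \<Rightarrow> real) \<Rightarrow> bool" where
  "linear_process M A \<epsilon> X \<longleftrightarrow>
     L2_process M X \<and>
     (\<forall>t. AE \<omega> in M. ((\<lambda>j. blinfun_apply (A j) (\<epsilon> (t - j) \<omega>)) has_sum abs_L2 (X t \<omega>)) UNIV)"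

definition independent_processes ::
  "'w measure \<Rightarrow> (int \<Rightarrow> 'w \<Rightarrow> real \<Rightarrow> real) \<Rightarrow> (int \<Rightarrow> 'w \<Rightarrow> real \<Rightarrow> real) \<Rightarrow> bool" where
  "independent_processes M X Y \<longleftrightarrow>
     prob_space.indep_var M
       (PiM UNIV (\<lambda>_. borel)) (\<lambda>\<omega> t. abs_L2 (X t \<omega>) :: real_L2)
       (PiM UNIV (\<lambda>_. borel)) (\<lambda>\<omega> t. abs_L2 (Y t \<omega>) :: real_L2)"


section \<open>Spectral density operators\<close>

definition autocov_kernel ::
  "'w measure \<Rightarrow> (int \<Rightarrow> 'w \<Rightarrow> real \<Rightarrow> real) \<Rightarrow> int \<Rightarrow> real \<Rightarrow> real \<Rightarrow> real" where
  "autocov_kernel M X t \<sigma> \<tau> = (LINT \<omega>|M. X t \<omega> \<sigma> * X 0 \<omega> \<tau>)"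

definition spectral_density_kernel ::
  "'w measure \<Rightarrow> (int \<Rightarrow> 'w \<Rightarrow> real \<Rightarrow> real) \<Rightarrow> real \<Rightarrow> (real \<times> real, complex) L2" where
  "spectral_density_kernel M X \<xi> =
     (1 / (2 * pi)) *\<^sub>R
       (\<Sum>\<^sub>\<infinity>t\<in>UNIV. abs_L2 (\<lambda>(\<sigma>, \<tau>). cis (- \<xi> * of_int t) * of_real (autocov_kernel M X t \<sigma> \<tau>)))"

definition spectral_density_op ::
  "'w measure \<Rightarrow> (int \<Rightarrow> 'w \<Rightarrow> real \<Rightarrow> real) \<Rightarrow> real \<Rightarrow> complex_L2 \<Rightarrow> complex_L2" where
  "spectral_density_op M X \<xi> = integral_op (rep_L2 (spectral_density_kernel M X \<xi>))"


section \<open>Estimators\<close>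

text \<open>The estimators are functions of a path \<open>x\<close>, of which only \<open>x 1, \<dots>, x T\<close> are used.\<close>

definition fourier_freq :: "nat \<Rightarrow> int \<Rightarrow> real" where
  "fourier_freq T t = 2 * pi * of_int t / real T"

definition periodogram_kernel :: "nat \<Rightarrow> (int \<Rightarrow> real \<Rightarrow> real) \<Rightarrow> real \<Rightarrow> real \<times> real \<Rightarrow> complex" where
  "periodogram_kernel T x \<xi> = (\<lambda>(\<sigma>, \<tau>).
     1 / (2 * pi * real T) *
       (\<Sum>s1 = 1..int T. \<Sum>s2 = 1..int T.
          of_real (x s1 \<sigma> * x s2 \<tau>) * cis (- \<xi> * of_int (s1 - s2))))"

definition spectral_estimator_kernel ::
  "(real \<Rightarrow> real) \<Rightarrow> real \<Rightarrow> nat \<Rightarrow> (int \<Rightarrow> real \<Rightarrow> real) \<Rightarrow> real \<Rightarrow> real \<times> real \<Rightarrow> complex" where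
  "spectral_estimator_kernel W b T x \<xi> = (\<lambda>st.
     (let N = (int T - 1) div 2 in
       1 / (b * real T) *
         (\<Sum>t = -N..N. W ((\<xi> - fourier_freq T t) / b) * periodogram_kernel T x (fourier_freq T t) st)))"

definition spectral_estimator_op ::
  "(real \<Rightarrow> real) \<Rightarrow> real \<Rightarrow> nat \<Rightarrow> (int \<Rightarrow> real \<Rightarrow> real) \<Rightarrow> real \<Rightarrow> complex_L2 \<Rightarrow> complex_L2" where
  "spectral_estimator_op W b T x \<xi> = integral_op (spectral_estimator_kernel W b T x \<xi>)"

definition op_diff ::
  "(complex_L2 \<Rightarrow> complex_L2) \<Rightarrow> (complex_L2 \<Rightarrow> complex_L2) \<Rightarrow> complex_L2 \<Rightarrow> complex_L2" where
  "op_diff F G g = F g - G g"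

definition op_average ::
  "(complex_L2 \<Rightarrow> complex_L2) \<Rightarrow> (complex_L2 \<Rightarrow> complex_L2) \<Rightarrow> complex_L2 \<Rightarrow> complex_L2" where
  "op_average F G g = (1/2) *\<^sub>R F g + (1/2) *\<^sub>R G g"

definition integrated_hs_distance ::
  "(real \<Rightarrow> complex_L2 \<Rightarrow> complex_L2) \<Rightarrow> (real \<Rightarrow> complex_L2 \<Rightarrow> complex_L2) \<Rightarrow> real" where
  "integrated_hs_distance F G = (LBINT \<xi>:{-pi..pi}. (hs_norm (op_diff (F \<xi>) (G \<xi>)))\<^sup>2)"

text \<open>In \<open>centering\<close> the operators are estimated spectral density operators. These are Hermitian
  and nonnegative, so their trace is real.\<close>

definition centering :: "(real \<Rightarrow> real) \<Rightarrow> (real \<Rightarrow> complex_L2 \<Rightarrow> complex_L2) \<Rightarrow> real" where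
  "centering W F =
     1 / pi * (LBINT \<xi>:{-pi..pi}. (Re (op_trace (F \<xi>)))\<^sup>2) * (LBINT u:{-pi..pi}. (W u)\<^sup>2)"

text \<open>At the pooled estimator, \<open>scaling\<close> is the studentizing factor; at the average of the two
  spectral density operators it is the limit of that factor in probability.\<close>

definition scaling :: "(real \<Rightarrow> real) \<Rightarrow> (real \<Rightarrow> complex_L2 \<Rightarrow> complex_L2) \<Rightarrow> real" where
  "scaling W F =
     sqrt (4 / pi\<^sup>2 * (LBINT x:{-2*pi..2*pi}. (LBINT u:{-pi..pi}. W u * W (u - x))\<^sup>2) *
       (LBINT \<xi>:{-pi..pi}. (hs_norm (F \<xi>)) ^ 4))"

definition test_statistic ::
  "(real \<Rightarrow> real) \<Rightarrow> real \<Rightarrow> nat \<Rightarrow> (int \<Rightarrow> real \<Rightarrow> real) \<Rightarrow> (int \<Rightarrow> real \<Rightarrow> real) \<Rightarrow> real" where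
  "test_statistic W b T x y =
     integrated_hs_distance (spectral_estimator_op W b T x) (spectral_estimator_op W b T y)"

definition studentized_statistic ::
  "(real \<Rightarrow> real) \<Rightarrow> real \<Rightarrow> nat \<Rightarrow> (int \<Rightarrow> real \<Rightarrow> real) \<Rightarrow> (int \<Rightarrow> real \<Rightarrow> real) \<Rightarrow> real" where
  "studentized_statistic W b T x y =
     (let pooled = (\<lambda>\<xi>. op_average (spectral_estimator_op W b T x \<xi>)
                                   (spectral_estimator_op W b T y \<xi>))
      in (sqrt b * real T * test_statistic W b T x y - b powr (-1/2) * centering W pooled)
           / scaling W pooled)"


section \<open>Stochastic convergence\<close>

definition small_o_prob :: "'w measure \<Rightarrow> (nat \<Rightarrow> 'w \<Rightarrow> real) \<Rightarrow> (nat \<Rightarrow> real) \<Rightarrow> bool" where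
  "small_o_prob M Z a \<longleftrightarrow>
     (\<forall>n. Z n \<in> borel_measurable M) \<and>
     (\<forall>\<delta>>0. (\<lambda>n. measure M {\<omega> \<in> space M. \<bar>Z n \<omega> / a n\<bar> > \<delta>}) \<longlonglongrightarrow> 0)"

definition tends_to_infinity_prob :: "'w measure \<Rightarrow> (nat \<Rightarrow> 'w \<Rightarrow> real) \<Rightarrow> bool" where
  "tends_to_infinity_prob M Z \<longleftrightarrow>
     (\<forall>n. Z n \<in> borel_measurable M) \<and>
     (\<forall>K. (\<lambda>n. measure M {\<omega> \<in> space M. Z n \<omega> > K}) \<longlonglongrightarrow> 1)"

end

theory Submission
  imports Defs
begin

text \<open>
  Let \<open>f\<^sub>X\<close>, \<open>f\<^sub>Y\<close> be the spectral density kernels, viewed as elements of \<open>L\<^sup>2\<close> of the square. The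
  estimator is a quadratic form in \<open>X\<^sub>1, \<dots>, X\<^sub>T\<close> whose coefficients are lag weights, the discrete Fourier
  transform of the smoothing weights. Expanding \<open>X\<^sub>t\<close> into the noise, the centered tensors
  \<open>\<epsilon>\<^sub>p \<otimes> \<epsilon>\<^sub>q\<close> are nearly orthogonal, so the mean deviation of the estimator from its expectation is
  \<open>O((bT)\<^sup>-\<^sup>1\<^sup>/\<^sup>2)\<close> by Parseval for the lag weights; the expectation converges because the lag weights are
  bounded and tend to \<open>exp (- i \<xi> h)\<close> for every \<open>\<xi>\<close> in \<open>(- \<pi>, \<pi>)\<close>. Gaussian moment bounds, uniform in \<open>T\<close> and
  \<open>\<xi>\<close>, upgrade this to convergence to \<open>0\<close> of the expected integrals of the first and fourth powers of the error.
  By Markov's inequality the integrated squared distance and the integrated fourth power in the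
  studentizing factor converge in probability, and the centering divided by \<open>b T\<close> tends to \<open>0\<close>.

  The limit of the studentizing factor is positive: the estimators are nonnegative combinations of
  periodograms, hence have nonnegative inner products, so \<open>f\<^sub>X \<bullet> f\<^sub>Y \<ge> 0\<close> and
  \<open>\<parallel>f\<^sub>X + f\<^sub>Y\<parallel> \<ge> \<parallel>f\<^sub>X - f\<^sub>Y\<parallel>\<close>.
\<close>

section \<open>The spaces L2 are separable Hilbert spaces\<close>

text \<open>Gaussianity is given only through the laws of inner products with fixed vectors, so no
  moment of the norm is available at the start. A Parseval frame expresses the norm by such inner
  products, and one constant, \<open>noise_trace\<close>, then bounds every even moment of every
  finite linear combination of the noise in terms of the sum of its squared coefficients. This is
  why the moments of a periodogram do not grow with \<open>T\<close>: its cosine and sine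
  coefficients have square sums at most \<open>T\<close>, which the normalisation removes. The mean
  error converges frequency by frequency, but the studentizing factor contains fourth powers; a
  uniform fifth moment bridges the gap. Convergence fails to be available at the end points -\<pi>
  and \<pi>, where the Fourier frequencies lie on one side only, but these form a null set. Divided
  by \<open>sqrt b * T\<close>, the statistic is a continuous function of three quantities, the
  integrated distance, the centering divided by \<open>b * T\<close> and the quartic integral, near
  a point where the last one is positive.\<close>

lemma space_unit_cube [simp]: "space unit_cube = cbox 0 One"
  by (simp add: unit_cube_def space_restrict_space)

lemma emeasure_unit_cube_space [simp]: "emeasure (unit_cube :: 'd::euclidean_space measure) (cbox 0 One) = 1"
  by (simp add: unit_cube_def emeasure_restrict_space emeasure_lborel_cbox_eq)

lemma prob_space_unit_cube: "prob_space (unit_cube :: 'd::euclidean_space measure)"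
  by standard simp

interpretation unit_cube: prob_space "unit_cube :: 'd::euclidean_space measure"
  by (rule prob_space_unit_cube)

lemma borel_measurable_unit_cube: "f \<in> borel_measurable borel \<Longrightarrow> f \<in> borel_measurable unit_cube"
  by (simp add: unit_cube_def measurable_restrict_space1)

lemma square_integrable_measurable: "square_integrable f \<Longrightarrow> f \<in> borel_measurable unit_cube"
  by (simp add: square_integrable_def)

lemma square_integrable_bounded:
  assumes "f \<in> borel_measurable unit_cube" "\<And>x. norm (f x) \<le> B"
  shows "square_integrable f"
proof -
  have "(norm (f x))\<^sup>2 \<le> B\<^sup>2" for x
    by (intro power_mono assms) auto
  then show ?thesis
    unfolding square_integrable_def using assms(1)
    by (auto intro!: unit_cube.integrable_const_bound[of _ "B\<^sup>2"])
qed

lemma L2_eq_refl_iff: "L2_eq f f \<longleftrightarrow> square_integrable f"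
  by (simp add: L2_eq_def)

lemma square_integrable_rep: "square_integrable (rep_L2 f)"
  using Quotient3_rep_reflp[OF Quotient3_L2, of f] by (simp add: L2_eq_refl_iff)

lemma measurable_rep [measurable]: "rep_L2 f \<in> borel_measurable unit_cube"
  by (rule square_integrable_measurable[OF square_integrable_rep])

lemma abs_rep_L2 [simp]: "abs_L2 (rep_L2 f) = f"
  by (rule Quotient3_abs_rep[OF Quotient3_L2])

lemma rep_abs_L2: "square_integrable f \<Longrightarrow> AE x in unit_cube. rep_L2 (abs_L2 f) x = f x"
  using rep_abs_rsp_left[OF Quotient3_L2, of f f] by (simp add: L2_eq_def)

lemma abs_L2_eqI:
  "square_integrable f \<Longrightarrow> square_integrable g \<Longrightarrow> AE x in unit_cube. f x = g x \<Longrightarrow> abs_L2 f = abs_L2 g"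
  by (rule Quotient3_rel_abs[OF Quotient3_L2]) (simp add: L2_eq_def)

lemma inner_abs_L2:
  "square_integrable f \<Longrightarrow> square_integrable g \<Longrightarrow>
    abs_L2 f \<bullet> abs_L2 g = (LINT x|unit_cube. f x \<bullet> g x)"
  by (subst inner_L2.abs_eq) (auto simp: L2_eq_refl_iff)

lemma norm_abs_L2: "square_integrable f \<Longrightarrow> (norm (abs_L2 f))\<^sup>2 = (LINT x|unit_cube. (norm (f x))\<^sup>2)"
  by (simp add: power2_norm_eq_inner inner_abs_L2)

lemma add_abs_L2: "square_integrable f \<Longrightarrow> square_integrable g \<Longrightarrow> abs_L2 f + abs_L2 g = abs_L2 (\<lambda>x. f x + g x)"
  by (subst plus_L2.abs_eq) (auto simp: L2_eq_refl_iff)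

lemma diff_abs_L2: "square_integrable f \<Longrightarrow> square_integrable g \<Longrightarrow> abs_L2 f - abs_L2 g = abs_L2 (\<lambda>x. f x - g x)"
  by (subst minus_L2.abs_eq) (auto simp: L2_eq_refl_iff)

lemma scaleR_abs_L2: "square_integrable f \<Longrightarrow> c *\<^sub>R abs_L2 f = abs_L2 (\<lambda>x. c *\<^sub>R f x)"
  by (subst scaleR_L2.abs_eq) (auto simp: L2_eq_refl_iff)

lemma inner_rep_L2: "f \<bullet> g = (LINT x|unit_cube. rep_L2 f x \<bullet> rep_L2 g x)"
  using inner_abs_L2[OF square_integrable_rep square_integrable_rep, of f g] by simp

lemma norm_rep_L2: "(norm f)\<^sup>2 = (LINT x|unit_cube. (norm (rep_L2 f x))\<^sup>2)"
  using norm_abs_L2[OF square_integrable_rep, of f] by simp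

lemma rep_diff_L2: "AE x in unit_cube. rep_L2 (f - g) x = rep_L2 f x - rep_L2 g x"
  using rep_abs_L2[OF square_integrable_diff[OF square_integrable_rep[of f] square_integrable_rep[of g]]]
    diff_abs_L2[OF square_integrable_rep[of f] square_integrable_rep[of g]] by simp

lemma nn_integral_norm_rep_L2: "(\<integral>\<^sup>+x. ennreal ((norm (rep_L2 f x))\<^sup>2) \<partial>unit_cube) = ennreal ((norm f)\<^sup>2)"
  using square_integrable_rep[of f]
  by (subst nn_integral_eq_integral) (auto simp: norm_rep_L2 square_integrable_def)

section \<open>Integrability and completeness\<close>

lemma square_integrable_imp_integrable:
  fixes f :: "'d::euclidean_space \<Rightarrow> 'a::euclidean_space"
  assumes "square_integrable f" shows "integrable unit_cube f"
proof (rule Bochner_Integration.integrable_bound)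
  show "integrable unit_cube (\<lambda>x. 1 + (norm (f x))\<^sup>2)"
    using assms by (auto simp: square_integrable_def)
  have "norm y \<le> 1 + (norm y)\<^sup>2" for y :: 'a
    using sum_squares_bound[of "norm y" 1] norm_ge_zero[of y] by (simp only: power_one mult_1_right)
  then show "AE x in unit_cube. norm (f x) \<le> norm (1 + (norm (f x))\<^sup>2)"
    by (auto intro!: AE_I2 simp: abs_of_nonneg)
qed (use assms in \<open>auto simp: square_integrable_def\<close>)

text \<open>Cauchy-Schwarz against the constant function 1, which has norm 1 because
  \<open>unit_cube\<close> is a probability measure.\<close>

lemma integral_norm_rep_le: "(LINT x|unit_cube. norm (rep_L2 f x)) \<le> norm f"
proof -
  let ?g = "\<lambda>x. norm (rep_L2 f x)"
  have sq: "square_integrable ?g" "square_integrable (\<lambda>x. 1::real)"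
    using square_integrable_rep[of f] by (auto simp: square_integrable_def)
  have "(LINT x|unit_cube. ?g x) = abs_L2 ?g \<bullet> abs_L2 (\<lambda>x. 1)"
    by (simp add: inner_abs_L2 sq)
  also have "\<dots> \<le> norm (abs_L2 ?g) * norm (abs_L2 (\<lambda>x::'a. 1::real))"
    by (rule norm_cauchy_schwarz)
  also have "(norm (abs_L2 (\<lambda>x::'a. 1::real)))\<^sup>2 = 1"
    using sq by (subst norm_abs_L2) (auto simp: unit_cube.prob_space[simplified])
  then have "norm (abs_L2 (\<lambda>x::'a. 1::real)) = 1"
    by (metis norm_ge_zero power2_eq_1_iff abs_of_nonneg abs_minus_cancel abs_1)
  also have "(norm (abs_L2 ?g))\<^sup>2 = (norm f)\<^sup>2"
    using sq by (subst norm_abs_L2) (auto simp: norm_rep_L2)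
  then have "norm (abs_L2 ?g) = norm f"
    by (simp add: power2_eq_iff_nonneg)
  finally show ?thesis by simp
qed

text \<open>Riesz-Fischer. Along indices where consecutive distances are below
  \<open>(1/2)^k\<close> the L1 norms of the increments are summable, so the representatives
  converge almost everywhere; Fatou's lemma then bounds the L2 distance from the pointwise limit to
  the whole sequence. Completeness is what makes projections, infinite sums and Bochner integrals
  available.\<close>

instance L2 :: (euclidean_space, euclidean_space) complete_space
proof
  fix X :: "nat \<Rightarrow> ('a, 'b) L2"
  assume C: "Cauchy X"
  have "\<exists>N. \<forall>m\<ge>N. \<forall>n\<ge>N. norm (X m - X n) < (1/2)^k" for k :: nat
    using C unfolding Cauchy_def dist_norm by (auto simp: zero_less_power)
  then obtain N where N: "\<And>k m n. m \<ge> N k \<Longrightarrow> n \<ge> N k \<Longrightarrow> norm (X m - X n) < (1/2)^k" by metis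
  \<comment> \<open>Summing the thresholds makes \<open>r m\<close> at least \<open>N k\<close> for
    every \<open>k \<le> m\<close> without \<open>N\<close> being monotone.\<close>
  define r where "r k = (\<Sum>j\<le>k. N j) + k" for k
  have rN: "r k \<ge> N k" "r (Suc k) \<ge> N k" for k
    unfolding r_def using member_le_sum[of k "{..k}" N] by auto
  define F where "F k = rep_L2 (X (r k))" for k
  have [measurable]: "F k \<in> borel_measurable unit_cube" for k by (simp add: F_def)
  have "(\<integral>\<^sup>+x. (\<Sum>k. ennreal (norm (F (Suc k) x - F k x))) \<partial>unit_cube)
      = (\<Sum>k. \<integral>\<^sup>+x. ennreal (norm (F (Suc k) x - F k x)) \<partial>unit_cube)"
    by (rule nn_integral_suminf) simp
  also have "\<dots> \<le> (\<Sum>k. ennreal ((1/2)^k))"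
  proof (intro suminf_le allI)
    fix k
    have "(\<integral>\<^sup>+x. ennreal (norm (F (Suc k) x - F k x)) \<partial>unit_cube)
       = (\<integral>\<^sup>+x. ennreal (norm (rep_L2 (X (r (Suc k)) - X (r k)) x)) \<partial>unit_cube)"
      by (intro nn_integral_cong_AE) (use rep_diff_L2[of "X (r (Suc k))" "X (r k)"] in \<open>auto simp: F_def\<close>)
    also have "\<dots> = ennreal (LINT x|unit_cube. norm (rep_L2 (X (r (Suc k)) - X (r k)) x))"
      by (intro nn_integral_eq_integral integrable_norm square_integrable_imp_integrable square_integrable_rep) auto
    also have "\<dots> \<le> ennreal ((1/2)^k)"
      using integral_norm_rep_le[of "X (r (Suc k)) - X (r k)"] N[OF rN(2) rN(1), of k]
      by (intro ennreal_leI) linarith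
    finally show "(\<integral>\<^sup>+x. ennreal (norm (F (Suc k) x - F k x)) \<partial>unit_cube) \<le> ennreal ((1/2)^k)" .
  qed auto
  also have "\<dots> = ennreal (\<Sum>k. (1/2)^k)"
    by (intro suminf_ennreal2) (auto simp: summable_geometric)
  finally have "(\<integral>\<^sup>+x. (\<Sum>k. ennreal (norm (F (Suc k) x - F k x))) \<partial>unit_cube) \<noteq> \<infinity>"
    using ennreal_less_top neq_top_trans infinity_ennreal_def by (metis less_top)
  then have "AE x in unit_cube. (\<Sum>k. ennreal (norm (F (Suc k) x - F k x))) \<noteq> \<infinity>"
    by (intro nn_integral_PInf_AE) auto
  then have conv: "AE x in unit_cube. (\<lambda>k. F k x) \<longlonglongrightarrow> lim (\<lambda>k. F k x)"
  proof eventually_elim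
    case (elim x)
    then have "summable (\<lambda>k. norm (F (Suc k) x - F k x))"
      by (intro summable_suminf_not_top) auto
    then have "summable (\<lambda>k. F (Suc k) x - F k x)"
      by (rule summable_norm_cancel)
    then have "convergent (\<lambda>n. F n x - F 0 x)"
      unfolding summable_iff_convergent sum_lessThan_telescope[of "\<lambda>k. F k x"] .
    then have "convergent (\<lambda>n. (F n x - F 0 x) + F 0 x)"
      by (intro convergent_add convergent_const)
    then show ?case by (simp add: convergent_LIMSEQ_iff)
  qed
  define f where "f x = lim (\<lambda>k. F k x)" for x
  have [measurable]: "f \<in> borel_measurable unit_cube"
    unfolding f_def by (rule borel_measurable_lim_metric) auto
  \<comment> \<open>The bound holds for the approximants \<open>F m\<close> with
    \<open>m \<ge> k\<close>, since then \<open>r m \<ge> N k\<close>, and Fatou's lemma carries it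
    to the limit.\<close>
  have fatou: "(\<integral>\<^sup>+x. ennreal ((norm (f x - rep_L2 (X n) x))\<^sup>2) \<partial>unit_cube) \<le> ennreal (((1/2)^k)\<^sup>2)"
    if n: "n \<ge> N k" for n k
  proof -
    have "(\<integral>\<^sup>+x. ennreal ((norm (f x - rep_L2 (X n) x))\<^sup>2) \<partial>unit_cube)
      = (\<integral>\<^sup>+x. liminf (\<lambda>m. ennreal ((norm (F m x - rep_L2 (X n) x))\<^sup>2)) \<partial>unit_cube)"
    proof (rule nn_integral_cong_AE, use conv in eventually_elim)
      case (elim x)
      have "(\<lambda>m. ennreal ((norm (F m x - rep_L2 (X n) x))\<^sup>2)) \<longlonglongrightarrow> ennreal ((norm (f x - rep_L2 (X n) x))\<^sup>2)"
        using elim unfolding f_def by (intro tendsto_intros)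
      then show ?case by (subst lim_imp_Liminf) (auto simp del: tendsto_ennreal_iff)
    qed
    also have "\<dots> \<le> liminf (\<lambda>m. \<integral>\<^sup>+x. ennreal ((norm (F m x - rep_L2 (X n) x))\<^sup>2) \<partial>unit_cube)"
      by (rule nn_integral_liminf) auto
    also have "\<dots> \<le> ennreal (((1/2)^k)\<^sup>2)"
    proof (rule Liminf_le)
      show "\<forall>\<^sub>F m in sequentially. (\<integral>\<^sup>+x. ennreal ((norm (F m x - rep_L2 (X n) x))\<^sup>2) \<partial>unit_cube) \<le> ennreal (((1/2)^k)\<^sup>2)"
        using eventually_ge_at_top[of k]
      proof eventually_elim
        case (elim m)
        have "r m \<ge> N k" unfolding r_def using member_le_sum[of k "{..m}" N] elim by auto
        then have le: "norm (X (r m) - X n) < (1/2)^k" using N n by blast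
        have "(\<integral>\<^sup>+x. ennreal ((norm (F m x - rep_L2 (X n) x))\<^sup>2) \<partial>unit_cube)
          = (\<integral>\<^sup>+x. ennreal ((norm (rep_L2 (X (r m) - X n) x))\<^sup>2) \<partial>unit_cube)"
          by (intro nn_integral_cong_AE) (use rep_diff_L2[of "X (r m)" "X n"] in \<open>auto simp: F_def\<close>)
        also have "\<dots> = ennreal ((norm (X (r m) - X n))\<^sup>2)" by (rule nn_integral_norm_rep_L2)
        also have "\<dots> \<le> ennreal (((1/2)^k)\<^sup>2)"
          using le by (intro ennreal_leI power_mono) auto
        finally show ?case .
      qed
    qed simp
    finally show ?thesis .
  qed
  have sqd: "square_integrable (\<lambda>x. f x - rep_L2 (X n) x)" if "n \<ge> N k" for n k
    unfolding square_integrable_def using fatou[OF that]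
    by (auto intro!: integrableI_bounded simp: less_top[symmetric] top_unique)
  have "square_integrable (\<lambda>x. (f x - rep_L2 (X (N 0)) x) + rep_L2 (X (N 0)) x)"
    by (intro square_integrable_add square_integrable_rep sqd[of 0]) simp
  then have sqf: "square_integrable f" by simp
  have dist: "norm (abs_L2 f - X n) \<le> (1/2)^k" if "n \<ge> N k" for n k
  proof -
    have "abs_L2 f - X n = abs_L2 (\<lambda>x. f x - rep_L2 (X n) x)"
      using diff_abs_L2[OF sqf square_integrable_rep[of "X n"]] by simp
    then have "ennreal ((norm (abs_L2 f - X n))\<^sup>2) = (\<integral>\<^sup>+x. ennreal ((norm (f x - rep_L2 (X n) x))\<^sup>2) \<partial>unit_cube)"
      using sqd[OF that] by (subst nn_integral_eq_integral) (auto simp: norm_abs_L2 square_integrable_def)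
    with fatou[OF that] have "ennreal ((norm (abs_L2 f - X n))\<^sup>2) \<le> ennreal (((1/2)^k)\<^sup>2)"
      by simp
    then have "(norm (abs_L2 f - X n))\<^sup>2 \<le> ((1/2)^k)\<^sup>2"
      by (subst (asm) ennreal_le_iff) auto
    then show ?thesis by (rule power2_le_imp_le) simp
  qed
  have "X \<longlonglongrightarrow> abs_L2 f"
    unfolding LIMSEQ_def
  proof (intro allI impI)
    fix e :: real assume "e > 0"
    then obtain k where k: "(1/2::real)^k < e"
      using real_arch_pow_inv[of e "1/2"] by auto
    then show "\<exists>no. \<forall>n\<ge>no. dist (X n) (abs_L2 f) < e"
      using dist by (intro exI[of _ "N k"]) (fastforce simp: dist_norm norm_minus_commute)
  qed
  then show "convergent X" by (auto simp: convergent_def)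
qed

instance L2 :: (euclidean_space, euclidean_space) banach ..

section \<open>Separability\<close>

lemma sets_unit_cube: "A \<in> sets borel \<Longrightarrow> A \<inter> cbox 0 One \<in> sets unit_cube"
  by (auto simp: unit_cube_def sets_restrict_space)

text \<open>The sets over which \<open>f\<close> integrates to 0 form a Dynkin system, so it is
  enough to test on an intersection-stable generator containing the whole space. Vanishing of all
  set integrals then forces \<open>f\<close> to be 0 almost everywhere. The lemma serves twice: for
  separability and for totality of the trigonometric monomials.\<close>

lemma L2_eq_0I:
  fixes f :: "('d::euclidean_space, 'a::euclidean_space) L2"
  assumes "Int_stable G" "UNIV \<in> G" and sigma: "sigma_sets UNIV G = sets borel"
    and orth: "\<And>U. U \<in> G \<Longrightarrow> (LINT x:(U \<inter> cbox 0 One)|unit_cube. rep_L2 f x) = 0"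
  shows "f = 0"
proof -
  let ?h = "rep_L2 f" and ?C = "cbox 0 One :: 'd set"
  have int: "integrable unit_cube ?h"
    by (intro square_integrable_imp_integrable square_integrable_rep)
  have intA: "set_integrable unit_cube (A \<inter> ?C) ?h" if "A \<in> sets borel" for A :: "'d set"
    using sets_unit_cube[OF that] int unfolding set_integrable_def
    by (rule integrable_mult_indicator)
  have vanish: "(LINT x:(A \<inter> ?C)|unit_cube. ?h x) = 0" if "A \<in> sets borel" for A
  proof -
    have sub: "G \<subseteq> Pow UNIV" by auto
    have "A \<in> sigma_sets UNIV G" using that sigma by simp
    with assms(1) sub show ?thesis
    proof (induction rule: sigma_sets_induct_disjoint)
      case (basic A) then show ?case using orth by simp
    next
      case empty then show ?case by (simp add: set_lebesgue_integral_def)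
    next
      case (compl A)
      have A: "A \<in> sets borel" "UNIV - A \<in> sets borel" using compl sigma by auto
      have "(LINT x:((A \<inter> ?C) \<union> ((UNIV - A) \<inter> ?C))|unit_cube. ?h x) = 0 + (LINT x:((UNIV - A) \<inter> ?C)|unit_cube. ?h x)"
        using compl by (subst set_integral_Un) (auto intro!: intA A)
      moreover have "(A \<inter> ?C) \<union> ((UNIV - A) \<inter> ?C) = UNIV \<inter> ?C" by auto
      ultimately show ?case using orth[OF assms(2)] by simp
    next
      case (union A)
      have A: "A i \<in> sets borel" "(\<Union>i. A i) \<in> sets borel" for i using union(2) sigma by auto
      have "(LINT x:(\<Union>i. A i \<inter> ?C)|unit_cube. ?h x) = (\<Sum>i. (LINT x:(A i \<inter> ?C)|unit_cube. ?h x))"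
        using union(1) intA[OF A(2)]
        by (intro lebesgue_integral_countable_add sets_unit_cube A) (auto simp: disjoint_family_on_def)
      with union(3) show ?case by simp
    qed
  qed
  have "AE x in unit_cube. ?h x = 0"
  proof (rule unit_cube.density_zero[OF int])
    fix A :: "'d set" assume "A \<in> sets unit_cube"
    then obtain B where "B \<in> sets borel" "A = B \<inter> ?C"
      by (auto simp: unit_cube_def sets_restrict_space)
    then show "(LINT x:A|unit_cube. ?h x) = 0" using vanish by simp
  qed
  then have "(norm f)\<^sup>2 = 0"
    unfolding norm_rep_L2 by (subst integral_cong_AE[where g="\<lambda>_. 0"]) auto
  then show ?thesis by simp
qed

text \<open>Projection theorem. The parallelogram law turns a minimising sequence for the distance
  from \<open>x\<close> to \<open>S\<close> into a Cauchy sequence, because midpoints stay in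
  \<open>S\<close>; the residual at its limit is the orthogonal vector.\<close>

lemma closed_subspace_orthogonal:
  fixes S :: "'a::{real_inner, complete_space} set"
  assumes S: "subspace S" "closed S" and x: "x \<notin> S"
  obtains z where "z \<noteq> 0" "\<And>y. y \<in> S \<Longrightarrow> z \<bullet> y = 0"
proof -
  define d where "d = infdist x S"
  have ne: "S \<noteq> {}" using subspace_0[OF S(1)] by auto
  have d_le: "d \<le> norm (x - y)" if "y \<in> S" for y
    using infdist_le[OF that, of x] by (simp add: d_def dist_norm)
  have d0: "d \<ge> 0" by (simp add: d_def infdist_nonneg)
  have "\<exists>y\<in>S. norm (x - y) < d + 1 / Suc n" for n :: nat
  proof (rule ccontr)
    assume "\<not> ?thesis"
    then have "d + 1 / Suc n \<le> infdist x S"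
      unfolding infdist_notempty[OF ne] by (intro cINF_greatest[OF ne]) (auto simp: dist_norm not_less)
    then show False by (simp add: d_def)
  qed
  then obtain y where y: "\<And>n. y n \<in> S" "\<And>n. norm (x - y n) < d + 1 / Suc n" by metis
  have par: "(norm (y m - y n))\<^sup>2 \<le> 2 * ((norm (x - y m))\<^sup>2 - d\<^sup>2) + 2 * ((norm (x - y n))\<^sup>2 - d\<^sup>2)" for m n
  proof -
    have "(1/2) *\<^sub>R (y m + y n) \<in> S"
      using S(1) y by (simp add: subspace_add subspace_scale)
    then have d4: "d\<^sup>2 \<le> (norm (x - (1/2) *\<^sub>R (y m + y n)))\<^sup>2"
      using d_le d0 by (intro power_mono) auto
    define u v where "u = x - y m" and "v = x - y n"
    have uv: "u + v = 2 *\<^sub>R (x - (1/2) *\<^sub>R (y m + y n))"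
      by (simp add: u_def v_def scaleR_diff_right scaleR_2 algebra_simps)
    have "(norm (u + v))\<^sup>2 = 4 * (norm (x - (1/2) *\<^sub>R (y m + y n)))\<^sup>2"
      unfolding uv norm_scaleR by (simp add: power_mult_distrib)
    moreover have "(norm (u - v))\<^sup>2 = 2 * (norm u)\<^sup>2 + 2 * (norm v)\<^sup>2 - (norm (u + v))\<^sup>2"
      unfolding power2_norm_eq_inner inner_add_left inner_add_right inner_diff_left inner_diff_right by simp
    moreover have "norm (y m - y n) = norm (u - v)" by (simp add: u_def v_def norm_minus_commute)
    ultimately show ?thesis using d4 by (simp add: u_def v_def)
  qed
  have lim: "(\<lambda>n. norm (x - y n)) \<longlonglongrightarrow> d"
  proof (rule tendsto_sandwich[of "\<lambda>_. d" _ _ "\<lambda>n. d + 1 / Suc n"])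
    show "(\<lambda>n. d + 1 / Suc n) \<longlonglongrightarrow> d"
      using tendsto_add[OF tendsto_const LIMSEQ_Suc[OF lim_1_over_n], of d] by simp
  qed (use y d_le in \<open>auto intro!: always_eventually less_imp_le\<close>)
  then have lim2: "(\<lambda>n. (norm (x - y n))\<^sup>2 - d\<^sup>2) \<longlonglongrightarrow> 0"
    using tendsto_diff[OF tendsto_power[OF lim, of 2] tendsto_const[of "d\<^sup>2"]] by simp
  have "Cauchy y"
  proof (rule metric_CauchyI)
    fix e :: real assume e: "e > 0"
    then have "e\<^sup>2 / 4 > 0" by simp
    from order_tendstoD(2)[OF lim2 this] obtain N where
      N: "\<And>n. n \<ge> N \<Longrightarrow> (norm (x - y n))\<^sup>2 - d\<^sup>2 < e\<^sup>2 / 4"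
      by (auto simp: eventually_sequentially)
    have "dist (y m) (y n) < e" if "m \<ge> N" "n \<ge> N" for m n
    proof -
      have *: "a \<le> 2 * p + 2 * q \<Longrightarrow> p < c / 4 \<Longrightarrow> q < c / 4 \<Longrightarrow> a < c" for a p q c :: real
        by linarith
      have "(norm (y m - y n))\<^sup>2 < e\<^sup>2" by (rule *[OF par N[OF that(1)] N[OF that(2)]])
      then show ?thesis using e by (simp add: dist_norm power2_less_imp_less)
    qed
    then show "\<exists>M. \<forall>m\<ge>M. \<forall>n\<ge>M. dist (y m) (y n) < e" by blast
  qed
  then obtain y0 where y0: "y \<longlonglongrightarrow> y0" by (auto simp: Cauchy_convergent_iff convergent_def)
  then have "y0 \<in> S" using S(2) y(1) closed_sequentially by blast
  have nd: "norm (x - y0) = d"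
    using LIMSEQ_unique[OF lim tendsto_norm[OF tendsto_diff[OF tendsto_const y0]]] by simp
  define z where "z = x - y0"
  have "z \<noteq> 0" using x \<open>y0 \<in> S\<close> by (auto simp: z_def)
  moreover have "z \<bullet> s = 0" if s: "s \<in> S" for s
  proof (cases "s = 0")
    case False
    \<comment> \<open>This \<open>t\<close> minimises \<open>norm (z - t *\<^sub>R s)\<close>, so
      the minimality of the distance \<open>d\<close> forces
      \<open>z \<bullet> s = 0\<close>.\<close>
    define t where "t = (z \<bullet> s) / (s \<bullet> s)"
    have "y0 + t *\<^sub>R s \<in> S" using S(1) s \<open>y0 \<in> S\<close> by (simp add: subspace_add subspace_scale)
    then have "d\<^sup>2 \<le> (norm (z - t *\<^sub>R s))\<^sup>2"
      using d_le[of "y0 + t *\<^sub>R s"] d0 by (intro power_mono) (auto simp: z_def algebra_simps)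
    also have "\<dots> = (norm z)\<^sup>2 - 2 * t * (z \<bullet> s) + t\<^sup>2 * (s \<bullet> s)"
      unfolding power2_norm_eq_inner inner_diff_left inner_diff_right inner_scaleR_left inner_scaleR_right
      by (simp add: inner_commute[of s z] power2_eq_square right_diff_distrib)
    also have "t\<^sup>2 * (s \<bullet> s) = t * (z \<bullet> s)"
      using False by (simp add: t_def power2_eq_square)
    also have "(norm z)\<^sup>2 - 2 * t * (z \<bullet> s) + t * (z \<bullet> s) = (norm z)\<^sup>2 - (z \<bullet> s)\<^sup>2 / (s \<bullet> s)"
      by (simp add: t_def power2_eq_square)
    finally have "(z \<bullet> s)\<^sup>2 / (s \<bullet> s) \<le> 0" using nd by (simp add: z_def)
    moreover have "s \<bullet> s > 0" using False by simp
    ultimately show ?thesis by (simp add: divide_le_0_iff) 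
  qed simp
  ultimately show ?thesis by (rule that)
qed

text \<open>Combinations are coded by finite lists, so that countability follows from that of the
  set of lists, and the sum of two combinations is a concatenation.\<close>

definition rational_span :: "'a::real_vector set \<Rightarrow> 'a set" where
  "rational_span G = (\<lambda>l. \<Sum>(q, g)\<leftarrow>l. real_of_rat q *\<^sub>R g) ` lists (UNIV \<times> G)"

lemma countable_rational_span: "countable G \<Longrightarrow> countable (rational_span G)"
  unfolding rational_span_def by (intro countable_image countable_lists) auto

lemma rational_span_add: "x \<in> rational_span G \<Longrightarrow> y \<in> rational_span G \<Longrightarrow> x + y \<in> rational_span G"
proof -
  assume "x \<in> rational_span G" "y \<in> rational_span G"
  then obtain l l' where l: "l \<in> lists (UNIV \<times> G)" "l' \<in> lists (UNIV \<times> G)"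
    "x = (\<Sum>(q, g)\<leftarrow>l. real_of_rat q *\<^sub>R g)" "y = (\<Sum>(q, g)\<leftarrow>l'. real_of_rat q *\<^sub>R g)"
    by (auto simp: rational_span_def)
  then show ?thesis unfolding rational_span_def
    by (intro image_eqI[of _ _ "l @ l'"]) auto
qed

lemma rational_span_scale: "x \<in> rational_span G \<Longrightarrow> real_of_rat q *\<^sub>R x \<in> rational_span G"
proof -
  assume "x \<in> rational_span G"
  then obtain l where l: "l \<in> lists (UNIV \<times> G)" "x = (\<Sum>(q, g)\<leftarrow>l. real_of_rat q *\<^sub>R g)"
    by (auto simp: rational_span_def)
  have "real_of_rat q *\<^sub>R (\<Sum>(q, g)\<leftarrow>l. real_of_rat q *\<^sub>R g)
      = (\<Sum>(q, g)\<leftarrow>map (\<lambda>(q', g). (q * q', g)) l. real_of_rat q *\<^sub>R g)"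
    by (induction l) (auto simp: scaleR_add_right of_rat_mult)
  moreover have "map (\<lambda>(q', g). (q * q', g)) l \<in> lists (UNIV \<times> G)"
    using l(1) by (induction l) auto
  ultimately show ?thesis unfolding rational_span_def l(2) by (intro image_eqI)
qed

text \<open>A real multiple is reached as the limit of rational multiples of approximants, which is
  why the closure of a merely rational span is a real subspace.\<close>

lemma subspace_closure_rational_span:
  fixes G :: "'a::real_normed_vector set"
  shows "subspace (closure (rational_span G))"
  unfolding subspace_def
proof (intro conjI ballI allI)
  have "0 \<in> rational_span G" unfolding rational_span_def by (intro image_eqI[of _ _ "[]"]) auto
  then show "0 \<in> closure (rational_span G)" using closure_subset by blast
next
  fix x y assume "x \<in> closure (rational_span G)" "y \<in> closure (rational_span G)"
  then obtain u v where "\<And>n. u n \<in> rational_span G" "u \<longlonglongrightarrow> x" "\<And>n. v n \<in> rational_span G" "v \<longlonglongrightarrow> y"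
    by (metis closure_sequential)
  then show "x + y \<in> closure (rational_span G)"
    unfolding closure_sequential by (intro exI[of _ "\<lambda>n. u n + v n"]) (auto intro: rational_span_add tendsto_add)
next
  fix c :: real and x assume "x \<in> closure (rational_span G)"
  then obtain u where u: "\<And>n. u n \<in> rational_span G" "u \<longlonglongrightarrow> x"
    by (metis closure_sequential)
  have "c \<in> closure \<rat>" by (simp add: Rats_closure_real)
  then obtain q where q: "\<And>n. q n \<in> \<rat>" "q \<longlonglongrightarrow> c" by (metis closure_sequential)
  have "q n *\<^sub>R u n \<in> rational_span G" for n
    using q(1)[of n] rational_span_scale[OF u(1)[of n]] by (auto elim!: Rats_cases)
  then show "c *\<^sub>R x \<in> closure (rational_span G)"
    unfolding closure_sequential using q(2) u(2) by (intro exI[of _ "\<lambda>n. q n *\<^sub>R u n"]) (auto intro: tendsto_scaleR)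
qed

text \<open>The closure is a closed subspace; if a point were missing, a nonzero vector would be
  orthogonal to the closure, hence to \<open>G\<close>.\<close>

lemma total_imp_dense:
  fixes G :: "'a::{real_inner, complete_space} set"
  assumes "\<And>z. (\<And>g. g \<in> G \<Longrightarrow> z \<bullet> g = 0) \<Longrightarrow> z = 0"
  shows "closure (rational_span G) = UNIV"
proof (rule ccontr)
  assume "closure (rational_span G) \<noteq> UNIV"
  then obtain x where "x \<notin> closure (rational_span G)" by auto
  from closed_subspace_orthogonal[OF subspace_closure_rational_span closed_closure this]
  obtain z where z: "z \<noteq> 0" "\<And>y. y \<in> closure (rational_span G) \<Longrightarrow> z \<bullet> y = 0" by blast
  have "g \<in> rational_span G" if "g \<in> G" for g
    unfolding rational_span_def using that by (intro image_eqI[of _ _ "[(1, g)]"]) auto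
  then have "z \<bullet> g = 0" if "g \<in> G" for g using z(2) closure_subset that by blast
  with assms z(1) show False by blast
qed

lemma dense_imp_countable_subbasis:
  fixes D :: "'a::metric_space set"
  assumes D: "countable D" "closure D = UNIV"
  shows "\<exists>B::'a set set. countable B \<and> open = generate_topology B"
proof (intro exI conjI)
  let ?B = "(\<lambda>(x, q). ball x (real_of_rat q)) ` (D \<times> UNIV)"
  show "countable ?B" using D(1) by (intro countable_image countable_SIGMA) auto
  have "topological_basis ?B"
  proof (rule topological_basisI)
    fix O' :: "'a set" and x assume O: "open O'" "x \<in> O'"
    then obtain e where e: "e > 0" "ball x e \<subseteq> O'" by (auto simp: open_contains_ball)
    obtain q where q: "0 < real_of_rat q" "real_of_rat q < e / 2"
      using of_rat_dense[of 0 "e/2"] e(1) by auto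
    have "x \<in> closure D" using D(2) by simp
    then obtain y where y: "y \<in> D" "dist y x < real_of_rat q"
      using q(1) unfolding closure_approachable by blast
    have "ball y (real_of_rat q) \<subseteq> ball x e"
    proof
      fix z assume "z \<in> ball y (real_of_rat q)"
      then show "z \<in> ball x e" using y q dist_triangle[of x z y] by (auto simp: dist_commute)
    qed
    then show "\<exists>B'\<in>?B. x \<in> B' \<and> B' \<subseteq> O'"
      using y e by (intro bexI[of _ "ball y (real_of_rat q)"]) auto
  qed auto
  then show "open = generate_topology ?B" by (rule topological_basis_imp_subbasis)
qed

lemma square_integrable_indicator_scaleR:
  "A \<in> sets borel \<Longrightarrow> square_integrable (\<lambda>x. indicator A x *\<^sub>R b)"
  by (rule square_integrable_bounded[of _ "norm b"])
    (auto intro!: borel_measurable_unit_cube borel_measurable_scaleR borel_measurable_indicator simp: indicator_def)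

lemma inner_indicator_L2:
  fixes f :: "('d::euclidean_space, 'a::euclidean_space) L2"
  assumes "A \<in> sets borel"
  shows "f \<bullet> abs_L2 (\<lambda>x. indicator A x *\<^sub>R b) = (LINT x:(A \<inter> cbox 0 One)|unit_cube. rep_L2 f x) \<bullet> b"
proof -
  have "f \<bullet> abs_L2 (\<lambda>x. indicator A x *\<^sub>R b) = (LINT x|unit_cube. (indicator A x *\<^sub>R rep_L2 f x) \<bullet> b)"
    using inner_abs_L2[OF square_integrable_rep[of f] square_integrable_indicator_scaleR[OF assms, of b]]
    by simp
  also have "\<dots> = (LINT x|unit_cube. (indicator (A \<inter> cbox 0 One) x *\<^sub>R rep_L2 f x) \<bullet> b)"
    by (intro Bochner_Integration.integral_cong) (auto simp: indicator_def)
  also have "\<dots> = (LINT x:(A \<inter> cbox 0 One)|unit_cube. rep_L2 f x) \<bullet> b"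
    unfolding set_lebesgue_integral_def
    by (intro integral_inner_left impI integrable_mult_indicator sets_unit_cube assms
        square_integrable_imp_integrable square_integrable_rep)
  finally show ?thesis .
qed

text \<open>The witnesses are indicators of finite intersections of a countable topological basis,
  multiplied by the basis vectors of the value space. Taking intersections makes the generator
  stable, as \<open>L2_eq_0I\<close> demands, and keeps it countable; the empty intersection
  contributes the whole space.\<close>

lemma L2_countable_total:
  "\<exists>G :: ('d::euclidean_space, 'a::euclidean_space) L2 set.
     countable G \<and> (\<forall>f. (\<forall>g\<in>G. f \<bullet> g = 0) \<longrightarrow> f = 0)"
proof -
  obtain B :: "'d set set" where B: "countable B" "topological_basis B" using ex_countable_basis by auto
  define \<I> where "\<I> = Inter ` {F. finite F \<and> F \<subseteq> B}"
  have count: "countable \<I>" unfolding \<I>_def by (intro countable_image countable_Collect_finite_subset B)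
  have op: "open U" if "U \<in> B" for U using B(2) that by (rule topological_basis_open)
  have sets: "U \<in> sets borel" if "U \<in> \<I>" for U
    using that op by (auto simp: \<I>_def intro!: borel_open open_Inter)
  have sub: "B \<subseteq> \<I>" unfolding \<I>_def by (auto intro!: image_eqI[of _ _ "{_}"])
  have sigma: "sigma_sets UNIV \<I> = sets borel"
  proof (rule antisym)
    show "sigma_sets UNIV \<I> \<subseteq> sets borel"
      using sets by (metis sets.sigma_sets_subset space_borel subsetI)
    have "sets borel = sigma_sets UNIV B"
      by (subst borel_eq_countable_basis[OF B]) simp
    then show "sets borel \<subseteq> sigma_sets UNIV \<I>" using sigma_sets_mono'[OF sub] by auto
  qed
  have stable: "Int_stable \<I>"
    unfolding Int_stable_def
  proof (intro ballI)
    fix a b assume "a \<in> \<I>" "b \<in> \<I>"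
    then obtain F F' where F: "finite F" "F \<subseteq> B" "finite F'" "F' \<subseteq> B" "a = \<Inter>F" "b = \<Inter>F'"
      by (auto simp: \<I>_def)
    then show "a \<inter> b \<in> \<I>" unfolding \<I>_def
      by (intro image_eqI[of _ _ "F \<union> F'"]) auto
  qed
  have univ: "UNIV \<in> \<I>" unfolding \<I>_def by (auto intro!: image_eqI[of _ _ "{}"])
  define G where "G = (\<lambda>(U, b). abs_L2 (\<lambda>x. indicator U x *\<^sub>R b) :: ('d, 'a) L2) ` (\<I> \<times> Basis)"
  have "countable G" unfolding G_def using count by (intro countable_image countable_SIGMA) (auto intro: countable_finite)
  moreover have "f = 0" if f: "\<forall>g\<in>G. f \<bullet> g = 0" for f
  proof (rule L2_eq_0I[OF stable univ sigma])
    fix U assume U: "U \<in> \<I>"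
    show "(LINT x:(U \<inter> cbox 0 One)|unit_cube. rep_L2 f x) = 0"
    proof (rule euclidean_eqI)
      fix b :: 'a assume "b \<in> Basis"
      then have "f \<bullet> abs_L2 (\<lambda>x. indicator U x *\<^sub>R b) = 0" using f U by (auto simp: G_def)
      then show "(LINT x:(U \<inter> cbox 0 One)|unit_cube. rep_L2 f x) \<bullet> b = 0 \<bullet> b"
        by (simp add: inner_indicator_L2[OF sets[OF U]])
    qed
  qed
  ultimately show ?thesis by blast
qed

text \<open>A countable total set has a countable dense rational span. Second countability is needed
  for Bochner integrals of \<open>L2\<close>-valued random elements and for the measurability of
  their sums and products.\<close>

instance L2 :: (euclidean_space, euclidean_space) second_countable_topology
proof
  obtain G :: "('a, 'b) L2 set" where "countable G \<and> (\<forall>f. (\<forall>g\<in>G. f \<bullet> g = 0) \<longrightarrow> f = 0)"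
    by (rule exE[OF L2_countable_total])
  then have G: "countable G" "\<And>f. (\<And>g. g \<in> G \<Longrightarrow> f \<bullet> g = 0) \<Longrightarrow> f = 0" by auto
  have "closure (rational_span G) = UNIV" by (rule total_imp_dense) (rule G(2))
  then show "\<exists>B::('a, 'b) L2 set set. countable B \<and> open = generate_topology B"
    by (rule dense_imp_countable_subbasis[OF countable_rational_span[OF G(1)]])
qed

section \<open>Product kernels\<close>

lemma cbox_real_square: "cbox (0::real \<times> real) One = cbox 0 1 \<times> cbox 0 1"
proof -
  have "One = (1::real, 1::real)"
    by (auto simp: Basis_prod_def sum.union_disjoint sum.reindex inj_on_def)
  then show ?thesis by (simp only: zero_prod_def cbox_Pair_eq)
qed

text \<open>Lets Fubini's theorem for product measures be applied to kernels, whose domain carries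
  the measure \<open>unit_cube\<close> on pairs. Both measures agree on rectangles, which determines
  a sigma-finite product measure.\<close>

lemma unit_cube_pair: "(unit_cube :: real measure) \<Otimes>\<^sub>M (unit_cube :: real measure) = unit_cube"
proof (rule pair_measure_eqI)
  show "sigma_finite_measure (unit_cube :: real measure)" "sigma_finite_measure (unit_cube :: real measure)"
    by (rule unit_cube.sigma_finite_measure)+
  let ?U = "unit_cube :: real measure" and ?C = "cbox 0 1 :: real set"
  show sets: "sets (?U \<Otimes>\<^sub>M ?U) = sets unit_cube"
  proof (rule antisym)
    show "sets (?U \<Otimes>\<^sub>M ?U) \<subseteq> sets unit_cube"
      unfolding sets_pair_measure
    proof (rule sets.sigma_sets_subset')
      show "{a \<times> b |a b. a \<in> sets ?U \<and> b \<in> sets ?U} \<subseteq> sets unit_cube"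
      proof safe
        fix a b assume "a \<in> sets ?U" "b \<in> sets ?U"
        then obtain a' b' where "a = a' \<inter> ?C" "b = b' \<inter> ?C" "a' \<in> sets borel" "b' \<in> sets borel"
          by (auto simp: unit_cube_def sets_restrict_space)
        then have "a \<times> b = (a' \<times> b') \<inter> cbox 0 One" "a' \<times> b' \<in> sets borel"
          by (auto simp: cbox_real_square borel_prod[symmetric])
        then show "a \<times> b \<in> sets unit_cube" using sets_unit_cube by metis
      qed
      show "space ?U \<times> space ?U \<in> sets unit_cube"
        using sets.top[of "unit_cube :: (real \<times> real) measure"] by (simp add: cbox_real_square)
    qed
    show "sets unit_cube \<subseteq> sets (?U \<Otimes>\<^sub>M ?U)"
    proof
      fix S :: "(real \<times> real) set" assume "S \<in> sets unit_cube"
      then obtain S' where S': "S' \<in> sets borel" "S = S' \<inter> cbox 0 One"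
        by (auto simp: unit_cube_def sets_restrict_space)
      have "(\<lambda>x. (fst x, snd x)) \<in> ?U \<Otimes>\<^sub>M ?U \<rightarrow>\<^sub>M borel \<Otimes>\<^sub>M borel"
        by (intro measurable_Pair measurable_compose[OF measurable_fst] measurable_compose[OF measurable_snd]
            borel_measurable_unit_cube measurable_ident_sets) auto
      then have "(\<lambda>x. x) \<in> ?U \<Otimes>\<^sub>M ?U \<rightarrow>\<^sub>M borel" by (simp add: borel_prod)
      from measurable_sets[OF this S'(1)] show "S \<in> sets (?U \<Otimes>\<^sub>M ?U)"
        using S'(2) by (simp add: space_pair_measure cbox_real_square)
    qed
  qed
  fix A B assume AB: "A \<in> sets ?U" "B \<in> sets ?U"
  then have sub: "A \<subseteq> ?C" "B \<subseteq> ?C" "A \<in> sets borel" "B \<in> sets borel"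
    by (auto simp: unit_cube_def sets_restrict_space)
  then have "emeasure (unit_cube :: (real \<times> real) measure) (A \<times> B) = emeasure lborel (A \<times> B)"
    unfolding unit_cube_def by (subst emeasure_restrict_space) (auto simp: cbox_real_square intro!: borel_closed closed_Times)
  also have "\<dots> = emeasure (lborel \<Otimes>\<^sub>M lborel) (A \<times> B)" by (simp add: lborel_prod)
  also have "\<dots> = emeasure lborel A * emeasure lborel B"
    using sub by (subst lborel.emeasure_pair_measure_Times) auto
  also have "\<dots> = emeasure ?U A * emeasure ?U B"
    using sub unfolding unit_cube_def by (subst (1 2) emeasure_restrict_space) auto
  finally show "emeasure ?U A * emeasure ?U B = emeasure unit_cube (A \<times> B)" ..
qed

interpretation unit_square: pair_sigma_finite "unit_cube :: real measure" "unit_cube :: real measure" ..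

lemma measurable_fst_unit_square [measurable]: "fst \<in> (unit_cube :: (real \<times> real) measure) \<rightarrow>\<^sub>M (unit_cube :: real measure)"
  by (simp flip: unit_cube_pair)

lemma measurable_snd_unit_square [measurable]: "snd \<in> (unit_cube :: (real \<times> real) measure) \<rightarrow>\<^sub>M (unit_cube :: real measure)"
  by (simp flip: unit_cube_pair)

lemma distr_fst_unit_square: "distr (unit_cube :: (real \<times> real) measure) (unit_cube :: real measure) fst = unit_cube"
proof -
  have "distr (unit_cube \<Otimes>\<^sub>M (unit_cube :: real measure)) (unit_cube :: real measure) fst = unit_cube"
    by (rule unit_cube.distr_pair_fst)
  then show ?thesis by (simp add: unit_cube_pair)
qed

lemma distr_snd_unit_square: "distr (unit_cube :: (real \<times> real) measure) (unit_cube :: real measure) snd = unit_cube"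
proof -
  let ?U = "unit_cube :: real measure"
  have "distr (?U \<Otimes>\<^sub>M ?U) ?U snd = distr (distr (?U \<Otimes>\<^sub>M ?U) (?U \<Otimes>\<^sub>M ?U) (\<lambda>(x, y). (y, x))) ?U fst"
    by (subst distr_distr) (auto simp: comp_def case_prod_unfold)
  also have "\<dots> = distr (?U \<Otimes>\<^sub>M ?U) ?U fst"
    by (simp flip: unit_square.distr_pair_swap)
  finally show ?thesis using distr_fst_unit_square by (simp add: unit_cube_pair)
qed

lemma AE_fst_unit_square: "AE x in unit_cube. P x \<Longrightarrow> AE p in (unit_cube :: (real \<times> real) measure). P (fst p :: real)"
  using AE_distrD[OF measurable_fst_unit_square, of P] unfolding distr_fst_unit_square by blast

lemma AE_snd_unit_square: "AE x in unit_cube. P x \<Longrightarrow> AE p in (unit_cube :: (real \<times> real) measure). P (snd p :: real)"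
  using AE_distrD[OF measurable_snd_unit_square, of P] unfolding distr_snd_unit_square by blast

lemma integral_unit_square:
  fixes f :: "real \<times> real \<Rightarrow> 'a::{banach, second_countable_topology}"
  assumes "integrable unit_cube f"
  shows "(LINT p|unit_cube. f p) = (LINT x|unit_cube. LINT y|unit_cube. f (x, y))"
  using unit_square.integral_fst'[of f] assms by (simp add: unit_cube_pair)

lemma integrable_product_unit_square:
  fixes f g :: "real \<Rightarrow> real"
  assumes f: "integrable unit_cube f" and g: "integrable unit_cube g"
  shows "integrable unit_cube (\<lambda>p. f (fst p) * g (snd p))"
    and "(LINT p|unit_cube. f (fst p) * g (snd p)) = (LINT x|unit_cube. f x) * (LINT x|unit_cube. g x)"
proof -
  note [measurable] = borel_measurable_integrable[OF f] borel_measurable_integrable[OF g]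
  have "integrable (unit_cube \<Otimes>\<^sub>M unit_cube) (\<lambda>p. f (fst p) * g (snd p))"
  proof (rule unit_square.Fubini_integrable)
    show "integrable unit_cube (\<lambda>x. LINT y|unit_cube. norm (f (fst (x, y)) * g (snd (x, y))))"
      using f by (simp add: abs_mult integrable_abs)
  qed (use g in \<open>auto simp: integrable_mult_right\<close>)
  then show *: "integrable unit_cube (\<lambda>p. f (fst p) * g (snd p))" by (simp add: unit_cube_pair)
  show "(LINT p|unit_cube. f (fst p) * g (snd p)) = (LINT x|unit_cube. f x) * (LINT x|unit_cube. g x)"
    by (subst integral_unit_square[OF *]) simp
qed

type_synonym kernel_L2 = "(real \<times> real, complex) L2"

lemma square_integrable_product:
  fixes f g :: "real \<Rightarrow> real"
  assumes "square_integrable f" "square_integrable g"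
  shows "square_integrable (\<lambda>p. complex_of_real (f (fst p) * g (snd p)))"
proof -
  have [measurable]: "f \<in> borel_measurable unit_cube" "g \<in> borel_measurable unit_cube"
    using assms by (auto simp: square_integrable_def)
  have "integrable unit_cube (\<lambda>p. (f (fst p))\<^sup>2 * (g (snd p))\<^sup>2)"
    using assms integrable_product_unit_square(1)[of "\<lambda>x. (f x)\<^sup>2" "\<lambda>x. (g x)\<^sup>2"] by (simp add: square_integrable_def)
  then show ?thesis
    by (simp add: square_integrable_def norm_mult power_mult_distrib)
qed

lemma square_integrable_scaled_product:
  fixes f g :: "real \<Rightarrow> real"
  assumes "square_integrable f" "square_integrable g"
  shows "square_integrable (\<lambda>p. complex_of_real (r * (f (fst p) * g (snd p))))"
  using square_integrable_scaleR[OF square_integrable_product[OF assms], of r]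
  by (simp add: scaleR_conv_of_real)

text \<open>The kernel of a rank one operator. It is complex valued although both factors are real,
  because the spectral kernels live in \<open>kernel_L2\<close>.\<close>

lift_definition tens :: "real_L2 \<Rightarrow> real_L2 \<Rightarrow> kernel_L2"
  is "\<lambda>f g p. complex_of_real (f (fst p) * g (snd p))"
proof -
  fix f f' g g' :: "real \<Rightarrow> real"
  assume a: "L2_eq f f'" "L2_eq g g'"
  then have "AE p in (unit_cube :: (real \<times> real) measure). f (fst p) = f' (fst p)"
    "AE p in (unit_cube :: (real \<times> real) measure). g (snd p) = g' (snd p)"
    by (auto simp: L2_eq_def intro: AE_fst_unit_square AE_snd_unit_square)
  then have "AE p in unit_cube. complex_of_real (f (fst p) * g (snd p)) = complex_of_real (f' (fst p) * g' (snd p))"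
    by eventually_elim simp
  with a show "L2_eq (\<lambda>p. complex_of_real (f (fst p) * g (snd p))) (\<lambda>p. complex_of_real (f' (fst p) * g' (snd p)))"
    unfolding L2_eq_def using square_integrable_product by blast
qed

lemma tens_abs_L2:
  "square_integrable f \<Longrightarrow> square_integrable g \<Longrightarrow>
    tens (abs_L2 f) (abs_L2 g) = abs_L2 (\<lambda>p. complex_of_real (f (fst p) * g (snd p)))"
  by (subst tens.abs_eq) (auto simp: L2_eq_refl_iff)

text \<open>Fubini separates the two variables; all values are real, so the real inner product of
  complex numbers is plain multiplication.\<close>

lemma inner_tens: "tens x y \<bullet> tens x' y' = (x \<bullet> x') * (y \<bullet> y')"
proof transfer
  fix x y x' y' :: "real \<Rightarrow> real"
  assume "L2_eq x x" "L2_eq y y" "L2_eq x' x'" "L2_eq y' y'"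
  then have sq: "square_integrable x" "square_integrable y" "square_integrable x'" "square_integrable y'"
    by (auto simp: L2_eq_refl_iff)
  have "(LINT p|unit_cube. (x (fst p) \<bullet> x' (fst p)) * (y (snd p) \<bullet> y' (snd p)))
      = (LINT s|unit_cube. x s \<bullet> x' s) * (LINT s|unit_cube. y s \<bullet> y' s)"
    by (intro integrable_product_unit_square integrable_inner_square_integrable sq)
  then show "(LINT p|unit_cube. complex_of_real (x (fst p) * y (snd p)) \<bullet> complex_of_real (x' (fst p) * y' (snd p)))
      = (LINT s|unit_cube. x s \<bullet> x' s) * (LINT s|unit_cube. y s \<bullet> y' s)"
    by (simp add: inner_complex_def mult_ac)
qed

lemma norm_tens: "norm (tens x y) = norm x * norm y"
  unfolding norm_eq_sqrt_inner inner_tens by (simp add: real_sqrt_mult)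

lemma bounded_bilinear_tens: "bounded_bilinear tens"
proof
  fix a b c d :: real_L2 and r :: real
  show "tens (a + b) c = tens a c + tens b c"
    by transfer (auto simp: L2_eq_def distrib_right simp del: of_real_mult intro!: square_integrable_product square_integrable_add)
  show "tens a (b + c) = tens a b + tens a c"
    by transfer (auto simp: L2_eq_def distrib_left simp del: of_real_mult intro!: square_integrable_product square_integrable_add)
  have *: "tens a (r *\<^sub>R b) = tens (r *\<^sub>R a) b" for a b r
    by transfer (auto simp: L2_eq_def mult_ac simp del: of_real_mult intro!: square_integrable_scaled_product)
  show **: "tens (r *\<^sub>R a) b = r *\<^sub>R tens a b" for a b r
    by transfer (auto simp: L2_eq_def scaleR_conv_of_real mult_ac simp del: of_real_mult of_real_eq_iff
       simp flip: of_real_mult intro!: square_integrable_scaled_product)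
  show "tens a (r *\<^sub>R b) = r *\<^sub>R tens a b" unfolding * ** ..
  show "\<exists>K. \<forall>a b. norm (tens a b) \<le> norm a * norm b * K"
    by (intro exI[of _ 1]) (simp add: norm_tens)
qed

interpretation tens: bounded_bilinear tens by (rule bounded_bilinear_tens)

section \<open>Complex scalars\<close>

lemma square_integrable_cmult:
  "square_integrable f \<Longrightarrow> square_integrable (\<lambda>x. c * f x :: complex)"
  by (auto simp: square_integrable_def norm_mult power_mult_distrib)

text \<open>The instance provides real scalars only. Multiplication by complex numbers is added as a
  real-bilinear operation, so that limits, sums and integrals pass through it by the general facts
  on bounded bilinear maps.\<close>

lift_definition cmul :: "complex \<Rightarrow> ('d::euclidean_space, complex) L2 \<Rightarrow> ('d, complex) L2"
  is "\<lambda>c f x. c * f x"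
  by (auto simp: L2_eq_def intro: square_integrable_cmult)

lemma cmul_abs_L2: "square_integrable f \<Longrightarrow> cmul c (abs_L2 f) = abs_L2 (\<lambda>x. c * f x)"
  by (subst cmul.abs_eq) (auto simp: L2_eq_refl_iff)

lemma inner_complex_Re: "(x::complex) \<bullet> y = Re (x * cnj y)"
  by (simp add: inner_complex_def)

lemma inner_cmul: "cmul a f \<bullet> g = f \<bullet> cmul (cnj a) g"
proof transfer
  fix a :: complex and f g :: "'a \<Rightarrow> complex"
  have "(a * f x) \<bullet> g x = f x \<bullet> (cnj a * g x)" for x
    by (simp add: inner_complex_Re mult_ac)
  then show "(LINT x|unit_cube. (a * f x) \<bullet> g x) = (LINT x|unit_cube. f x \<bullet> (cnj a * g x))"
    by simp
qed

lemma cmul_cmul: "cmul a (cmul b f) = cmul (a * b) f"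
  by transfer (auto simp: L2_eq_def mult_ac intro: square_integrable_cmult)

lemma cmul_of_real: "cmul (of_real r) f = r *\<^sub>R f"
  by transfer (auto simp: L2_eq_def scaleR_conv_of_real intro: square_integrable_cmult)

lemma cmul_add_left: "cmul (a + b) f = cmul a f + cmul b f"
  by transfer (auto simp: L2_eq_def distrib_right intro!: square_integrable_cmult square_integrable_add)

lemma cmul_add_right: "cmul a (f + g) = cmul a f + cmul a g"
  by transfer (auto simp: L2_eq_def distrib_left intro!: square_integrable_cmult square_integrable_add)

lemma norm_cmul: "norm (cmul c f) = cmod c * norm f"
proof -
  have "(norm (cmul c f))\<^sup>2 = f \<bullet> cmul (cnj c * c) f"
    by (simp add: power2_norm_eq_inner inner_cmul cmul_cmul)
  also have "cnj c * c = of_real ((cmod c)\<^sup>2)"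
    by (simp add: complex_norm_square mult.commute flip: of_real_power)
  also have "f \<bullet> cmul \<dots> f = (cmod c * norm f)\<^sup>2"
    unfolding cmul_of_real by (simp add: power_mult_distrib power2_norm_eq_inner)
  finally show ?thesis by (simp add: power2_eq_iff_nonneg)
qed

lemma bounded_bilinear_cmul: "bounded_bilinear (cmul :: complex \<Rightarrow> ('d::euclidean_space, complex) L2 \<Rightarrow> _)"
proof
  fix a b :: complex and f g :: "('d, complex) L2" and r :: real
  show "cmul (r *\<^sub>R a) f = r *\<^sub>R cmul a f" "cmul a (r *\<^sub>R f) = r *\<^sub>R cmul a f"
    by (simp_all flip: cmul_of_real add: cmul_cmul scaleR_conv_of_real mult.commute)
  show "\<exists>K. \<forall>a f. norm (cmul a (f::('d, complex) L2)) \<le> norm a * norm f * K"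
    by (intro exI[of _ 1]) (simp add: norm_cmul)
qed (rule cmul_add_left cmul_add_right)+

interpretation cmul: bounded_bilinear cmul by (rule bounded_bilinear_cmul)

section \<open>The Fourier basis\<close>

lemma borel_measurable_cnj [measurable]: "f \<in> borel_measurable M \<Longrightarrow> (\<lambda>x. cnj (f x)) \<in> borel_measurable M"
  by (rule measurable_compose[OF _ borel_measurable_continuous_onI]) (auto intro!: continuous_intros)

lemma borel_measurable_cis [measurable]: "f \<in> borel_measurable M \<Longrightarrow> (\<lambda>x. cis (f x)) \<in> borel_measurable M"
  by (rule measurable_compose[OF _ borel_measurable_continuous_onI]) (auto intro!: continuous_intros)

lemma measurable_id_unit_cube [measurable]: "(\<lambda>x. x) \<in> borel_measurable unit_cube"
  by (rule borel_measurable_unit_cube) simp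

lemma Re_Im_cmod: "Re z * Re z + Im z * Im z = (cmod z)\<^sup>2"
  unfolding cmod_power2 by (simp only: power2_eq_square)

lemma integrable_cinner: "integrable unit_cube (\<lambda>x. rep_L2 (g :: complex_L2) x * cnj (rep_L2 h x))"
proof -
  have "integrable unit_cube (\<lambda>x. norm (rep_L2 g x) \<bullet> norm (rep_L2 h x))"
    using square_integrable_rep[of g] square_integrable_rep[of h]
    by (intro integrable_inner_square_integrable) (auto simp: square_integrable_def)
  then show ?thesis
    by (rule Bochner_Integration.integrable_bound) (auto simp: norm_mult)
qed

lemma Re_cinner: "Re (cinner g h) = g \<bullet> h"
  unfolding cinner_def inner_rep_L2 inner_complex_Re
  by (rule integral_Re[OF integrable_cinner, symmetric])

lemma rep_cmul: "AE x in unit_cube. rep_L2 (cmul c f) x = c * rep_L2 f x"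
  using rep_abs_L2[OF square_integrable_cmult[OF square_integrable_rep[of f], of c]]
    cmul_abs_L2[OF square_integrable_rep[of f], of c] by simp

lemma cinner_cmul_left: "cinner (cmul c g) h = c * cinner g h"
proof -
  have "cinner (cmul c g) h = (LINT x|unit_cube. c * (rep_L2 g x * cnj (rep_L2 h x)))"
    unfolding cinner_def using rep_cmul[of c g] by (intro integral_cong_AE) (auto elim!: eventually_mono)
  then show ?thesis by (simp add: cinner_def)
qed

lemma cinner_commute: "cinner h g = cnj (cinner g h)"
  unfolding cinner_def by (subst Bochner_Integration.integral_cnj[symmetric]) (simp add: mult.commute)

text \<open>The imaginary part of the Hermitian product is the real product with \<open>h\<close>
  rotated by the imaginary unit. Additivity and continuity of \<open>cinner\<close> thereby reduce
  to those of the real inner product.\<close>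

lemma cinner_conv_inner: "cinner g h = Complex (g \<bullet> h) (g \<bullet> cmul \<i> h)"
proof (rule complex_eqI)
  have "g \<bullet> cmul \<i> h = cmul (- \<i>) g \<bullet> h" by (simp add: inner_cmul)
  also have "\<dots> = Re (- \<i> * cinner g h)" by (simp add: Re_cinner flip: cinner_cmul_left)
  finally show "Im (cinner g h) = Im (Complex (g \<bullet> h) (g \<bullet> cmul \<i> h))" by simp
qed (simp add: Re_cinner)

lemma cinner_add_left: "cinner (f + g) h = cinner f h + cinner g h"
  by (simp add: cinner_conv_inner inner_add_left complex_eq_iff)

lemma cinner_diff_left: "cinner (f - g) h = cinner f h - cinner g h"
  by (simp add: cinner_conv_inner inner_diff_left complex_eq_iff)

lemma cinner_sum_left: "cinner (\<Sum>i\<in>I. f i) h = (\<Sum>i\<in>I. cinner (f i) h)"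
  by (simp add: cinner_conv_inner complex_eq_iff inner_sum_left)

lemma tendsto_cinner_left: "(f \<longlongrightarrow> g) F \<Longrightarrow> ((\<lambda>n. cinner (f n) h) \<longlongrightarrow> cinner g h) F"
  unfolding cinner_conv_inner by (intro tendsto_Complex tendsto_intros)

section \<open>Orthonormal expansions\<close>

context
  fixes e :: "nat \<Rightarrow> complex_L2"
  assumes e: "orthonormal_basis e"
begin

lemma cinner_basis: "cinner (e m) (e n) = (if m = n then 1 else 0)"
  using e by (auto simp: orthonormal_basis_def)

lemma norm_sum_basis: "finite F \<Longrightarrow> (norm (\<Sum>n\<in>F. cmul (c n) (e n)))\<^sup>2 = (\<Sum>n\<in>F. (cmod (c n))\<^sup>2)"
proof -
  assume F: "finite F"
  have *: "cmul (c m) (e m) \<bullet> cmul (c n) (e n) = (if m = n then (cmod (c n))\<^sup>2 else 0)" for m n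
  proof -
    have "cmul (c m) (e m) \<bullet> cmul (c n) (e n) = cmul (cnj (c n) * c m) (e m) \<bullet> e n"
      using inner_cmul[of "cnj (c n)" "cmul (c m) (e m)" "e n"] by (simp add: cmul_cmul)
    also have "\<dots> = Re (cnj (c n) * c m * (if m = n then 1 else 0))"
      by (simp only: Re_cinner[symmetric] cinner_cmul_left cinner_basis)
    finally show ?thesis by (auto simp: Re_Im_cmod dot_square_norm inner_complex_def)
  qed
  show ?thesis unfolding power2_norm_eq_inner inner_sum_left inner_sum_right
    using F by (simp add: * power2_norm_eq_inner)
qed

text \<open>Expand \<open>0 \<le> (norm (x - s))\<^sup>2\<close> for the partial Fourier sum
  \<open>s\<close>, where both \<open>x \<bullet> s\<close> and the squared norm of \<open>s\<close>
  equal the sum of squared coefficients.\<close>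

lemma Bessel: "(\<Sum>n<N. (cmod (cinner x (e n)))\<^sup>2) \<le> (norm x)\<^sup>2"
proof -
  let ?c = "\<lambda>n. cinner x (e n)"
  let ?s = "\<Sum>n<N. cmul (?c n) (e n)"
  have "x \<bullet> ?s = (\<Sum>n<N. x \<bullet> cmul (?c n) (e n))" by (simp add: inner_sum_right)
  also have "\<dots> = (\<Sum>n<N. (cmod (?c n))\<^sup>2)"
  proof (rule sum.cong[OF refl])
    fix n
    have "x \<bullet> cmul (?c n) (e n) = Re (cnj (?c n) * ?c n)"
      using inner_cmul[of "cnj (?c n)" x "e n"] by (simp add: Re_cinner flip: cinner_cmul_left)
    then show "x \<bullet> cmul (?c n) (e n) = (cmod (?c n))\<^sup>2" by (simp add: Re_Im_cmod)
  qed
  finally have xs: "x \<bullet> ?s = (\<Sum>n<N. (cmod (?c n))\<^sup>2)" .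
  have "0 \<le> (norm (x - ?s))\<^sup>2" by simp
  also have "\<dots> = (norm x)\<^sup>2 - 2 * (x \<bullet> ?s) + (norm ?s)\<^sup>2"
    unfolding power2_norm_eq_inner inner_diff_left inner_diff_right by (simp add: inner_commute[of ?s x])
  finally show ?thesis using xs norm_sum_basis[of "{..<N}" ?c] by simp
qed

text \<open>Bessel's inequality makes the partial sums Cauchy. Their limit has the same coefficients
  as \<open>x\<close>, so the difference is orthogonal to the basis and vanishes by
  totality.\<close>

lemma Fourier_expansion: "(\<lambda>N. \<Sum>n<N. cmul (cinner x (e n)) (e n)) \<longlonglongrightarrow> x"
proof -
  let ?c = "\<lambda>n. cinner x (e n)"
  let ?s = "\<lambda>N. \<Sum>n<N. cmul (?c n) (e n)"
  have "summable (\<lambda>n. (cmod (?c n))\<^sup>2)"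
    by (rule bounded_imp_summable[of _ "(norm x)\<^sup>2"]) (auto simp only: lessThan_Suc_atMost[symmetric] Bessel zero_le_power2)
  then have conv: "Cauchy (\<lambda>N. \<Sum>n<N. (cmod (?c n))\<^sup>2)"
    by (simp add: summable_iff_convergent Cauchy_convergent_iff)
  have "Cauchy ?s"
  proof (rule metric_CauchyI)
    fix r :: real assume r: "r > 0"
    then have "r\<^sup>2 > 0" by simp
    from metric_CauchyD[OF conv this] obtain M where
      M: "\<And>m n. m \<ge> M \<Longrightarrow> n \<ge> M \<Longrightarrow> dist (\<Sum>n<m. (cmod (?c n))\<^sup>2) (\<Sum>n<n. (cmod (?c n))\<^sup>2) < r\<^sup>2"
      by blast
    have le: "dist (?s m) (?s n) < r" if "m \<ge> M" "n \<ge> m" for m n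
    proof -
      have d: "{..<n} - {..<m} = {m..<n}" by auto
      have "?s n - ?s m = (\<Sum>k\<in>{m..<n}. cmul (?c k) (e k))"
        using that by (subst sum_diff[symmetric]) (auto simp: d)
      then have "(dist (?s m) (?s n))\<^sup>2 = (\<Sum>k\<in>{m..<n}. (cmod (?c k))\<^sup>2)"
        by (simp add: dist_norm norm_minus_commute[of "?s m"] norm_sum_basis)
      also have "\<dots> = (\<Sum>k<n. (cmod (?c k))\<^sup>2) - (\<Sum>k<m. (cmod (?c k))\<^sup>2)"
        using that by (subst sum_diff[symmetric]) (auto simp: d)
      also have "\<dots> < r\<^sup>2" using M[of n m] that by (simp add: dist_real_def)
      finally show ?thesis using r by (simp add: power2_less_imp_less)
    qed
    show "\<exists>M. \<forall>m\<ge>M. \<forall>n\<ge>M. dist (?s m) (?s n) < r"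
    proof (intro exI[of _ M] allI impI)
      fix m n assume "m \<ge> M" "n \<ge> M"
      then show "dist (?s m) (?s n) < r" using le[of m n] le[of n m] by (cases "m \<le> n") (auto simp: dist_commute)
    qed
  qed
  then obtain y where y: "?s \<longlonglongrightarrow> y" by (auto simp: Cauchy_convergent_iff convergent_def)
  have "cinner (x - y) (e k) = 0" for k
  proof -
    have "(\<lambda>N. cinner (?s N) (e k)) \<longlonglongrightarrow> cinner y (e k)" by (rule tendsto_cinner_left[OF y])
    moreover have "\<forall>\<^sub>F N in sequentially. cinner (?s N) (e k) = ?c k"
      using eventually_gt_at_top[of k]
      by eventually_elim (simp add: cinner_sum_left cinner_cmul_left cinner_basis sum.delta' if_distrib cong: if_cong)
    ultimately have "(\<lambda>N. ?c k) \<longlonglongrightarrow> cinner y (e k)" by (rule Lim_transform_eventually)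
    then show ?thesis by (simp add: LIMSEQ_const_iff cinner_diff_left)
  qed
  then have "x - y = 0" using e unfolding orthonormal_basis_def by blast
  then have "x = y" by simp
  with y show ?thesis by simp
qed

text \<open>\<open>has_sum\<close> asks for unordered convergence, so absolute summability is needed
  besides the limit of the partial sums; it comes from
  \<open>a * b \<le> a\<^sup>2 + b\<^sup>2\<close> and Bessel's inequality.\<close>

lemma Parseval: "((\<lambda>n. cinner x (e n) * cnj (cinner y (e n))) has_sum cinner x y) UNIV"
proof (rule norm_summable_imp_has_sum)
  show "(\<lambda>n. cinner x (e n) * cnj (cinner y (e n))) sums cinner x y"
    using tendsto_cinner_left[OF Fourier_expansion[of x], of y]
    by (simp add: sums_def cinner_sum_left cinner_cmul_left cinner_commute[of "e _" y])
  have sm: "summable (\<lambda>n. (cmod (cinner x (e n)))\<^sup>2)" for x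
    by (rule bounded_imp_summable[of _ "(norm x)\<^sup>2"]) (auto simp only: lessThan_Suc_atMost[symmetric] Bessel zero_le_power2)
  have *: "a * b \<le> a\<^sup>2 + b\<^sup>2" if "a \<ge> 0" "b \<ge> 0" for a b :: real
    using sum_squares_bound[of a b] mult_nonneg_nonneg[OF that] by linarith
  show "summable (\<lambda>n. norm (cinner x (e n) * cnj (cinner y (e n))))"
    by (rule summable_comparison_test'[OF summable_add[OF sm[of x] sm[of y]], of 0]) (auto simp: norm_mult intro!: *)
qed

lemma Parseval_norm: "((\<lambda>n. (cmod (cinner x (e n)))\<^sup>2) has_sum (norm x)\<^sup>2) UNIV"
proof -
  have "((\<lambda>n. Re (cinner x (e n) * cnj (cinner x (e n)))) has_sum Re (cinner x x)) UNIV"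
    by (rule has_sum_Re[OF Parseval])
  then show ?thesis
    by (simp add: Re_cinner power2_norm_eq_inner[symmetric] Re_Im_cmod)
       (simp add: Re_Im_cmod[symmetric] Re_cinner)
qed

end

section \<open>Totality of the trigonometric monomials\<close>

lemma integral_unit_interval: "(LINT x|unit_cube. f x) = (LBINT x:{0..1::real}. f x)"
  for f :: "real \<Rightarrow> 'a::{banach, second_countable_topology}"
  unfolding unit_cube_def set_lebesgue_integral_def by (subst integral_restrict_space) simp_all

lemma integral_cis:
  "(LINT x|unit_cube. cis (2 * pi * of_int k * x)) = (if k = 0 then 1 else 0)"
proof (cases "k = 0")
  case True
  then show ?thesis using unit_cube.prob_space[where 'd=real] by simp
next
  case False
  let ?F = "\<lambda>x. - \<i> / (2 * pi * of_int k) * cis (2 * pi * of_int k * x)"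
  have "(LINT x|unit_cube. cis (2 * pi * of_int k * x)) = (LBINT x. indicator {0..1} x *\<^sub>R cis (2 * pi * of_int k * x))"
    by (simp add: integral_unit_interval set_lebesgue_integral_def)
  also have "\<dots> = ?F 1 - ?F 0"
  proof (rule integral_FTC_atLeastAtMost)
    fix x :: real
    have "((\<lambda>x. cis (2 * pi * of_int k * x)) has_derivative (\<lambda>t. (2 * pi * of_int k * t) *\<^sub>R (\<i> * cis (2 * pi * of_int k * x)))) (at x within {0..1})"
      by (rule has_derivative_cis) (auto intro!: derivative_eq_intros)
    then have "(?F has_derivative (\<lambda>t. - \<i> / (2 * pi * of_int k) * ((2 * pi * of_int k * t) *\<^sub>R (\<i> * cis (2 * pi * of_int k * x))))) (at x within {0..1})"
      by (rule has_derivative_mult_right)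
    moreover have "(\<lambda>t. - \<i> / (2 * pi * of_int k) * ((2 * pi * of_int k * t) *\<^sub>R (\<i> * cis (2 * pi * of_int k * x)))) = (\<lambda>t. t *\<^sub>R cis (2 * pi * of_int k * x))"
      using False by (auto simp: scaleR_conv_of_real field_simps)
    ultimately show "(?F has_vector_derivative cis (2 * pi * of_int k * x)) (at x within {0..1})"
      by (simp add: has_vector_derivative_def)
  next
    show "continuous_on {0..1} (\<lambda>x. cis (2 * pi * of_int k * x))"
      by (intro continuous_intros)
  qed simp
  also have "cis (2 * pi * of_int k) = 1" using cos_int_2pin[of k] sin_int_2pin[of k] by (simp add: complex_eq_iff mult_ac)
  then have "?F 1 - ?F 0 = 0" by simp
  finally show ?thesis using False by simp
qed

definition trig_mono :: "int \<Rightarrow> complex_L2" where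
  "trig_mono n = abs_L2 (\<lambda>x. cis (2 * pi * of_int n * x))"

lemma square_integrable_cis: "square_integrable (\<lambda>x::real. cis (2 * pi * of_int n * x))"
  by (rule square_integrable_bounded[of _ 1]) (auto intro!: borel_measurable_unit_cube borel_measurable_continuous_onI continuous_intros)

lemma rep_trig_mono: "AE x in unit_cube. rep_L2 (trig_mono n) x = cis (2 * pi * of_int n * x)"
  unfolding trig_mono_def by (rule rep_abs_L2[OF square_integrable_cis])

lemma cinner_trig_mono: "cinner g (trig_mono n) = (LINT x|unit_cube. rep_L2 g x * cis (2 * pi * of_int (- n) * x))"
  unfolding cinner_def using rep_trig_mono[of n]
  by (intro integral_cong_AE) (auto elim!: eventually_mono simp: cis_cnj)

text \<open>Finite sums are generated without an index set, so closure under products is a double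
  induction. These functions form the algebra to which polynomials on the circle are
  transferred.\<close>

inductive trig_poly :: "(real \<Rightarrow> complex) \<Rightarrow> bool" where
  mono: "trig_poly (\<lambda>x. c * cis (2 * pi * of_int n * x))"
| add: "trig_poly f \<Longrightarrow> trig_poly g \<Longrightarrow> trig_poly (\<lambda>x. f x + g x)"

lemma trig_poly_mult: "trig_poly f \<Longrightarrow> trig_poly g \<Longrightarrow> trig_poly (\<lambda>x. f x * g x)"
proof (induction arbitrary: g rule: trig_poly.induct)
  case (mono c n)
  from mono show ?case
  proof (induction rule: trig_poly.induct)
    case (mono d m)
    have "(\<lambda>x. c * cis (2 * pi * of_int n * x) * (d * cis (2 * pi * of_int m * x)))
        = (\<lambda>x. (c * d) * cis (2 * pi * of_int (n + m) * x))"
      by (auto simp: fun_eq_iff algebra_simps simp flip: cis_mult)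
    then show ?case by (metis trig_poly.mono)
  next
    case (add f g)
    from trig_poly.add[OF add.IH] show ?case by (simp add: distrib_left)
  qed
next
  case (add f h)
  from trig_poly.add[OF add.IH[OF add.prems]] show ?case by (simp add: distrib_right)
qed

text \<open>Stone-Weierstrass supplies polynomials in the coordinates of the plane; composed with
  the parametrisation of the unit circle they become trigonometric polynomials.\<close>

lemma trig_poly_real_polynomial_function:
  "real_polynomial_function p \<Longrightarrow> trig_poly (\<lambda>x. complex_of_real (p (cis (2 * pi * x))))"
proof (induction rule: real_polynomial_function.induct)
  case (linear h)
  interpret bounded_linear h by fact
  \<comment> \<open>The coefficients come from writing cosine and sine as combinations of
    \<open>cis\<close> at opposite angles.\<close>
  have *: "complex_of_real (h (cis (2 * pi * x))) =
     (of_real (h 1) / 2 - \<i> * of_real (h \<i>) / 2) * cis (2 * pi * of_int 1 * x)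
     + (of_real (h 1) / 2 + \<i> * of_real (h \<i>) / 2) * cis (2 * pi * of_int (- 1) * x)" for x
  proof -
    have "cis (2 * pi * x) = cos (2 * pi * x) *\<^sub>R 1 + sin (2 * pi * x) *\<^sub>R \<i>"
      by (simp add: complex_eq_iff)
    then have "h (cis (2 * pi * x)) = cos (2 * pi * x) * h 1 + sin (2 * pi * x) * h \<i>"
      by (simp only: add scaleR real_scaleR_def)
    then show ?thesis by (simp add: complex_eq_iff algebra_simps)
  qed
  show ?case unfolding * by (intro trig_poly.intros)
next
  case (const c)
  then show ?case using trig_poly.mono[of "of_real c" 0] by simp
next
  case (add f g)
  from trig_poly.add[OF add.IH] show ?case by simp
next
  case (mult f g)
  from trig_poly_mult[OF mult.IH] show ?case by simp
qed

lemma orthogonal_trig_poly: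
  assumes g: "\<And>n. cinner g (trig_mono n) = 0" and f: "trig_poly f"
  shows "integrable unit_cube (\<lambda>x. rep_L2 g x * f x)" "(LINT x|unit_cube. rep_L2 g x * f x) = 0"
proof -
  have "integrable unit_cube (\<lambda>x. rep_L2 g x * f x) \<and> (LINT x|unit_cube. rep_L2 g x * f x) = 0"
    using f
  proof (induction rule: trig_poly.induct)
    case (mono c n)
    have i: "integrable unit_cube (\<lambda>x. rep_L2 g x * cis (2 * pi * of_int n * x))"
      by (rule Bochner_Integration.integrable_bound[OF square_integrable_imp_integrable[OF square_integrable_rep[of g]]])
       (auto simp: norm_mult)
    then have "integrable unit_cube (\<lambda>x. c * (rep_L2 g x * cis (2 * pi * of_int n * x)))" by simp
    moreover have "(LINT x|unit_cube. c * (rep_L2 g x * cis (2 * pi * of_int n * x))) = 0"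
      using g[of "- n"] by (simp add: cinner_trig_mono)
    ultimately show ?case by (simp add: mult_ac)
  next
    case (add f h)
    then show ?case by (simp add: distrib_left)
  qed
  then show "integrable unit_cube (\<lambda>x. rep_L2 g x * f x)" "(LINT x|unit_cube. rep_L2 g x * f x) = 0" by auto
qed

text \<open>On the unit circle \<open>\<Phi>\<close> is within \<open>r\<close> of a polynomial,
  against which \<open>g\<close> integrates to 0, so the integral is at most \<open>r\<close> times
  the norm of \<open>g\<close> for every positive \<open>r\<close>.\<close>

lemma orthogonal_continuous_circle:
  assumes g: "\<And>n. cinner g (trig_mono n) = 0" and \<Phi>: "continuous_on UNIV \<Phi>" "\<And>z. \<bar>\<Phi> z\<bar> \<le> 1"
  shows "(LINT x|unit_cube. rep_L2 g x * complex_of_real (\<Phi> (cis (2 * pi * x)))) = 0"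
proof -
  let ?I = "LINT x|unit_cube. rep_L2 g x * complex_of_real (\<Phi> (cis (2 * pi * x)))"
  have gi: "integrable unit_cube (rep_L2 g)" by (intro square_integrable_imp_integrable square_integrable_rep)
  have cm: "(\<lambda>x. complex_of_real (\<Phi> (cis (2 * pi * x)))) \<in> borel_measurable unit_cube"
    by (intro borel_measurable_unit_cube borel_measurable_continuous_onI continuous_intros
        continuous_on_compose2[OF \<Phi>(1)]) auto
  have i1: "integrable unit_cube (\<lambda>x. rep_L2 g x * complex_of_real (\<Phi> (cis (2 * pi * x))))"
    by (rule Bochner_Integration.integrable_bound[OF gi])
      (use \<Phi>(2) cm in \<open>auto simp: norm_mult intro!: mult_left_le borel_measurable_times\<close>)
  have bound: "norm ?I \<le> r * norm g" if r: "r > 0" for r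
  proof -
    obtain p where p: "real_polynomial_function p" "\<And>z. z \<in> sphere 0 1 \<Longrightarrow> \<bar>\<Phi> z - p z\<bar> < r"
      by (rule Stone_Weierstrass_real_polynomial_function[of "sphere (0::complex) 1" \<Phi> r])
        (use \<Phi> r in \<open>auto intro: continuous_on_subset\<close>)
    let ?f = "\<lambda>x. complex_of_real (p (cis (2 * pi * x)))"
    note o = orthogonal_trig_poly[OF g trig_poly_real_polynomial_function[OF p(1)]]
    have "?I = (LINT x|unit_cube. rep_L2 g x * complex_of_real (\<Phi> (cis (2 * pi * x))) - rep_L2 g x * ?f x)"
      using Bochner_Integration.integral_diff[OF i1 o(1)] o(2) by simp
    also have "norm \<dots> \<le> (LINT x|unit_cube. r * norm (rep_L2 g x))"
    proof (rule Bochner_Integration.integral_norm_bound_integral)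
      fix x :: real
      have "norm (rep_L2 g x * complex_of_real (\<Phi> (cis (2 * pi * x))) - rep_L2 g x * ?f x)
          = norm (rep_L2 g x) * \<bar>\<Phi> (cis (2 * pi * x)) - p (cis (2 * pi * x))\<bar>"
        by (simp flip: right_diff_distrib of_real_diff add: norm_mult)
      also have "\<dots> \<le> norm (rep_L2 g x) * r"
        using p(2)[of "cis (2 * pi * x)"] by (intro mult_left_mono) auto
      finally show "norm (rep_L2 g x * complex_of_real (\<Phi> (cis (2 * pi * x))) - rep_L2 g x * ?f x) \<le> r * norm (rep_L2 g x)"
        by (simp add: mult.commute)
    qed (use gi i1 o in auto)
    also have "\<dots> \<le> r * norm g" using integral_norm_rep_le[of g] r by simp
    finally show ?thesis .
  qed
  have "norm ?I \<le> 0"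
  proof (rule field_le_epsilon)
    fix d :: real assume d: "d > 0"
    \<comment> \<open>The 1 in the denominator covers the case \<open>norm g = 0\<close>.\<close>
    have "norm ?I \<le> d / (norm g + 1) * norm g" by (rule bound) (use d norm_ge_zero[of g] in \<open>intro divide_pos_pos, auto simp del: norm_ge_zero\<close>)
    also have "\<dots> \<le> d"
      using d by (simp add: pos_divide_le_eq add_nonneg_pos distrib_left)
    finally show "norm ?I \<le> 0 + d" by simp
  qed
  then show ?thesis by simp
qed

text \<open>The point \<open>x\<close> has to be interior because the end points 0 and 1 have the
  same image on the circle.\<close>

lemma cis_2pi_inj:
  assumes "cis (2 * pi * x) = cis (2 * pi * y)" "0 < x" "x < 1" "0 \<le> y" "y \<le> 1"
  shows "x = y"
proof -
  have "cis (2 * pi * (x - y)) = 1" using assms(1) by (simp add: right_diff_distrib flip: cis_divide)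
  then have "cos (2 * pi * (x - y)) = 1" by (metis cis.sel(1) one_complex.sel(1))
  then obtain n :: int where "2 * pi * (x - y) = of_int n * (2 * pi)" by (auto simp: cos_one_2pi_int)
  then have n: "x - y = of_int n" by (simp add: mult.commute)
  then have "-1 < real_of_int n" "real_of_int n < 1" using assms by linarith+
  then have "n = 0" by linarith
  then show ?thesis using n by simp
qed

text \<open>Continuous functions on the circle approximate indicators of open sets from below, which
  upgrades orthogonality to the monomials to vanishing integrals over all open sets.\<close>

lemma trig_mono_total:
  assumes g: "\<And>n. cinner g (trig_mono n) = 0"
  shows "g = 0"
proof (rule L2_eq_0I[of "{S. open S}"])
  show "Int_stable {S::real set. open S}" by (auto simp: Int_stable_def)
  show "sigma_sets UNIV {S. open S} = sets (borel :: real measure)" by (simp add: sets_borel)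
  fix U :: "real set" assume "U \<in> {S. open S}"
  then have U: "open U" by simp
  \<comment> \<open>The end points are removed because the circle identifies them, so that
    membership in \<open>V\<close> can be read off from the image point. They form a null set, so
    \<open>U\<close> and \<open>V\<close> give the same integral.\<close>
  define V where "V = U \<inter> {0<..<1}"
  define K where "K = (\<lambda>x. cis (2 * pi * x)) ` ({0..1} - V)"
  have "compact ({0..1} - V)" unfolding V_def by (intro compact_diff) (use U in auto)
  then have "compact K" unfolding K_def by (intro compact_continuous_image continuous_intros)
  have "0 \<in> {0..1} - V" by (simp add: V_def)
  then have ne: "K \<noteq> {}" unfolding K_def by blast
  \<comment> \<open>As \<open>n\<close> grows, this truncated multiple of the distance tends to 1
    off the closed set \<open>K\<close> and stays 0 on it.\<close>
  define \<Phi> where "\<Phi> n z = min 1 (real n * infdist z K)" for n z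
  have z: "(LINT x|unit_cube. rep_L2 g x * complex_of_real (\<Phi> n (cis (2 * pi * x)))) = 0" for n
    by (rule orthogonal_continuous_circle[OF g])
      (auto simp: \<Phi>_def infdist_nonneg intro!: continuous_intros)
  have gi: "integrable unit_cube (rep_L2 g)" by (intro square_integrable_imp_integrable square_integrable_rep)
  have "(\<lambda>n. LINT x|unit_cube. rep_L2 g x * complex_of_real (\<Phi> n (cis (2 * pi * x)))) \<longlonglongrightarrow> (LINT x|unit_cube. rep_L2 g x * indicator V x)"
  proof (rule integral_dominated_convergence[where w = "\<lambda>x. norm (rep_L2 g x)"])
    show "AE x in unit_cube. (\<lambda>n. rep_L2 g x * complex_of_real (\<Phi> n (cis (2 * pi * x)))) \<longlonglongrightarrow> rep_L2 g x * indicator V x"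
    proof (rule AE_I2)
      fix x :: real assume "x \<in> space unit_cube"
      then have x: "x \<in> {0..1}" by simp
      have "(\<lambda>n. \<Phi> n (cis (2 * pi * x))) \<longlonglongrightarrow> indicator V x"
      proof (cases "x \<in> V")
        case False
        then have "cis (2 * pi * x) \<in> K" using x by (auto simp: K_def)
        then show ?thesis using False by (simp add: \<Phi>_def infdist_zero)
      next
        case True
        then have "cis (2 * pi * x) \<notin> K" using cis_2pi_inj by (fastforce simp: K_def V_def)
        then have pos: "infdist (cis (2 * pi * x)) K > 0"
          using infdist_pos_not_in_closed[OF compact_imp_closed[OF \<open>compact K\<close>] ne] by blast
        obtain N where N: "1 / infdist (cis (2 * pi * x)) K < real N" using reals_Archimedean2 by blast
        have "\<forall>\<^sub>F n in sequentially. \<Phi> n (cis (2 * pi * x)) = 1"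
          using eventually_ge_at_top[of N]
        proof eventually_elim
          case (elim n)
          then have "1 / infdist (cis (2 * pi * x)) K < real n" using N by linarith
          then show ?case using pos by (simp add: \<Phi>_def field_simps min_def)
        qed
        then show ?thesis using True by (simp add: tendsto_eventually)
      qed
      then have "(\<lambda>n. complex_of_real (\<Phi> n (cis (2 * pi * x)))) \<longlonglongrightarrow> complex_of_real (indicator V x)"
        by (rule tendsto_of_real)
      then show "(\<lambda>n. rep_L2 g x * complex_of_real (\<Phi> n (cis (2 * pi * x)))) \<longlonglongrightarrow> rep_L2 g x * indicator V x"
        by (intro tendsto_mult tendsto_const) (simp add: of_real_indicator)
    qed
    show "AE x in unit_cube. norm (rep_L2 g x * complex_of_real (\<Phi> n (cis (2 * pi * x)))) \<le> norm (rep_L2 g x)" for n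
      by (intro AE_I2) (auto simp: norm_mult \<Phi>_def infdist_nonneg intro!: mult_left_le)
    show "(\<lambda>x. rep_L2 g x * complex_of_real (\<Phi> n (cis (2 * pi * x)))) \<in> borel_measurable unit_cube" for n
      by (intro borel_measurable_times measurable_rep borel_measurable_unit_cube borel_measurable_continuous_onI)
        (auto simp: \<Phi>_def intro!: continuous_intros)
    show "(\<lambda>x. rep_L2 g x * indicator V x) \<in> borel_measurable unit_cube"
      using U by (intro borel_measurable_times measurable_rep borel_measurable_unit_cube borel_measurable_indicator) (auto simp: V_def)
  qed (use gi in auto)
  then have V0: "(LINT x|unit_cube. rep_L2 g x * indicator V x) = 0"
    unfolding z by (simp add: LIMSEQ_const_iff)
  have "AE x in lborel. x \<noteq> 0 \<and> x \<noteq> (1::real)"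
    using AE_lborel_singleton[of "0::real"] AE_lborel_singleton[of "1::real"] by eventually_elim auto
  then have ae: "AE x in unit_cube. x \<noteq> 0 \<and> x \<noteq> (1::real)"
    unfolding unit_cube_def by (subst AE_restrict_space_iff) (auto elim: eventually_mono)
  have "(LINT x:(U \<inter> cbox 0 One)|unit_cube. rep_L2 g x) = (LINT x|unit_cube. rep_L2 g x * indicator V x)"
    unfolding set_lebesgue_integral_def
  proof (rule integral_cong_AE)
    have "AE x in unit_cube. x \<in> space unit_cube" by (rule AE_space)
    with ae show "AE x in unit_cube. indicator (U \<inter> cbox 0 One) x *\<^sub>R rep_L2 g x = rep_L2 g x * indicator V x"
      by eventually_elim (auto simp: V_def indicator_def)
    show "(\<lambda>x. indicator (U \<inter> cbox 0 One) x *\<^sub>R rep_L2 g x) \<in> borel_measurable unit_cube"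
      using U by (intro borel_measurable_scaleR measurable_rep borel_measurable_indicator sets_unit_cube) auto
    show "(\<lambda>x. rep_L2 g x * indicator V x) \<in> borel_measurable unit_cube"
      using U by (intro borel_measurable_times measurable_rep borel_measurable_unit_cube borel_measurable_indicator) (auto simp: V_def)
  qed
  with V0 show "(LINT x:(U \<inter> cbox 0 One)|unit_cube. rep_L2 g x) = 0" by simp
qed simp

text \<open>Provides the witness for the choice in \<open>some_basis\<close>; without it the
  Hilbert-Schmidt norm and the trace would refer to an arbitrary sequence. \<open>int_decode\<close>
  renumbers the integer frequencies by natural numbers.\<close>

lemma orthonormal_basis_trig: "orthonormal_basis (\<lambda>n. trig_mono (int_decode n))"
  unfolding orthonormal_basis_def
proof (intro conjI allI impI)
  fix m n
  have "cinner (trig_mono k) (trig_mono l) = (if k = l then 1 else 0)" for k l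
  proof -
    have "cinner (trig_mono k) (trig_mono l) = (LINT x|unit_cube. cis (2 * pi * of_int (k - l) * x))"
      unfolding cinner_trig_mono using rep_trig_mono[of k]
      by (intro integral_cong_AE) (auto elim!: eventually_mono simp: cis_mult algebra_simps)
    then show ?thesis by (simp only: integral_cis) auto
  qed
  then show "cinner (trig_mono (int_decode m)) (trig_mono (int_decode n)) = (if m = n then 1 else 0)"
    by (simp add: int_decode_eq)
next
  fix g assume a: "\<forall>n. cinner g (trig_mono (int_decode n)) = 0"
  show "g = 0"
    by (rule trig_mono_total) (use a[rule_format, of "int_encode _"] in simp)
qed

lemma orthonormal_basis_some_basis: "orthonormal_basis some_basis"
  unfolding some_basis_def by (rule someI[of orthonormal_basis, OF orthonormal_basis_trig])

section \<open>Integral operators\<close>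

lemma measurable_kernel_slice:
  fixes k :: "real \<times> real \<Rightarrow> 'a::topological_space"
  assumes "k \<in> borel_measurable unit_cube" "\<sigma> \<in> space unit_cube"
  shows "(\<lambda>\<tau>. k (\<sigma>, \<tau>)) \<in> borel_measurable unit_cube"
  using assms by (intro measurable_compose[OF measurable_Pair1' assms(1)[folded unit_cube_pair]]) auto

lemma square_integrable_kernel_slice:
  fixes k :: "real \<times> real \<Rightarrow> complex"
  assumes "square_integrable k"
  shows "AE \<sigma> in unit_cube. square_integrable (\<lambda>\<tau>. k (\<sigma>, \<tau>))"
proof -
  have "AE \<sigma> in unit_cube. integrable unit_cube (\<lambda>\<tau>. (norm (k (\<sigma>, \<tau>)))\<^sup>2)"
    using unit_square.AE_integrable_fst'[of "\<lambda>p. (norm (k p))\<^sup>2"] assms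
    by (simp add: unit_cube_pair square_integrable_def)
  with AE_space[of unit_cube] show ?thesis
    by eventually_elim (use assms in \<open>auto simp: square_integrable_def intro!: measurable_kernel_slice\<close>)
qed

text \<open>The kernel acts without conjugation whereas \<open>cinner\<close> conjugates its second
  argument; so the slice is conjugated and the resulting product is conjugated back.\<close>

lemma integral_mult_eq_cinner:
  assumes "square_integrable f"
  shows "(LINT x|unit_cube. f x * rep_L2 g x) = cnj (cinner (abs_L2 (\<lambda>x. cnj (f x))) g)"
proof -
  have sq: "square_integrable (\<lambda>x. cnj (f x))"
    using assms by (auto simp: square_integrable_def)
  have [measurable]: "f \<in> borel_measurable unit_cube" using assms by (simp add: square_integrable_def)
  have "cinner (abs_L2 (\<lambda>x. cnj (f x))) g = (LINT x|unit_cube. cnj (f x) * cnj (rep_L2 g x))"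
    unfolding cinner_def using rep_abs_L2[OF sq] by (intro integral_cong_AE) (auto elim!: eventually_mono)
  also have "\<dots> = cnj (LINT x|unit_cube. f x * rep_L2 g x)"
    by (subst Bochner_Integration.integral_cnj[symmetric]) simp
  finally show ?thesis by simp
qed

text \<open>Multiplying \<open>g\<close> by the conjugate phase of the product makes the product
  real and nonnegative, which reduces the claim to Cauchy-Schwarz for the real inner
  product.\<close>

lemma norm_cinner_le: "cmod (cinner g h) \<le> norm g * norm h"
proof (cases "cinner g h = 0")
  case False
  define z where "z = cinner g h"
  define c where "c = cnj (sgn z)"
  have "cnj z * z = of_real ((cmod z)\<^sup>2)"
    by (simp add: complex_norm_square mult.commute flip: of_real_power)
  then have "c * z = of_real ((cmod z)\<^sup>2) / of_real (cmod z)"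
    by (simp add: c_def sgn_eq)
  also have "\<dots> = of_real (cmod z)" by (simp add: power2_eq_square)
  finally have "cmod (cinner g h) = Re (c * cinner g h)" by (simp add: z_def)
  also have "\<dots> = cmul c g \<bullet> h" by (simp add: Re_cinner flip: cinner_cmul_left)
  also have "\<dots> \<le> norm (cmul c g) * norm h" by (rule norm_cauchy_schwarz)
  also have "\<dots> = norm g * norm h" using False by (simp add: norm_cmul c_def z_def norm_sgn)
  finally show ?thesis .
qed simp

lemma norm_abs_cnj:
  fixes f :: "real \<Rightarrow> complex"
  assumes "square_integrable f" shows "(norm (abs_L2 (\<lambda>x. cnj (f x))))\<^sup>2 = (LINT x|unit_cube. (norm (f x))\<^sup>2)"
  using assms by (subst norm_abs_L2) (auto simp: square_integrable_def)

context
  fixes k :: "real \<times> real \<Rightarrow> complex"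
  assumes k: "square_integrable k"
begin

lemma measurable_integral_op [measurable]:
  "(\<lambda>\<sigma>. LINT \<tau>|unit_cube. k (\<sigma>, \<tau>) * rep_L2 g \<tau>) \<in> borel_measurable unit_cube"
proof -
  have [measurable]: "k \<in> borel_measurable (unit_cube \<Otimes>\<^sub>M unit_cube)"
    using k by (simp add: square_integrable_def unit_cube_pair)
  show ?thesis by (rule unit_cube.borel_measurable_lebesgue_integral) measurable
qed

lemma integral_op_slice:
  "AE \<sigma> in unit_cube. (LINT \<tau>|unit_cube. k (\<sigma>, \<tau>) * rep_L2 g \<tau>)
     = cnj (cinner (abs_L2 (\<lambda>\<tau>. cnj (k (\<sigma>, \<tau>)))) g)"
  using square_integrable_kernel_slice[OF k] by eventually_elim (rule integral_mult_eq_cinner)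

lemma integrable_slice_norm: "integrable unit_cube (\<lambda>\<sigma>. LINT \<tau>|unit_cube. (norm (k (\<sigma>, \<tau>)))\<^sup>2)"
  and integral_slice_norm: "(LINT \<sigma>|unit_cube. LINT \<tau>|unit_cube. (norm (k (\<sigma>, \<tau>)))\<^sup>2) = (norm (abs_L2 k))\<^sup>2"
  using unit_square.integrable_fst'[of "\<lambda>p. (norm (k p))\<^sup>2"] k integral_unit_square[of "\<lambda>p. (norm (k p))\<^sup>2"]
  by (simp_all add: unit_cube_pair square_integrable_def norm_abs_L2[OF k])

text \<open>Cauchy-Schwarz on almost every slice bounds the value at \<open>\<sigma>\<close> by the
  slice norm times \<open>norm g\<close>, and the squared slice norms are integrable by
  Fubini.\<close>

lemma square_integrable_integral_op:
  "square_integrable (\<lambda>\<sigma>. LINT \<tau>|unit_cube. k (\<sigma>, \<tau>) * rep_L2 g \<tau>)"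
  unfolding square_integrable_def
proof (intro conjI measurable_integral_op)
  show "integrable unit_cube (\<lambda>\<sigma>. (norm (LINT \<tau>|unit_cube. k (\<sigma>, \<tau>) * rep_L2 g \<tau>))\<^sup>2)"
  proof (rule Bochner_Integration.integrable_bound)
    show "integrable unit_cube (\<lambda>\<sigma>. (LINT \<tau>|unit_cube. (norm (k (\<sigma>, \<tau>)))\<^sup>2) * (norm g)\<^sup>2)"
      using integrable_slice_norm by simp
    show "AE \<sigma> in unit_cube. norm ((norm (LINT \<tau>|unit_cube. k (\<sigma>, \<tau>) * rep_L2 g \<tau>))\<^sup>2)
        \<le> norm ((LINT \<tau>|unit_cube. (norm (k (\<sigma>, \<tau>)))\<^sup>2) * (norm g)\<^sup>2)"
      using square_integrable_kernel_slice[OF k] integral_op_slice[of g]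
    proof eventually_elim
      case (elim \<sigma>)
      have "(cmod (cinner (abs_L2 (\<lambda>\<tau>. cnj (k (\<sigma>, \<tau>)))) g))\<^sup>2 \<le> (norm (abs_L2 (\<lambda>\<tau>. cnj (k (\<sigma>, \<tau>)))) * norm g)\<^sup>2"
        by (intro power_mono norm_cinner_le) simp
      then show ?case unfolding elim(2) using norm_abs_cnj[OF elim(1)] by (simp add: power_mult_distrib)
    qed
  qed simp
qed

text \<open>For almost every \<open>\<sigma>\<close> the values at \<open>\<sigma>\<close> of the
  images of the basis are the conjugated Fourier coefficients of the conjugated slice. Parseval
  evaluates the sum over the basis slice by slice, and Tonelli integrates the result over
  \<open>\<sigma>\<close>.\<close>

lemma integral_op_sum_norm:
  assumes e: "orthonormal_basis e"
  shows "((\<lambda>n. (norm (integral_op k (e n)))\<^sup>2) has_sum (norm (abs_L2 k))\<^sup>2) UNIV"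
proof -
  let ?f = "\<lambda>n \<sigma>. LINT \<tau>|unit_cube. k (\<sigma>, \<tau>) * rep_L2 (e n) \<tau>"
  have n: "ennreal ((norm (integral_op k (e n)))\<^sup>2) = (\<integral>\<^sup>+\<sigma>. ennreal ((norm (?f n \<sigma>))\<^sup>2) \<partial>unit_cube)" for n
    using square_integrable_integral_op[of "e n"] unfolding integral_op_def
    by (subst nn_integral_eq_integral) (auto simp: norm_abs_L2 square_integrable_def)
  have "(\<Sum>n. ennreal ((norm (integral_op k (e n)))\<^sup>2)) = (\<integral>\<^sup>+\<sigma>. (\<Sum>n. ennreal ((norm (?f n \<sigma>))\<^sup>2)) \<partial>unit_cube)"
    unfolding n by (rule nn_integral_suminf[symmetric]) measurable
  also have "\<dots> = (\<integral>\<^sup>+\<sigma>. ennreal (LINT \<tau>|unit_cube. (norm (k (\<sigma>, \<tau>)))\<^sup>2) \<partial>unit_cube)"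
  proof (rule nn_integral_cong_AE)
    have "AE \<sigma> in unit_cube. \<forall>n. ?f n \<sigma> = cnj (cinner (abs_L2 (\<lambda>\<tau>. cnj (k (\<sigma>, \<tau>)))) (e n))"
      by (intro AE_all_countable[THEN iffD2] allI integral_op_slice)
    then show "AE \<sigma> in unit_cube. (\<Sum>n. ennreal ((norm (?f n \<sigma>))\<^sup>2)) = ennreal (LINT \<tau>|unit_cube. (norm (k (\<sigma>, \<tau>)))\<^sup>2)"
      using square_integrable_kernel_slice[OF k]
    proof eventually_elim
      case (elim \<sigma>)
      have "(\<lambda>n. (norm (?f n \<sigma>))\<^sup>2) sums (norm (abs_L2 (\<lambda>\<tau>. cnj (k (\<sigma>, \<tau>)))))\<^sup>2"
        using has_sum_imp_sums[OF Parseval_norm[OF e, of "abs_L2 (\<lambda>\<tau>. cnj (k (\<sigma>, \<tau>)))"]] elim(1) by simp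
      then show ?case unfolding norm_abs_cnj[OF elim(2)] by (intro suminf_ennreal_eq) auto
    qed
  qed
  also have "\<dots> = ennreal ((norm (abs_L2 k))\<^sup>2)"
    unfolding integral_slice_norm[symmetric]
    by (intro nn_integral_eq_integral integrable_slice_norm AE_I2) simp
  finally have *: "(\<Sum>n. ennreal ((norm (integral_op k (e n)))\<^sup>2)) = ennreal ((norm (abs_L2 k))\<^sup>2)" .
  then have s: "summable (\<lambda>n. (norm (integral_op k (e n)))\<^sup>2)"
    by (intro summable_suminf_not_top) auto
  then have "(\<Sum>n. (norm (integral_op k (e n)))\<^sup>2) = (norm (abs_L2 k))\<^sup>2"
    using * by (subst (asm) suminf_ennreal2) (auto simp: suminf_nonneg)
  with s show ?thesis
    by (intro norm_summable_imp_has_sum) (auto simp: sums_iff)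
qed

text \<open>The bridge from Hilbert-Schmidt norms of operators to norms of their kernels, where all
  estimates are made.\<close>

lemma hs_norm_integral_op: "hs_norm (integral_op k) = norm (abs_L2 k)"
  unfolding hs_norm_def infsumI[OF integral_op_sum_norm[OF orthonormal_basis_some_basis]] by simp

end

text \<open>A slice is square integrable only for almost every \<open>\<sigma>\<close>, so the two
  sides agree almost everywhere, which suffices for equality of classes.\<close>

lemma integral_op_linear_combination:
  fixes k l :: "real \<times> real \<Rightarrow> complex"
  assumes k: "square_integrable k" "square_integrable l"
  shows "a *\<^sub>R integral_op k g + b *\<^sub>R integral_op l g = integral_op (\<lambda>p. a *\<^sub>R k p + b *\<^sub>R l p) g"
proof -
  have kl: "square_integrable (\<lambda>p. a *\<^sub>R k p + b *\<^sub>R l p)"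
    by (intro square_integrable_add square_integrable_scaleR k)
  have prod: "integrable unit_cube (\<lambda>\<tau>. f \<tau> * rep_L2 g \<tau>)" if "square_integrable f" for f :: "real \<Rightarrow> complex"
  proof -
    have "integrable unit_cube (\<lambda>x. norm (f x) \<bullet> norm (rep_L2 g x))"
      using that square_integrable_rep[of g]
      by (intro integrable_inner_square_integrable) (auto simp: square_integrable_def)
    then show ?thesis
      by (rule Bochner_Integration.integrable_bound)
       (use that in \<open>auto simp: norm_mult square_integrable_def\<close>)
  qed
  have "AE \<sigma> in unit_cube. a *\<^sub>R (LINT \<tau>|unit_cube. k (\<sigma>, \<tau>) * rep_L2 g \<tau>) + b *\<^sub>R (LINT \<tau>|unit_cube. l (\<sigma>, \<tau>) * rep_L2 g \<tau>)
     = (LINT \<tau>|unit_cube. (a *\<^sub>R k (\<sigma>, \<tau>) + b *\<^sub>R l (\<sigma>, \<tau>)) * rep_L2 g \<tau>)"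
    using square_integrable_kernel_slice[OF k(1)] square_integrable_kernel_slice[OF k(2)]
    by eventually_elim (use prod in \<open>simp add: distrib_right\<close>)
  then show ?thesis
    unfolding integral_op_def scaleR_abs_L2[OF square_integrable_integral_op[OF k(1)]]
      scaleR_abs_L2[OF square_integrable_integral_op[OF k(2)]]
    using square_integrable_integral_op[OF kl] 
    by (subst add_abs_L2) (auto intro!: abs_L2_eqI square_integrable_add square_integrable_scaleR square_integrable_integral_op k)
qed

lemma op_diff_integral_op:
  assumes "square_integrable k" "square_integrable l"
  shows "op_diff (integral_op k) (integral_op l) = integral_op (\<lambda>p. k p - l p)"
  using integral_op_linear_combination[OF assms, of 1 _ "-1"] by (auto simp: op_diff_def fun_eq_iff)

lemma hs_norm_op_diff:
  assumes "square_integrable k" "square_integrable l"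
  shows "hs_norm (op_diff (integral_op k) (integral_op l)) = norm (abs_L2 k - abs_L2 l)"
  by (simp add: op_diff_integral_op assms hs_norm_integral_op square_integrable_diff diff_abs_L2)

lemma hs_norm_op_average:
  assumes "square_integrable k" "square_integrable l"
  shows "hs_norm (op_average (integral_op k) (integral_op l)) = norm (abs_L2 k + abs_L2 l) / 2"
proof -
  have "op_average (integral_op k) (integral_op l) = integral_op (\<lambda>p. (1/2) *\<^sub>R k p + (1/2) *\<^sub>R l p)"
    using integral_op_linear_combination[OF assms, of "1/2" _ "1/2"] by (auto simp: op_average_def fun_eq_iff)
  then have "hs_norm (op_average (integral_op k) (integral_op l)) = norm ((1/2) *\<^sub>R abs_L2 k + (1/2) *\<^sub>R abs_L2 l)"
    using assms by (simp add: hs_norm_integral_op square_integrable_add square_integrable_scaleR add_abs_L2 scaleR_abs_L2)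
  also have "\<dots> = norm ((1/2) *\<^sub>R (abs_L2 k + abs_L2 l))" by (simp add: scaleR_add_right)
  finally show ?thesis by simp
qed

section \<open>Traces, and real vectors inside the complex space\<close>

definition cplx :: "real_L2 \<Rightarrow> complex_L2" where
  "cplx x = abs_L2 (\<lambda>s. complex_of_real (rep_L2 x s))"

lemma square_integrable_of_real:
  "square_integrable f \<Longrightarrow> square_integrable (\<lambda>s. complex_of_real (f s))"
  by (auto simp: square_integrable_def)

lemma cinner_cplx_left: "cinner (cplx x) g = (LINT s|unit_cube. of_real (rep_L2 x s) * cnj (rep_L2 g s))"
  unfolding cinner_def cplx_def
  using rep_abs_L2[OF square_integrable_of_real[OF square_integrable_rep[of x]]]
  by (intro integral_cong_AE) (auto elim!: eventually_mono)

lemma cinner_cplx: "cinner (cplx x) (cplx y) = of_real (x \<bullet> y)"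
proof -
  have "cinner (cplx x) (cplx y) = (LINT s|unit_cube. of_real (rep_L2 x s) * cnj (of_real (rep_L2 y s)))"
    unfolding cinner_cplx_left using rep_abs_L2[OF square_integrable_of_real[OF square_integrable_rep[of y]]]
    by (intro integral_cong_AE) (auto elim!: eventually_mono simp: cplx_def)
  then show ?thesis by (simp add: inner_rep_L2 flip: of_real_mult)
qed

lemma has_sum_finite_sum:
  fixes f :: "'i \<Rightarrow> 'n \<Rightarrow> 'a::topological_comm_monoid_add"
  shows "finite I \<Longrightarrow> (\<And>i. i \<in> I \<Longrightarrow> (f i has_sum s i) A) \<Longrightarrow> ((\<lambda>n. \<Sum>i\<in>I. f i n) has_sum (\<Sum>i\<in>I. s i)) A"
  by (induction I rule: finite_induct) (auto intro!: has_sum_add)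

text \<open>The kernel has finite rank, and each summand contributes one Parseval sum, whose value
  is the inner product of its two factors. This shows that the infinite sum in
  \<open>op_trace\<close> converges, and evaluates it.\<close>

lemma op_trace_has_sum:
  fixes c :: "'i \<Rightarrow> complex" and f h :: "'i \<Rightarrow> real \<Rightarrow> real"
  assumes I: "finite I" and f: "\<And>i. i \<in> I \<Longrightarrow> square_integrable (f i)" and h: "\<And>i. i \<in> I \<Longrightarrow> square_integrable (h i)"
    and e: "orthonormal_basis e"
  shows "((\<lambda>n. cinner (integral_op (\<lambda>p. \<Sum>i\<in>I. c i * of_real (f i (fst p) * h i (snd p))) (e n)) (e n))
     has_sum (\<Sum>i\<in>I. c i * of_real (abs_L2 (f i) \<bullet> abs_L2 (h i)))) UNIV"
proof -
  let ?k = "\<lambda>p. \<Sum>i\<in>I. c i * of_real (f i (fst p) * h i (snd p))"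
  have op: "integral_op ?k g = (\<Sum>i\<in>I. cmul (c i * cnj (cinner (cplx (abs_L2 (h i))) g)) (cplx (abs_L2 (f i))))" for g
  proof -
    have int: "(LINT \<tau>|unit_cube. of_real (h i \<tau>) * rep_L2 g \<tau>) = cnj (cinner (cplx (abs_L2 (h i))) g)" if "i \<in> I" for i
    proof -
      note [measurable] = square_integrable_measurable[OF h[OF that]]
      have "(LINT \<tau>|unit_cube. of_real (h i \<tau>) * rep_L2 g \<tau>) = cnj (cinner (abs_L2 (\<lambda>x. cnj (of_real (h i x)))) g)"
        by (rule integral_mult_eq_cinner[OF square_integrable_of_real[OF h[OF that]]])
      also have "abs_L2 (\<lambda>x. cnj (complex_of_real (h i x))) = cplx (abs_L2 (h i))"
        unfolding cplx_def using rep_abs_L2[OF h[OF that]] h[OF that]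
        by (intro abs_L2_eqI) (auto intro!: square_integrable_of_real square_integrable_rep elim!: eventually_mono)
      finally show ?thesis .
    qed
    have prod: "integrable unit_cube (\<lambda>\<tau>. of_real (h i \<tau>) * rep_L2 g \<tau>)" if "i \<in> I" for i
    proof -
      have "integrable unit_cube (\<lambda>x. norm (h i x) \<bullet> norm (rep_L2 g x))"
        using h[OF that] square_integrable_rep[of g]
        by (intro integrable_inner_square_integrable) (auto simp: square_integrable_def)
      then show ?thesis
        by (rule Bochner_Integration.integrable_bound)
         (use h[OF that] in \<open>auto simp: norm_mult square_integrable_def\<close>)
    qed
    let ?d = "\<lambda>i. c i * cnj (cinner (cplx (abs_L2 (h i))) g)"
    have "(LINT \<tau>|unit_cube. ?k (\<sigma>, \<tau>) * rep_L2 g \<tau>) = (\<Sum>i\<in>I. ?d i * of_real (f i \<sigma>))" for \<sigma>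
    proof -
      have "(LINT \<tau>|unit_cube. ?k (\<sigma>, \<tau>) * rep_L2 g \<tau>)
        = (LINT \<tau>|unit_cube. (\<Sum>i\<in>I. (c i * of_real (f i \<sigma>)) * (of_real (h i \<tau>) * rep_L2 g \<tau>)))"
        unfolding sum_distrib_right by (intro Bochner_Integration.integral_cong refl sum.cong) (simp add: mult_ac)
      also have "\<dots> = (\<Sum>i\<in>I. (c i * of_real (f i \<sigma>)) * (LINT \<tau>|unit_cube. of_real (h i \<tau>) * rep_L2 g \<tau>))"
        by (subst Bochner_Integration.integral_sum) (auto intro!: integrable_mult_right prod)
      also have "\<dots> = (\<Sum>i\<in>I. ?d i * of_real (f i \<sigma>))"
        by (rule sum.cong) (simp_all only: int, simp add: mult_ac)
      finally show ?thesis .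
    qed
    then have "integral_op ?k g = abs_L2 (\<lambda>\<sigma>. \<Sum>i\<in>I. ?d i * of_real (f i \<sigma>))"
      by (simp only: integral_op_def)
    also have "\<dots> = (\<Sum>i\<in>I. cmul (?d i) (cplx (abs_L2 (f i))))"
      using I f
    proof (induction I)
      case empty
      show ?case by (simp add: zero_L2_def)
    next
      case (insert i I)
      have sq: "square_integrable (\<lambda>\<sigma>. ?d j * of_real (f j \<sigma>))" if "j \<in> insert i I" for j
        by (intro square_integrable_cmult square_integrable_of_real insert.prems that)
      have sq2: "square_integrable (\<lambda>\<sigma>. \<Sum>j\<in>I. ?d j * of_real (f j \<sigma>))"
        using \<open>finite I\<close> sq by (induction I) (auto intro!: square_integrable_zero square_integrable_add)
      have "cmul (?d i) (cplx (abs_L2 (f i))) = abs_L2 (\<lambda>\<sigma>. ?d i * of_real (f i \<sigma>))"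
      proof -
        have "cplx (abs_L2 (f i)) = abs_L2 (\<lambda>\<sigma>. of_real (f i \<sigma>))"
          unfolding cplx_def using rep_abs_L2[OF insert.prems[of i]] insert.prems[of i]
          by (intro abs_L2_eqI) (auto intro!: square_integrable_of_real square_integrable_rep elim!: eventually_mono)
        then show ?thesis using insert.prems[of i] by (simp add: cmul_abs_L2 square_integrable_of_real)
      qed
      then show ?case using insert sq sq2 by (simp flip: add_abs_L2)
    qed
    finally show ?thesis .
  qed
  have "((\<lambda>n. \<Sum>i\<in>I. c i * (cinner (cplx (abs_L2 (f i))) (e n) * cnj (cinner (cplx (abs_L2 (h i))) (e n))))
     has_sum (\<Sum>i\<in>I. c i * of_real (abs_L2 (f i) \<bullet> abs_L2 (h i)))) UNIV"
    by (intro has_sum_finite_sum I has_sum_cmult_right) (simp add: Parseval[OF e] flip: cinner_cplx)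
  then show ?thesis unfolding op by (simp add: cinner_sum_left cinner_cmul_left mult_ac)
qed

text \<open>Real and imaginary parts of a complex orthonormal basis satisfy Parseval's identity on
  real vectors, though they need not be orthonormal. They express the norm of a noise vector by real
  inner products, the quantities whose laws are given.\<close>

lemma real_Parseval_frame:
  "\<exists>\<psi> :: nat \<times> bool \<Rightarrow> real_L2. \<forall>x. (\<lambda>n. \<Sum>b\<in>UNIV. (x \<bullet> \<psi> (n, b))\<^sup>2) sums (norm x)\<^sup>2"
proof -
  define \<psi> where "\<psi> = (\<lambda>(n, b). abs_L2 (\<lambda>s. if b then Re (rep_L2 (some_basis n) s) else Im (rep_L2 (some_basis n) s)) :: real_L2)"
  have sq: "square_integrable (\<lambda>s. Re (rep_L2 g s))" "square_integrable (\<lambda>s. Im (rep_L2 g s))" for g :: complex_L2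
  proof -
    have *: "\<bar>Re z\<bar>\<^sup>2 \<le> (norm z)\<^sup>2" "\<bar>Im z\<bar>\<^sup>2 \<le> (norm z)\<^sup>2" for z
      by (intro power_mono abs_Re_le_cmod abs_Im_le_cmod; simp)+
    show "square_integrable (\<lambda>s. Re (rep_L2 g s))" "square_integrable (\<lambda>s. Im (rep_L2 g s))"
      using square_integrable_rep[of g] * unfolding square_integrable_def
      by (auto intro!: Bochner_Integration.integrable_bound[of unit_cube "\<lambda>x. (norm (rep_L2 g x))\<^sup>2"])
  qed
  have c: "cinner (cplx x) (some_basis n) = Complex (x \<bullet> \<psi> (n, True)) (- (x \<bullet> \<psi> (n, False)))" for x n
  proof -
    let ?g = "some_basis n"
    have i: "integrable unit_cube (\<lambda>s. of_real (rep_L2 x s) * cnj (rep_L2 ?g s))"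
    proof -
      have "integrable unit_cube (\<lambda>s. norm (rep_L2 x s) \<bullet> norm (rep_L2 ?g s))"
        using square_integrable_rep[of x] square_integrable_rep[of ?g]
        by (intro integrable_inner_square_integrable) (auto simp: square_integrable_def)
      then show ?thesis
        by (rule Bochner_Integration.integrable_bound) (auto simp: norm_mult)
    qed
    have "Re (cinner (cplx x) ?g) = (LINT s|unit_cube. rep_L2 x s * Re (rep_L2 ?g s))"
      unfolding cinner_cplx_left using integral_Re[OF i, symmetric] by simp
    also have "\<dots> = x \<bullet> \<psi> (n, True)"
      using inner_abs_L2[OF square_integrable_rep[of x] sq(1)[of ?g]] by (simp add: \<psi>_def)
    finally have 1: "Re (cinner (cplx x) ?g) = x \<bullet> \<psi> (n, True)" .
    have "Im (cinner (cplx x) ?g) = - (LINT s|unit_cube. rep_L2 x s * Im (rep_L2 ?g s))"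
      unfolding cinner_cplx_left using integral_Im[OF i, symmetric] by simp
    also have "\<dots> = - (x \<bullet> \<psi> (n, False))"
      using inner_abs_L2[OF square_integrable_rep[of x] sq(2)[of ?g]] by (simp add: \<psi>_def)
    finally show ?thesis using 1 by (simp add: complex_eq_iff)
  qed
  have "(\<lambda>n. \<Sum>b\<in>UNIV. (x \<bullet> \<psi> (n, b))\<^sup>2) sums (norm x)\<^sup>2" for x
  proof -
    have "(norm (cplx x))\<^sup>2 = (norm x)\<^sup>2"
      using cinner_cplx[of x x] by (simp add: power2_norm_eq_inner complex_eq_iff Re_cinner)
    then show ?thesis
      using has_sum_imp_sums[OF Parseval_norm[OF orthonormal_basis_some_basis, of "cplx x"]]
      by (simp add: c cmod_power2 UNIV_bool add.commute)
  qed
  then show ?thesis by blast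
qed

section \<open>Moments of Gaussian elements\<close>

lemma convex_on_power_nonneg: "convex_on {0..} (\<lambda>x::real. x ^ n)"
proof (cases "even n")
  case True
  then show ?thesis using convex_power_even convex_on_subset by blast
next
  case False
  then show ?thesis by (rule convex_power_odd)
qed

text \<open>Jensen's inequality for the power \<open>Suc p\<close>, with the weights normalised to
  total mass 1. It yields moments of sums whose terms may be dependent.\<close>

lemma weighted_power_mean:
  fixes w u :: "'i \<Rightarrow> real"
  assumes I: "finite I" and w: "\<And>i. i \<in> I \<Longrightarrow> w i \<ge> 0" and u: "\<And>i. i \<in> I \<Longrightarrow> u i \<ge> 0"
  shows "(\<Sum>i\<in>I. w i * u i) ^ Suc p \<le> (\<Sum>i\<in>I. w i) ^ p * (\<Sum>i\<in>I. w i * u i ^ Suc p)"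
proof (cases "(\<Sum>i\<in>I. w i) = 0")
  case True
  then have "\<forall>i\<in>I. w i = 0" using sum_nonneg_eq_0_iff[of I w] I w by auto
  then show ?thesis by simp
next
  case False
  define S where "S = (\<Sum>i\<in>I. w i)"
  have S: "S > 0" using False sum_nonneg[of I w] w by (auto simp: S_def less_le)
  have ne: "I \<noteq> {}" using False by auto
  have "(\<Sum>i\<in>I. (w i / S) *\<^sub>R u i) ^ Suc p \<le> (\<Sum>i\<in>I. (w i / S) * u i ^ Suc p)"
    using w u S
    by (intro convex_on_sum[OF I ne convex_on_power_nonneg[of "Suc p"]])
       (auto simp: S_def simp flip: sum_divide_distrib)
  then have "((\<Sum>i\<in>I. w i * u i) / S) ^ Suc p \<le> (\<Sum>i\<in>I. w i * u i ^ Suc p) / S"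
    by (simp add: sum_divide_distrib)
  then have "S ^ Suc p * ((\<Sum>i\<in>I. w i * u i) / S) ^ Suc p \<le> S ^ Suc p * ((\<Sum>i\<in>I. w i * u i ^ Suc p) / S)"
    using S by (intro mult_left_mono) auto
  then show ?thesis using S by (simp add: power_divide flip: S_def)
qed

text \<open>The number (2p - 1)!!, the moment of order 2p of a standard normal variable.\<close>

definition normal_moment :: "nat \<Rightarrow> real" where
  "normal_moment p = fact (2 * p) / (2 ^ p * fact p)"

lemma normal_moment_nonneg [simp]: "normal_moment p \<ge> 0"
  by (simp add: normal_moment_def)

lemma (in prob_space) normal_law_moment:
  fixes Z :: "'a \<Rightarrow> real"
  assumes Z [measurable]: "Z \<in> borel_measurable M" and law: "distr M borel Z = normal_law 0 s" and s: "s \<ge> 0"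
  shows "integrable M (\<lambda>\<omega>. Z \<omega> ^ (2 * p))"
    and "expectation (\<lambda>\<omega>. Z \<omega> ^ (2 * p)) = normal_moment p * (s\<^sup>2) ^ p"
proof -
  have "integrable (normal_law 0 s) (\<lambda>x. x ^ (2 * p)) \<and>
      (LINT x|normal_law 0 s. x ^ (2 * p)) = normal_moment p * (s\<^sup>2) ^ p"
  proof (cases "s = 0")
    case True
    have "integrable (return borel (0::real)) (\<lambda>x. x ^ (2 * p))"
      by (rule integrableI_bounded) (auto simp: nn_integral_return)
    with True show ?thesis
      by (cases "p = 0") (auto simp: normal_law_def integral_return normal_moment_def power_0_left measure_return)
  next
    case False
    then have pos: "s > 0" using s by simp
    have e: "(2 / s\<^sup>2) ^ p * fact p = (2 ^ p * fact p) / (s\<^sup>2) ^ p" by (simp add: power_divide)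
    show ?thesis
      using normal_moment_even[OF pos, of 0 p] False
      by (auto simp: normal_law_def integrable_density integral_density has_bochner_integral_iff
          e normal_moment_def)
  qed
  then show "integrable M (\<lambda>\<omega>. Z \<omega> ^ (2 * p))" "expectation (\<lambda>\<omega>. Z \<omega> ^ (2 * p)) = normal_moment p * (s\<^sup>2) ^ p"
    unfolding law[symmetric] by (auto simp: integrable_distr_eq integral_distr)
qed

lemma (in prob_space) distributed_normal_iff:
  assumes [measurable]: "Z \<in> borel_measurable M" and s: "s > 0"
  shows "distributed M lborel Z (normal_density 0 s) \<longleftrightarrow> distr M borel Z = normal_law 0 s"
proof -
  have "distr M lborel Z = distr M borel Z" by (rule distr_cong) simp_all
  then show ?thesis using s by (simp add: distributed_def normal_law_def)
qed

locale gaussian_noise = prob_space M for M :: "'w measure" +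
  fixes \<epsilon> :: "int \<Rightarrow> 'w \<Rightarrow> real_L2"
  assumes indep: "indep_vars (\<lambda>_. borel) \<epsilon> UNIV"
    and distr_eq: "distr M borel (\<epsilon> s) = distr M borel (\<epsilon> t)"
    and gaussian: "gaussian_element M (\<epsilon> t)"
    and mean_zero: "mean_zero M (\<epsilon> t)"
begin

lemma measurable_noise [measurable]: "\<epsilon> t \<in> borel_measurable M"
  using gaussian by (auto simp: gaussian_element_def)

lemma inner_noise_distr_eq: "distr M borel (\<lambda>\<omega>. \<epsilon> s \<omega> \<bullet> g) = distr M borel (\<lambda>\<omega>. \<epsilon> t \<omega> \<bullet> g)"
proof -
  have "distr M borel (\<lambda>\<omega>. \<epsilon> u \<omega> \<bullet> g) = distr (distr M borel (\<epsilon> u)) borel (\<lambda>x. x \<bullet> g)" for u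
    by (subst distr_distr) (auto simp: comp_def intro!: borel_measurable_continuous_onI continuous_intros)
  then show ?thesis using distr_eq[of s t] by simp
qed

text \<open>The mean of the normal law is identified as 0 from \<open>mean_zero\<close>, and one
  deviation serves all times because the noise is identically distributed.\<close>

lemma inner_noise_law: "\<exists>s\<ge>0. \<forall>t. distr M borel (\<lambda>\<omega>. \<epsilon> t \<omega> \<bullet> g) = normal_law 0 s"
proof -
  obtain m s where ms: "s \<ge> 0" "distr M borel (\<lambda>\<omega>. \<epsilon> 0 \<omega> \<bullet> g) = normal_law m s"
    using gaussian[of 0] unfolding gaussian_element_def by blast
  have "0 = expectation (\<lambda>\<omega>. \<epsilon> 0 \<omega> \<bullet> g)" using mean_zero[of 0] by (simp add: mean_zero_def)
  also have "\<dots> = (LINT x|distr M borel (\<lambda>\<omega>. \<epsilon> 0 \<omega> \<bullet> g). x)" by (subst integral_distr) auto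
  also have "\<dots> = m"
  proof (cases "s = 0")
    case True then show ?thesis unfolding ms(2) by (simp add: normal_law_def integral_return)
  next
    case False
    then show ?thesis unfolding ms(2) using integral_normal_moment_nz_1[of s m] ms(1)
      by (auto simp: normal_law_def integral_density)
  qed
  finally have "m = 0" ..
  then show ?thesis using ms inner_noise_distr_eq[of _ g 0] by metis
qed

definition noise_sd :: "real_L2 \<Rightarrow> real" where
  "noise_sd g = (SOME s. s \<ge> 0 \<and> (\<forall>t. distr M borel (\<lambda>\<omega>. \<epsilon> t \<omega> \<bullet> g) = normal_law 0 s))"

lemma noise_sd: "noise_sd g \<ge> 0" "distr M borel (\<lambda>\<omega>. \<epsilon> t \<omega> \<bullet> g) = normal_law 0 (noise_sd g)"
proof -
  have "noise_sd g \<ge> 0 \<and> (\<forall>t. distr M borel (\<lambda>\<omega>. \<epsilon> t \<omega> \<bullet> g) = normal_law 0 (noise_sd g))"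
    unfolding noise_sd_def by (rule someI_ex[OF inner_noise_law])
  then show "noise_sd g \<ge> 0" "distr M borel (\<lambda>\<omega>. \<epsilon> t \<omega> \<bullet> g) = normal_law 0 (noise_sd g)"
    by blast+
qed

text \<open>Sums of independent normals are handled through densities, which exist only for positive
  deviations. Directions of deviation 0 and terms with coefficient 0 are therefore split off; there
  the sum is almost surely 0 or unaffected.\<close>

lemma inner_noise_sum_law:
  assumes S: "finite S"
  shows "distr M borel (\<lambda>\<omega>. \<Sum>t\<in>S. a t * (\<epsilon> t \<omega> \<bullet> g)) = normal_law 0 (noise_sd g * sqrt (\<Sum>t\<in>S. (a t)\<^sup>2))"
proof -
  have ret: "distr M borel f = return borel 0" if "AE \<omega> in M. f \<omega> = 0" "f \<in> borel_measurable M" for f :: "'w \<Rightarrow> real"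
  proof -
    have "distr M borel f = distr M borel (\<lambda>_. 0)" using that by (intro distr_cong_AE) auto
    then show ?thesis by (simp add: distr_const)
  qed
  show ?thesis
  proof (cases "noise_sd g = 0")
    case True
    have "AE \<omega> in M. \<epsilon> t \<omega> \<bullet> g = 0" for t
    proof -
      have "AE x in distr M borel (\<lambda>\<omega>. \<epsilon> t \<omega> \<bullet> g). x = 0"
        unfolding noise_sd(2) True normal_law_def by (simp add: AE_return)
      then show ?thesis by (subst (asm) AE_distr_iff) auto
    qed
    then have "AE \<omega> in M. \<forall>t\<in>S. \<epsilon> t \<omega> \<bullet> g = 0" using S by (simp add: AE_finite_all)
    then have "AE \<omega> in M. (\<Sum>t\<in>S. a t * (\<epsilon> t \<omega> \<bullet> g)) = 0" by eventually_elim simp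
    then show ?thesis using True by (subst ret) (auto simp: normal_law_def)
  next
    case False
    then have pos: "noise_sd g > 0" using noise_sd(1)[of g] by simp
    define S' where "S' = {t\<in>S. a t \<noteq> 0}"
    have S': "finite S'" "S' \<subseteq> S" using S by (auto simp: S'_def)
    have eq: "(\<Sum>t\<in>S. a t * (\<epsilon> t \<omega> \<bullet> g)) = (\<Sum>t\<in>S'. a t * (\<epsilon> t \<omega> \<bullet> g))" for \<omega>
      by (rule sum.mono_neutral_right[OF S S'(2)]) (auto simp: S'_def)
    have eq2: "(\<Sum>t\<in>S. (a t)\<^sup>2) = (\<Sum>t\<in>S'. (a t)\<^sup>2)"
      by (rule sum.mono_neutral_right[OF S S'(2)]) (auto simp: S'_def)
    show ?thesis
    proof (cases "S' = {}")
      case True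
      then show ?thesis unfolding eq eq2 by (subst ret) (auto simp: normal_law_def)
    next
      case ne: False
      have ind: "indep_vars (\<lambda>_. borel) (\<lambda>t \<omega>. a t * (\<epsilon> t \<omega> \<bullet> g)) S'"
        by (rule indep_vars_compose2[OF indep_vars_subset[OF indep]]) auto
      have d: "distributed M lborel (\<lambda>\<omega>. a t * (\<epsilon> t \<omega> \<bullet> g)) (normal_density 0 (\<bar>a t\<bar> * noise_sd g))" if "t \<in> S'" for t
      proof -
        have "distributed M lborel (\<lambda>\<omega>. \<epsilon> t \<omega> \<bullet> g) (normal_density 0 (noise_sd g))"
          by (subst distributed_normal_iff[OF _ pos]) (auto simp: noise_sd(2))
        from normal_density_affine[OF this pos, of "a t" 0] show ?thesis using that by (auto simp: S'_def)
      qed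
      have "distributed M lborel (\<lambda>\<omega>. \<Sum>t\<in>S'. a t * (\<epsilon> t \<omega> \<bullet> g)) (normal_density (\<Sum>t\<in>S'. 0) (sqrt (\<Sum>t\<in>S'. (\<bar>a t\<bar> * noise_sd g)\<^sup>2)))"
        by (rule sum_indep_normal[OF S'(1) ne ind _ d]) (use pos in \<open>simp_all add: S'_def\<close>)
      then have "distr M borel (\<lambda>\<omega>. \<Sum>t\<in>S'. a t * (\<epsilon> t \<omega> \<bullet> g)) = normal_law 0 (sqrt (\<Sum>t\<in>S'. (\<bar>a t\<bar> * noise_sd g)\<^sup>2))"
        using S'(1) ne pos by (subst (asm) sum.neutral_const, subst (asm) distributed_normal_iff)
          (auto intro!: real_sqrt_gt_zero sum_pos simp: S'_def)
      moreover have "sqrt (\<Sum>t\<in>S'. (\<bar>a t\<bar> * noise_sd g)\<^sup>2) = noise_sd g * sqrt (\<Sum>t\<in>S'. (a t)\<^sup>2)"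
        using pos by (simp add: power_mult_distrib real_sqrt_mult flip: sum_distrib_right)
      ultimately show ?thesis unfolding eq eq2 by simp
    qed
  qed
qed

text \<open>Write \<open>V\<close> as the sum of \<open>v k * ((z k)\<^sup>2 / v k)\<close> with the
  variances \<open>v k\<close> as weights and apply \<open>weighted_power_mean\<close>. Each
  quotient has the moments of a squared standard normal, so the bound depends only on the total
  variance, whatever the correlations between the coordinates.\<close>

lemma frame_moment:
  fixes \<psi> :: "'k \<Rightarrow> real_L2" and a :: "int \<Rightarrow> real"
  assumes S: "finite S" and F: "finite F"
  defines "V \<equiv> \<lambda>\<omega>. \<Sum>k\<in>F. ((\<Sum>t\<in>S. a t *\<^sub>R \<epsilon> t \<omega>) \<bullet> \<psi> k)\<^sup>2"
  shows "integrable M (\<lambda>\<omega>. V \<omega> ^ p)"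
    "expectation (\<lambda>\<omega>. V \<omega> ^ p) \<le> normal_moment p * ((\<Sum>t\<in>S. (a t)\<^sup>2) * (\<Sum>k\<in>F. (noise_sd (\<psi> k))\<^sup>2)) ^ p"
proof -
  let ?A = "\<Sum>t\<in>S. (a t)\<^sup>2"
  define z where "z k \<omega> = (\<Sum>t\<in>S. a t * (\<epsilon> t \<omega> \<bullet> \<psi> k))" for k \<omega>
  define v where "v k = ?A * (noise_sd (\<psi> k))\<^sup>2" for k
  have A0: "?A \<ge> 0" by (simp add: sum_nonneg)
  have v0: "v k \<ge> 0" for k by (simp add: v_def A0)
  have V: "V \<omega> = (\<Sum>k\<in>F. (z k \<omega>)\<^sup>2)" for \<omega>
    by (simp add: V_def z_def inner_sum_left)
  have [measurable]: "z k \<in> borel_measurable M" for k unfolding z_def by measurable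
  have law: "distr M borel (z k) = normal_law 0 (noise_sd (\<psi> k) * sqrt ?A)" for k
    unfolding z_def by (rule inner_noise_sum_law[OF S])
  have sq: "(noise_sd (\<psi> k) * sqrt ?A)\<^sup>2 = v k" for k
    using A0 by (simp add: power_mult_distrib v_def mult.commute)
  have zint: "integrable M (\<lambda>\<omega>. ((z k \<omega>)\<^sup>2) ^ q)" and zexp: "expectation (\<lambda>\<omega>. ((z k \<omega>)\<^sup>2) ^ q) = normal_moment q * v k ^ q" for k q
    using normal_law_moment[OF _ law[of k], of q, unfolded sq power_mult] noise_sd(1) A0 by auto
  \<comment> \<open>Coordinates of variance 0 vanish almost surely and are dropped, since the
    weights appear as denominators.\<close>
  define F' where "F' = {k\<in>F. v k > 0}"
  have F': "finite F'" "F' \<subseteq> F" using F by (auto simp: F'_def)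
  have "AE \<omega> in M. z k \<omega> = 0" if "k \<in> F - F'" for k
  proof -
    have "v k = 0" using that v0[of k] by (auto simp: F'_def)
    then have "expectation (\<lambda>\<omega>. (z k \<omega>)\<^sup>2) = 0" using zexp[of k 1] by simp
    then have "AE \<omega> in M. (z k \<omega>)\<^sup>2 = 0"
      using zint[of k 1] by (subst (asm) integral_nonneg_eq_0_iff_AE) auto
    then show ?thesis by eventually_elim simp
  qed
  then have "AE \<omega> in M. \<forall>k\<in>F - F'. z k \<omega> = 0" using F by (intro AE_finite_allI) auto
  then have Vae: "AE \<omega> in M. V \<omega> = (\<Sum>k\<in>F'. (z k \<omega>)\<^sup>2)"
    by eventually_elim (unfold V, rule sum.mono_neutral_right[OF F F'(2)], auto)
  have total: "(\<Sum>k\<in>F'. v k) = ?A * (\<Sum>k\<in>F. (noise_sd (\<psi> k))\<^sup>2)"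
  proof -
    have "(\<Sum>k\<in>F'. v k) = (\<Sum>k\<in>F. v k)"
      using v0 by (intro sum.mono_neutral_left[OF F F'(2)]) (auto simp: F'_def less_le)
    then show ?thesis by (simp add: v_def sum_distrib_left)
  qed
  have [measurable]: "V \<in> borel_measurable M" unfolding V by measurable
  have "integrable M (\<lambda>\<omega>. V \<omega> ^ p) \<and> expectation (\<lambda>\<omega>. V \<omega> ^ p) \<le> normal_moment p * (\<Sum>k\<in>F'. v k) ^ p"
  proof (cases p)
    case 0
    then show ?thesis by (simp add: normal_moment_def prob_space)
  next
    case (Suc q)
    let ?W = "\<lambda>\<omega>. (\<Sum>k\<in>F'. v k) ^ q * (\<Sum>k\<in>F'. v k * ((z k \<omega>)\<^sup>2 / v k) ^ p)"
    have W: "?W \<omega> = (\<Sum>k\<in>F'. ((\<Sum>k\<in>F'. v k) ^ q * (v k / v k ^ p)) * ((z k \<omega>)\<^sup>2) ^ p)" for \<omega>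
      unfolding sum_distrib_left power_divide by (simp add: mult_ac)
    have Wi: "integrable M ?W" unfolding W
      by (intro Bochner_Integration.integrable_sum integrable_mult_right zint)
    have le: "AE \<omega> in M. V \<omega> ^ p \<le> ?W \<omega>"
      using Vae
    proof eventually_elim
      case (elim \<omega>)
      have "V \<omega> = (\<Sum>k\<in>F'. v k * ((z k \<omega>)\<^sup>2 / v k))"
        unfolding elim by (rule sum.cong) (auto simp: F'_def)
      then show ?case unfolding Suc using v0
        by (simp only:) (intro weighted_power_mean F'(1), auto)
    qed
    have V0: "V \<omega> \<ge> 0" for \<omega> by (simp add: V sum_nonneg)
    have int: "integrable M (\<lambda>\<omega>. V \<omega> ^ p)"
      by (rule Bochner_Integration.integrable_bound[OF Wi]) (use le V0 in \<open>auto elim!: eventually_mono\<close>)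
    have "expectation (\<lambda>\<omega>. V \<omega> ^ p) \<le> expectation ?W"
      by (rule integral_mono_AE[OF int Wi le])
    also have "\<dots> = (\<Sum>k\<in>F'. ((\<Sum>k\<in>F'. v k) ^ q * (v k / v k ^ p)) * (normal_moment p * v k ^ p))"
      unfolding W by (subst Bochner_Integration.integral_sum) (auto intro!: zint simp: zexp)
    also have "\<dots> = (\<Sum>k\<in>F'. ((\<Sum>k\<in>F'. v k) ^ q * normal_moment p) * v k)"
      by (rule sum.cong) (auto simp: F'_def)
    also have "\<dots> = normal_moment p * (\<Sum>k\<in>F'. v k) ^ p"
      unfolding Suc sum_distrib_left[symmetric] by (simp add: mult_ac)
    finally show ?thesis using int by simp
  qed
  then show "integrable M (\<lambda>\<omega>. V \<omega> ^ p)"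
    "expectation (\<lambda>\<omega>. V \<omega> ^ p) \<le> normal_moment p * (?A * (\<Sum>k\<in>F. (noise_sd (\<psi> k))\<^sup>2)) ^ p"
    unfolding total by auto
qed

text \<open>A Gaussian element has finite second moment: by the Paley-Zygmund inequality the partial
  sums \<open>V\<close> of its squared norm, which satisfy \<open>E V\<^sup>2 \<le> 3 (E V)\<^sup>2\<close>, exceed half of their mean with
  probability at least \<open>1/12\<close>, so their means are bounded.\<close>

lemma noise_sd_bounded:
  assumes \<psi>: "\<And>x n. (\<Sum>k\<in>F n. (x \<bullet> \<psi> k)\<^sup>2) \<le> (norm x)\<^sup>2" and F: "\<And>n. finite (F n)"
  shows "\<exists>K\<ge>0. \<forall>n. (\<Sum>k\<in>F n. (noise_sd (\<psi> k))\<^sup>2) \<le> K"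
proof -
  have lim: "(\<lambda>n. prob {\<omega>\<in>space M. real n < (norm (\<epsilon> 0 \<omega>))\<^sup>2}) \<longlonglongrightarrow> prob (\<Inter>n. {\<omega>\<in>space M. real n < (norm (\<epsilon> 0 \<omega>))\<^sup>2})"
    by (rule finite_Lim_measure_decseq) (auto simp: decseq_def)
  have "(\<Inter>n. {\<omega>\<in>space M. real n < (norm (\<epsilon> 0 \<omega>))\<^sup>2}) = {}"
  proof (rule equals0I)
    fix \<omega> assume a: "\<omega> \<in> (\<Inter>n. {\<omega>\<in>space M. real n < (norm (\<epsilon> 0 \<omega>))\<^sup>2})"
    obtain n where "(norm (\<epsilon> 0 \<omega>))\<^sup>2 < real n" using reals_Archimedean2 by blast
    moreover have "real n < (norm (\<epsilon> 0 \<omega>))\<^sup>2" using a by blast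
    ultimately show False by simp
  qed
  then have "(\<lambda>n. prob {\<omega>\<in>space M. real n < (norm (\<epsilon> 0 \<omega>))\<^sup>2}) \<longlonglongrightarrow> 0" using lim by simp
  then have "\<forall>\<^sub>F n in sequentially. prob {\<omega>\<in>space M. real n < (norm (\<epsilon> 0 \<omega>))\<^sup>2} < 1/12"
    by (rule order_tendstoD) simp
  then obtain K where K: "prob {\<omega>\<in>space M. real K < (norm (\<epsilon> 0 \<omega>))\<^sup>2} < 1/12"
    by (auto simp: eventually_sequentially simp del: of_nat_less_iff)
  have "(\<Sum>k\<in>F n. (noise_sd (\<psi> k))\<^sup>2) \<le> 2 * real K" for n
  proof (rule ccontr)
    define m where "m = (\<Sum>k\<in>F n. (noise_sd (\<psi> k))\<^sup>2)"
    assume "\<not> ?thesis"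
    then have m: "m > 2 * real K" "m > 0" by (auto simp: m_def not_le)
    define V where "V \<omega> = (\<Sum>k\<in>F n. (\<epsilon> 0 \<omega> \<bullet> \<psi> k)\<^sup>2)" for \<omega>
    define I where "I = {\<omega>\<in>space M. real K < (norm (\<epsilon> 0 \<omega>))\<^sup>2}"
    have [measurable]: "V \<in> borel_measurable M" "I \<in> sets M" unfolding V_def I_def by measurable
    note fm = frame_moment[where S = "{0}" and F = "F n" and a = "\<lambda>_. 1" and \<psi> = \<psi>, OF _ F, simplified, folded V_def m_def]
    have V2: "integrable M (\<lambda>\<omega>. (V \<omega>)\<^sup>2)" "expectation (\<lambda>\<omega>. (V \<omega>)\<^sup>2) \<le> 3 * m\<^sup>2"
      using fm(1)[of 2] fm(2)[of 2] by (auto simp: normal_moment_def fact_numeral)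
    have V1: "integrable M V" "expectation V = m"
    proof -
      have i: "integrable M (\<lambda>\<omega>. (\<epsilon> 0 \<omega> \<bullet> g)\<^sup>2)" "expectation (\<lambda>\<omega>. (\<epsilon> 0 \<omega> \<bullet> g)\<^sup>2) = (noise_sd g)\<^sup>2" for g
        using normal_law_moment[OF _ noise_sd(2)[of 0 g] noise_sd(1)[of g], of 1] by (auto simp: normal_moment_def)
      show "integrable M V" unfolding V_def by (intro Bochner_Integration.integrable_sum i)
      show "expectation V = m" unfolding V_def m_def by (subst Bochner_Integration.integral_sum) (auto intro: i simp: i)
    qed
    \<comment> \<open>On \<open>I\<close> this is
      \<open>(V \<omega> - 6 * m)\<^sup>2 \<ge> 0\<close> divided by \<open>12 * m\<close>; off
      \<open>I\<close> the frame inequality gives \<open>V \<omega> \<le> real K < m / 2\<close>. In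
      expectation the three terms contribute at most \<open>m / 2\<close>, at most
      \<open>m / 4\<close> and less than \<open>m / 4\<close>.\<close>
    have "V \<omega> \<le> m / 2 + (V \<omega>)\<^sup>2 / (12 * m) + 3 * m * indicator I \<omega>" if "\<omega> \<in> space M" for \<omega>
    proof (cases "\<omega> \<in> I")
      case True
      have "0 \<le> (V \<omega> - 6 * m)\<^sup>2 / (12 * m)" using m by simp
      also have "\<dots> = (V \<omega>)\<^sup>2 / (12 * m) - V \<omega> + 3 * m"
        using m by (simp add: power2_eq_square field_simps)
      finally show ?thesis using True m by simp
    next
      case False
      then have "(norm (\<epsilon> 0 \<omega>))\<^sup>2 \<le> real K" using that by (auto simp: I_def)
      then have "V \<omega> \<le> m / 2" using \<psi>[of "\<epsilon> 0 \<omega>" n] m by (simp add: V_def)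
      then show ?thesis using False m by (simp add: add_increasing2)
    qed
    moreover have int: "integrable M (\<lambda>\<omega>. m / 2 + (V \<omega>)\<^sup>2 / (12 * m) + 3 * m * indicator I \<omega>)"
      by (intro Bochner_Integration.integrable_add integrable_divide V2 integrable_mult_right) (auto simp: integrable_indicator_iff emeasure_eq_measure)
    ultimately have "expectation V \<le> expectation (\<lambda>\<omega>. m / 2 + (V \<omega>)\<^sup>2 / (12 * m) + 3 * m * indicator I \<omega>)"
      by (intro integral_mono V1 int)
    also have "\<dots> = m / 2 + expectation (\<lambda>\<omega>. (V \<omega>)\<^sup>2) / (12 * m) + 3 * m * prob I"
      using V2 by (simp add: prob_space emeasure_eq_measure)
    also have "\<dots> \<le> m / 2 + 3 * m\<^sup>2 / (12 * m) + 3 * m * prob I"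
      using V2(2) m by (intro add_mono divide_right_mono) auto
    also have "\<dots> < m / 2 + m / 4 + 3 * m * (1/12)"
    proof -
      have "3 * m * prob I < 3 * m * (1/12)" using K m by (intro mult_strict_left_mono) (auto simp: I_def)
      moreover have "3 * m\<^sup>2 / (12 * m) = m / 4" using m by (simp add: power2_eq_square)
      ultimately show ?thesis by simp
    qed
    finally show False using V1 by simp
  qed
  then show ?thesis by (intro exI[of _ "2 * real K"]) auto
qed

text \<open>Fatou's lemma carries \<open>frame_moment\<close> from the partial sums of the frame to
  the full norm. A single \<open>\<tau>\<close>, bounding the variances summed along the frame,
  serves all exponents and all coefficients.\<close>

lemma noise_moments:
  "\<exists>\<tau>\<ge>0. \<forall>p S a. finite S \<longrightarrow> integrable M (\<lambda>\<omega>. norm (\<Sum>t\<in>S. a t *\<^sub>R \<epsilon> t \<omega>) ^ (2 * p)) \<and>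
     expectation (\<lambda>\<omega>. norm (\<Sum>t\<in>S. a t *\<^sub>R \<epsilon> t \<omega>) ^ (2 * p)) \<le> normal_moment p * (\<tau> * (\<Sum>t\<in>S. (a t)\<^sup>2)) ^ p"
proof -
  obtain \<psi> :: "nat \<times> bool \<Rightarrow> real_L2" where \<psi>: "\<And>x. (\<lambda>n. \<Sum>b\<in>UNIV. (x \<bullet> \<psi> (n, b))\<^sup>2) sums (norm x)\<^sup>2"
    using real_Parseval_frame by metis
  define F :: "nat \<Rightarrow> (nat \<times> bool) set" where "F n = {..<n} \<times> UNIV" for n
  have F: "finite (F n)" for n by (simp add: F_def)
  have part: "(\<Sum>k\<in>F n. (x \<bullet> \<psi> k)\<^sup>2) = (\<Sum>i<n. \<Sum>b\<in>UNIV. (x \<bullet> \<psi> (i, b))\<^sup>2)" for x n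
    unfolding F_def by (simp add: sum.cartesian_product')
  have lim: "(\<lambda>n. \<Sum>k\<in>F n. (x \<bullet> \<psi> k)\<^sup>2) \<longlonglongrightarrow> (norm x)\<^sup>2" for x
    using \<psi>[of x] unfolding part sums_def .
  have le: "(\<Sum>k\<in>F n. (x \<bullet> \<psi> k)\<^sup>2) \<le> (norm x)\<^sup>2" for x n
    unfolding part sums_unique[OF \<psi>[of x]]
    by (intro sum_le_suminf sums_summable[OF \<psi>]) (auto intro!: sum_nonneg)
  obtain \<tau> where \<tau>: "\<tau> \<ge> 0" "\<And>n. (\<Sum>k\<in>F n. (noise_sd (\<psi> k))\<^sup>2) \<le> \<tau>"
    using noise_sd_bounded[where F = F and \<psi> = \<psi>, OF le F] by auto
  have "integrable M (\<lambda>\<omega>. norm (\<Sum>t\<in>S. a t *\<^sub>R \<epsilon> t \<omega>) ^ (2 * p)) \<and>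
     expectation (\<lambda>\<omega>. norm (\<Sum>t\<in>S. a t *\<^sub>R \<epsilon> t \<omega>) ^ (2 * p)) \<le> normal_moment p * (\<tau> * (\<Sum>t\<in>S. (a t)\<^sup>2)) ^ p"
    if S: "finite S" for S a p
  proof -
    let ?Z = "\<lambda>\<omega>. \<Sum>t\<in>S. a t *\<^sub>R \<epsilon> t \<omega>"
    let ?B = "normal_moment p * (\<tau> * (\<Sum>t\<in>S. (a t)\<^sup>2)) ^ p"
    define V where "V n \<omega> = (\<Sum>k\<in>F n. (?Z \<omega> \<bullet> \<psi> k)\<^sup>2)" for n \<omega>
    note fm = frame_moment[where a = a and \<psi> = \<psi>, OF S F, folded V_def]
    have [measurable]: "V n \<in> borel_measurable M" "?Z \<in> borel_measurable M" for n unfolding V_def by measurable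
    have V0: "V n \<omega> \<ge> 0" for n \<omega> by (simp add: V_def sum_nonneg)
    have "(\<integral>\<^sup>+\<omega>. ennreal (norm (?Z \<omega>) ^ (2 * p)) \<partial>M) = (\<integral>\<^sup>+\<omega>. liminf (\<lambda>n. ennreal (V n \<omega> ^ p)) \<partial>M)"
    proof (rule nn_integral_cong)
      fix \<omega>
      have "(\<lambda>n. V n \<omega> ^ p) \<longlonglongrightarrow> ((norm (?Z \<omega>))\<^sup>2) ^ p"
        unfolding V_def by (intro tendsto_power lim)
      then have "(\<lambda>n. ennreal (V n \<omega> ^ p)) \<longlonglongrightarrow> ennreal (norm (?Z \<omega>) ^ (2 * p))"
        by (simp add: power_mult)
      then show "ennreal (norm (?Z \<omega>) ^ (2 * p)) = liminf (\<lambda>n. ennreal (V n \<omega> ^ p))"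
        by (subst lim_imp_Liminf) auto
    qed
    also have "\<dots> \<le> liminf (\<lambda>n. \<integral>\<^sup>+\<omega>. ennreal (V n \<omega> ^ p) \<partial>M)"
      by (rule nn_integral_liminf) measurable
    also have "\<dots> \<le> ennreal ?B"
    proof (rule Liminf_le)
      show "\<forall>\<^sub>F n in sequentially. (\<integral>\<^sup>+\<omega>. ennreal (V n \<omega> ^ p) \<partial>M) \<le> ennreal ?B"
      proof (rule always_eventually, rule allI)
        fix n
        have "(\<integral>\<^sup>+\<omega>. ennreal (V n \<omega> ^ p) \<partial>M) = ennreal (expectation (\<lambda>\<omega>. V n \<omega> ^ p))"
          using fm(1) V0 by (intro nn_integral_eq_integral) auto
        also have "expectation (\<lambda>\<omega>. V n \<omega> ^ p) \<le> normal_moment p * ((\<Sum>t\<in>S. (a t)\<^sup>2) * (\<Sum>k\<in>F n. (noise_sd (\<psi> k))\<^sup>2)) ^ p"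
          by (rule fm(2))
        also have "\<dots> \<le> normal_moment p * ((\<Sum>t\<in>S. (a t)\<^sup>2) * \<tau>) ^ p"
          using \<tau> by (intro mult_left_mono power_mono mult_nonneg_nonneg) (auto intro!: sum_nonneg)
        finally show "(\<integral>\<^sup>+\<omega>. ennreal (V n \<omega> ^ p) \<partial>M) \<le> ennreal ?B"
          by (simp add: ennreal_leI mult.commute)
      qed
    qed simp
    finally have bound: "(\<integral>\<^sup>+\<omega>. ennreal (norm (?Z \<omega>) ^ (2 * p)) \<partial>M) \<le> ennreal ?B" .
    then have int: "integrable M (\<lambda>\<omega>. norm (?Z \<omega>) ^ (2 * p))"
      by (intro integrableI_bounded) (auto simp: less_top[symmetric] top_unique)
    have B0: "?B \<ge> 0" using \<tau> by (simp add: sum_nonneg)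
    show ?thesis
      using int bound B0 by (subst (asm) nn_integral_eq_integral) (auto simp: ennreal_le_iff)
  qed
  with \<tau>(1) show ?thesis by blast
qed

end

section \<open>Bilinear forms in the noise\<close>

context prob_space
begin

text \<open>A class closed under sums, products and bounded bilinear maps, so that integrability of
  polynomial expressions in the noise follows from closure rules instead of separate
  estimates.\<close>

definition all_moments :: "('a \<Rightarrow> 'b::{banach, second_countable_topology}) \<Rightarrow> bool" where
  "all_moments f \<longleftrightarrow> f \<in> borel_measurable M \<and> (\<forall>p. integrable M (\<lambda>\<omega>. norm (f \<omega>) ^ p))"

lemma all_moments_measurable: "all_moments f \<Longrightarrow> f \<in> borel_measurable M"
  by (simp add: all_moments_def)

lemma all_moments_power: "all_moments f \<Longrightarrow> integrable M (\<lambda>\<omega>. norm (f \<omega>) ^ p)"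
  by (simp add: all_moments_def)

lemma all_moments_integrable: "all_moments f \<Longrightarrow> integrable M f"
  using all_moments_power[of f 1] by (auto simp: all_moments_def intro: integrable_norm_cancel)

lemma all_moments_bound:
  assumes "all_moments g" "f \<in> borel_measurable M" "AE \<omega> in M. norm (f \<omega>) \<le> norm (g \<omega>)"
  shows "all_moments f"
  unfolding all_moments_def
proof (intro conjI allI assms)
  fix p
  show "integrable M (\<lambda>\<omega>. norm (f \<omega>) ^ p)"
    by (rule Bochner_Integration.integrable_bound[OF all_moments_power[OF assms(1), of p]])
      (use assms in \<open>auto elim!: eventually_mono intro!: power_mono\<close>)
qed

text \<open>Gaussian bounds are available for even exponents; the others follow from
  \<open>x ^ p \<le> 1 + x ^ (2 * p)\<close>.\<close>

lemma all_moments_even: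
  assumes "f \<in> borel_measurable M" "\<And>p. integrable M (\<lambda>\<omega>. norm (f \<omega>) ^ (2 * p))"
  shows "all_moments f"
  unfolding all_moments_def
proof (intro conjI allI assms(1))
  fix p
  have le: "x ^ p \<le> 1 + x ^ (2 * p)" if "x \<ge> 0" for x :: real
  proof -
    have "2 * x ^ p * 1 \<le> (x ^ p)\<^sup>2 + 1\<^sup>2" by (rule sum_squares_bound)
    moreover have "(x ^ p)\<^sup>2 = x ^ (2 * p)" by (simp add: mult.commute flip: power_mult)
    ultimately show ?thesis using zero_le_power[OF that, of p] by simp
  qed
  show "integrable M (\<lambda>\<omega>. norm (f \<omega>) ^ p)"
    by (rule Bochner_Integration.integrable_bound[of _ "\<lambda>\<omega>. 1 + norm (f \<omega>) ^ (2 * p)"])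
      (use assms le in auto)
qed

lemma all_moments_const [intro, simp]: "all_moments (\<lambda>_. c)"
  by (simp add: all_moments_def)

lemma all_moments_norm: "all_moments f \<Longrightarrow> all_moments (\<lambda>\<omega>. norm (f \<omega>))"
  by (auto simp: all_moments_def)

lemma all_moments_mult:
  fixes f g :: "'a \<Rightarrow> real"
  assumes f: "all_moments f" and g: "all_moments g"
  shows "all_moments (\<lambda>\<omega>. f \<omega> * g \<omega>)"
  unfolding all_moments_def
proof (intro conjI allI)
  have [measurable]: "f \<in> borel_measurable M" "g \<in> borel_measurable M" using f g by (auto simp: all_moments_def)
  show "(\<lambda>\<omega>. f \<omega> * g \<omega>) \<in> borel_measurable M" by measurable
  fix p
  show "integrable M (\<lambda>\<omega>. norm (f \<omega> * g \<omega>) ^ p)"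
  proof (rule Bochner_Integration.integrable_bound)
    show "integrable M (\<lambda>\<omega>. norm (f \<omega>) ^ (2 * p) + norm (g \<omega>) ^ (2 * p))"
      by (intro Bochner_Integration.integrable_add all_moments_power f g)
    have "norm x ^ p * norm y ^ p \<le> norm x ^ (2 * p) + norm y ^ (2 * p)" for x y :: real
    proof -
      have "2 * (norm x ^ p * norm y ^ p) \<le> (norm x ^ p)\<^sup>2 + (norm y ^ p)\<^sup>2"
        using sum_squares_bound[of "norm x ^ p" "norm y ^ p"] by (simp add: mult.assoc)
      moreover have "(norm x ^ p)\<^sup>2 = norm x ^ (2 * p)" for x :: real by (simp add: mult.commute flip: power_mult)
      moreover have "norm x ^ p * norm y ^ p \<ge> 0" by simp
      ultimately show ?thesis by (simp only:)
    qed
    then show "AE \<omega> in M. norm (norm (f \<omega> * g \<omega>) ^ p) \<le> norm (norm (f \<omega>) ^ (2 * p) + norm (g \<omega>) ^ (2 * p))"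
      by (intro AE_I2) (simp add: abs_mult power_mult_distrib power_abs)
  qed measurable
qed

lemma all_moments_bounded_bilinear:
  assumes "bounded_bilinear h" and f: "all_moments f" and g: "all_moments g"
    and m: "(\<lambda>\<omega>. h (f \<omega>) (g \<omega>)) \<in> borel_measurable M"
  shows "all_moments (\<lambda>\<omega>. h (f \<omega>) (g \<omega>))"
proof -
  interpret bounded_bilinear h by fact
  obtain K where K: "\<And>a b. norm (h a b) \<le> norm a * norm b * K" using bounded by blast
  show ?thesis
  proof (rule all_moments_bound[OF _ m])
    show "all_moments (\<lambda>\<omega>. norm (f \<omega>) * norm (g \<omega>) * K)"
      by (intro all_moments_mult all_moments_norm f g all_moments_const)
    show "AE \<omega> in M. norm (h (f \<omega>) (g \<omega>)) \<le> norm (norm (f \<omega>) * norm (g \<omega>) * K)"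
      using order_trans[OF K abs_ge_self] by simp
  qed
qed

lemma all_moments_add:
  assumes f: "all_moments f" and g: "all_moments g"
  shows "all_moments (\<lambda>\<omega>. f \<omega> + g \<omega>)"
proof -
  have [measurable]: "f \<in> borel_measurable M" "g \<in> borel_measurable M" using f g by (auto simp: all_moments_def)
  have "all_moments (\<lambda>\<omega>. norm (f \<omega>) + norm (g \<omega>))"
    unfolding all_moments_def
  proof (intro conjI allI)
    fix p
    have "norm (norm a + norm b) ^ p \<le> (2 * norm a) ^ p + (2 * norm b) ^ p" for a b :: 'b
    proof -
      have "(norm a + norm b) ^ p \<le> (2 * max (norm a) (norm b)) ^ p" by (intro power_mono) auto
      also have "\<dots> \<le> (2 * norm a) ^ p + (2 * norm b) ^ p" by (simp add: max_def add_increasing add_increasing2)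
      finally show ?thesis by simp
    qed
    then have le: "AE \<omega> in M. norm (norm (norm (f \<omega>) + norm (g \<omega>)) ^ p) \<le> norm ((2 * norm (f \<omega>)) ^ p + (2 * norm (g \<omega>)) ^ p)"
      by (simp del: norm_power)
    have "integrable M (\<lambda>\<omega>. (2 * norm (f \<omega>)) ^ p + (2 * norm (g \<omega>)) ^ p)"
      unfolding power_mult_distrib
      by (intro Bochner_Integration.integrable_add integrable_mult_right all_moments_power f g)
    then show "integrable M (\<lambda>\<omega>. norm (norm (f \<omega>) + norm (g \<omega>)) ^ p)"
      by (rule Bochner_Integration.integrable_bound[OF _ _ le]) measurable
  qed measurable
  then show ?thesis
  proof (rule all_moments_bound)
    have "norm (a + b) \<le> norm (norm a + norm b)" for a b :: 'b
      using norm_triangle_ineq[of a b] by simp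
    then show "AE \<omega> in M. norm (f \<omega> + g \<omega>) \<le> norm (norm (f \<omega>) + norm (g \<omega>))" by simp
  qed measurable
qed

lemma all_moments_sum: "finite I \<Longrightarrow> (\<And>i. i \<in> I \<Longrightarrow> all_moments (f i)) \<Longrightarrow> all_moments (\<lambda>\<omega>. \<Sum>i\<in>I. f i \<omega>)"
  by (induction I rule: finite_induct) (auto intro!: all_moments_add)

lemma all_moments_bounded_linear:
  assumes "bounded_linear h" "all_moments f"
  shows "all_moments (\<lambda>\<omega>. h (f \<omega>))"
proof -
  interpret bounded_linear h by fact
  obtain K where K: "\<And>a. norm (h a) \<le> norm a * K" using bounded by blast
  have [measurable]: "f \<in> borel_measurable M" using assms by (auto simp: all_moments_def)
  have "h \<in> borel_measurable borel" by (intro borel_measurable_continuous_onI linear_continuous_on assms)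
  then have m: "(\<lambda>\<omega>. h (f \<omega>)) \<in> borel_measurable M" by measurable
  show ?thesis
  proof (rule all_moments_bound[OF _ m])
    show "all_moments (\<lambda>\<omega>. norm (f \<omega>) * K)"
      by (intro all_moments_mult all_moments_norm assms all_moments_const)
    show "AE \<omega> in M. norm (h (f \<omega>)) \<le> norm (norm (f \<omega>) * K)"
      using order_trans[OF K abs_ge_self] by simp
  qed
qed

text \<open>Independence makes the joint law a product, and Fubini moves the expectation through
  each argument of the inner product in turn.\<close>

lemma indep_expectation_inner:
  fixes U V :: "'a \<Rightarrow> 'b::{real_inner, banach, second_countable_topology}"
  assumes ind: "indep_var borel U borel V" and U: "integrable M U" and V: "integrable M V"
  shows "expectation (\<lambda>\<omega>. U \<omega> \<bullet> V \<omega>) = expectation U \<bullet> expectation V"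
proof -
  note rv [measurable] = indep_var_rv1[OF ind] indep_var_rv2[OF ind]
  let ?P = "distr M borel U" and ?Q = "distr M borel V"
  interpret P: prob_space ?P by (rule prob_space_distr) fact
  interpret Q: prob_space ?Q by (rule prob_space_distr) fact
  interpret PQ: pair_prob_space ?P ?Q ..
  have joint: "?P \<Otimes>\<^sub>M ?Q = distr M (borel \<Otimes>\<^sub>M borel) (\<lambda>\<omega>. (U \<omega>, V \<omega>))"
    using ind by (simp add: indep_var_distribution_eq)
  have m: "(\<lambda>p. fst p \<bullet> snd p) \<in> borel_measurable (borel \<Otimes>\<^sub>M (borel :: 'b measure))" by measurable
  have iP: "integrable ?P (\<lambda>x. x)" and iQ: "integrable ?Q (\<lambda>x. x)"
    using U V by (simp_all add: integrable_distr_eq)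
  have int: "integrable (?P \<Otimes>\<^sub>M ?Q) (\<lambda>p. fst p \<bullet> snd p)"
  proof -
    have "indep_var borel (\<lambda>\<omega>. norm (U \<omega>)) borel (\<lambda>\<omega>. norm (V \<omega>))"
      using indep_var_compose[OF ind, of norm borel norm borel] by (simp add: comp_def)
    then have "integrable M (\<lambda>\<omega>. norm (U \<omega>) * norm (V \<omega>))"
      using U V by (intro indep_var_integrable) auto
    then have "integrable M (\<lambda>\<omega>. U \<omega> \<bullet> V \<omega>)"
      by (rule Bochner_Integration.integrable_bound) (auto intro!: AE_I2 Cauchy_Schwarz_ineq2)
    then show ?thesis unfolding joint using m by (subst integrable_distr_eq) auto
  qed
  have "expectation (\<lambda>\<omega>. U \<omega> \<bullet> V \<omega>) = (LINT p|(?P \<Otimes>\<^sub>M ?Q). fst p \<bullet> snd p)"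
    unfolding joint using m by (subst integral_distr) auto
  also have "\<dots> = (LINT x|?P. LINT y|?Q. x \<bullet> y)"
    using PQ.integral_fst'[OF int] by simp
  also have "\<dots> = (LINT x|?P. x \<bullet> (LINT y|?Q. y))"
    using iQ by (simp add: integral_inner_right)
  also have "\<dots> = (LINT x|?P. x) \<bullet> (LINT y|?Q. y)"
    using iP by (simp add: integral_inner_left)
  finally show ?thesis by (simp add: integral_distr)
qed

end

context gaussian_noise
begin

text \<open>A constant that enters all Gaussian moment bounds and plays the part of the trace of the
  covariance operator; its existence is \<open>noise_moments\<close>.\<close>

definition noise_trace :: real where
  "noise_trace = (SOME \<tau>. \<tau> \<ge> 0 \<and> (\<forall>p S a. finite S \<longrightarrow>
     integrable M (\<lambda>\<omega>. norm (\<Sum>t\<in>S. a t *\<^sub>R \<epsilon> t \<omega>) ^ (2 * p)) \<and>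
     expectation (\<lambda>\<omega>. norm (\<Sum>t\<in>S. a t *\<^sub>R \<epsilon> t \<omega>) ^ (2 * p)) \<le> normal_moment p * (\<tau> * (\<Sum>t\<in>S. (a t)\<^sup>2)) ^ p))"

lemma noise_trace_nonneg: "noise_trace \<ge> 0"
  and noise_sum_moment:
    "finite S \<Longrightarrow> expectation (\<lambda>\<omega>. norm (\<Sum>t\<in>S. a t *\<^sub>R \<epsilon> t \<omega>) ^ (2 * p)) \<le> normal_moment p * (noise_trace * (\<Sum>t\<in>S. (a t)\<^sup>2)) ^ p"
  and noise_sum_moment_integrable:
    "finite S \<Longrightarrow> integrable M (\<lambda>\<omega>. norm (\<Sum>t\<in>S. a t *\<^sub>R \<epsilon> t \<omega>) ^ (2 * p))"
proof -
  have *: "noise_trace \<ge> 0 \<and> (\<forall>p S a. finite S \<longrightarrow>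
     integrable M (\<lambda>\<omega>. norm (\<Sum>t\<in>S. a t *\<^sub>R \<epsilon> t \<omega>) ^ (2 * p)) \<and>
     expectation (\<lambda>\<omega>. norm (\<Sum>t\<in>S. a t *\<^sub>R \<epsilon> t \<omega>) ^ (2 * p)) \<le> normal_moment p * (noise_trace * (\<Sum>t\<in>S. (a t)\<^sup>2)) ^ p)"
    unfolding noise_trace_def by (rule someI_ex[OF noise_moments])
  then show "noise_trace \<ge> 0" by blast
  show "finite S \<Longrightarrow> expectation (\<lambda>\<omega>. norm (\<Sum>t\<in>S. a t *\<^sub>R \<epsilon> t \<omega>) ^ (2 * p)) \<le> normal_moment p * (noise_trace * (\<Sum>t\<in>S. (a t)\<^sup>2)) ^ p"
    using * by blast
  show "finite S \<Longrightarrow> integrable M (\<lambda>\<omega>. norm (\<Sum>t\<in>S. a t *\<^sub>R \<epsilon> t \<omega>) ^ (2 * p))"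
    using * by blast
qed

lemma all_moments_noise: "all_moments (\<epsilon> t)"
  by (rule all_moments_even[OF measurable_noise])
    (use noise_sum_moment_integrable[of "{t}" "\<lambda>_. 1"] in simp)

lemma noise_moment_le: "expectation (\<lambda>\<omega>. norm (\<epsilon> t \<omega>) ^ (2 * p)) \<le> normal_moment p * noise_trace ^ p"
  using noise_sum_moment[of "{t}" "\<lambda>_. 1" p] by simp

lemma expectation_noise: "expectation (\<epsilon> t) = 0"
proof -
  have "expectation (\<epsilon> t) \<bullet> g = 0" for g
    using mean_zero[of t] all_moments_integrable[OF all_moments_noise[of t]]
    by (simp add: mean_zero_def flip: integral_inner_left)
  then show ?thesis by (metis inner_eq_zero_iff)
qed

lemma all_moments_blinfun_noise: "all_moments (\<lambda>\<omega>. blinfun_apply A (\<epsilon> t \<omega>))"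
  by (rule all_moments_bounded_linear[OF blinfun.bounded_linear_right all_moments_noise])

lemma measurable_blinfun [measurable]:
  "f \<in> borel_measurable N \<Longrightarrow> (\<lambda>x. blinfun_apply A (f x)) \<in> borel_measurable N"
  by (rule measurable_compose[OF _ borel_measurable_continuous_onI])
    (auto intro!: linear_continuous_on blinfun.bounded_linear_right)

lemma expectation_blinfun_noise: "expectation (\<lambda>\<omega>. blinfun_apply A (\<epsilon> t \<omega>)) = 0"
  using integral_bounded_linear[OF blinfun.bounded_linear_right[of A] all_moments_integrable[OF all_moments_noise[of t]]]
  by (simp add: expectation_noise blinfun.zero_right)

text \<open>Separates the noise at one time from any function of the noise at other times: grouping
  by disjoint index sets preserves independence.\<close>

lemma indep_noise_rest:
  fixes f :: "real_L2 \<Rightarrow> 'b::{second_countable_topology, banach}" and g :: "(int \<Rightarrow> real_L2) \<Rightarrow> 'b"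
  assumes f: "f \<in> borel_measurable borel" and g: "g \<in> borel_measurable (Pi\<^sub>M J (\<lambda>_. borel))" and p: "p \<notin> J"
  shows "indep_var borel (\<lambda>\<omega>. f (\<epsilon> p \<omega>)) borel (\<lambda>\<omega>. g (\<lambda>i\<in>J. \<epsilon> i \<omega>))"
proof -
  have ind: "indep_var (Pi\<^sub>M {p} (\<lambda>_. borel)) (\<lambda>\<omega>. restrict (\<lambda>i. \<epsilon> i \<omega>) {p}) (Pi\<^sub>M J (\<lambda>_. borel)) (\<lambda>\<omega>. restrict (\<lambda>i. \<epsilon> i \<omega>) J)"
    using p by (intro indep_var_restrict[OF indep]) auto
  have "(\<lambda>x. f (x p)) \<in> borel_measurable (Pi\<^sub>M {p} (\<lambda>_. borel))"
    by (rule measurable_compose[OF measurable_component_singleton]) (use f in auto)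
  from indep_var_compose[OF ind this g] show ?thesis by (simp add: comp_def)
qed

text \<open>The product is the inner product of a mean zero vector at time \<open>p\<close> with a
  random vector built from the other three times, hence independent of it. Moving the scalar factor
  into the second vector gives it this shape.\<close>

lemma expectation_four_zero:
  fixes A B C D :: "real_L2 \<Rightarrow>\<^sub>L real_L2"
  assumes p: "p \<notin> {q, r, s}"
  shows "expectation (\<lambda>\<omega>. (blinfun_apply A (\<epsilon> p \<omega>) \<bullet> blinfun_apply B (\<epsilon> q \<omega>)) *
     (blinfun_apply C (\<epsilon> r \<omega>) \<bullet> blinfun_apply D (\<epsilon> s \<omega>))) = 0"
proof -
  let ?g = "\<lambda>x. (blinfun_apply C (x r) \<bullet> blinfun_apply D (x s)) *\<^sub>R blinfun_apply B (x q)"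
  have m: "(\<lambda>x. x q) \<in> borel_measurable (Pi\<^sub>M {q, r, s} (\<lambda>_. borel :: real_L2 measure))"
    "(\<lambda>x. x r) \<in> borel_measurable (Pi\<^sub>M {q, r, s} (\<lambda>_. borel :: real_L2 measure))"
    "(\<lambda>x. x s) \<in> borel_measurable (Pi\<^sub>M {q, r, s} (\<lambda>_. borel :: real_L2 measure))"
    by (rule measurable_component_singleton, simp)+
  have g: "?g \<in> borel_measurable (Pi\<^sub>M {q, r, s} (\<lambda>_. borel))"
    by (intro borel_measurable_scaleR borel_measurable_inner measurable_blinfun m)
  have f: "blinfun_apply A \<in> borel_measurable borel"
    using measurable_blinfun[of "\<lambda>x. x" borel A] by simp
  have ind: "indep_var borel (\<lambda>\<omega>. blinfun_apply A (\<epsilon> p \<omega>)) borel (\<lambda>\<omega>. ?g (\<lambda>i. \<epsilon> i \<omega>))"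
    using indep_noise_rest[OF f g p] by simp
  have "all_moments (\<lambda>\<omega>. ?g (\<lambda>i. \<epsilon> i \<omega>))"
    by (intro all_moments_bounded_bilinear[OF bounded_bilinear_scaleR] all_moments_bounded_bilinear[OF bounded_bilinear_inner]
        all_moments_blinfun_noise) measurable
  then have "expectation (\<lambda>\<omega>. blinfun_apply A (\<epsilon> p \<omega>) \<bullet> ?g (\<lambda>i. \<epsilon> i \<omega>)) = 0"
    using indep_expectation_inner[OF ind all_moments_integrable[OF all_moments_blinfun_noise] all_moments_integrable]
    by (simp add: expectation_blinfun_noise)
  then show ?thesis by (simp add: mult.commute)
qed

lemma borel_measurable_tens [measurable]:
  "f \<in> borel_measurable N \<Longrightarrow> g \<in> borel_measurable N \<Longrightarrow> (\<lambda>x. tens (f x) (g x)) \<in> borel_measurable N"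
  by (rule borel_measurable_continuous_Pair) (auto intro!: continuous_intros tens.continuous_on)

definition noise_tensor :: "(real_L2 \<Rightarrow>\<^sub>L real_L2) \<Rightarrow> (real_L2 \<Rightarrow>\<^sub>L real_L2) \<Rightarrow> int \<Rightarrow> int \<Rightarrow> 'w \<Rightarrow> kernel_L2" where
  "noise_tensor A B p q \<omega> = tens (blinfun_apply A (\<epsilon> p \<omega>)) (blinfun_apply B (\<epsilon> q \<omega>))"

definition noise_cov :: "(real_L2 \<Rightarrow>\<^sub>L real_L2) \<Rightarrow> (real_L2 \<Rightarrow>\<^sub>L real_L2) \<Rightarrow> kernel_L2" where
  "noise_cov A B = expectation (noise_tensor A B 0 0)"

lemma all_moments_noise_tensor: "all_moments (noise_tensor A B p q)"
  unfolding noise_tensor_def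
  by (intro all_moments_bounded_bilinear[OF bounded_bilinear_tens] all_moments_blinfun_noise) measurable

lemma measurable_noise_tensor [measurable]: "noise_tensor A B p q \<in> borel_measurable M"
  by (rule all_moments_measurable[OF all_moments_noise_tensor])

text \<open>Off the diagonal, Fubini over the product of the two laws integrates out the second
  factor first, which has mean 0; on the diagonal, identical distribution removes the dependence on
  the time.\<close>

lemma expectation_noise_tensor: "expectation (noise_tensor A B p q) = (if p = q then noise_cov A B else 0)"
proof (cases "p = q")
  case True
  have "expectation (noise_tensor A B t t) = (LINT x|distr M borel (\<epsilon> t). tens (blinfun_apply A x) (blinfun_apply B x))" for t
    unfolding noise_tensor_def by (subst integral_distr) auto
  then show ?thesis using True distr_eq[of q 0] by (simp add: noise_cov_def)
next
  case False
  have "expectation (noise_tensor A B p q) \<bullet> expectation (noise_tensor A B p q)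
      = expectation (\<lambda>\<omega>. noise_tensor A B p q \<omega> \<bullet> expectation (noise_tensor A B p q))"
    by (rule integral_inner_left[symmetric]) (use all_moments_integrable[OF all_moments_noise_tensor] in simp)
  have g: "(\<lambda>x. G) \<in> borel_measurable (Pi\<^sub>M {} (\<lambda>_. borel))" for G :: kernel_L2 by simp
  have f: "blinfun_apply A \<in> borel_measurable borel"
    using measurable_blinfun[of "\<lambda>x. x" borel A] by simp
  have "blinfun_apply B \<in> borel_measurable borel"
    using measurable_blinfun[of "\<lambda>x. x" borel B] by simp
  then have m: "(\<lambda>x. blinfun_apply B (x q)) \<in> borel_measurable (Pi\<^sub>M {q} (\<lambda>_. borel))"
    by (intro measurable_compose[OF measurable_component_singleton]) auto
  let ?P = "distr M borel (\<lambda>\<omega>. blinfun_apply A (\<epsilon> p \<omega>))" and ?Q = "distr M borel (\<lambda>\<omega>. blinfun_apply B (\<epsilon> q \<omega>))"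
  have ind: "indep_var borel (\<lambda>\<omega>. blinfun_apply A (\<epsilon> p \<omega>)) borel (\<lambda>\<omega>. blinfun_apply B (\<epsilon> q \<omega>))"
    using indep_noise_rest[OF f m] False by simp
  interpret P: prob_space ?P by (rule prob_space_distr) measurable
  interpret Q: prob_space ?Q by (rule prob_space_distr) measurable
  interpret PQ: pair_prob_space ?P ?Q ..
  have joint: "?P \<Otimes>\<^sub>M ?Q = distr M (borel \<Otimes>\<^sub>M borel) (\<lambda>\<omega>. (blinfun_apply A (\<epsilon> p \<omega>), blinfun_apply B (\<epsilon> q \<omega>)))"
    using ind by (simp add: indep_var_distribution_eq)
  have mt: "(\<lambda>z. tens (fst z) (snd z)) \<in> borel_measurable (borel \<Otimes>\<^sub>M borel)" by measurable
  have int: "integrable (?P \<Otimes>\<^sub>M ?Q) (\<lambda>z. tens (fst z) (snd z))"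
    unfolding joint using all_moments_integrable[OF all_moments_noise_tensor[of A B p q]] mt
    by (subst integrable_distr_eq) (auto simp: noise_tensor_def[abs_def])
  have iQ: "integrable ?Q (\<lambda>x. x)"
    using all_moments_integrable[OF all_moments_blinfun_noise] by (simp add: integrable_distr_eq)
  have "expectation (noise_tensor A B p q) = (LINT z|(?P \<Otimes>\<^sub>M ?Q). tens (fst z) (snd z))"
    unfolding joint noise_tensor_def[abs_def] using mt by (subst integral_distr) auto
  also have "\<dots> = (LINT x|?P. LINT y|?Q. tens x y)"
    using PQ.integral_fst'[OF int] by simp
  also have "\<dots> = (LINT x|?P. tens x (LINT y|?Q. y))"
    using integral_bounded_linear[OF tens.bounded_linear_right iQ] by simp
  also have "(LINT y|?Q. y) = 0" by (simp add: integral_distr expectation_blinfun_noise)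
  finally show ?thesis using False by (simp add: tens.zero_right)
qed

definition centered_tensor :: "(real_L2 \<Rightarrow>\<^sub>L real_L2) \<Rightarrow> (real_L2 \<Rightarrow>\<^sub>L real_L2) \<Rightarrow> int \<times> int \<Rightarrow> 'w \<Rightarrow> kernel_L2" where
  "centered_tensor A B x \<omega> = noise_tensor A B (fst x) (snd x) \<omega> - expectation (noise_tensor A B (fst x) (snd x))"

lemma all_moments_centered_tensor: "all_moments (centered_tensor A B x)"
  unfolding centered_tensor_def
  using all_moments_add[OF all_moments_noise_tensor all_moments_const, of A B "fst x" "snd x" "- expectation (noise_tensor A B (fst x) (snd x))"]
  by simp

text \<open>If the pairs do not match, even after swapping, then either both tensors are diagonal at
  different times and hence independent, or some time occurs exactly once among the four and makes
  both sides vanish.\<close>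

lemma expectation_inner_noise_tensor:
  "expectation (\<lambda>\<omega>. noise_tensor A B p q \<omega> \<bullet> noise_tensor A B r s \<omega>) =
     expectation (noise_tensor A B p q) \<bullet> expectation (noise_tensor A B r s)"
  if "(r, s) \<noteq> (p, q)" "(r, s) \<noteq> (q, p)"
proof (cases "p = q \<and> r = s")
  case True
  then have pr: "p \<noteq> r" using that by auto
  have b: "blinfun_apply A \<in> borel_measurable borel" "blinfun_apply B \<in> borel_measurable borel"
    using measurable_blinfun[of "\<lambda>x. x" borel A] measurable_blinfun[of "\<lambda>x. x" borel B] by simp_all
  have f: "(\<lambda>x. tens (blinfun_apply A x) (blinfun_apply B x)) \<in> borel_measurable borel" by measurable
  have g: "(\<lambda>x. tens (blinfun_apply A (x r)) (blinfun_apply B (x r))) \<in> borel_measurable (Pi\<^sub>M {r} (\<lambda>_. borel))"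
    by (rule measurable_compose[OF measurable_component_singleton]) (use f in auto)
  have "indep_var borel (noise_tensor A B p q) borel (noise_tensor A B r s)"
    using indep_noise_rest[OF f g, of p] pr True by (simp add: noise_tensor_def[abs_def])
  then show ?thesis
    by (intro indep_expectation_inner all_moments_integrable all_moments_noise_tensor)
next
  case False
  then have zero: "expectation (noise_tensor A B p q) \<bullet> expectation (noise_tensor A B r s) = 0"
    by (auto simp: expectation_noise_tensor)
  have eq: "noise_tensor A B p q \<omega> \<bullet> noise_tensor A B r s \<omega> =
     (blinfun_apply A (\<epsilon> p \<omega>) \<bullet> blinfun_apply A (\<epsilon> r \<omega>)) * (blinfun_apply B (\<epsilon> q \<omega>) \<bullet> blinfun_apply B (\<epsilon> s \<omega>))" for \<omega>
    by (simp add: noise_tensor_def inner_tens)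
  have "p \<notin> {r, q, s} \<or> r \<notin> {p, q, s} \<or> q \<notin> {s, p, r} \<or> s \<notin> {q, p, r}"
    using that False by (cases "p = q"; cases "r = s"; cases "p = r"; cases "p = s"; cases "q = r"; cases "q = s") auto
  then consider "p \<notin> {r, q, s}" | "r \<notin> {p, q, s}" | "q \<notin> {s, p, r}" | "s \<notin> {q, p, r}"
    by blast
  then have "expectation (\<lambda>\<omega>. noise_tensor A B p q \<omega> \<bullet> noise_tensor A B r s \<omega>) = 0"
  proof cases
    case 1 then show ?thesis unfolding eq by (rule expectation_four_zero)
  next
    case 2 then show ?thesis unfolding eq using expectation_four_zero[of r p q s A A B B] by (simp add: inner_commute)
  next
    case 3 then show ?thesis unfolding eq using expectation_four_zero[of q s p r B B A A] by (simp add: mult.commute)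
  next
    case 4 then show ?thesis unfolding eq using expectation_four_zero[of s q p r B B A A] by (simp add: mult.commute inner_commute)
  qed
  then show ?thesis using zero by simp
qed

lemma expectation_inner_centered_tensor:
  assumes "y \<noteq> x" "y \<noteq> prod.swap x"
  shows "expectation (\<lambda>\<omega>. centered_tensor A B x \<omega> \<bullet> centered_tensor A B y \<omega>) = 0"
proof -
  let ?N = "\<lambda>x. noise_tensor A B (fst x) (snd x)"
  have i: "integrable M (?N x)" for x by (intro all_moments_integrable all_moments_noise_tensor)
  have i2: "integrable M (\<lambda>\<omega>. ?N x \<omega> \<bullet> ?N y \<omega>)"
    by (intro all_moments_integrable all_moments_bounded_bilinear[OF bounded_bilinear_inner] all_moments_noise_tensor) measurable
  have "expectation (\<lambda>\<omega>. centered_tensor A B x \<omega> \<bullet> centered_tensor A B y \<omega>)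
     = expectation (\<lambda>\<omega>. ?N x \<omega> \<bullet> ?N y \<omega> - ?N x \<omega> \<bullet> expectation (?N y) - expectation (?N x) \<bullet> ?N y \<omega> + expectation (?N x) \<bullet> expectation (?N y))"
    by (simp add: centered_tensor_def inner_diff_left inner_diff_right algebra_simps)
  also have "\<dots> = expectation (\<lambda>\<omega>. ?N x \<omega> \<bullet> ?N y \<omega>) - expectation (?N x) \<bullet> expectation (?N y)"
    using i[of x] i[of y] i2 by (simp add: prob_space)
  also have "\<dots> = 0"
    using expectation_inner_noise_tensor[of "fst y" "snd y" "fst x" "snd x" A B] assms
    by (cases x; cases y) auto
  finally show ?thesis .
qed

text \<open>The factor 12 is 3 times 4: 3 is the fourth moment of a standard normal variable, and
  centering costs at most a factor 4.\<close>

definition tensor_var :: real where "tensor_var = 12 * noise_trace\<^sup>2"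

lemma tensor_var_nonneg: "tensor_var \<ge> 0" by (simp add: tensor_var_def)

lemma norm_noise_tensor_sq:
  "expectation (\<lambda>\<omega>. (norm (noise_tensor A B p q \<omega>))\<^sup>2) \<le> 3 * noise_trace\<^sup>2 * (norm A * norm B)\<^sup>2"
proof -
  have i: "integrable M (\<lambda>\<omega>. norm (\<epsilon> t \<omega>) ^ 4)" for t by (rule all_moments_power[OF all_moments_noise])
  have "(norm (noise_tensor A B p q \<omega>))\<^sup>2 \<le> (norm A * norm B)\<^sup>2 * ((norm (\<epsilon> p \<omega>) ^ 4 + norm (\<epsilon> q \<omega>) ^ 4) / 2)" for \<omega>
  proof -
    have "norm (noise_tensor A B p q \<omega>) \<le> (norm A * norm (\<epsilon> p \<omega>)) * (norm B * norm (\<epsilon> q \<omega>))"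
      unfolding noise_tensor_def norm_tens by (intro mult_mono norm_blinfun) auto
    then have "(norm (noise_tensor A B p q \<omega>))\<^sup>2 \<le> ((norm A * norm (\<epsilon> p \<omega>)) * (norm B * norm (\<epsilon> q \<omega>)))\<^sup>2"
      by (intro power_mono) auto
    also have "\<dots> = (norm A * norm B)\<^sup>2 * ((norm (\<epsilon> p \<omega>))\<^sup>2 * (norm (\<epsilon> q \<omega>))\<^sup>2)"
      by (simp add: power_mult_distrib mult_ac)
    also have "\<dots> \<le> (norm A * norm B)\<^sup>2 * ((norm (\<epsilon> p \<omega>) ^ 4 + norm (\<epsilon> q \<omega>) ^ 4) / 2)"
      using sum_squares_bound[of "(norm (\<epsilon> p \<omega>))\<^sup>2" "(norm (\<epsilon> q \<omega>))\<^sup>2"]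
      by (intro mult_left_mono) (auto simp flip: power_mult)
    finally show ?thesis .
  qed
  then have "expectation (\<lambda>\<omega>. (norm (noise_tensor A B p q \<omega>))\<^sup>2)
     \<le> expectation (\<lambda>\<omega>. (norm A * norm B)\<^sup>2 * ((norm (\<epsilon> p \<omega>) ^ 4 + norm (\<epsilon> q \<omega>) ^ 4) / 2))"
    using i by (intro integral_mono all_moments_power[OF all_moments_noise_tensor]) auto
  also have "\<dots> = (norm A * norm B)\<^sup>2 * ((expectation (\<lambda>\<omega>. norm (\<epsilon> p \<omega>) ^ 4) + expectation (\<lambda>\<omega>. norm (\<epsilon> q \<omega>) ^ 4)) / 2)"
    using i by simp
  also have "\<dots> \<le> (norm A * norm B)\<^sup>2 * ((3 * noise_trace\<^sup>2 + 3 * noise_trace\<^sup>2) / 2)"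
    using noise_moment_le[of p 2] noise_moment_le[of q 2]
    by (intro mult_left_mono divide_right_mono add_mono) (auto simp: normal_moment_def fact_numeral)
  finally show ?thesis by (simp add: mult_ac)
qed

lemma norm_expectation_noise_tensor:
  "(norm (expectation (noise_tensor A B p q)))\<^sup>2 \<le> expectation (\<lambda>\<omega>. (norm (noise_tensor A B p q \<omega>))\<^sup>2)"
proof -
  let ?m = "norm (expectation (noise_tensor A B p q))"
  have i: "integrable M (noise_tensor A B p q)" "integrable M (\<lambda>\<omega>. (norm (noise_tensor A B p q \<omega>))\<^sup>2)"
    by (intro all_moments_integrable all_moments_power all_moments_noise_tensor)+
  have le: "?m \<le> expectation (\<lambda>\<omega>. norm (noise_tensor A B p q \<omega>))" by (rule integral_norm_bound)
  have "0 \<le> expectation (\<lambda>\<omega>. (norm (noise_tensor A B p q \<omega>) - ?m)\<^sup>2)" by (rule integral_nonneg_AE) simp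
  also have "\<dots> = expectation (\<lambda>\<omega>. (norm (noise_tensor A B p q \<omega>))\<^sup>2 - 2 * ?m * norm (noise_tensor A B p q \<omega>) + ?m\<^sup>2)"
    by (simp add: power2_diff algebra_simps)
  also have "\<dots> = expectation (\<lambda>\<omega>. (norm (noise_tensor A B p q \<omega>))\<^sup>2) - 2 * ?m * expectation (\<lambda>\<omega>. norm (noise_tensor A B p q \<omega>)) + ?m\<^sup>2"
    using i by (simp add: prob_space)
  also have "\<dots> \<le> expectation (\<lambda>\<omega>. (norm (noise_tensor A B p q \<omega>))\<^sup>2) - 2 * ?m * ?m + ?m\<^sup>2"
    using le by (intro add_mono diff_mono mult_left_mono) auto
  finally show ?thesis by (simp add: power2_eq_square)
qed

lemma norm_centered_tensor_sq:
  "expectation (\<lambda>\<omega>. (norm (centered_tensor A B x \<omega>))\<^sup>2) \<le> tensor_var * (norm A * norm B)\<^sup>2"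
proof -
  let ?N = "noise_tensor A B (fst x) (snd x)"
  have "(norm (centered_tensor A B x \<omega>))\<^sup>2 \<le> 2 * (norm (?N \<omega>))\<^sup>2 + 2 * (norm (expectation ?N))\<^sup>2" for \<omega>
  proof -
    have "(norm (centered_tensor A B x \<omega>))\<^sup>2 \<le> (norm (?N \<omega>) + norm (expectation ?N))\<^sup>2"
      unfolding centered_tensor_def by (intro power_mono norm_triangle_ineq4) auto
    also have "\<dots> \<le> 2 * (norm (?N \<omega>))\<^sup>2 + 2 * (norm (expectation ?N))\<^sup>2"
      using sum_squares_bound[of "norm (?N \<omega>)" "norm (expectation ?N)"] by (simp add: power2_sum)
    finally show ?thesis .
  qed
  then have "expectation (\<lambda>\<omega>. (norm (centered_tensor A B x \<omega>))\<^sup>2)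
     \<le> expectation (\<lambda>\<omega>. 2 * (norm (?N \<omega>))\<^sup>2 + 2 * (norm (expectation ?N))\<^sup>2)"
    using all_moments_power[OF all_moments_noise_tensor, of A B "fst x" "snd x" 2]
    by (intro integral_mono all_moments_power[OF all_moments_centered_tensor]) auto
  also have "\<dots> = 2 * expectation (\<lambda>\<omega>. (norm (?N \<omega>))\<^sup>2) + 2 * (norm (expectation ?N))\<^sup>2"
    using all_moments_power[OF all_moments_noise_tensor, of A B "fst x" "snd x" 2] by (simp add: prob_space)
  also have "\<dots> \<le> tensor_var * (norm A * norm B)\<^sup>2"
    using norm_expectation_noise_tensor[of A B "fst x" "snd x"] norm_noise_tensor_sq[of A B "fst x" "snd x"]
    by (simp add: tensor_var_def)
  finally show ?thesis .
qed

text \<open>Entries of the Gram matrix of the centered tensors vanish unless \<open>y = x\<close> or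
  \<open>y = prod.swap x\<close>, so its quadratic form is bounded by twice a diagonal one. This
  near orthogonality is the source of the variance rate.\<close>

lemma centered_tensor_sum_sq:
  assumes P: "finite P"
  shows "expectation (\<lambda>\<omega>. (norm (\<Sum>x\<in>P. c x *\<^sub>R centered_tensor A B x \<omega>))\<^sup>2)
    \<le> 2 * tensor_var * (norm A * norm B)\<^sup>2 * (\<Sum>x\<in>P. (c x)\<^sup>2)"
proof -
  let ?Z = "centered_tensor A B" and ?K = "tensor_var * (norm A * norm B)\<^sup>2"
  define G where "G x y = expectation (\<lambda>\<omega>. ?Z x \<omega> \<bullet> ?Z y \<omega>)" for x y
  have i: "integrable M (\<lambda>\<omega>. ?Z x \<omega> \<bullet> ?Z y \<omega>)" for x y
    by (intro all_moments_integrable all_moments_bounded_bilinear[OF bounded_bilinear_inner] all_moments_centered_tensor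
        borel_measurable_inner all_moments_measurable[OF all_moments_centered_tensor])
  have K0: "?K \<ge> 0" using tensor_var_nonneg by simp
  have G: "\<bar>G x y\<bar> \<le> ?K" for x y
  proof -
    have half: "u \<le> v * w \<Longrightarrow> 2 * v * w \<le> z \<Longrightarrow> u \<le> z / 2" for u v w z :: real
      by simp
    have "\<bar>G x y\<bar> \<le> expectation (\<lambda>\<omega>. \<bar>?Z x \<omega> \<bullet> ?Z y \<omega>\<bar>)" unfolding G_def by (rule integral_abs_bound)
    also have "\<dots> \<le> expectation (\<lambda>\<omega>. ((norm (?Z x \<omega>))\<^sup>2 + (norm (?Z y \<omega>))\<^sup>2) / 2)"
    proof (rule integral_mono)
      fix \<omega>
      show "\<bar>?Z x \<omega> \<bullet> ?Z y \<omega>\<bar> \<le> ((norm (?Z x \<omega>))\<^sup>2 + (norm (?Z y \<omega>))\<^sup>2) / 2"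
        by (rule half[OF Cauchy_Schwarz_ineq2 sum_squares_bound])
    qed (auto intro!: integrable_abs i all_moments_power[OF all_moments_centered_tensor])
    also have "\<dots> = (expectation (\<lambda>\<omega>. (norm (?Z x \<omega>))\<^sup>2) + expectation (\<lambda>\<omega>. (norm (?Z y \<omega>))\<^sup>2)) / 2"
      using all_moments_power[OF all_moments_centered_tensor, of A B _ 2] by simp
    also have "\<dots> \<le> (?K + ?K) / 2" by (intro divide_right_mono add_mono norm_centered_tensor_sq) auto
    finally show ?thesis by simp
  qed
  have G0: "G x y = 0" if "y \<noteq> x" "y \<noteq> prod.swap x" for x y
    unfolding G_def by (rule expectation_inner_centered_tensor[OF that])
  have "expectation (\<lambda>\<omega>. (norm (\<Sum>x\<in>P. c x *\<^sub>R ?Z x \<omega>))\<^sup>2) = expectation (\<lambda>\<omega>. \<Sum>x\<in>P. \<Sum>y\<in>P. c x * c y * (?Z x \<omega> \<bullet> ?Z y \<omega>))"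
    unfolding power2_norm_eq_inner inner_sum_left inner_sum_right inner_scaleR_left inner_scaleR_right sum_distrib_left
    by (intro Bochner_Integration.integral_cong refl sum.cong) (simp add: inner_commute mult.assoc)
  also have "\<dots> = (\<Sum>x\<in>P. \<Sum>y\<in>P. c x * c y * G x y)"
    unfolding G_def using i
    by (subst Bochner_Integration.integral_sum) (auto simp: Bochner_Integration.integral_sum intro!: Bochner_Integration.integrable_sum)
  \<comment> \<open>The swapped product is split by \<open>2 * \<bar>c x * c y\<bar> \<le> (c
    x)\<^sup>2 + (c y)\<^sup>2\<close>. Swapping is an involution on the pairs whose swap also lies
    in \<open>P\<close>, so both squares have the same sum there.\<close>
  also have "\<dots> \<le> (\<Sum>x\<in>P. \<Sum>y\<in>P. ((if y = x then (c x)\<^sup>2 else 0) + (if y = prod.swap x then ((c x)\<^sup>2 + (c y)\<^sup>2) / 2 else 0)) * ?K)"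
  proof (intro sum_mono)
    fix x y
    have "c x * c y * G x y \<le> \<bar>c x * c y\<bar> * \<bar>G x y\<bar>"
      unfolding abs_mult[symmetric] by (rule abs_ge_self)
    also have "\<dots> \<le> \<bar>c x * c y\<bar> * ?K" by (intro mult_left_mono G) simp
    finally have 1: "c x * c y * G x y \<le> \<bar>c x * c y\<bar> * ?K" .
    have 2: "\<bar>c x * c y\<bar> \<le> ((c x)\<^sup>2 + (c y)\<^sup>2) / 2"
      using sum_squares_bound[of "\<bar>c x\<bar>" "\<bar>c y\<bar>"] by (simp add: abs_mult)
    show "c x * c y * G x y \<le> ((if y = x then (c x)\<^sup>2 else 0) + (if y = prod.swap x then ((c x)\<^sup>2 + (c y)\<^sup>2) / 2 else 0)) * ?K"
    proof (cases "y = x \<or> y = prod.swap x")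
      case False
      then show ?thesis using G0[of y x] by simp
    next
      case True
      then have "\<bar>c x * c y\<bar> \<le> (if y = x then (c x)\<^sup>2 else 0) + (if y = prod.swap x then ((c x)\<^sup>2 + (c y)\<^sup>2) / 2 else 0)"
        using 2 by (auto simp: power2_eq_square)
      then show ?thesis by (rule order_trans[OF 1 mult_right_mono[OF _ K0]])
    qed
  qed
  also have "\<dots> = (\<Sum>x\<in>P. (c x)\<^sup>2 + (if prod.swap x \<in> P then ((c x)\<^sup>2 + (c (prod.swap x))\<^sup>2) / 2 else 0)) * ?K"
    unfolding sum_distrib_right[symmetric] by (simp only: sum.distrib sum.delta[OF P] cong: sum.cong if_cong) simp
  also have "\<dots> \<le> (2 * (\<Sum>x\<in>P. (c x)\<^sup>2)) * ?K"
  proof (rule mult_right_mono[OF _ K0])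
    let ?Q = "{x\<in>P. prod.swap x \<in> P}"
    have "(\<Sum>x\<in>P. if prod.swap x \<in> P then ((c x)\<^sup>2 + (c (prod.swap x))\<^sup>2) / 2 else 0)
      = (\<Sum>x\<in>?Q. ((c x)\<^sup>2 + (c (prod.swap x))\<^sup>2) / 2)"
      using P by (simp add: sum.inter_filter)
    also have "\<dots> = ((\<Sum>x\<in>?Q. (c x)\<^sup>2) + (\<Sum>x\<in>?Q. (c (prod.swap x))\<^sup>2)) / 2"
      by (simp add: sum.distrib flip: sum_divide_distrib)
    also have "(\<Sum>x\<in>?Q. (c (prod.swap x))\<^sup>2) = (\<Sum>x\<in>?Q. (c x)\<^sup>2)"
      by (rule sum.reindex_bij_witness[of _ prod.swap prod.swap]) auto
    also have "((\<Sum>x\<in>?Q. (c x)\<^sup>2) + (\<Sum>x\<in>?Q. (c x)\<^sup>2)) / 2 \<le> (\<Sum>x\<in>P. (c x)\<^sup>2)"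
      using P by (simp, intro sum_mono2) auto
    finally show "(\<Sum>x\<in>P. (c x)\<^sup>2 + (if prod.swap x \<in> P then ((c x)\<^sup>2 + (c (prod.swap x))\<^sup>2) / 2 else 0)) \<le> 2 * (\<Sum>x\<in>P. (c x)\<^sup>2)"
      by (simp add: sum.distrib)
  qed
  finally show ?thesis by (simp add: mult_ac)
qed

end

section \<open>The lag weights of the spectral estimator\<close>

definition taper :: "(real \<Rightarrow> real) \<Rightarrow> real \<Rightarrow> nat \<Rightarrow> real \<Rightarrow> int \<Rightarrow> real" where
  "taper W b T \<xi> t = W ((\<xi> - fourier_freq T t) / b) / (b * real T)"

definition freqs :: "nat \<Rightarrow> int set" where
  "freqs T = {- ((int T - 1) div 2)..(int T - 1) div 2}"

definition lag_weight :: "(real \<Rightarrow> real) \<Rightarrow> real \<Rightarrow> nat \<Rightarrow> real \<Rightarrow> int \<Rightarrow> complex" where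
  "lag_weight W b T \<xi> h = (\<Sum>t\<in>freqs T. taper W b T \<xi> t *\<^sub>R cis (- fourier_freq T t * of_int h))"

lemma finite_freqs [simp]: "finite (freqs T)" by (simp add: freqs_def)

text \<open>The assumption keeps the right-hand side nonnegative when no integer lies between the
  bounds, and even allows them to be in reversed order.\<close>

lemma card_int_interval_le:
  assumes "x \<le> y + 1"
  shows "real (card {t::int. x \<le> of_int t \<and> of_int t \<le> y}) \<le> y - x + 1"
proof -
  have "{t::int. x \<le> of_int t \<and> of_int t \<le> y} = {\<lceil>x\<rceil>..\<lfloor>y\<rfloor>}" by (auto simp: ceiling_le_iff le_floor_iff)
  then have "real (card {t::int. x \<le> of_int t \<and> of_int t \<le> y}) = real (nat (\<lfloor>y\<rfloor> - \<lceil>x\<rceil> + 1))" by simp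
  also have "\<dots> \<le> y - x + 1"
  proof (cases "\<lfloor>y\<rfloor> - \<lceil>x\<rceil> + 1 \<ge> 0")
    case True
    then have "real (nat (\<lfloor>y\<rfloor> - \<lceil>x\<rceil> + 1)) = real_of_int \<lfloor>y\<rfloor> - real_of_int \<lceil>x\<rceil> + 1" by simp
    then show ?thesis using of_int_floor_le[of y] le_of_int_ceiling[of x] by linarith
  qed (use assms in simp)
  finally show ?thesis .
qed

lemma finite_int_interval: "finite {t::int. x \<le> real_of_int t \<and> real_of_int t \<le> y}"
proof -
  have "{t::int. x \<le> of_int t \<and> of_int t \<le> y} = {\<lceil>x\<rceil>..\<lfloor>y\<rfloor>}" by (auto simp: ceiling_le_iff le_floor_iff)
  then show ?thesis by simp
qed

text \<open>The rescaled distances \<open>(\<xi> - fourier_freq T t) / b\<close> form a grid of mesh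
  \<open>2 * pi / (b * T)\<close>.\<close>

lemma card_grid_le:
  fixes \<xi> :: real
  assumes bT: "b > 0" "T > 0" and ac: "a \<le> c"
  defines "G \<equiv> {t \<in> freqs T. a \<le> (\<xi> - fourier_freq T t) / b \<and> (\<xi> - fourier_freq T t) / b \<le> c}"
  shows "real (card G) \<le> (c - a) * (b * real T) / (2 * pi) + 1"
proof -
  let ?x = "(\<xi> - c * b) * real T / (2 * pi)" and ?y = "(\<xi> - a * b) * real T / (2 * pi)"
  have "G \<subseteq> {t. ?x \<le> of_int t \<and> of_int t \<le> ?y}"
    using bT by (auto simp: G_def fourier_freq_def field_simps)
  then have "card G \<le> card {t::int. ?x \<le> of_int t \<and> of_int t \<le> ?y}"
    by (intro card_mono finite_int_interval)
  then have "real (card G) \<le> real (card {t::int. ?x \<le> of_int t \<and> of_int t \<le> ?y})" by simp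
  also have "\<dots> \<le> ?y - ?x + 1"
  proof (rule card_int_interval_le)
    have "(\<xi> - c * b) * real T \<le> (\<xi> - a * b) * real T" using bT ac by (intro mult_right_mono) auto
    then have "?x \<le> ?y" by (intro divide_right_mono) auto
    then show "?x \<le> ?y + 1" by linarith
  qed
  also have "?y - ?x = (c - a) * (b * real T) / (2 * pi)"
    by (simp add: field_simps)
  finally show ?thesis .
qed

lemma sum_cis_root_of_unity:
  assumes T: "T > 0" and k: "\<not> int T dvd k"
  shows "(\<Sum>s=1..int T. cis (2 * pi * of_int k / real T * of_int s)) = 0"
proof -
  define \<theta> where "\<theta> = 2 * pi * of_int k / real T"
  have zT: "cis \<theta> ^ T = 1"
  proof -
    have "cis \<theta> ^ T = cis (real T * \<theta>)" by (rule Complex.DeMoivre)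
    also have "real T * \<theta> = 2 * pi * of_int k" using T by (simp add: \<theta>_def)
    finally show ?thesis using cos_int_2pin[of k] sin_int_2pin[of k] by (simp add: complex_eq_iff mult_ac)
  qed
  have z1: "cis \<theta> \<noteq> 1"
  proof
    assume "cis \<theta> = 1"
    then have "cos \<theta> = 1" by (metis cis.sel(1) one_complex.sel(1))
    then obtain n :: int where "\<theta> = of_int n * (2 * pi)" by (auto simp: cos_one_2pi_int)
    then have "of_int k = of_int n * real T" using T by (simp add: \<theta>_def field_simps)
    then have "k = n * int T" by (metis of_int_eq_iff of_int_mult of_int_of_nat_eq)
    with k show False by simp
  qed
  have "(\<Sum>s=1..int T. cis (\<theta> * of_int s)) = (\<Sum>n<T. cis \<theta> * cis \<theta> ^ n)"
  proof (rule sum.reindex_bij_witness[of _ "\<lambda>n. int n + 1" "\<lambda>s. nat (s - 1)"])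
    fix s assume s: "s \<in> {1..int T}"
    then have "real (nat (s - 1)) = of_int s - 1" by simp
    then show "cis \<theta> * cis \<theta> ^ nat (s - 1) = cis (\<theta> * of_int s)"
      unfolding Complex.DeMoivre cis_mult by (simp add: algebra_simps)
  qed auto
  also have "\<dots> = cis \<theta> * ((cis \<theta> ^ T - 1) / (cis \<theta> - 1))"
    using z1 by (simp add: geometric_sum flip: sum_distrib_left)
  finally show ?thesis using zT by (simp add: \<theta>_def)
qed

text \<open>Two elements of \<open>freqs T\<close> differ by at most \<open>T - 1\<close>, so they
  are distinct residues modulo \<open>T\<close>.\<close>

lemma freqs_diff_dvd: "t \<in> freqs T \<Longrightarrow> t' \<in> freqs T \<Longrightarrow> int T dvd t - t' \<Longrightarrow> T > 0 \<Longrightarrow> t = t'"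
proof -
  assume a: "t \<in> freqs T" "t' \<in> freqs T" "int T dvd t - t'" "T > 0"
  then have "\<bar>t - t'\<bar> < int T" by (auto simp: freqs_def)
  then have "t - t' = 0" using a(3) zdvd_not_zless[of "t - t'" "int T"] dvd_imp_le_int[of "t - t'" "int T"] by (cases "t - t' = 0") auto
  then show "t = t'" by simp
qed

text \<open>Expand the squared modulus. The phase in \<open>s1 - s2\<close> factors into a character
  of \<open>s1\<close> and one of \<open>s2\<close>, and summation over a full period of length
  \<open>T\<close> leaves only equal frequencies. The double sum over times is the one that appears
  for the coefficients of a quadratic form.\<close>

lemma lag_weight_Parseval:
  assumes T: "T > 0"
  shows "(\<Sum>s1=1..int T. \<Sum>s2=1..int T. (cmod (lag_weight W b T \<xi> (s1 - s2)))\<^sup>2)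
     = (real T)\<^sup>2 * (\<Sum>t\<in>freqs T. (taper W b T \<xi> t)\<^sup>2)"
proof -
  let ?w = "taper W b T \<xi>" and ?f = "fourier_freq T"
  define D where "D t t' = (\<Sum>s=1..int T. cis (2 * pi * of_int (t - t') / real T * of_int s))" for t t'
  have D: "D t t' = (if t = t' then of_nat T else 0)" if "t \<in> freqs T" "t' \<in> freqs T" for t t'
    using sum_cis_root_of_unity[OF T, of "t - t'"] freqs_diff_dvd[OF that _ T] by (auto simp: D_def)
  have sq: "complex_of_real ((cmod (lag_weight W b T \<xi> (s1 - s2)))\<^sup>2) =
      (\<Sum>t\<in>freqs T. \<Sum>t'\<in>freqs T. complex_of_real (?w t * ?w t') *
         (cis (2 * pi * of_int (t' - t) / real T * of_int s1) * cis (2 * pi * of_int (t - t') / real T * of_int s2)))" for s1 s2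
  proof -
    have "complex_of_real ((cmod (lag_weight W b T \<xi> (s1 - s2)))\<^sup>2) = lag_weight W b T \<xi> (s1 - s2) * cnj (lag_weight W b T \<xi> (s1 - s2))"
      by (rule complex_norm_square)
    also have "\<dots> = (\<Sum>t\<in>freqs T. \<Sum>t'\<in>freqs T. (?w t *\<^sub>R cis (- ?f t * of_int (s1 - s2))) * (?w t' *\<^sub>R cis (?f t' * of_int (s1 - s2))))"
      by (simp add: lag_weight_def sum_product cis_cnj)
    also have "\<dots> = (\<Sum>t\<in>freqs T. \<Sum>t'\<in>freqs T. complex_of_real (?w t * ?w t') *
         (cis (2 * pi * of_int (t' - t) / real T * of_int s1) * cis (2 * pi * of_int (t - t') / real T * of_int s2)))"
    proof (intro sum.cong refl)
      fix t t'
      have "cis (- ?f t * of_int (s1 - s2)) * cis (?f t' * of_int (s1 - s2))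
        = cis (2 * pi * of_int (t' - t) / real T * of_int s1) * cis (2 * pi * of_int (t - t') / real T * of_int s2)"
        unfolding cis_mult by (rule arg_cong[of _ _ cis]) (simp add: fourier_freq_def diff_divide_distrib algebra_simps)
      then show "(?w t *\<^sub>R cis (- ?f t * of_int (s1 - s2))) * (?w t' *\<^sub>R cis (?f t' * of_int (s1 - s2)))
        = complex_of_real (?w t * ?w t') *
         (cis (2 * pi * of_int (t' - t) / real T * of_int s1) * cis (2 * pi * of_int (t - t') / real T * of_int s2))"
        by (simp add: scaleR_conv_of_real mult_ac)
    qed
    finally show ?thesis .
  qed
  have "complex_of_real (\<Sum>s1=1..int T. \<Sum>s2=1..int T. (cmod (lag_weight W b T \<xi> (s1 - s2)))\<^sup>2)
    = (\<Sum>s1=1..int T. \<Sum>s2=1..int T. \<Sum>t\<in>freqs T. \<Sum>t'\<in>freqs T. complex_of_real (?w t * ?w t') *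
         (cis (2 * pi * of_int (t' - t) / real T * of_int s1) * cis (2 * pi * of_int (t - t') / real T * of_int s2)))"
    unfolding of_real_sum sq ..
  also have "\<dots> = (\<Sum>t\<in>freqs T. \<Sum>t'\<in>freqs T. \<Sum>s1=1..int T. \<Sum>s2=1..int T. complex_of_real (?w t * ?w t') *
         (cis (2 * pi * of_int (t' - t) / real T * of_int s1) * cis (2 * pi * of_int (t - t') / real T * of_int s2)))"
    by (subst sum.swap, subst (2) sum.swap, subst sum.swap, subst (3) sum.swap, subst (2) sum.swap) (rule sum.swap)
  also have "\<dots> = (\<Sum>t\<in>freqs T. \<Sum>t'\<in>freqs T. complex_of_real (?w t * ?w t') * (D t' t * D t t'))"
    unfolding D_def sum_product unfolding sum_distrib_left ..
  also have "\<dots> = (\<Sum>t\<in>freqs T. \<Sum>t'\<in>freqs T. if t' = t then complex_of_real ((real T)\<^sup>2 * (?w t)\<^sup>2) else 0)"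
    by (intro sum.cong refl) (auto simp: D power2_eq_square)
  also have "\<dots> = complex_of_real ((real T)\<^sup>2 * (\<Sum>t\<in>freqs T. (?w t)\<^sup>2))"
    by (simp add: sum.delta sum_distrib_left)
  finally show ?thesis by (simp only: of_real_eq_iff)
qed

section \<open>Size and limit of the lag weights\<close>

locale lag_window =
  fixes W :: "real \<Rightarrow> real" and w\<^sub>0 L :: real
  assumes W_nonneg: "W x \<ge> 0" and W_le: "W x \<le> w\<^sub>0"
    and W_lipschitz: "L-lipschitz_on UNIV W"
    and W_support: "x \<notin> {-pi<..pi} \<Longrightarrow> W x = 0"
    and W_integral: "(LBINT x:{-pi..pi}. W x) = 2 * pi"
begin

lemma w0_nonneg: "w\<^sub>0 \<ge> 0"
  using W_nonneg W_le order_trans by blast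

lemma L_nonneg: "L \<ge> 0"
  using W_lipschitz by (simp add: lipschitz_on_def)

lemma continuous_W: "continuous_on A W"
  using lipschitz_on_continuous_on[OF W_lipschitz] continuous_on_subset by blast

lemma W_diff: "\<bar>W x - W y\<bar> \<le> L * \<bar>x - y\<bar>"
  using lipschitz_onD[OF W_lipschitz, of x y] by (simp add: dist_real_def)

lemma taper_nonneg: "b > 0 \<Longrightarrow> taper W b T \<xi> t \<ge> 0"
  by (simp add: taper_def W_nonneg)

lemma card_taper_support:
  assumes "b > 0" "T > 0"
  shows "real (card {t \<in> freqs T. taper W b T \<xi> t \<noteq> 0}) \<le> b * real T + 1"
proof -
  have "{t \<in> freqs T. taper W b T \<xi> t \<noteq> 0} \<subseteq>
    {t \<in> freqs T. -pi \<le> (\<xi> - fourier_freq T t) / b \<and> (\<xi> - fourier_freq T t) / b \<le> pi}"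
  proof
    fix t assume t: "t \<in> {t \<in> freqs T. taper W b T \<xi> t \<noteq> 0}"
    then have "(\<xi> - fourier_freq T t) / b \<in> {-pi<..pi}"
      using W_support[of "(\<xi> - fourier_freq T t) / b"] by (auto simp: taper_def)
    then show "t \<in> {t \<in> freqs T. -pi \<le> (\<xi> - fourier_freq T t) / b \<and> (\<xi> - fourier_freq T t) / b \<le> pi}"
      using t by simp
  qed
  then have "card {t \<in> freqs T. taper W b T \<xi> t \<noteq> 0} \<le> card {t \<in> freqs T. -pi \<le> (\<xi> - fourier_freq T t) / b \<and> (\<xi> - fourier_freq T t) / b \<le> pi}"
    by (intro card_mono) auto
  then have "real (card {t \<in> freqs T. taper W b T \<xi> t \<noteq> 0}) \<le> real (card {t \<in> freqs T. -pi \<le> (\<xi> - fourier_freq T t) / b \<and> (\<xi> - fourier_freq T t) / b \<le> pi})"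
    by simp
  also have "\<dots> \<le> (pi - (- pi)) * (b * real T) / (2 * pi) + 1"
    by (rule card_grid_le) (use assms in auto)
  finally show ?thesis by simp
qed

text \<open>At most \<open>b * T + 1\<close> weights are nonzero and each is at most
  \<open>w\<^sub>0 / (b * T)\<close>. The factor 2 absorbs the additional grid point, as
  \<open>b * T \<ge> 1\<close>.\<close>

lemma sum_taper_power_le:
  assumes b: "b > 0" and T: "T > 0" and bT: "b * real T \<ge> 1" and p: "p > 0"
  shows "(\<Sum>t\<in>freqs T. taper W b T \<xi> t ^ p) \<le> 2 * w\<^sub>0 ^ p * (b * real T) / (b * real T) ^ p"
proof -
  let ?S = "{t \<in> freqs T. taper W b T \<xi> t \<noteq> 0}"
  have "(\<Sum>t\<in>freqs T. taper W b T \<xi> t ^ p) = (\<Sum>t\<in>?S. taper W b T \<xi> t ^ p)"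
    using p by (intro sum.mono_neutral_right) auto
  also have "\<dots> \<le> (\<Sum>t\<in>?S. (w\<^sub>0 / (b * real T)) ^ p)"
    using b T by (intro sum_mono power_mono taper_nonneg) (auto simp: taper_def intro!: divide_right_mono W_le)
  also have "\<dots> = real (card ?S) * (w\<^sub>0 / (b * real T)) ^ p" by simp
  also have "\<dots> \<le> (b * real T + 1) * (w\<^sub>0 / (b * real T)) ^ p"
    using b T w0_nonneg by (intro mult_right_mono card_taper_support) auto
  also have "\<dots> \<le> (2 * (b * real T)) * (w\<^sub>0 / (b * real T)) ^ p"
    using b T bT w0_nonneg by (intro mult_right_mono) auto
  finally show ?thesis by (simp add: power_divide mult_ac)
qed

lemma sum_taper_le: "b > 0 \<Longrightarrow> T > 0 \<Longrightarrow> b * real T \<ge> 1 \<Longrightarrow> (\<Sum>t\<in>freqs T. taper W b T \<xi> t) \<le> 2 * w\<^sub>0"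
  using sum_taper_power_le[of b T 1 \<xi>] by simp

lemma norm_lag_weight_le:
  assumes "b > 0" "T > 0" "b * real T \<ge> 1"
  shows "cmod (lag_weight W b T \<xi> h) \<le> 2 * w\<^sub>0"
proof -
  have "cmod (lag_weight W b T \<xi> h) \<le> (\<Sum>t\<in>freqs T. taper W b T \<xi> t)"
    unfolding lag_weight_def
    by (rule order_trans[OF norm_sum]) (use taper_nonneg[OF assms(1)] in \<open>simp add: abs_of_nonneg\<close>)
  then show ?thesis using sum_taper_le[OF assms, of \<xi>] by simp
qed

text \<open>Divided by \<open>(2 * pi * T)\<^sup>2\<close> this is of order
  \<open>1 / (b * T)\<close>, the order of the variance bound for the spectral estimator.\<close>

lemma sum_lag_weight_sq_le:
  assumes "b > 0" "T > 0" "b * real T \<ge> 1"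
  shows "(\<Sum>s1=1..int T. \<Sum>s2=1..int T. (cmod (lag_weight W b T \<xi> (s1 - s2)))\<^sup>2) \<le> 2 * w\<^sub>0\<^sup>2 * (real T)\<^sup>2 / (b * real T)"
proof -
  have "(\<Sum>t\<in>freqs T. (taper W b T \<xi> t)\<^sup>2) \<le> 2 * w\<^sub>0\<^sup>2 * (b * real T) / (b * real T)\<^sup>2"
    using sum_taper_power_le[OF assms, of 2] by simp
  also have "\<dots> = 2 * w\<^sub>0\<^sup>2 / (b * real T)" using assms by (simp add: power2_eq_square)
  finally have "(real T)\<^sup>2 * (\<Sum>t\<in>freqs T. (taper W b T \<xi> t)\<^sup>2) \<le> (real T)\<^sup>2 * (2 * w\<^sub>0\<^sup>2 / (b * real T))"
    by (intro mult_left_mono) auto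
  then show ?thesis unfolding lag_weight_Parseval[OF assms(2)] by (simp add: mult_ac)
qed

text \<open>The weights form a Riemann sum of mesh \<open>m\<close> for the integral of
  \<open>W / (2 * pi)\<close>. On each cell the Lipschitz condition costs
  \<open>L * m\<^sup>2\<close>, and only cells meeting the support count. The assumptions
  \<open>left\<close> and \<open>right\<close> say that the Fourier frequencies cover the whole
  support of the shifted window.\<close>

lemma sum_taper_Riemann:
  assumes b: "b > 0" and T: "T > 0"
    and left: "(\<xi> - fourier_freq T ((int T - 1) div 2)) / b \<le> - pi"
    and right: "(\<xi> - fourier_freq T (- ((int T - 1) div 2) - 1)) / b \<ge> pi"
  defines "m \<equiv> 2 * pi / (b * real T)"
  shows "\<bar>(\<Sum>t\<in>freqs T. taper W b T \<xi> t) - 1\<bar> \<le> L * m * (2 * pi + 2 * m) / (2 * pi)"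
proof -
  define u where "u t = (\<xi> - fourier_freq T t) / b" for t
  define N where "N = (int T - 1) div 2"
  have N0: "N \<ge> 0" using T by (simp add: N_def)
  have m: "m > 0" using b T by (simp add: m_def)
  \<comment> \<open>The grid runs downwards as \<open>t\<close> grows, so the cell belonging to
    \<open>t\<close> reaches from \<open>u t\<close> up to \<open>u (t - 1)\<close>.\<close>
  have step: "u (t - 1) = u t + m" for t
    using b T by (simp add: u_def m_def fourier_freq_def field_simps)
  \<comment> \<open>With an antiderivative, integrals over cells become increments that telescope,
    and the mean value theorem replaces integral estimates. \<open>G\<close> is constant to the left
    of \<open>-pi\<close> and to the right of \<open>pi\<close>.\<close>
  obtain G where G: "\<And>x. (G has_real_derivative W x) (at x)"
  proof -
    have "\<exists>F. \<forall>x :: real. -\<infinity> < ereal x \<longrightarrow> ereal x < \<infinity> \<longrightarrow> (F has_vector_derivative W x) (at x)"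
      by (rule einterval_antiderivative) (use continuous_W[of UNIV] in \<open>auto simp: continuous_on_eq_continuous_at\<close>)
    then show ?thesis using that by (auto simp: has_real_derivative_iff_has_vector_derivative)
  qed
  have mvt: "\<exists>z. x < z \<and> z < y \<and> G y - G x = (y - x) * W z" if "x < y" for x y
    using MVT2[OF that, of G W] G by blast
  have hi: "G x = G pi" if "x \<ge> pi" for x
  proof (cases "x = pi")
    case False
    then obtain z where "pi < z" "G x - G pi = (x - pi) * W z" using mvt[of pi x] \<open>x \<ge> pi\<close> by auto
    then show ?thesis using W_support[of z] by simp
  qed simp
  have lo: "G x = G (-pi)" if "x \<le> -pi" for x
  proof (cases "x = -pi")
    case False
    then obtain z where "z < -pi" "G (-pi) - G x = (-pi - x) * W z" using mvt[of x "-pi"] \<open>x \<le> -pi\<close> by auto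
    then show ?thesis using W_support[of z] by simp
  qed simp
  have tot: "G pi - G (-pi) = 2 * pi"
  proof -
    have "(LBINT x:{-pi..pi}. W x) = G pi - G (-pi)"
      unfolding set_lebesgue_integral_def
    proof (rule integral_FTC_atLeastAtMost)
      show "(G has_vector_derivative W x) (at x within {-pi..pi})" for x
        using has_field_derivative_at_within[OF G[of x]] by (simp add: has_real_derivative_iff_has_vector_derivative)
    qed (simp_all add: continuous_W)
    then show ?thesis using W_integral by simp
  qed
  have tele: "(\<Sum>t\<in>{a..c}. G (u (t - 1)) - G (u t)) = G (u (a - 1)) - G (u c)" if "a - 1 \<le> c" for a c
    using that
  proof (induction c rule: int_ge_induct)
    case base then show ?case by simp
  next
    case (step i)
    have "{a..i + 1} = insert (i + 1) {a..i}" using step.hyps by auto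
    then show ?case using step by simp
  qed
  have "(\<Sum>t\<in>freqs T. G (u (t - 1)) - G (u t)) = G (u (- N - 1)) - G (u N)"
    unfolding freqs_def N_def[symmetric] using N0 by (intro tele) auto
  also have "\<dots> = 2 * pi"
    using hi[of "u (- N - 1)"] lo[of "u N"] tot left right by (simp add: u_def N_def)
  finally have G2pi: "(\<Sum>t\<in>freqs T. G (u (t - 1)) - G (u t)) = 2 * pi" .
  \<comment> \<open>The range starts at \<open>-pi - m\<close> because a cell whose left end lies
    below \<open>-pi\<close> may still reach into the support.\<close>
  have err: "\<bar>G (u (t - 1)) - G (u t) - m * W (u t)\<bar> \<le> (if -pi - m \<le> u t \<and> u t \<le> pi then L * m\<^sup>2 else 0)" for t
  proof -
    obtain z where z: "u t < z" "z < u t + m" "G (u t + m) - G (u t) = m * W z"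
      using mvt[of "u t" "u t + m"] m by auto
    then have eq: "G (u (t - 1)) - G (u t) - m * W (u t) = m * (W z - W (u t))"
      unfolding step by (simp add: right_diff_distrib)
    show ?thesis
    proof (cases "-pi - m \<le> u t \<and> u t \<le> pi")
      case True
      have "\<bar>W z - W (u t)\<bar> \<le> L * \<bar>z - u t\<bar>" by (rule W_diff)
      also have "\<dots> \<le> L * m" using z L_nonneg by (intro mult_left_mono) auto
      finally have "m * \<bar>W z - W (u t)\<bar> \<le> m * (L * m)" using m by (intro mult_left_mono) auto
      then show ?thesis using True m unfolding eq by (simp add: abs_mult power2_eq_square mult_ac)
    next
      case False
      then have "W z = 0" "W (u t) = 0" using z m by (auto intro!: W_support)
      then have "G (u (t - 1)) - G (u t) - m * W (u t) = 0" unfolding eq by simp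
      then show ?thesis using False by (simp only: abs_zero if_False)
    qed
  qed
  let ?Q = "{t \<in> freqs T. -pi - m \<le> u t \<and> u t \<le> pi}"
  have "\<bar>(\<Sum>t\<in>freqs T. m * W (u t)) - 2 * pi\<bar> = \<bar>\<Sum>t\<in>freqs T. G (u (t - 1)) - G (u t) - m * W (u t)\<bar>"
    unfolding sum_subtractf[of _ "\<lambda>t. m * W (u t)"] G2pi by (rule abs_minus_commute)
  also have "\<dots> \<le> (\<Sum>t\<in>freqs T. if -pi - m \<le> u t \<and> u t \<le> pi then L * m\<^sup>2 else 0)"
    by (rule order_trans[OF sum_abs]) (intro sum_mono err)
  also have "\<dots> = real (card ?Q) * (L * m\<^sup>2)" by (simp add: sum.inter_filter[symmetric])
  also have "\<dots> \<le> ((pi - (- pi - m)) * (b * real T) / (2 * pi) + 1) * (L * m\<^sup>2)"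
  proof (intro mult_right_mono)
    have "- pi - m \<le> pi" using m pi_gt_zero by linarith
    then show "real (card ?Q) \<le> (pi - (- pi - m)) * (b * real T) / (2 * pi) + 1"
      unfolding u_def by (intro card_grid_le b T)
  qed (use L_nonneg in simp)
  also have "\<dots> = L * m * (2 * pi + 2 * m)"
  proof -
    have "b * real T = 2 * pi / m" using b T by (simp add: m_def)
    then have "(pi - (- pi - m)) * (b * real T) / (2 * pi) + 1 = (2 * pi + m) / m + 1" by simp
    then show ?thesis using m by (simp add: field_simps power2_eq_square)
  qed
  finally have *: "\<bar>(\<Sum>t\<in>freqs T. m * W (u t)) - 2 * pi\<bar> \<le> L * m * (2 * pi + 2 * m)" .
  have "m * W (u t) = 2 * pi * taper W b T \<xi> t" for t
    by (simp add: m_def taper_def u_def)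
  then have "(\<Sum>t\<in>freqs T. m * W (u t)) - 2 * pi = 2 * pi * ((\<Sum>t\<in>freqs T. taper W b T \<xi> t) - 1)"
    by (simp add: sum_distrib_left right_diff_distrib)
  with * have "2 * pi * \<bar>(\<Sum>t\<in>freqs T. taper W b T \<xi> t) - 1\<bar> \<le> L * m * (2 * pi + 2 * m)"
    by (simp add: abs_mult)
  then show ?thesis by (simp add: field_simps)
qed

lemma norm_cis_diff_le: "cmod (cis x - cis y) \<le> \<bar>x - y\<bar>"
proof -
  have "cmod (cis x - cis y) = cmod (cis y * (cis (x - y) - 1))"
    by (simp add: right_diff_distrib cis_mult)
  also have "\<dots> = cmod (cis (x - y) - 1)" by (simp add: norm_mult)
  also have "\<dots> \<le> \<bar>x - y\<bar>"
    using iexp_approx1[of "x - y" 0] by (simp add: cis_conv_exp)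
  finally show ?thesis .
qed

text \<open>The total weight tends to 1, and every frequency of nonzero weight is within
  \<open>pi * b\<close> of \<open>\<xi>\<close>, so replacing its phase by that of
  \<open>\<xi>\<close> costs at most \<open>pi * b * \<bar>h\<bar>\<close>. The frequency is
  interior so that eventually the whole window is covered by Fourier frequencies.\<close>

lemma lag_weight_tendsto:
  assumes \<xi>: "-pi < \<xi>" "\<xi> < pi" and b0: "b \<longlonglongrightarrow> 0" and bpos: "eventually (\<lambda>T. b T > 0) sequentially"
    and bT: "filterlim (\<lambda>T. b T * real T) at_top sequentially"
  shows "(\<lambda>T. lag_weight W (b T) T \<xi> h) \<longlonglongrightarrow> cis (- \<xi> * of_int h)"
proof -
  define m where "m T = 2 * pi / (b T * real T)" for T
  have m0: "m \<longlonglongrightarrow> 0"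
    unfolding m_def by (rule real_tendsto_divide_at_top[OF tendsto_const bT])
  have big: "eventually (\<lambda>T. b T * real T \<ge> 1) sequentially"
    using bT by (simp add: filterlim_at_top)
  define S where "S T = (\<Sum>t\<in>freqs T. taper W (b T) T \<xi> t)" for T
  have left: "eventually (\<lambda>T. (\<xi> - fourier_freq T ((int T - 1) div 2)) / b T \<le> - pi) sequentially"
  proof -
    have "(\<lambda>T. \<xi> - pi + 2 * pi / real T + pi * b T) \<longlonglongrightarrow> \<xi> - pi + 0 + pi * 0"
      by (intro tendsto_intros b0 lim_const_over_n)
    then have "eventually (\<lambda>T. \<xi> - pi + 2 * pi / real T + pi * b T < 0) sequentially"
      using \<xi> by (intro order_tendstoD(2)[where y = "\<xi> - pi + 0 + pi * 0"]) auto
    with bpos eventually_gt_at_top[of 0] show ?thesis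
    proof eventually_elim
      case (elim T)
      \<comment> \<open>The integer quotient loses at most 1/2, so the largest Fourier frequency is
        at least \<open>pi - 2 * pi / T\<close>.\<close>
      have "int T - 2 \<le> 2 * ((int T - 1) div 2)" by linarith
      then have "real_of_int (int T - 2) \<le> real_of_int (2 * ((int T - 1) div 2))" by (simp only: of_int_le_iff)
      then have "real_of_int ((int T - 1) div 2) \<ge> (real T - 2) / 2" by simp
      then have "fourier_freq T ((int T - 1) div 2) \<ge> 2 * pi * ((real T - 2) / 2) / real T"
        unfolding fourier_freq_def using elim by (intro divide_right_mono mult_left_mono) auto
      also have "2 * pi * ((real T - 2) / 2) / real T = pi - 2 * pi / real T"
        using elim by (simp add: field_simps)
      finally show ?case using elim by (simp add: pos_divide_le_eq)
    qed
  qed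
  have right: "eventually (\<lambda>T. (\<xi> - fourier_freq T (- ((int T - 1) div 2) - 1)) / b T \<ge> pi) sequentially"
  proof -
    have "(\<lambda>T. \<xi> + pi - pi * b T) \<longlonglongrightarrow> \<xi> + pi - pi * 0"
      by (intro tendsto_intros b0)
    then have "eventually (\<lambda>T. \<xi> + pi - pi * b T > 0) sequentially"
      using \<xi> by (intro order_tendstoD(1)[where y = "\<xi> + pi - pi * 0"]) auto
    with bpos eventually_gt_at_top[of 0] show ?thesis
    proof eventually_elim
      case (elim T)
      have "int T - 2 \<le> 2 * ((int T - 1) div 2)" by linarith
      then have "2 * (- ((int T - 1) div 2) - 1) \<le> - int T" by simp
      then have "real_of_int (2 * (- ((int T - 1) div 2) - 1)) \<le> real_of_int (- int T)" by (simp only: of_int_le_iff)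
      then have "real_of_int (- ((int T - 1) div 2) - 1) \<le> - (real T / 2)" by simp
      then have "fourier_freq T (- ((int T - 1) div 2) - 1) \<le> 2 * pi * (- (real T / 2)) / real T"
        unfolding fourier_freq_def using elim by (intro divide_right_mono mult_left_mono) auto
      also have "2 * pi * (- (real T / 2)) / real T = - pi" using elim by simp
      finally show ?case using elim by (simp add: pos_le_divide_eq)
    qed
  qed
  have S1: "S \<longlonglongrightarrow> 1"
  proof (rule LIM_zero_cancel, rule Lim_null_comparison)
    show "eventually (\<lambda>T. norm (S T - 1) \<le> L * m T * (2 * pi + 2 * m T) / (2 * pi)) sequentially"
      using left right bpos eventually_gt_at_top[of 0]
      by eventually_elim (simp only: S_def m_def real_norm_def, rule sum_taper_Riemann)
    have "(\<lambda>T. L * m T * (2 * pi + 2 * m T) / (2 * pi)) \<longlonglongrightarrow> L * 0 * (2 * pi + 2 * 0) / (2 * pi)"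
      by (intro tendsto_intros m0) auto
    then show "(\<lambda>T. L * m T * (2 * pi + 2 * m T) / (2 * pi)) \<longlonglongrightarrow> 0" by simp
  qed
  have diff: "(\<lambda>T. lag_weight W (b T) T \<xi> h - S T *\<^sub>R cis (- \<xi> * of_int h)) \<longlonglongrightarrow> 0"
  proof (rule Lim_null_comparison)
    show "eventually (\<lambda>T. norm (lag_weight W (b T) T \<xi> h - S T *\<^sub>R cis (- \<xi> * of_int h)) \<le> 2 * w\<^sub>0 * (pi * b T * \<bar>of_int h\<bar>)) sequentially"
      using bpos big eventually_gt_at_top[of 0]
    proof eventually_elim
      case (elim T)
      let ?w = "taper W (b T) T \<xi>" and ?f = "fourier_freq T"
      have "lag_weight W (b T) T \<xi> h - S T *\<^sub>R cis (- \<xi> * of_int h) = (\<Sum>t\<in>freqs T. ?w t *\<^sub>R (cis (- ?f t * of_int h) - cis (- \<xi> * of_int h)))"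
        by (simp add: lag_weight_def S_def scaleR_sum_left scaleR_diff_right sum_subtractf)
      also have "norm \<dots> \<le> (\<Sum>t\<in>freqs T. ?w t * (pi * b T * \<bar>of_int h\<bar>))"
      proof (rule order_trans[OF norm_sum], rule sum_mono)
        fix t
        show "norm (?w t *\<^sub>R (cis (- ?f t * of_int h) - cis (- \<xi> * of_int h))) \<le> ?w t * (pi * b T * \<bar>of_int h\<bar>)"
        proof (cases "?w t = 0")
          case False
          then have "(\<xi> - ?f t) / b T \<in> {-pi<..pi}" using W_support[of "(\<xi> - ?f t) / b T"] by (auto simp: taper_def)
          then have "\<bar>\<xi> - ?f t\<bar> \<le> pi * b T" using elim by (auto simp: field_simps abs_le_iff)
          have "cmod (cis (- ?f t * of_int h) - cis (- \<xi> * of_int h)) \<le> \<bar>- ?f t * of_int h - (- \<xi> * of_int h)\<bar>"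
            by (rule norm_cis_diff_le)
          also have "\<dots> = \<bar>\<xi> - ?f t\<bar> * \<bar>of_int h\<bar>" by (simp add: abs_mult[symmetric] algebra_simps)
          also have "\<dots> \<le> pi * b T * \<bar>of_int h\<bar>" by (intro mult_right_mono) (fact, simp)
          finally show ?thesis using taper_nonneg[of "b T" T \<xi> t] elim by (simp add: mult_left_mono)
        qed simp
      qed
      also have "\<dots> \<le> 2 * w\<^sub>0 * (pi * b T * \<bar>of_int h\<bar>)"
        unfolding sum_distrib_right[symmetric] using elim by (intro mult_right_mono sum_taper_le) auto
      finally show ?case .
    qed
    have "(\<lambda>T. 2 * w\<^sub>0 * (pi * b T * \<bar>of_int h\<bar>)) \<longlonglongrightarrow> 2 * w\<^sub>0 * (pi * 0 * \<bar>of_int h\<bar>)"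
      by (intro tendsto_intros b0)
    then show "(\<lambda>T. 2 * w\<^sub>0 * (pi * b T * \<bar>of_int h\<bar>)) \<longlonglongrightarrow> 0" by simp
  qed
  have "(\<lambda>T. (lag_weight W (b T) T \<xi> h - S T *\<^sub>R cis (- \<xi> * of_int h)) + S T *\<^sub>R cis (- \<xi> * of_int h)) \<longlonglongrightarrow> 0 + 1 *\<^sub>R cis (- \<xi> * of_int h)"
    by (intro tendsto_add diff tendsto_scaleR S1 tendsto_const)
  then show ?thesis by simp
qed

end

section \<open>Linear processes\<close>

lemma (in prob_space) expectation_norm_le_sqrt:
  assumes "all_moments f"
  shows "expectation (\<lambda>\<omega>. norm (f \<omega>)) \<le> sqrt (expectation (\<lambda>\<omega>. (norm (f \<omega>))\<^sup>2))"
proof (rule real_le_rsqrt)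
  let ?m = "expectation (\<lambda>\<omega>. norm (f \<omega>))"
  have i: "integrable M (\<lambda>\<omega>. norm (f \<omega>))" "integrable M (\<lambda>\<omega>. (norm (f \<omega>))\<^sup>2)"
    using all_moments_power[OF assms, of 1] all_moments_power[OF assms, of 2] by simp_all
  have "0 \<le> expectation (\<lambda>\<omega>. (norm (f \<omega>) - ?m)\<^sup>2)" by (rule integral_nonneg_AE) simp
  also have "\<dots> = expectation (\<lambda>\<omega>. (norm (f \<omega>))\<^sup>2 - 2 * ?m * norm (f \<omega>) + ?m\<^sup>2)"
    by (simp add: power2_diff algebra_simps)
  also have "\<dots> = expectation (\<lambda>\<omega>. (norm (f \<omega>))\<^sup>2) - 2 * ?m * ?m + ?m\<^sup>2"
    using i by (simp add: prob_space)
  finally show "?m\<^sup>2 \<le> expectation (\<lambda>\<omega>. (norm (f \<omega>))\<^sup>2)" by (simp add: power2_eq_square)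
qed

definition quadratic :: "(int \<Rightarrow> int \<Rightarrow> complex) \<Rightarrow> int set \<Rightarrow> (int \<Rightarrow> real_L2) \<Rightarrow> kernel_L2" where
  "quadratic c S x = (\<Sum>s\<in>S. \<Sum>t\<in>S. cmul (c s t) (tens (x s) (x t)))"

locale linear_gaussian = gaussian_noise M \<epsilon> for M :: "'w measure" and \<epsilon> :: "int \<Rightarrow> 'w \<Rightarrow> real_L2" +
  fixes A :: "int \<Rightarrow> real_L2 \<Rightarrow>\<^sub>L real_L2" and X :: "int \<Rightarrow> 'w \<Rightarrow> real_L2"
  assumes A_summable: "(\<lambda>j. norm (A j)) summable_on UNIV"
    and X_measurable [measurable]: "X t \<in> borel_measurable M"
    and X_sum: "AE \<omega> in M. ((\<lambda>j. blinfun_apply (A j) (\<epsilon> (t - j) \<omega>)) has_sum X t \<omega>) UNIV"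
begin

section \<open>Truncations of the process and their moments\<close>

definition \<alpha> :: real where "\<alpha> = (\<Sum>\<^sub>\<infinity>j\<in>UNIV. norm (A j))"

definition window :: "nat \<Rightarrow> int set" where "window m = {- int m..int m}"

lemma finite_window [simp]: "finite (window m)" by (simp add: window_def)

lemma window_mono: "m \<le> n \<Longrightarrow> window m \<subseteq> window n" by (auto simp: window_def)

text \<open>Turns the unordered sum defining the process into a limit along a sequence, the form
  needed for dominated convergence.\<close>

lemma window_at_top: "filterlim window (finite_subsets_at_top UNIV) sequentially"
  unfolding filterlim_finite_subsets_at_top
proof (intro allI impI)
  fix F :: "int set" assume F: "finite F \<and> F \<subseteq> UNIV"
  then obtain n where n: "\<And>j. j \<in> F \<Longrightarrow> nat \<bar>j\<bar> \<le> n"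
    using finite_nat_set_iff_bounded_le[of "(\<lambda>j. nat \<bar>j\<bar>) ` F"] by auto
  show "\<forall>\<^sub>F m in sequentially. finite (window m) \<and> F \<subseteq> window m \<and> window m \<subseteq> UNIV"
    using eventually_ge_at_top[of n]
  proof eventually_elim
    case (elim m)
    have "j \<in> window m" if "j \<in> F" for j using n[OF that] elim by (auto simp: window_def)
    then show ?case by auto
  qed
qed

lemma sum_A_le: "finite F \<Longrightarrow> (\<Sum>j\<in>F. norm (A j)) \<le> \<alpha>"
  unfolding \<alpha>_def by (rule finite_sum_le_infsum[OF A_summable]) auto

lemma \<alpha>_nonneg: "\<alpha> \<ge> 0"
  using sum_A_le[of "{}"] by simp

definition truncated :: "nat \<Rightarrow> int \<Rightarrow> 'w \<Rightarrow> real_L2" where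
  "truncated m t \<omega> = (\<Sum>j\<in>window m. blinfun_apply (A j) (\<epsilon> (t - j) \<omega>))"

definition partial_envelope :: "nat \<Rightarrow> int \<Rightarrow> 'w \<Rightarrow> real" where
  "partial_envelope m t \<omega> = (\<Sum>j\<in>window m. norm (A j) * norm (\<epsilon> (t - j) \<omega>))"

lemma measurable_partial_envelope [measurable]: "partial_envelope m t \<in> borel_measurable M"
  unfolding partial_envelope_def by measurable

text \<open>Dominates all truncations at once. A supremum of extended reals is measurable without
  knowing that it is finite; finiteness almost everywhere is proved afterwards, and
  \<open>enn2real\<close> sets the exceptional values to 0.\<close>

definition envelope :: "int \<Rightarrow> 'w \<Rightarrow> real" where
  "envelope t \<omega> = enn2real (SUP m. ennreal (partial_envelope m t \<omega>))"

lemma truncated_tendsto: "AE \<omega> in M. (\<lambda>m. truncated m t \<omega>) \<longlonglongrightarrow> X t \<omega>"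
  using X_sum[of t] by eventually_elim (auto simp: has_sum_def truncated_def intro: filterlim_compose[OF _ window_at_top])

lemma all_moments_truncated: "all_moments (truncated m t)"
  unfolding truncated_def by (intro all_moments_sum all_moments_blinfun_noise) simp

lemma measurable_envelope [measurable]: "envelope t \<in> borel_measurable M"
  unfolding envelope_def by measurable

lemma partial_envelope_nonneg: "partial_envelope m t \<omega> \<ge> 0"
  by (simp add: partial_envelope_def sum_nonneg)

lemma partial_envelope_mono: "m \<le> n \<Longrightarrow> partial_envelope m t \<omega> \<le> partial_envelope n t \<omega>"
  unfolding partial_envelope_def using window_mono by (intro sum_mono2) auto

text \<open>Weighted power mean with weights \<open>norm (A j)\<close>, whose total is at most
  \<open>\<alpha>\<close>; hence the bound does not depend on \<open>m\<close>.\<close>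

lemma partial_envelope_moment:
  "(\<integral>\<^sup>+\<omega>. ennreal (partial_envelope m t \<omega> ^ (2 * Suc p)) \<partial>M)
     \<le> ennreal (\<alpha> ^ (2 * Suc p) * (normal_moment (Suc p) * noise_trace ^ Suc p))"
proof -
  let ?c = "normal_moment (Suc p) * noise_trace ^ Suc p"
  let ?h = "\<lambda>\<omega>. (\<Sum>j\<in>window m. norm (A j)) ^ (2 * p + 1) * (\<Sum>j\<in>window m. norm (A j) * norm (\<epsilon> (t - j) \<omega>) ^ (2 * Suc p))"
  have Suc2: "Suc (2 * p + 1) = 2 * Suc p" by simp
  have i: "integrable M (\<lambda>\<omega>. norm (\<epsilon> s \<omega>) ^ (2 * Suc p))" for s
    by (rule all_moments_power[OF all_moments_noise])
  have hi: "integrable M ?h"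
    by (intro integrable_mult_right Bochner_Integration.integrable_sum i)
  have h0: "?h \<omega> \<ge> 0" for \<omega> by (intro mult_nonneg_nonneg zero_le_power sum_nonneg) auto
  have "(\<integral>\<^sup>+\<omega>. ennreal (partial_envelope m t \<omega> ^ (2 * Suc p)) \<partial>M) \<le> (\<integral>\<^sup>+\<omega>. ennreal (?h \<omega>) \<partial>M)"
    unfolding partial_envelope_def
    by (intro nn_integral_mono ennreal_leI weighted_power_mean[where p = "2 * p + 1", unfolded Suc2]) auto
  also have "\<dots> = ennreal (expectation ?h)"
    by (rule nn_integral_eq_integral[OF hi]) (use h0 in auto)
  also have "\<dots> \<le> ennreal (\<alpha> ^ (2 * Suc p) * ?c)"
  proof (rule ennreal_leI)
    have c0: "?c \<ge> 0" using noise_trace_nonneg by simp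
    have "expectation ?h = (\<Sum>j\<in>window m. norm (A j)) ^ (2 * p + 1) * (\<Sum>j\<in>window m. norm (A j) * expectation (\<lambda>\<omega>. norm (\<epsilon> (t - j) \<omega>) ^ (2 * Suc p)))"
      using i by (subst integral_mult_right_zero, subst Bochner_Integration.integral_sum) auto
    also have "\<dots> \<le> (\<Sum>j\<in>window m. norm (A j)) ^ (2 * p + 1) * (\<Sum>j\<in>window m. norm (A j) * ?c)"
      by (intro mult_left_mono sum_mono noise_moment_le zero_le_power[OF sum_nonneg]) auto
    also have "\<dots> = (\<Sum>j\<in>window m. norm (A j)) ^ (2 * Suc p) * ?c"
      by (simp add: sum_distrib_right[symmetric])
    also have "\<dots> \<le> \<alpha> ^ (2 * Suc p) * ?c"
      by (intro mult_right_mono power_mono sum_A_le sum_nonneg c0) auto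
    finally show "expectation ?h \<le> \<alpha> ^ (2 * Suc p) * ?c" .
  qed
  finally show ?thesis .
qed

text \<open>Monotone convergence reduces finiteness to a uniform first moment, which is bounded
  through the second one by \<open>x \<le> 1 + x\<^sup>2\<close>.\<close>

lemma envelope_sup_finite: "AE \<omega> in M. (SUP m. ennreal (partial_envelope m t \<omega>)) \<noteq> \<infinity>"
proof (rule nn_integral_PInf_AE)
  let ?B = "1 + ennreal (\<alpha> ^ (2 * Suc 0) * (normal_moment (Suc 0) * noise_trace ^ Suc 0))"
  have "(\<integral>\<^sup>+\<omega>. (SUP m. ennreal (partial_envelope m t \<omega>)) \<partial>M) = (SUP m. \<integral>\<^sup>+\<omega>. ennreal (partial_envelope m t \<omega>) \<partial>M)"
    by (rule nn_integral_monotone_convergence_SUP)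
      (auto simp: incseq_def le_fun_def intro!: ennreal_leI partial_envelope_mono)
  also have "\<dots> \<le> ?B"
  proof (rule SUP_least)
    fix m
    have le: "x \<le> 1 + x ^ (2 * Suc 0)" for x :: real
      using zero_le_power2[of "x - 1/2"] by (simp add: power2_eq_square algebra_simps)
    have "(\<integral>\<^sup>+\<omega>. ennreal (partial_envelope m t \<omega>) \<partial>M) \<le> (\<integral>\<^sup>+\<omega>. 1 + ennreal (partial_envelope m t \<omega> ^ (2 * Suc 0)) \<partial>M)"
      using le by (intro nn_integral_mono) (simp add: ennreal_leI flip: ennreal_1 ennreal_plus)
    also have "\<dots> = 1 + (\<integral>\<^sup>+\<omega>. ennreal (partial_envelope m t \<omega> ^ (2 * Suc 0)) \<partial>M)"
      by (subst nn_integral_add) (auto simp: emeasure_space_1)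
    also have "\<dots> \<le> ?B" by (intro add_left_mono partial_envelope_moment)
    finally show "(\<integral>\<^sup>+\<omega>. ennreal (partial_envelope m t \<omega>) \<partial>M) \<le> ?B" .
  qed
  also have "\<dots> < \<infinity>" by simp
  finally show "(\<integral>\<^sup>+\<omega>. (SUP m. ennreal (partial_envelope m t \<omega>)) \<partial>M) \<noteq> \<infinity>" by simp
qed measurable

lemma partial_envelope_tendsto: "AE \<omega> in M. (\<lambda>m. partial_envelope m t \<omega>) \<longlonglongrightarrow> envelope t \<omega>"
  using envelope_sup_finite[of t]
proof eventually_elim
  case (elim \<omega>)
  have "(\<lambda>m. ennreal (partial_envelope m t \<omega>)) \<longlonglongrightarrow> (SUP m. ennreal (partial_envelope m t \<omega>))"
    by (intro LIMSEQ_SUP) (auto simp: incseq_def intro!: ennreal_leI partial_envelope_mono)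
  also have "(SUP m. ennreal (partial_envelope m t \<omega>)) = ennreal (envelope t \<omega>)"
    using elim unfolding envelope_def by (subst ennreal_enn2real) (simp_all only: less_top infinity_ennreal_def)
  finally show ?case
    by (subst (asm) tendsto_ennreal_iff) (auto simp: envelope_def partial_envelope_nonneg)
qed

text \<open>Fatou's lemma along the partial envelopes, whose even moments are bounded independently
  of \<open>m\<close>.\<close>

lemma all_moments_envelope: "all_moments (envelope t)"
proof (rule all_moments_even[OF measurable_envelope])
  fix p
  show "integrable M (\<lambda>\<omega>. norm (envelope t \<omega>) ^ (2 * p))"
  proof (cases p)
    case (Suc q)
    have "(\<integral>\<^sup>+\<omega>. ennreal (norm (norm (envelope t \<omega>) ^ (2 * p))) \<partial>M) = (\<integral>\<^sup>+\<omega>. liminf (\<lambda>m. ennreal (partial_envelope m t \<omega> ^ (2 * p))) \<partial>M)"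
    proof (rule nn_integral_cong_AE, use partial_envelope_tendsto[of t] in eventually_elim)
      case (elim \<omega>)
      have "(\<lambda>m. ennreal (partial_envelope m t \<omega> ^ (2 * p))) \<longlonglongrightarrow> ennreal (envelope t \<omega> ^ (2 * p))"
        using elim by (intro tendsto_ennrealI tendsto_power)
      then show ?case by (subst lim_imp_Liminf) (auto simp: envelope_def)
    qed
    also have "\<dots> \<le> liminf (\<lambda>m. \<integral>\<^sup>+\<omega>. ennreal (partial_envelope m t \<omega> ^ (2 * p)) \<partial>M)"
      by (rule nn_integral_liminf) measurable
    also have "\<dots> \<le> ennreal (\<alpha> ^ (2 * p) * (normal_moment p * noise_trace ^ p))"
      unfolding Suc by (rule Liminf_le) (auto intro!: always_eventually partial_envelope_moment simp del: mult_Suc_right power_Suc)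
    also have "\<dots> < \<infinity>" by simp
    finally show ?thesis by (intro integrableI_bounded) auto
  qed simp
qed

lemma envelope_nonneg: "envelope t \<omega> \<ge> 0" by (simp add: envelope_def)

lemma partial_envelope_le: "AE \<omega> in M. \<forall>m. partial_envelope m t \<omega> \<le> envelope t \<omega>"
  using partial_envelope_tendsto[of t]
proof eventually_elim
  case (elim \<omega>)
  show ?case using incseq_le[OF _ elim] by (auto simp: incseq_def intro: partial_envelope_mono)
qed

lemma norm_truncated_le: "AE \<omega> in M. \<forall>m. norm (truncated m t \<omega>) \<le> envelope t \<omega>"
  using partial_envelope_le[of t]
proof eventually_elim
  case (elim \<omega>)
  show ?case
  proof
    fix m
    have "norm (truncated m t \<omega>) \<le> (\<Sum>j\<in>window m. norm (A j) * norm (\<epsilon> (t - j) \<omega>))"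
      unfolding truncated_def by (rule order_trans[OF norm_sum]) (intro sum_mono norm_blinfun)
    also have "\<dots> = partial_envelope m t \<omega>" by (simp add: partial_envelope_def)
    also have "\<dots> \<le> envelope t \<omega>" using elim by blast
    finally show "norm (truncated m t \<omega>) \<le> envelope t \<omega>" .
  qed
qed

lemma norm_X_le: "AE \<omega> in M. norm (X t \<omega>) \<le> envelope t \<omega>"
  using norm_truncated_le[of t] truncated_tendsto[of t]
proof eventually_elim
  case (elim \<omega>)
  show ?case by (rule LIMSEQ_le_const2[OF tendsto_norm[OF elim(2)]]) (use elim(1) in blast)
qed

lemma all_moments_X: "all_moments (X t)"
  by (rule all_moments_bound[OF all_moments_envelope[of t] X_measurable])
    (use norm_X_le[of t] envelope_nonneg in \<open>auto elim!: eventually_mono simp: abs_of_nonneg\<close>)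

text \<open>After interchanging sums, the truncated combination is the sum over \<open>j\<close> of
  \<open>A j\<close> applied to a noise combination with shifted times, whose coefficients have the
  same sum of squares. Hence the bound sees only that sum of squares, not the number of terms;
  dominated convergence under the envelopes then removes the truncation.\<close>

lemma linear_combination_moment:
  assumes S: "finite S"
  shows "expectation (\<lambda>\<omega>. norm (\<Sum>s\<in>S. a s *\<^sub>R X s \<omega>) ^ (2 * Suc p))
     \<le> \<alpha> ^ (2 * Suc p) * (normal_moment (Suc p) * (noise_trace * (\<Sum>s\<in>S. (a s)\<^sup>2)) ^ Suc p)"
proof -
  let ?c = "normal_moment (Suc p) * (noise_trace * (\<Sum>s\<in>S. (a s)\<^sup>2)) ^ Suc p"
  define U where "U j \<omega> = norm (\<Sum>s\<in>S. a s *\<^sub>R \<epsilon> (s - j) \<omega>)" for j \<omega>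
  have U: "integrable M (\<lambda>\<omega>. U j \<omega> ^ (2 * Suc p))" "expectation (\<lambda>\<omega>. U j \<omega> ^ (2 * Suc p)) \<le> ?c" for j
  proof -
    let ?S = "(\<lambda>s. s - j) ` S"
    have "(\<Sum>t\<in>?S. a (t + j) *\<^sub>R \<epsilon> t \<omega>) = (\<Sum>s\<in>S. a s *\<^sub>R \<epsilon> (s - j) \<omega>)" for \<omega>
      by (subst sum.reindex) (auto simp: inj_on_def)
    moreover have "(\<Sum>t\<in>?S. (a (t + j))\<^sup>2) = (\<Sum>s\<in>S. (a s)\<^sup>2)"
      by (subst sum.reindex) (auto simp: inj_on_def)
    ultimately show "integrable M (\<lambda>\<omega>. U j \<omega> ^ (2 * Suc p))" "expectation (\<lambda>\<omega>. U j \<omega> ^ (2 * Suc p)) \<le> ?c"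
      using noise_sum_moment[of ?S "\<lambda>t. a (t + j)" "Suc p"] noise_sum_moment_integrable[of ?S "\<lambda>t. a (t + j)" "Suc p"] S
      unfolding U_def by simp_all
  qed
  have c0: "?c \<ge> 0" using noise_trace_nonneg by (simp add: sum_nonneg)
  have trunc: "expectation (\<lambda>\<omega>. norm (\<Sum>s\<in>S. a s *\<^sub>R truncated m s \<omega>) ^ (2 * Suc p)) \<le> \<alpha> ^ (2 * Suc p) * ?c" for m
  proof -
    let ?a = "\<Sum>j\<in>window m. norm (A j)"
    have am: "all_moments (\<lambda>\<omega>. \<Sum>s\<in>S. a s *\<^sub>R truncated m s \<omega>)"
      by (intro all_moments_sum[OF S] all_moments_bounded_linear[OF bounded_linear_scaleR_right] all_moments_truncated)
    have "expectation (\<lambda>\<omega>. norm (\<Sum>s\<in>S. a s *\<^sub>R truncated m s \<omega>) ^ (2 * Suc p))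
      \<le> expectation (\<lambda>\<omega>. ?a ^ (2 * p + 1) * (\<Sum>j\<in>window m. norm (A j) * U j \<omega> ^ (2 * Suc p)))"
    proof (rule integral_mono)
      fix \<omega>
      have "(\<Sum>s\<in>S. a s *\<^sub>R truncated m s \<omega>) = (\<Sum>j\<in>window m. blinfun_apply (A j) (\<Sum>s\<in>S. a s *\<^sub>R \<epsilon> (s - j) \<omega>))"
        unfolding truncated_def scaleR_sum_right blinfun.sum_right blinfun.scaleR_right by (rule sum.swap)
      then have "norm (\<Sum>s\<in>S. a s *\<^sub>R truncated m s \<omega>) \<le> (\<Sum>j\<in>window m. norm (A j) * U j \<omega>)"
        unfolding U_def by (simp only:) (rule order_trans[OF norm_sum], intro sum_mono norm_blinfun)
      then have "norm (\<Sum>s\<in>S. a s *\<^sub>R truncated m s \<omega>) ^ Suc (2 * p + 1) \<le> (\<Sum>j\<in>window m. norm (A j) * U j \<omega>) ^ Suc (2 * p + 1)"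
        by (intro power_mono) auto
      also have "\<dots> \<le> ?a ^ (2 * p + 1) * (\<Sum>j\<in>window m. norm (A j) * U j \<omega> ^ Suc (2 * p + 1))"
        by (rule weighted_power_mean) (auto simp: U_def)
      finally show "norm (\<Sum>s\<in>S. a s *\<^sub>R truncated m s \<omega>) ^ (2 * Suc p) \<le> ?a ^ (2 * p + 1) * (\<Sum>j\<in>window m. norm (A j) * U j \<omega> ^ (2 * Suc p))"
        by simp
    qed (intro all_moments_power am integrable_mult_right Bochner_Integration.integrable_sum U)+
    also have "\<dots> = ?a ^ (2 * p + 1) * (\<Sum>j\<in>window m. norm (A j) * expectation (\<lambda>\<omega>. U j \<omega> ^ (2 * Suc p)))"
      using U(1) by (subst integral_mult_right_zero, subst Bochner_Integration.integral_sum) auto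
    also have "\<dots> \<le> ?a ^ (2 * p + 1) * (\<Sum>j\<in>window m. norm (A j) * ?c)"
      by (intro mult_left_mono sum_mono U zero_le_power[OF sum_nonneg]) auto
    also have "\<dots> = ?a ^ (2 * Suc p) * ?c"
      by (simp add: sum_distrib_right[symmetric])
    also have "\<dots> \<le> \<alpha> ^ (2 * Suc p) * ?c"
      by (intro mult_right_mono power_mono sum_A_le sum_nonneg c0) auto
    finally show ?thesis .
  qed
  have env: "all_moments (\<lambda>\<omega>. \<Sum>s\<in>S. \<bar>a s\<bar> * envelope s \<omega>)"
    by (intro all_moments_sum[OF S] all_moments_mult all_moments_const all_moments_envelope)
  have aeS: "AE \<omega> in M. \<forall>s\<in>S. (\<forall>m. norm (truncated m s \<omega>) \<le> envelope s \<omega>) \<and> (\<lambda>m. truncated m s \<omega>) \<longlonglongrightarrow> X s \<omega>"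
    using norm_truncated_le truncated_tendsto by (intro AE_finite_allI[OF S] AE_conjI) auto
  have [measurable]: "truncated m s \<in> borel_measurable M" for m s by (rule all_moments_measurable[OF all_moments_truncated])
  have "(\<lambda>m. expectation (\<lambda>\<omega>. norm (\<Sum>s\<in>S. a s *\<^sub>R truncated m s \<omega>) ^ (2 * Suc p)))
     \<longlonglongrightarrow> expectation (\<lambda>\<omega>. norm (\<Sum>s\<in>S. a s *\<^sub>R X s \<omega>) ^ (2 * Suc p))"
  proof (rule integral_dominated_convergence[where w = "\<lambda>\<omega>. norm (\<Sum>s\<in>S. \<bar>a s\<bar> * envelope s \<omega>) ^ (2 * Suc p)"])
    show "AE \<omega> in M. (\<lambda>m. norm (\<Sum>s\<in>S. a s *\<^sub>R truncated m s \<omega>) ^ (2 * Suc p)) \<longlonglongrightarrow> norm (\<Sum>s\<in>S. a s *\<^sub>R X s \<omega>) ^ (2 * Suc p)"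
      using aeS by eventually_elim (intro tendsto_power tendsto_norm tendsto_sum tendsto_scaleR tendsto_const, blast)
    show "AE \<omega> in M. norm (norm (\<Sum>s\<in>S. a s *\<^sub>R truncated m s \<omega>) ^ (2 * Suc p)) \<le> norm (\<Sum>s\<in>S. \<bar>a s\<bar> * envelope s \<omega>) ^ (2 * Suc p)" for m
      using aeS
    proof eventually_elim
      case (elim \<omega>)
      have "norm (\<Sum>s\<in>S. a s *\<^sub>R truncated m s \<omega>) \<le> (\<Sum>s\<in>S. \<bar>a s\<bar> * envelope s \<omega>)"
        by (rule order_trans[OF norm_sum]) (use elim in \<open>auto intro!: sum_mono mult_left_mono\<close>)
      then show ?case by (simp only: norm_power real_norm_def power_abs abs_norm_cancel) (intro power_mono, auto)
    qed
  qed (measurable, rule all_moments_power[OF env])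
  then show ?thesis by (rule LIMSEQ_le_const2) (use trunc in blast)
qed

section \<open>Autocovariances and deviations of quadratic forms\<close>

lemma norm_noise_cov_le: "norm (noise_cov B C) \<le> 2 * noise_trace * (norm B * norm C)"
proof (rule power2_le_imp_le)
  have "(norm (noise_cov B C))\<^sup>2 \<le> 3 * noise_trace\<^sup>2 * (norm B * norm C)\<^sup>2"
    using norm_expectation_noise_tensor[of B C 0 0] norm_noise_tensor_sq[of B C 0 0] by (simp add: noise_cov_def)
  \<comment> \<open>The 3 is enlarged to 4 to obtain a perfect square.\<close>
  also have "\<dots> \<le> 4 * noise_trace\<^sup>2 * (norm B * norm C)\<^sup>2" by (intro mult_right_mono) auto
  finally show "(norm (noise_cov B C))\<^sup>2 \<le> (2 * noise_trace * (norm B * norm C))\<^sup>2"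
    by (simp add: power_mult_distrib)
qed (use noise_trace_nonneg in simp)

definition autocov :: "int \<Rightarrow> kernel_L2" where
  "autocov h = expectation (\<lambda>\<omega>. tens (X h \<omega>) (X 0 \<omega>))"

text \<open>The noise times \<open>s - j\<close> and \<open>t - k\<close> coincide exactly when
  \<open>j - k = s - t\<close>, and tensors at different times have mean 0.\<close>

definition truncated_autocov :: "nat \<Rightarrow> int \<Rightarrow> kernel_L2" where
  "truncated_autocov m h = (\<Sum>j\<in>window m. \<Sum>k\<in>window m. if j - k = h then noise_cov (A j) (A k) else 0)"

lemma tens_truncated: "tens (truncated m s \<omega>) (truncated m t \<omega>) = (\<Sum>j\<in>window m. \<Sum>k\<in>window m. noise_tensor (A j) (A k) (s - j) (t - k) \<omega>)"
  unfolding truncated_def noise_tensor_def tens.sum_left unfolding tens.sum_right ..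

lemma expectation_tens_truncated: "expectation (\<lambda>\<omega>. tens (truncated m s \<omega>) (truncated m t \<omega>)) = truncated_autocov m (s - t)"
  unfolding tens_truncated truncated_autocov_def
  by (subst Bochner_Integration.integral_sum, (intro Bochner_Integration.integrable_sum all_moments_integrable[OF all_moments_noise_tensor])?)
    (auto intro!: sum.cong simp: Bochner_Integration.integral_sum all_moments_integrable[OF all_moments_noise_tensor] expectation_noise_tensor)

lemma truncated_autocov_tendsto: "(\<lambda>m. truncated_autocov m (s - t)) \<longlonglongrightarrow> expectation (\<lambda>\<omega>. tens (X s \<omega>) (X t \<omega>))"
  unfolding expectation_tens_truncated[symmetric]
proof (rule integral_dominated_convergence[where w = "\<lambda>\<omega>. envelope s \<omega> * envelope t \<omega>"])
  have [measurable]: "truncated m s \<in> borel_measurable M" for m s by (rule all_moments_measurable[OF all_moments_truncated])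
  show "(\<lambda>\<omega>. tens (X s \<omega>) (X t \<omega>)) \<in> borel_measurable M" by measurable
  show "(\<lambda>\<omega>. tens (truncated m s \<omega>) (truncated m t \<omega>)) \<in> borel_measurable M" for m by measurable
  show "integrable M (\<lambda>\<omega>. envelope s \<omega> * envelope t \<omega>)"
    by (intro all_moments_integrable all_moments_mult all_moments_envelope)
  show "AE \<omega> in M. (\<lambda>m. tens (truncated m s \<omega>) (truncated m t \<omega>)) \<longlonglongrightarrow> tens (X s \<omega>) (X t \<omega>)"
    using truncated_tendsto[of s] truncated_tendsto[of t] by eventually_elim (intro tens.tendsto)
  show "AE \<omega> in M. norm (tens (truncated m s \<omega>) (truncated m t \<omega>)) \<le> envelope s \<omega> * envelope t \<omega>" for m
    using norm_truncated_le[of s] norm_truncated_le[of t]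
    by eventually_elim (auto simp: norm_tens intro!: mult_mono envelope_nonneg)
qed

text \<open>Stationarity: the truncated moments depend on \<open>s\<close> and \<open>t\<close> only
  through \<open>s - t\<close>, and limits are unique.\<close>

lemma autocov_eq: "expectation (\<lambda>\<omega>. tens (X s \<omega>) (X t \<omega>)) = autocov (s - t)"
  using LIMSEQ_unique[OF truncated_autocov_tendsto[of s t] truncated_autocov_tendsto[of "s - t" 0, simplified]]
  by (simp add: autocov_def)

text \<open>For a finite set of lags each pair \<open>(j, k)\<close> of the window is counted at
  most once, so the sum is at most \<open>2 * noise_trace\<close> times the squared sum of the
  operator norms; the bound survives the limit in \<open>m\<close>.\<close>

lemma autocov_summable: "(\<lambda>h. norm (autocov h)) summable_on UNIV"
proof (rule nonneg_bdd_above_summable_on)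
  let ?B = "2 * noise_trace * \<alpha>\<^sup>2"
  have "(\<Sum>h\<in>H. norm (autocov h)) \<le> ?B" if H: "finite H" for H
  proof -
    have "(\<Sum>h\<in>H. norm (truncated_autocov m h)) \<le> ?B" for m
    proof -
      have "(\<Sum>h\<in>H. norm (truncated_autocov m h)) \<le> (\<Sum>h\<in>H. \<Sum>j\<in>window m. \<Sum>k\<in>window m. if j - k = h then norm (noise_cov (A j) (A k)) else 0)"
        unfolding truncated_autocov_def
        by (intro sum_mono order_trans[OF norm_sum] sum_mono order_trans[OF norm_sum]) (auto intro!: sum_mono)
      also have "\<dots> = (\<Sum>j\<in>window m. \<Sum>k\<in>window m. \<Sum>h\<in>H. if j - k = h then norm (noise_cov (A j) (A k)) else 0)"
        by (rule trans[OF sum.swap]) (rule sum.cong[OF refl], rule sum.swap)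
      also have "\<dots> \<le> (\<Sum>j\<in>window m. \<Sum>k\<in>window m. 2 * noise_trace * (norm (A j) * norm (A k)))"
        using H norm_noise_cov_le noise_trace_nonneg by (intro sum_mono) (auto simp: sum.delta')
      also have "\<dots> = 2 * noise_trace * (\<Sum>j\<in>window m. norm (A j))\<^sup>2"
        unfolding power2_eq_square sum_product unfolding sum_distrib_left ..
      also have "\<dots> \<le> ?B"
        using noise_trace_nonneg by (intro mult_left_mono power_mono sum_A_le sum_nonneg) auto
      finally show ?thesis .
    qed
    moreover have "(\<lambda>m. \<Sum>h\<in>H. norm (truncated_autocov m h)) \<longlonglongrightarrow> (\<Sum>h\<in>H. norm (autocov h))"
      using truncated_autocov_tendsto[of _ 0] by (intro tendsto_sum tendsto_norm) (simp add: autocov_def)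
    ultimately show ?thesis by (intro LIMSEQ_le_const2) blast+
  qed
  then show "bdd_above (sum (\<lambda>h. norm (autocov h)) ` {F. F \<subseteq> UNIV \<and> finite F})"
    by (intro bdd_aboveI2) auto
qed auto

text \<open>Shifting both times is injective, so reindexing keeps the sum of squared coefficients.
  The orthogonality estimate is for real coefficients; real and imaginary parts are treated
  separately, whence the leading factor 2.\<close>

lemma tensor_sum_deviation:
  assumes S: "finite S"
  shows "expectation (\<lambda>\<omega>. norm (\<Sum>s\<in>S. \<Sum>t\<in>S. cmul (c s t) (centered_tensor B C (s - j, t - k) \<omega>)))
    \<le> 2 * sqrt (2 * tensor_var) * (norm B * norm C) * sqrt (\<Sum>s\<in>S. \<Sum>t\<in>S. (cmod (c s t))\<^sup>2)"
proof -
  let ?Z = "centered_tensor B C"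
  let ?P = "S \<times> S" and ?sh = "\<lambda>x. (fst x - j, snd x - k)"
  have real_part: "expectation (\<lambda>\<omega>. norm (\<Sum>x\<in>?P. d x *\<^sub>R ?Z (?sh x) \<omega>)) \<le> sqrt (2 * tensor_var * (norm B * norm C)\<^sup>2 * (\<Sum>x\<in>?P. (d x)\<^sup>2))"
    for d :: "int \<times> int \<Rightarrow> real"
  proof -
    let ?Q = "?sh ` ?P" and ?d = "\<lambda>y. d (fst y + j, snd y + k)"
    have "(\<Sum>y\<in>?Q. ?d y *\<^sub>R ?Z y \<omega>) = (\<Sum>x\<in>?P. d x *\<^sub>R ?Z (?sh x) \<omega>)" for \<omega>
      by (subst sum.reindex) (auto simp: inj_on_def)
    moreover have "(\<Sum>y\<in>?Q. (?d y)\<^sup>2) = (\<Sum>x\<in>?P. (d x)\<^sup>2)"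
      by (subst sum.reindex) (auto simp: inj_on_def)
    ultimately have "expectation (\<lambda>\<omega>. (norm (\<Sum>x\<in>?P. d x *\<^sub>R ?Z (?sh x) \<omega>))\<^sup>2) \<le> 2 * tensor_var * (norm B * norm C)\<^sup>2 * (\<Sum>x\<in>?P. (d x)\<^sup>2)"
      using centered_tensor_sum_sq[of ?Q ?d B C] S by simp
    moreover have "all_moments (\<lambda>\<omega>. \<Sum>x\<in>?P. d x *\<^sub>R ?Z (?sh x) \<omega>)"
      using S by (intro all_moments_sum all_moments_bounded_linear[OF bounded_linear_scaleR_right] all_moments_centered_tensor) auto
    ultimately show ?thesis
      by (intro order_trans[OF expectation_norm_le_sqrt] real_sqrt_le_mono)
  qed
  let ?n = "\<Sum>s\<in>S. \<Sum>t\<in>S. (cmod (c s t))\<^sup>2"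
  have n: "?n = (\<Sum>x\<in>?P. (cmod (c (fst x) (snd x)))\<^sup>2)" by (simp add: sum.cartesian_product case_prod_unfold)
  let ?re = "\<lambda>x. Re (c (fst x) (snd x))" and ?im = "\<lambda>x. Im (c (fst x) (snd x))"
  have split: "(\<Sum>s\<in>S. \<Sum>t\<in>S. cmul (c s t) (?Z (s - j, t - k) \<omega>)) = (\<Sum>x\<in>?P. ?re x *\<^sub>R ?Z (?sh x) \<omega>) + cmul \<i> (\<Sum>x\<in>?P. ?im x *\<^sub>R ?Z (?sh x) \<omega>)" for \<omega>
  proof -
    have *: "cmul z f = Re z *\<^sub>R f + cmul \<i> (Im z *\<^sub>R f)" for z and f :: kernel_L2
    proof -
      have "cmul z f = cmul (of_real (Re z) + \<i> * of_real (Im z)) f" by (simp flip: complex_eq)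
      then show ?thesis by (simp only: cmul_add_left cmul_of_real cmul_cmul[symmetric])
    qed
    have "(\<Sum>s\<in>S. \<Sum>t\<in>S. cmul (c s t) (?Z (s - j, t - k) \<omega>)) = (\<Sum>x\<in>?P. cmul (c (fst x) (snd x)) (?Z (?sh x) \<omega>))"
      by (simp add: sum.cartesian_product case_prod_unfold)
    also have "\<dots> = (\<Sum>x\<in>?P. ?re x *\<^sub>R ?Z (?sh x) \<omega> + cmul \<i> (?im x *\<^sub>R ?Z (?sh x) \<omega>))"
      by (rule sum.cong[OF refl]) (rule *)
    finally show ?thesis by (simp only: sum.distrib cmul.sum_right)
  qed
  have am: "all_moments (\<lambda>\<omega>. \<Sum>x\<in>?P. d x *\<^sub>R ?Z (?sh x) \<omega>)" for d :: "int \<times> int \<Rightarrow> real"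
    using S by (intro all_moments_sum all_moments_bounded_linear[OF bounded_linear_scaleR_right] all_moments_centered_tensor) auto
  have int: "integrable M (\<lambda>\<omega>. norm (\<Sum>x\<in>?P. d x *\<^sub>R ?Z (?sh x) \<omega>))" for d :: "int \<times> int \<Rightarrow> real"
    by (intro integrable_norm all_moments_integrable am)
  have "expectation (\<lambda>\<omega>. norm (\<Sum>s\<in>S. \<Sum>t\<in>S. cmul (c s t) (?Z (s - j, t - k) \<omega>)))
      \<le> expectation (\<lambda>\<omega>. norm (\<Sum>x\<in>?P. ?re x *\<^sub>R ?Z (?sh x) \<omega>) + norm (\<Sum>x\<in>?P. ?im x *\<^sub>R ?Z (?sh x) \<omega>))"
    unfolding split
  proof (rule integral_mono)
    show "integrable M (\<lambda>\<omega>. norm ((\<Sum>x\<in>?P. ?re x *\<^sub>R ?Z (?sh x) \<omega>) + cmul \<i> (\<Sum>x\<in>?P. ?im x *\<^sub>R ?Z (?sh x) \<omega>)))"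
      by (intro integrable_norm all_moments_integrable all_moments_add am all_moments_bounded_linear[OF cmul.bounded_linear_right])
    show "integrable M (\<lambda>\<omega>. norm (\<Sum>x\<in>?P. ?re x *\<^sub>R ?Z (?sh x) \<omega>) + norm (\<Sum>x\<in>?P. ?im x *\<^sub>R ?Z (?sh x) \<omega>))"
      by (intro Bochner_Integration.integrable_add int)
    fix \<omega>
    show "norm ((\<Sum>x\<in>?P. ?re x *\<^sub>R ?Z (?sh x) \<omega>) + cmul \<i> (\<Sum>x\<in>?P. ?im x *\<^sub>R ?Z (?sh x) \<omega>)) \<le> norm (\<Sum>x\<in>?P. ?re x *\<^sub>R ?Z (?sh x) \<omega>) + norm (\<Sum>x\<in>?P. ?im x *\<^sub>R ?Z (?sh x) \<omega>)"
      by (rule order_trans[OF norm_triangle_ineq]) (simp add: norm_cmul)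
  qed
  also have "\<dots> = expectation (\<lambda>\<omega>. norm (\<Sum>x\<in>?P. ?re x *\<^sub>R ?Z (?sh x) \<omega>)) + expectation (\<lambda>\<omega>. norm (\<Sum>x\<in>?P. ?im x *\<^sub>R ?Z (?sh x) \<omega>))"
    by (rule Bochner_Integration.integral_add[OF int int])
  also have "\<dots> \<le> sqrt (2 * tensor_var * (norm B * norm C)\<^sup>2 * ?n) + sqrt (2 * tensor_var * (norm B * norm C)\<^sup>2 * ?n)"
  proof (intro add_mono)
    have le: "(\<Sum>x\<in>?P. (?re x)\<^sup>2) \<le> ?n" "(\<Sum>x\<in>?P. (?im x)\<^sup>2) \<le> ?n"
      unfolding n by (intro sum_mono; simp add: cmod_power2)+
    show "expectation (\<lambda>\<omega>. norm (\<Sum>x\<in>?P. ?re x *\<^sub>R ?Z (?sh x) \<omega>)) \<le> sqrt (2 * tensor_var * (norm B * norm C)\<^sup>2 * ?n)"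
      using tensor_var_nonneg by (intro order_trans[OF real_part] real_sqrt_le_mono mult_left_mono le) auto
    show "expectation (\<lambda>\<omega>. norm (\<Sum>x\<in>?P. ?im x *\<^sub>R ?Z (?sh x) \<omega>)) \<le> sqrt (2 * tensor_var * (norm B * norm C)\<^sup>2 * ?n)"
      using tensor_var_nonneg by (intro order_trans[OF real_part] real_sqrt_le_mono mult_left_mono le) auto
  qed
  also have "\<dots> = 2 * sqrt (2 * tensor_var) * (norm B * norm C) * sqrt ?n"
    by (simp add: real_sqrt_mult)
  finally show ?thesis .
qed

lemma all_moments_quadratic:
  assumes "finite S" "\<And>s. s \<in> S \<Longrightarrow> all_moments (x s)"
  shows "all_moments (\<lambda>\<omega>. quadratic c S (\<lambda>s. x s \<omega>))"
proof -
  have "(\<lambda>\<omega>. tens (x s \<omega>) (x t \<omega>)) \<in> borel_measurable M" if "s \<in> S" "t \<in> S" for s t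
    using all_moments_measurable[OF assms(2)[OF that(1)]] all_moments_measurable[OF assms(2)[OF that(2)]] by measurable
  then show ?thesis
    unfolding quadratic_def
    by (intro all_moments_sum assms(1) all_moments_bounded_linear[OF cmul.bounded_linear_right]
        all_moments_bounded_bilinear[OF bounded_bilinear_tens] assms(2)) auto
qed

lemma expectation_quadratic:
  assumes "finite S" "\<And>s. s \<in> S \<Longrightarrow> all_moments (x s)"
  shows "expectation (\<lambda>\<omega>. quadratic c S (\<lambda>s. x s \<omega>)) = (\<Sum>s\<in>S. \<Sum>t\<in>S. cmul (c s t) (expectation (\<lambda>\<omega>. tens (x s \<omega>) (x t \<omega>))))"
proof -
  have i: "integrable M (\<lambda>\<omega>. tens (x s \<omega>) (x t \<omega>))" if "s \<in> S" "t \<in> S" for s t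
  proof -
    have "(\<lambda>\<omega>. tens (x s \<omega>) (x t \<omega>)) \<in> borel_measurable M"
      using all_moments_measurable[OF assms(2)[OF that(1)]] all_moments_measurable[OF assms(2)[OF that(2)]] by measurable
    then show ?thesis
      by (intro all_moments_integrable all_moments_bounded_bilinear[OF bounded_bilinear_tens] assms(2) that)
  qed
  have i2: "integrable M (\<lambda>\<omega>. cmul (c s t) (tens (x s \<omega>) (x t \<omega>)))" if "s \<in> S" "t \<in> S" for s t
    by (rule integrable_bounded_linear[OF cmul.bounded_linear_right i[OF that]])
  show ?thesis
    unfolding quadratic_def
    by (subst Bochner_Integration.integral_sum, intro Bochner_Integration.integrable_sum i2, assumption+,
        rule sum.cong[OF refl], subst Bochner_Integration.integral_sum, rule i2, assumption+, rule sum.cong[OF refl],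
        rule integral_bounded_linear[OF cmul.bounded_linear_right i])
qed

lemma expectation_quadratic_X:
  "finite S \<Longrightarrow> expectation (\<lambda>\<omega>. quadratic c S (\<lambda>s. X s \<omega>)) = (\<Sum>s\<in>S. \<Sum>t\<in>S. cmul (c s t) (autocov (s - t)))"
  by (simp add: expectation_quadratic all_moments_X autocov_eq)

text \<open>Expanding both truncations and exchanging sums gives one shifted tensor sum for each
  pair \<open>(j, k)\<close>. The triangle inequality adds their bounds with the weights
  \<open>norm (A j) * norm (A k)\<close>, whose total is at most
  \<open>\<alpha>\<^sup>2\<close>.\<close>

lemma quadratic_truncated_deviation:
  assumes S: "finite S"
  shows "expectation (\<lambda>\<omega>. norm (quadratic c S (\<lambda>s. truncated m s \<omega>) - expectation (\<lambda>\<omega>. quadratic c S (\<lambda>s. truncated m s \<omega>))))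
    \<le> 2 * sqrt (2 * tensor_var) * \<alpha>\<^sup>2 * sqrt (\<Sum>s\<in>S. \<Sum>t\<in>S. (cmod (c s t))\<^sup>2)"
proof -
  let ?n = "sqrt (\<Sum>s\<in>S. \<Sum>t\<in>S. (cmod (c s t))\<^sup>2)" and ?v = "2 * sqrt (2 * tensor_var)"
  define Y where "Y j k \<omega> = (\<Sum>s\<in>S. \<Sum>t\<in>S. cmul (c s t) (centered_tensor (A j) (A k) (s - j, t - k) \<omega>))" for j k \<omega>
  have eq: "quadratic c S (\<lambda>s. truncated m s \<omega>) - expectation (\<lambda>\<omega>. quadratic c S (\<lambda>s. truncated m s \<omega>))
     = (\<Sum>j\<in>window m. \<Sum>k\<in>window m. Y j k \<omega>)" for \<omega>
  proof -
    have *: "expectation (\<lambda>\<omega>. tens (truncated m s \<omega>) (truncated m t \<omega>)) = (\<Sum>j\<in>window m. \<Sum>k\<in>window m. expectation (noise_tensor (A j) (A k) (s - j) (t - k)))" for s t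
      unfolding expectation_tens_truncated truncated_autocov_def
      by (intro sum.cong refl) (auto simp: expectation_noise_tensor)
    have "expectation (\<lambda>\<omega>. quadratic c S (\<lambda>s. truncated m s \<omega>)) = (\<Sum>s\<in>S. \<Sum>t\<in>S. cmul (c s t) (\<Sum>j\<in>window m. \<Sum>k\<in>window m. expectation (noise_tensor (A j) (A k) (s - j) (t - k))))"
      by (simp only: expectation_quadratic[OF S all_moments_truncated] *)
    moreover have "quadratic c S (\<lambda>s. truncated m s \<omega>) = (\<Sum>s\<in>S. \<Sum>t\<in>S. cmul (c s t) (\<Sum>j\<in>window m. \<Sum>k\<in>window m. noise_tensor (A j) (A k) (s - j) (t - k) \<omega>))"
      by (simp only: quadratic_def tens_truncated)
    ultimately have "quadratic c S (\<lambda>s. truncated m s \<omega>) - expectation (\<lambda>\<omega>. quadratic c S (\<lambda>s. truncated m s \<omega>))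
      = (\<Sum>s\<in>S. \<Sum>t\<in>S. cmul (c s t) (\<Sum>j\<in>window m. \<Sum>k\<in>window m. centered_tensor (A j) (A k) (s - j, t - k) \<omega>))"
      by (simp only: centered_tensor_def fst_conv snd_conv sum_subtractf cmul.diff_right)
    also have "\<dots> = (\<Sum>s\<in>S. \<Sum>t\<in>S. \<Sum>j\<in>window m. \<Sum>k\<in>window m. cmul (c s t) (centered_tensor (A j) (A k) (s - j, t - k) \<omega>))"
      by (simp add: cmul.sum_right)
    also have "\<dots> = (\<Sum>s\<in>S. \<Sum>j\<in>window m. \<Sum>k\<in>window m. \<Sum>t\<in>S. cmul (c s t) (centered_tensor (A j) (A k) (s - j, t - k) \<omega>))"
      by (rule sum.cong[OF refl], rule trans[OF sum.swap], rule sum.cong[OF refl], rule sum.swap)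
    also have "\<dots> = (\<Sum>j\<in>window m. \<Sum>k\<in>window m. Y j k \<omega>)"
      unfolding Y_def by (rule trans[OF sum.swap], rule sum.cong[OF refl], rule sum.swap)
    finally show ?thesis .
  qed
  have Ym: "all_moments (Y j k)" for j k
    unfolding Y_def using S
    by (intro all_moments_sum all_moments_bounded_linear[OF cmul.bounded_linear_right] all_moments_centered_tensor)
  have Yi: "integrable M (\<lambda>\<omega>. norm (Y j k \<omega>))" for j k by (intro integrable_norm all_moments_integrable Ym)
  have "expectation (\<lambda>\<omega>. norm (\<Sum>j\<in>window m. \<Sum>k\<in>window m. Y j k \<omega>)) \<le> expectation (\<lambda>\<omega>. \<Sum>j\<in>window m. \<Sum>k\<in>window m. norm (Y j k \<omega>))"
    by (rule integral_mono)
      (auto intro!: integrable_norm Bochner_Integration.integrable_sum all_moments_integrable[OF Ym] Yi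
         order_trans[OF norm_sum] sum_mono norm_sum)
  also have "\<dots> = (\<Sum>j\<in>window m. \<Sum>k\<in>window m. expectation (\<lambda>\<omega>. norm (Y j k \<omega>)))"
    by (subst Bochner_Integration.integral_sum, intro Bochner_Integration.integrable_sum Yi, rule sum.cong[OF refl],
        rule Bochner_Integration.integral_sum, rule Yi)
  also have "\<dots> \<le> (\<Sum>j\<in>window m. \<Sum>k\<in>window m. ?v * (norm (A j) * norm (A k)) * ?n)"
    unfolding Y_def by (intro sum_mono tensor_sum_deviation S)
  also have "\<dots> = ?v * (\<Sum>j\<in>window m. norm (A j))\<^sup>2 * ?n"
    unfolding power2_eq_square sum_product by (simp add: sum_distrib_left sum_distrib_right)
  also have "\<dots> \<le> ?v * \<alpha>\<^sup>2 * ?n"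
    using tensor_var_nonneg by (intro mult_right_mono mult_left_mono power_mono sum_A_le sum_nonneg) (auto intro!: sum_nonneg)
  finally show ?thesis unfolding eq .
qed

text \<open>Dominated convergence in \<open>m\<close>: the truncated forms are bounded by the form
  in the envelopes with absolute coefficients, and their means converge, hence are bounded by some
  \<open>B\<close>.\<close>

lemma quadratic_deviation:
  assumes S: "finite S"
  shows "expectation (\<lambda>\<omega>. norm (quadratic c S (\<lambda>s. X s \<omega>) - (\<Sum>s\<in>S. \<Sum>t\<in>S. cmul (c s t) (autocov (s - t)))))
    \<le> 2 * sqrt (2 * tensor_var) * \<alpha>\<^sup>2 * sqrt (\<Sum>s\<in>S. \<Sum>t\<in>S. (cmod (c s t))\<^sup>2)"
proof -
  define e where "e m = (\<Sum>s\<in>S. \<Sum>t\<in>S. cmul (c s t) (truncated_autocov m (s - t)))" for m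
  define e' where "e' = (\<Sum>s\<in>S. \<Sum>t\<in>S. cmul (c s t) (autocov (s - t)))"
  have em: "expectation (\<lambda>\<omega>. quadratic c S (\<lambda>s. truncated m s \<omega>)) = e m" for m
    by (simp add: expectation_quadratic[OF S all_moments_truncated] expectation_tens_truncated e_def)
  have e_lim: "e \<longlonglongrightarrow> e'"
    unfolding e_def e'_def using truncated_autocov_tendsto
    by (intro tendsto_sum cmul.tendsto tendsto_const) (simp add: autocov_eq)
  obtain B where B: "\<And>m. norm (e m) \<le> B"
    using Bseq_bdd_above[OF convergent_imp_Bseq[OF convergentI[OF tendsto_norm[OF e_lim]]]] by (auto simp: bdd_above_def)
  define D where "D \<omega> = (\<Sum>s\<in>S. \<Sum>t\<in>S. cmod (c s t) * (envelope s \<omega> * envelope t \<omega>))" for \<omega>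
  have Dm: "all_moments D" unfolding D_def
    by (intro all_moments_sum S all_moments_mult all_moments_const all_moments_envelope)
  have aeS: "AE \<omega> in M. \<forall>s\<in>S. (\<forall>m. norm (truncated m s \<omega>) \<le> envelope s \<omega>) \<and> (\<lambda>m. truncated m s \<omega>) \<longlonglongrightarrow> X s \<omega>"
    using norm_truncated_le truncated_tendsto by (intro AE_finite_allI[OF S] AE_conjI) auto
  have "(\<lambda>m. expectation (\<lambda>\<omega>. norm (quadratic c S (\<lambda>s. truncated m s \<omega>) - e m))) \<longlonglongrightarrow> expectation (\<lambda>\<omega>. norm (quadratic c S (\<lambda>s. X s \<omega>) - e'))"
  proof (rule integral_dominated_convergence[where w = "\<lambda>\<omega>. D \<omega> + B"])
    show "(\<lambda>\<omega>. norm (quadratic c S (\<lambda>s. X s \<omega>) - e')) \<in> borel_measurable M"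
      using all_moments_measurable[OF all_moments_quadratic[OF S all_moments_X, where c = c]] by measurable
    show "(\<lambda>\<omega>. norm (quadratic c S (\<lambda>s. truncated m s \<omega>) - e m)) \<in> borel_measurable M" for m
      using all_moments_measurable[OF all_moments_quadratic[OF S all_moments_truncated, where c = c]] by measurable
    show "integrable M (\<lambda>\<omega>. D \<omega> + B)" using all_moments_integrable[OF Dm] by simp
    show "AE \<omega> in M. (\<lambda>m. norm (quadratic c S (\<lambda>s. truncated m s \<omega>) - e m)) \<longlonglongrightarrow> norm (quadratic c S (\<lambda>s. X s \<omega>) - e')"
      using aeS
    proof eventually_elim
      case (elim \<omega>)
      have "(\<lambda>m. truncated m s \<omega>) \<longlonglongrightarrow> X s \<omega>" if "s \<in> S" for s using elim that by blast
      then show ?case unfolding quadratic_def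
        by (intro tendsto_norm tendsto_diff e_lim tendsto_sum cmul.tendsto tendsto_const tens.tendsto)
    qed
    show "AE \<omega> in M. norm (norm (quadratic c S (\<lambda>s. truncated m s \<omega>) - e m)) \<le> D \<omega> + B" for m
      using aeS
    proof eventually_elim
      case (elim \<omega>)
      have "norm (quadratic c S (\<lambda>s. truncated m s \<omega>)) \<le> D \<omega>"
        unfolding quadratic_def D_def
        by (intro order_trans[OF norm_sum] sum_mono order_trans[OF norm_sum] sum_mono)
          (use elim envelope_nonneg in \<open>auto simp: norm_cmul norm_tens intro!: mult_left_mono mult_mono\<close>)
      then show ?case using norm_triangle_ineq4[of "quadratic c S (\<lambda>s. truncated m s \<omega>)" "e m"] B[of m]
        by (simp only: real_norm_def abs_norm_cancel)
    qed
  qed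
  then show ?thesis unfolding e'_def
    by (rule LIMSEQ_le_const2) (use quadratic_truncated_deviation[OF S, of c] em in auto)
qed

end

section \<open>The estimator as an average of periodograms\<close>

definition estimator :: "(real \<Rightarrow> real) \<Rightarrow> real \<Rightarrow> nat \<Rightarrow> real \<Rightarrow> (int \<Rightarrow> real_L2) \<Rightarrow> kernel_L2" where
  "estimator W b T \<xi> x = quadratic (\<lambda>s t. lag_weight W b T \<xi> (s - t) / of_real (2 * pi * real T)) {1..int T} x"

definition cos_transform :: "nat \<Rightarrow> int \<Rightarrow> (int \<Rightarrow> real_L2) \<Rightarrow> real_L2" where
  "cos_transform T t x = (\<Sum>s=1..int T. cos (fourier_freq T t * of_int s) *\<^sub>R x s)"

definition sin_transform :: "nat \<Rightarrow> int \<Rightarrow> (int \<Rightarrow> real_L2) \<Rightarrow> real_L2" where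
  "sin_transform T t x = (\<Sum>s=1..int T. sin (fourier_freq T t * of_int s) *\<^sub>R x s)"

text \<open>The trace of the periodogram operator at the frequency
  \<open>fourier_freq T t\<close>.\<close>

definition periodogram_norm :: "nat \<Rightarrow> int \<Rightarrow> (int \<Rightarrow> real_L2) \<Rightarrow> real" where
  "periodogram_norm T t x = ((norm (cos_transform T t x))\<^sup>2 + (norm (sin_transform T t x))\<^sup>2) / (2 * pi * real T)"

text \<open>The kernel of the tensor product of \<open>c - i s\<close> with its conjugate, where
  \<open>c\<close> and \<open>s\<close> are the cosine and sine parts of a discrete Fourier
  transform; it is expanded because \<open>tens\<close> takes real vectors.\<close>

definition rank_one :: "real_L2 \<Rightarrow> real_L2 \<Rightarrow> kernel_L2" where
  "rank_one c s = (tens c c + tens s s) + cmul \<i> (tens c s - tens s c)"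

text \<open>The trace of the spectral estimator, written as a combination of periodogram traces; for
  positive \<open>b\<close> and a nonnegative window it also bounds the norm of the estimator up to
  a factor 2.\<close>

definition total_power :: "(real \<Rightarrow> real) \<Rightarrow> real \<Rightarrow> nat \<Rightarrow> real \<Rightarrow> (int \<Rightarrow> real_L2) \<Rightarrow> real" where
  "total_power W b T \<xi> x = (\<Sum>t\<in>freqs T. taper W b T \<xi> t * periodogram_norm T t x)"

lemma inner_tens_cmul: "tens x y \<bullet> cmul a (tens x' y') = Re a * ((x \<bullet> x') * (y \<bullet> y'))"
proof -
  have i: "tens x y \<bullet> cmul \<i> (tens x' y') = 0" for x y x' y'
  proof transfer
    fix x y x' y' :: "real \<Rightarrow> real"
    show "(LINT p|unit_cube. complex_of_real (x (fst p) * y (snd p)) \<bullet> (\<i> * complex_of_real (x' (fst p) * y' (snd p)))) = 0"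
      by (simp add: inner_complex_def)
  qed
  have "a = of_real (Re a) + of_real (Im a) * \<i>"
    by (simp add: complex_eq_iff)
  then have "cmul a (tens x' y') = cmul (of_real (Re a) + of_real (Im a) * \<i>) (tens x' y')"
    by (rule arg_cong[where f = "\<lambda>a. cmul a (tens x' y')"])
  then have "cmul a (tens x' y') = Re a *\<^sub>R tens x' y' + Im a *\<^sub>R cmul \<i> (tens x' y')"
    by (simp only: cmul_add_left cmul_of_real cmul_cmul[symmetric])
  then show ?thesis by (simp add: inner_add_right i inner_tens)
qed

text \<open>The right-hand side is the squared modulus of the Hermitian product of
  \<open>c - i s\<close> and \<open>c' - i s'\<close>. Its nonnegativity is what makes inner
  products of estimators nonnegative.\<close>

lemma inner_rank_one: "rank_one c s \<bullet> rank_one c' s' = ((c \<bullet> c') + (s \<bullet> s'))\<^sup>2 + ((c \<bullet> s') - (s \<bullet> c'))\<^sup>2"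
proof -
  have 1: "cmul \<i> f \<bullet> cmul \<i> g = f \<bullet> g" for f g :: kernel_L2
    by (simp add: inner_cmul cmul_cmul) (simp add: cmul_of_real[of 1, simplified])
  have 2: "tens x y \<bullet> cmul \<i> (tens x' y') = 0" "cmul \<i> (tens x' y') \<bullet> tens x y = 0" for x y x' y'
    using inner_tens_cmul[of x y \<i> x' y'] by (simp_all add: inner_commute)
  show ?thesis
    by (simp add: rank_one_def inner_add_left inner_add_right cmul.diff_right inner_diff_left inner_diff_right 1 2 inner_tens)
      (simp add: power2_eq_square algebra_simps inner_commute)
qed

lemma norm_rank_one_le: "norm (rank_one c s) \<le> 2 * ((norm c)\<^sup>2 + (norm s)\<^sup>2)"
proof -
  have "norm (rank_one c s) \<le> (norm (tens c c) + norm (tens s s)) + (norm (tens c s) + norm (tens s c))"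
    unfolding rank_one_def
    by (intro order_trans[OF norm_triangle_ineq] add_mono norm_triangle_ineq) (simp add: norm_cmul norm_triangle_ineq4)
  also have "\<dots> = (norm c)\<^sup>2 + (norm s)\<^sup>2 + 2 * norm c * norm s" by (simp add: norm_tens power2_eq_square)
  also have "\<dots> \<le> 2 * ((norm c)\<^sup>2 + (norm s)\<^sup>2)" using sum_squares_bound[of "norm c" "norm s"] by simp
  finally show ?thesis .
qed

lemma cis_neg_diff: "cis (- a * of_int (s - t)) =
    of_real (cos (a * of_int s) * cos (a * of_int t) + sin (a * of_int s) * sin (a * of_int t))
    + \<i> * of_real (cos (a * of_int s) * sin (a * of_int t) - sin (a * of_int s) * cos (a * of_int t))"
proof -
  have "- a * of_int (s - t) = a * of_int t - a * of_int s" by (simp add: algebra_simps)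
  then show ?thesis by (simp only:) (simp add: complex_eq_iff cos_diff sin_diff mult_ac)
qed

lemma periodogram_rank_one:
  "(\<Sum>s=1..int T. \<Sum>u=1..int T. cmul (cis (- fourier_freq T t * of_int (s - u))) (tens (x s) (x u)))
     = rank_one (cos_transform T t x) (sin_transform T t x)"
proof -
  let ?c = "\<lambda>s. cos (fourier_freq T t * of_int s)" and ?s = "\<lambda>s. sin (fourier_freq T t * of_int s)"
  have "cmul (cis (- fourier_freq T t * of_int (s - u))) (tens (x s) (x u)) =
      (tens (?c s *\<^sub>R x s) (?c u *\<^sub>R x u) + tens (?s s *\<^sub>R x s) (?s u *\<^sub>R x u))
      + cmul \<i> (tens (?c s *\<^sub>R x s) (?s u *\<^sub>R x u) - tens (?s s *\<^sub>R x s) (?c u *\<^sub>R x u))" for s u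
    unfolding cis_neg_diff cmul_add_left cmul_cmul[symmetric] cmul_of_real
    by (simp add: tens.scaleR_left tens.scaleR_right scaleR_add_left scaleR_diff_left mult_ac)
  then show ?thesis
    unfolding rank_one_def cos_transform_def sin_transform_def tens.sum_left
    by (simp only: tens.sum_right sum.distrib sum_subtractf cmul.sum_right cmul.diff_right)
qed

text \<open>Exchanging the sums over times and frequencies undoes the Fourier transform in the lag
  weights. In this form nonnegativity of the smoothing weights can be used, which the lag form
  hides.\<close>

lemma estimator_eq:
  "estimator W b T \<xi> x = (\<Sum>t\<in>freqs T. (taper W b T \<xi> t / (2 * pi * real T)) *\<^sub>R rank_one (cos_transform T t x) (sin_transform T t x))"
proof -
  let ?d = "2 * pi * real T"
  have w: "lag_weight W b T \<xi> h / of_real ?d = (\<Sum>t\<in>freqs T. of_real (taper W b T \<xi> t / ?d) * cis (- fourier_freq T t * of_int h))" for h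
    by (simp add: lag_weight_def scaleR_conv_of_real sum_divide_distrib)
  have "estimator W b T \<xi> x = (\<Sum>s=1..int T. \<Sum>u=1..int T. \<Sum>t\<in>freqs T.
      (taper W b T \<xi> t / ?d) *\<^sub>R cmul (cis (- fourier_freq T t * of_int (s - u))) (tens (x s) (x u)))"
    unfolding estimator_def quadratic_def w cmul.sum_left cmul_cmul[symmetric] cmul_of_real ..
  also have "\<dots> = (\<Sum>s=1..int T. \<Sum>t\<in>freqs T. \<Sum>u=1..int T.
      (taper W b T \<xi> t / ?d) *\<^sub>R cmul (cis (- fourier_freq T t * of_int (s - u))) (tens (x s) (x u)))"
    by (rule sum.cong[OF refl]) (rule sum.swap)
  also have "\<dots> = (\<Sum>t\<in>freqs T. \<Sum>s=1..int T. \<Sum>u=1..int T.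
      (taper W b T \<xi> t / ?d) *\<^sub>R cmul (cis (- fourier_freq T t * of_int (s - u))) (tens (x s) (x u)))"
    by (rule sum.swap)
  finally show ?thesis by (simp only: scaleR_sum_right[symmetric] periodogram_rank_one)
qed

text \<open>The trace of \<open>tens (x s) (x u)\<close> is \<open>x s \<bullet> x u\<close>; at
  each frequency the mixed cosine and sine terms cancel by symmetry, so the result is real.\<close>

lemma estimator_trace:
  "(\<Sum>s=1..int T. \<Sum>u=1..int T. lag_weight W b T \<xi> (s - u) / of_real (2 * pi * real T) * of_real (x s \<bullet> x u))
     = of_real (total_power W b T \<xi> x)"
proof -
  let ?d = "2 * pi * real T"
  let ?C = "\<lambda>t. cos_transform T t x" and ?S = "\<lambda>t. sin_transform T t x"
  have w: "lag_weight W b T \<xi> h / of_real ?d = (\<Sum>t\<in>freqs T. of_real (taper W b T \<xi> t / ?d) * cis (- fourier_freq T t * of_int h))" for h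
    by (simp add: lag_weight_def scaleR_conv_of_real sum_divide_distrib)
  have p: "(\<Sum>s=1..int T. \<Sum>u=1..int T. cis (- fourier_freq T t * of_int (s - u)) * of_real (x s \<bullet> x u)) = of_real ((norm (?C t))\<^sup>2 + (norm (?S t))\<^sup>2)" for t
  proof -
    let ?c = "\<lambda>s. cos (fourier_freq T t * of_int s)" and ?s = "\<lambda>s. sin (fourier_freq T t * of_int s)"
    have "cis (- fourier_freq T t * of_int (s - u)) * of_real (x s \<bullet> x u) =
      (of_real ((?c s *\<^sub>R x s) \<bullet> (?c u *\<^sub>R x u)) + of_real ((?s s *\<^sub>R x s) \<bullet> (?s u *\<^sub>R x u)))
      + \<i> * (of_real ((?c s *\<^sub>R x s) \<bullet> (?s u *\<^sub>R x u)) - of_real ((?s s *\<^sub>R x s) \<bullet> (?c u *\<^sub>R x u)))" for s u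
      unfolding cis_neg_diff by (simp add: algebra_simps)
    then have "(\<Sum>s=1..int T. \<Sum>u=1..int T. cis (- fourier_freq T t * of_int (s - u)) * of_real (x s \<bullet> x u))
      = (of_real (?C t \<bullet> ?C t) + of_real (?S t \<bullet> ?S t)) + \<i> * (of_real (?C t \<bullet> ?S t) - of_real (?S t \<bullet> ?C t))"
      unfolding cos_transform_def sin_transform_def inner_sum_left unfolding inner_sum_right
      by (simp only: of_real_sum sum.distrib sum_subtractf sum_distrib_left right_diff_distrib)
    then show ?thesis by (simp add: power2_norm_eq_inner inner_commute)
  qed
  have "(\<Sum>s=1..int T. \<Sum>u=1..int T. lag_weight W b T \<xi> (s - u) / of_real ?d * of_real (x s \<bullet> x u))
    = (\<Sum>s=1..int T. \<Sum>u=1..int T. \<Sum>t\<in>freqs T. of_real (taper W b T \<xi> t / ?d) * (cis (- fourier_freq T t * of_int (s - u)) * of_real (x s \<bullet> x u)))"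
    unfolding w sum_distrib_right by (simp only: mult.assoc)
  also have "\<dots> = (\<Sum>s=1..int T. \<Sum>t\<in>freqs T. \<Sum>u=1..int T. of_real (taper W b T \<xi> t / ?d) * (cis (- fourier_freq T t * of_int (s - u)) * of_real (x s \<bullet> x u)))"
    by (rule sum.cong[OF refl]) (rule sum.swap)
  also have "\<dots> = (\<Sum>t\<in>freqs T. \<Sum>s=1..int T. \<Sum>u=1..int T. of_real (taper W b T \<xi> t / ?d) * (cis (- fourier_freq T t * of_int (s - u)) * of_real (x s \<bullet> x u)))"
    by (rule sum.swap)
  also have "\<dots> = (\<Sum>t\<in>freqs T. of_real (taper W b T \<xi> t / ?d) * of_real ((norm (?C t))\<^sup>2 + (norm (?S t))\<^sup>2))"
    by (simp only: sum_distrib_left[symmetric] p)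
  also have "\<dots> = of_real (total_power W b T \<xi> x)"
    by (simp add: total_power_def periodogram_norm_def)
  finally show ?thesis .
qed

lemma periodogram_norm_nonneg: "periodogram_norm T t x \<ge> 0"
  by (simp add: periodogram_norm_def)

context lag_window
begin

lemma total_power_nonneg: "b > 0 \<Longrightarrow> total_power W b T \<xi> x \<ge> 0"
  unfolding total_power_def by (intro sum_nonneg mult_nonneg_nonneg taper_nonneg periodogram_norm_nonneg)

lemma norm_estimator_le:
  assumes "b > 0" shows "norm (estimator W b T \<xi> x) \<le> 2 * total_power W b T \<xi> x"
proof -
  have "norm (estimator W b T \<xi> x) \<le> (\<Sum>t\<in>freqs T. (taper W b T \<xi> t / (2 * pi * real T)) * (2 * ((norm (cos_transform T t x))\<^sup>2 + (norm (sin_transform T t x))\<^sup>2)))"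
    unfolding estimator_eq
  proof (rule order_trans[OF norm_sum], rule sum_mono)
    fix t
    have "taper W b T \<xi> t / (2 * pi * real T) \<ge> 0" using taper_nonneg[OF assms] by simp
    then show "norm ((taper W b T \<xi> t / (2 * pi * real T)) *\<^sub>R rank_one (cos_transform T t x) (sin_transform T t x))
      \<le> (taper W b T \<xi> t / (2 * pi * real T)) * (2 * ((norm (cos_transform T t x))\<^sup>2 + (norm (sin_transform T t x))\<^sup>2))"
      by (simp only: norm_scaleR abs_of_nonneg) (rule mult_left_mono[OF norm_rank_one_le])
  qed
  also have "\<dots> = 2 * total_power W b T \<xi> x"
    unfolding total_power_def sum_distrib_left periodogram_norm_def
    by (rule sum.cong[OF refl]) (simp only: times_divide_eq_left times_divide_eq_right mult_ac)
  finally show ?thesis .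
qed

lemma inner_estimator_nonneg:
  assumes "b > 0" shows "estimator W b T \<xi> x \<bullet> estimator W b T \<xi> y \<ge> 0"
  unfolding estimator_eq inner_sum_left inner_sum_right inner_scaleR_left inner_scaleR_right inner_rank_one
  by (intro sum_nonneg mult_nonneg_nonneg divide_nonneg_nonneg taper_nonneg assms) auto

end

section \<open>Consistency of the spectral estimator\<close>

text \<open>The origin of the triangular factor in the mean of the estimator.\<close>

lemma sum_lag_differences:
  fixes g :: "int \<Rightarrow> 'a::real_vector"
  shows "(\<Sum>s=1..int T. \<Sum>t=1..int T. g (s - t)) = (\<Sum>h\<in>{- int T..int T}. real (nat (int T - \<bar>h\<bar>)) *\<^sub>R g h)"
proof -
  let ?S = "{1..int T}" and ?H = "{- int T..int T}"
  have inner: "(\<Sum>s\<in>?S. g (s - t)) = (\<Sum>h\<in>?H. if t + h \<in> ?S then g h else 0)" if "t \<in> ?S" for t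
  proof -
    have "(\<Sum>s\<in>?S. g (s - t)) = (\<Sum>h\<in>{h\<in>?H. t + h \<in> ?S}. g h)"
      using that by (intro sum.reindex_bij_witness[where j = "\<lambda>s. s - t" and i = "\<lambda>h. t + h"]) auto
    then show ?thesis by (rule trans[OF _ sum.inter_filter]) simp
  qed
  have card: "card {t\<in>?S. t + h \<in> ?S} = nat (int T - \<bar>h\<bar>)" for h
  proof -
    have "{t\<in>?S. t + h \<in> ?S} = {max 1 (1 - h)..min (int T) (int T - h)}" by auto
    then show ?thesis by (simp add: min_def max_def abs_if)
  qed
  have "(\<Sum>s\<in>?S. \<Sum>t\<in>?S. g (s - t)) = (\<Sum>t\<in>?S. \<Sum>h\<in>?H. if t + h \<in> ?S then g h else 0)"
    by (rule trans[OF sum.swap]) (rule sum.cong[OF refl inner])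
  also have "\<dots> = (\<Sum>h\<in>?H. \<Sum>t\<in>?S. if t + h \<in> ?S then g h else 0)" by (rule sum.swap)
  also have "\<dots> = (\<Sum>h\<in>?H. real (card {t\<in>?S. t + h \<in> ?S}) *\<^sub>R g h)"
    by (intro sum.cong refl) (simp add: sum.inter_filter[symmetric] sum_constant_scaleR del: mem_Collect_eq)
  finally show ?thesis unfolding card .
qed

context linear_gaussian
begin

definition spec :: "real \<Rightarrow> kernel_L2" where
  "spec \<xi> = (1 / (2 * pi)) *\<^sub>R (\<Sum>\<^sub>\<infinity>h\<in>UNIV. cmul (cis (- \<xi> * of_int h)) (autocov h))"

definition spec_bound :: real where
  "spec_bound = (\<Sum>\<^sub>\<infinity>h\<in>UNIV. norm (autocov h)) / (2 * pi)"

lemma spec_abs_summable: "(\<lambda>h. norm (cmul (cis (- \<xi> * of_int h)) (autocov h))) summable_on UNIV"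
  using autocov_summable by (simp add: norm_cmul)

lemma norm_spec_le: "norm (spec \<xi>) \<le> spec_bound"
  using norm_infsum_bound[OF spec_abs_summable[of \<xi>]]
  by (simp add: spec_def spec_bound_def norm_cmul divide_right_mono)

lemma spec_bound_nonneg: "spec_bound \<ge> 0"
  by (rule order_trans[OF norm_ge_zero norm_spec_le])

lemma borel_measurable_spec [measurable]: "spec \<in> borel_measurable borel"
proof (rule borel_measurable_LIMSEQ_metric)
  let ?f = "\<lambda>n \<xi>. (1 / (2 * pi)) *\<^sub>R (\<Sum>h\<in>window n. cmul (cis (- \<xi> * of_int h)) (autocov h))"
  show "?f n \<in> borel_measurable borel" for n
    by (intro borel_measurable_continuous_onI continuous_intros cmul.continuous_on)
      (auto simp: cis_conv_exp intro!: continuous_intros)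
  show "(\<lambda>n. ?f n \<xi>) \<longlonglongrightarrow> spec \<xi>" for \<xi>
    unfolding spec_def
    by (intro tendsto_scaleR tendsto_const filterlim_compose[OF _ window_at_top])
      (use has_sum_infsum[OF abs_summable_summable[OF spec_abs_summable]] in \<open>simp add: has_sum_def\<close>)
qed

end

locale spectral_consistency = linear_gaussian M \<epsilon> A X + lag_window W w\<^sub>0 L
  for M :: "'w measure" and \<epsilon> A X W w\<^sub>0 L +
  fixes b :: "nat \<Rightarrow> real"
  assumes b_tendsto: "b \<longlonglongrightarrow> 0" and b_pos: "eventually (\<lambda>T. b T > 0) sequentially"
    and bT_at_top: "filterlim (\<lambda>T. b T * real T) at_top sequentially"
begin

text \<open>The bandwidth is controlled only asymptotically, so finitely many \<open>T\<close> may
  carry useless values; the estimates are stated for the remaining ones.\<close>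

definition regular :: "nat \<Rightarrow> bool" where
  "regular T \<longleftrightarrow> b T > 0 \<and> T > 0 \<and> b T * real T \<ge> 1"

lemma eventually_regular: "eventually regular sequentially"
  unfolding regular_def
  using b_pos eventually_gt_at_top[of 0] filterlim_at_top[THEN iffD1, OF bT_at_top, rule_format, of 1]
  by eventually_elim auto

definition mean_estimator :: "nat \<Rightarrow> real \<Rightarrow> kernel_L2" where
  "mean_estimator T \<xi> = (\<Sum>s=1..int T. \<Sum>t=1..int T. cmul (lag_weight W (b T) T \<xi> (s - t) / of_real (2 * pi * real T)) (autocov (s - t)))"

text \<open>Extended by 0 to all lags and to irregular \<open>T\<close>, so that a single dominating
  function works for every \<open>T\<close>.\<close>

definition mean_term :: "nat \<Rightarrow> real \<Rightarrow> int \<Rightarrow> kernel_L2" where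
  "mean_term T \<xi> h = (if regular T then (real (nat (int T - \<bar>h\<bar>)) / real T) *\<^sub>R cmul (lag_weight W (b T) T \<xi> h) (autocov h) else 0)"

text \<open>Rewriting the mean as an integral over counting measure on the integers prepares
  dominated convergence in the lag.\<close>

lemma mean_estimator_integral:
  assumes "regular T"
  shows "mean_estimator T \<xi> = (1 / (2 * pi)) *\<^sub>R (LINT h|count_space UNIV. mean_term T \<xi> h)"
proof -
  have supp: "{h. mean_term T \<xi> h \<noteq> 0} \<subseteq> {- int T..int T}"
  proof
    fix h assume "h \<in> {h. mean_term T \<xi> h \<noteq> 0}"
    then have "nat (int T - \<bar>h\<bar>) \<noteq> 0" by (auto simp: mean_term_def split: if_splits)
    then show "h \<in> {- int T..int T}" by auto
  qed
  then have fin: "finite {h \<in> UNIV. mean_term T \<xi> h \<noteq> 0}" by (auto intro: finite_subset)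
  have "mean_estimator T \<xi> = (\<Sum>h\<in>{- int T..int T}. real (nat (int T - \<bar>h\<bar>)) *\<^sub>R cmul (lag_weight W (b T) T \<xi> h / of_real (2 * pi * real T)) (autocov h))"
    unfolding mean_estimator_def by (rule sum_lag_differences)
  also have "\<dots> = (\<Sum>h\<in>{- int T..int T}. (1 / (2 * pi)) *\<^sub>R mean_term T \<xi> h)"
  proof (intro sum.cong refl)
    fix h
    have "lag_weight W (b T) T \<xi> h / of_real (2 * pi * real T) = of_real (1 / (2 * pi * real T)) * lag_weight W (b T) T \<xi> h" by simp
    then show "real (nat (int T - \<bar>h\<bar>)) *\<^sub>R cmul (lag_weight W (b T) T \<xi> h / of_real (2 * pi * real T)) (autocov h) = (1 / (2 * pi)) *\<^sub>R mean_term T \<xi> h"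
      using assms by (simp only: cmul_cmul[symmetric] cmul_of_real) (simp add: mean_term_def)
  qed
  also have "\<dots> = (1 / (2 * pi)) *\<^sub>R (\<Sum>h | h \<in> UNIV \<and> mean_term T \<xi> h \<noteq> 0. mean_term T \<xi> h)"
    unfolding scaleR_sum_right[symmetric] using supp by (intro arg_cong[where f = "scaleR _"] sum.mono_neutral_right) auto
  finally show ?thesis unfolding lebesgue_integral_count_space_finite_support[OF fin] .
qed

lemma triangular_weight_tendsto: "(\<lambda>T. real (nat (int T - \<bar>h\<bar>)) / real T) \<longlonglongrightarrow> 1"
proof -
  have "(\<lambda>T. 1 - of_int \<bar>h\<bar> / real T) \<longlonglongrightarrow> 1 - 0"
    by (intro tendsto_diff tendsto_const real_tendsto_divide_at_top[OF tendsto_const filterlim_real_sequentially])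
  moreover have "eventually (\<lambda>T. 1 - of_int \<bar>h\<bar> / real T = real (nat (int T - \<bar>h\<bar>)) / real T) sequentially"
    using eventually_gt_at_top[of "nat \<bar>h\<bar>"]
  proof eventually_elim
    case (elim T)
    then have "real (nat (int T - \<bar>h\<bar>)) = real T - of_int \<bar>h\<bar>" by linarith
    then show ?case using elim by (simp add: diff_divide_distrib)
  qed
  ultimately show ?thesis by (simp add: tendsto_cong)
qed

text \<open>Dominated convergence over the lags: each term converges by
  \<open>lag_weight_tendsto\<close> and is bounded by \<open>2 * w\<^sub>0\<close> times a summable
  norm.\<close>

lemma mean_estimator_tendsto:
  assumes \<xi>: "-pi < \<xi>" "\<xi> < pi"
  shows "(\<lambda>T. mean_estimator T \<xi>) \<longlonglongrightarrow> spec \<xi>"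
proof -
  have "(\<lambda>T. LINT h|count_space UNIV. mean_term T \<xi> h) \<longlonglongrightarrow> (LINT h|count_space UNIV. cmul (cis (- \<xi> * of_int h)) (autocov h))"
  proof (rule integral_dominated_convergence[where w = "\<lambda>h. 2 * w\<^sub>0 * norm (autocov h)"])
    show "integrable (count_space UNIV) (\<lambda>h. 2 * w\<^sub>0 * norm (autocov h))"
      using autocov_summable abs_summable_equivalent[of autocov UNIV]
      by (intro integrable_mult_right integrable_norm) (simp add: abs_summable_on_def)
    show "AE h in count_space UNIV. (\<lambda>T. mean_term T \<xi> h) \<longlonglongrightarrow> cmul (cis (- \<xi> * of_int h)) (autocov h)"
    proof (rule AE_I2)
      fix h
      have "(\<lambda>T. (real (nat (int T - \<bar>h\<bar>)) / real T) *\<^sub>R cmul (lag_weight W (b T) T \<xi> h) (autocov h)) \<longlonglongrightarrow> 1 *\<^sub>R cmul (cis (- \<xi> * of_int h)) (autocov h)"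
        by (intro tendsto_scaleR triangular_weight_tendsto cmul.tendsto tendsto_const lag_weight_tendsto[OF \<xi> b_tendsto b_pos bT_at_top])
      moreover have "eventually (\<lambda>T. (real (nat (int T - \<bar>h\<bar>)) / real T) *\<^sub>R cmul (lag_weight W (b T) T \<xi> h) (autocov h) = mean_term T \<xi> h) sequentially"
        using eventually_regular by eventually_elim (simp add: mean_term_def)
      ultimately show "(\<lambda>T. mean_term T \<xi> h) \<longlonglongrightarrow> cmul (cis (- \<xi> * of_int h)) (autocov h)"
        by (simp add: tendsto_cong)
    qed
    show "AE h in count_space UNIV. norm (mean_term T \<xi> h) \<le> 2 * w\<^sub>0 * norm (autocov h)" for T
    proof (rule AE_I2)
      fix h
      show "norm (mean_term T \<xi> h) \<le> 2 * w\<^sub>0 * norm (autocov h)"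
      proof (cases "regular T")
        case True
        then have "real (nat (int T - \<bar>h\<bar>)) / real T \<le> 1" by (simp add: regular_def)
        then have "(real (nat (int T - \<bar>h\<bar>)) / real T) * cmod (lag_weight W (b T) T \<xi> h) \<le> 1 * (2 * w\<^sub>0)"
          using True by (intro mult_mono norm_lag_weight_le) (auto simp: regular_def)
        from mult_right_mono[OF this norm_ge_zero[of "autocov h"]] show ?thesis
          using True by (simp add: mean_term_def norm_cmul mult.assoc)
      qed (simp add: mean_term_def w0_nonneg)
    qed
  qed auto
  moreover have "(LINT h|count_space UNIV. cmul (cis (- \<xi> * of_int h)) (autocov h)) = (\<Sum>\<^sub>\<infinity>h\<in>UNIV. cmul (cis (- \<xi> * of_int h)) (autocov h))"
    using spec_abs_summable[of \<xi>] abs_summable_equivalent[of "\<lambda>h. cmul (cis (- \<xi> * of_int h)) (autocov h)" UNIV]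
    by (subst infsetsum_infsum[symmetric]) (auto simp: infsetsum_def)
  ultimately have "(\<lambda>T. (1 / (2 * pi)) *\<^sub>R (LINT h|count_space UNIV. mean_term T \<xi> h)) \<longlonglongrightarrow> spec \<xi>"
    unfolding spec_def by (simp add: tendsto_scaleR)
  moreover have "eventually (\<lambda>T. (1 / (2 * pi)) *\<^sub>R (LINT h|count_space UNIV. mean_term T \<xi> h) = mean_estimator T \<xi>) sequentially"
    using eventually_regular by eventually_elim (rule mean_estimator_integral[symmetric])
  ultimately show ?thesis by (simp add: tendsto_cong)
qed

definition est :: "nat \<Rightarrow> real \<Rightarrow> 'w \<Rightarrow> kernel_L2" where
  "est T \<xi> \<omega> = estimator W (b T) T \<xi> (\<lambda>s. X s \<omega>)"

definition band_power :: "nat \<Rightarrow> real \<Rightarrow> 'w \<Rightarrow> real" where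
  "band_power T \<xi> \<omega> = total_power W (b T) T \<xi> (\<lambda>s. X s \<omega>)"

definition err :: "nat \<Rightarrow> real \<Rightarrow> 'w \<Rightarrow> real" where
  "err T \<xi> \<omega> = norm (est T \<xi> \<omega> - spec \<xi>)"

lemma all_moments_est: "all_moments (est T \<xi>)"
  unfolding est_def[abs_def] estimator_def by (intro all_moments_quadratic all_moments_X) auto

lemma all_moments_err: "all_moments (err T \<xi>)"
proof -
  have "all_moments (\<lambda>\<omega>. est T \<xi> \<omega> + (- spec \<xi>))" by (intro all_moments_add all_moments_est all_moments_const)
  then show ?thesis unfolding err_def[abs_def] by (simp add: all_moments_norm)
qed

lemma deviation_bound:
  assumes "regular T"
  shows "expectation (\<lambda>\<omega>. norm (est T \<xi> \<omega> - mean_estimator T \<xi>)) \<le> 2 * sqrt (2 * tensor_var) * \<alpha>\<^sup>2 * sqrt (2 * w\<^sub>0\<^sup>2 / (2 * pi)\<^sup>2 / (b T * real T))"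
proof -
  let ?d = "2 * pi * real T"
  have "(\<Sum>s=1..int T. \<Sum>t=1..int T. (cmod (lag_weight W (b T) T \<xi> (s - t) / of_real ?d))\<^sup>2)
      = (\<Sum>s=1..int T. \<Sum>t=1..int T. (cmod (lag_weight W (b T) T \<xi> (s - t)))\<^sup>2) / ?d\<^sup>2"
    by (simp add: norm_divide norm_mult power_divide sum_divide_distrib)
  also have "\<dots> \<le> (2 * w\<^sub>0\<^sup>2 * (real T)\<^sup>2 / (b T * real T)) / ?d\<^sup>2"
    using assms by (intro divide_right_mono sum_lag_weight_sq_le) (auto simp: regular_def)
  also have "\<dots> = 2 * w\<^sub>0\<^sup>2 / (2 * pi)\<^sup>2 / (b T * real T)"
    using assms by (simp add: regular_def power2_eq_square)
  finally have le: "(\<Sum>s=1..int T. \<Sum>t=1..int T. (cmod (lag_weight W (b T) T \<xi> (s - t) / of_real ?d))\<^sup>2) \<le> 2 * w\<^sub>0\<^sup>2 / (2 * pi)\<^sup>2 / (b T * real T)" .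
  show ?thesis
    unfolding est_def estimator_def mean_estimator_def
    by (rule order_trans[OF quadratic_deviation]) (use tensor_var_nonneg in \<open>(intro mult_left_mono real_sqrt_le_mono le finite_atLeastAtMost_int; simp)+\<close>)
qed

lemma expectation_err_tendsto:
  assumes \<xi>: "-pi < \<xi>" "\<xi> < pi"
  shows "(\<lambda>T. expectation (err T \<xi>)) \<longlonglongrightarrow> 0"
proof (rule tendsto_sandwich[OF _ _ tendsto_const])
  let ?g = "\<lambda>T. 2 * sqrt (2 * tensor_var) * \<alpha>\<^sup>2 * sqrt (2 * w\<^sub>0\<^sup>2 / (2 * pi)\<^sup>2 / (b T * real T)) + norm (mean_estimator T \<xi> - spec \<xi>)"
  show "eventually (\<lambda>T. 0 \<le> expectation (err T \<xi>)) sequentially"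
    by (intro always_eventually allI integral_nonneg_AE) (simp add: err_def)
  show "eventually (\<lambda>T. expectation (err T \<xi>) \<le> ?g T) sequentially"
    using eventually_regular
  proof eventually_elim
    case (elim T)
    have "all_moments (\<lambda>\<omega>. est T \<xi> \<omega> + (- mean_estimator T \<xi>))" by (intro all_moments_add all_moments_est all_moments_const)
    then have i: "integrable M (\<lambda>\<omega>. norm (est T \<xi> \<omega> - mean_estimator T \<xi>))"
      by (intro integrable_norm all_moments_integrable) simp
    have "expectation (err T \<xi>) \<le> expectation (\<lambda>\<omega>. norm (est T \<xi> \<omega> - mean_estimator T \<xi>) + norm (mean_estimator T \<xi> - spec \<xi>))"
    proof (rule integral_mono)
      show "err T \<xi> \<omega> \<le> norm (est T \<xi> \<omega> - mean_estimator T \<xi>) + norm (mean_estimator T \<xi> - spec \<xi>)" for \<omega>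
        unfolding err_def using norm_triangle_ineq[of "est T \<xi> \<omega> - mean_estimator T \<xi>" "mean_estimator T \<xi> - spec \<xi>"] by simp
    qed (use i all_moments_integrable[OF all_moments_err] in auto)
    also have "\<dots> = expectation (\<lambda>\<omega>. norm (est T \<xi> \<omega> - mean_estimator T \<xi>)) + norm (mean_estimator T \<xi> - spec \<xi>)"
      using i by (simp add: prob_space)
    finally show ?case using deviation_bound[OF elim, of \<xi>] by linarith
  qed
  have "(\<lambda>T. 2 * sqrt (2 * tensor_var) * \<alpha>\<^sup>2 * sqrt (2 * w\<^sub>0\<^sup>2 / (2 * pi)\<^sup>2 / (b T * real T)) + norm (mean_estimator T \<xi> - spec \<xi>))
      \<longlonglongrightarrow> 2 * sqrt (2 * tensor_var) * \<alpha>\<^sup>2 * sqrt 0 + 0"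
    by (intro tendsto_add tendsto_mult tendsto_const tendsto_real_sqrt real_tendsto_divide_at_top[OF tendsto_const bT_at_top]
        tendsto_norm_zero LIM_zero mean_estimator_tendsto[OF \<xi>])
  then show "?g \<longlonglongrightarrow> 0" by simp
qed

text \<open>The squared cosines and sines sum to at most \<open>T\<close>, so
  \<open>linear_combination_moment\<close> gives a bound proportional to \<open>T ^ Suc p\<close>,
  which the normalisation \<open>1 / (2 * pi * T)\<close> cancels. The result is uniform in the
  frequency and in \<open>T\<close>.\<close>

lemma periodogram_moment:
  assumes T: "T > 0"
  shows "all_moments (\<lambda>\<omega>. periodogram_norm T t (\<lambda>s. X s \<omega>))"
    and "expectation (\<lambda>\<omega>. periodogram_norm T t (\<lambda>s. X s \<omega>) ^ Suc p) \<le> 2 * normal_moment (Suc p) * (\<alpha>\<^sup>2 * noise_trace / pi) ^ Suc p"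
proof -
  let ?C = "\<lambda>\<omega>. cos_transform T t (\<lambda>s. X s \<omega>)" and ?S = "\<lambda>\<omega>. sin_transform T t (\<lambda>s. X s \<omega>)"
  have m: "all_moments ?C" "all_moments ?S"
    unfolding cos_transform_def sin_transform_def
    by (intro all_moments_sum all_moments_bounded_linear[OF bounded_linear_scaleR_right] all_moments_X; simp)+
  have i: "integrable M (\<lambda>\<omega>. norm (?C \<omega>) ^ q)" "integrable M (\<lambda>\<omega>. norm (?S \<omega>) ^ q)" for q
    using all_moments_power[OF m(1)] all_moments_power[OF m(2)] by auto
  have "all_moments (\<lambda>\<omega>. (1 / (2 * pi * real T)) *\<^sub>R ((norm (?C \<omega>) * norm (?C \<omega>)) + (norm (?S \<omega>) * norm (?S \<omega>))))"
    by (intro all_moments_bounded_linear[OF bounded_linear_scaleR_right] all_moments_add all_moments_mult all_moments_norm m)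
  then show am: "all_moments (\<lambda>\<omega>. periodogram_norm T t (\<lambda>s. X s \<omega>))"
    by (simp add: periodogram_norm_def power2_eq_square)
  let ?B = "\<alpha> ^ (2 * Suc p) * (normal_moment (Suc p) * (noise_trace * real T) ^ Suc p)"
  have B: "expectation (\<lambda>\<omega>. norm (?C \<omega>) ^ (2 * Suc p)) \<le> ?B" "expectation (\<lambda>\<omega>. norm (?S \<omega>) ^ (2 * Suc p)) \<le> ?B"
  proof -
    have *: "\<alpha> ^ (2 * Suc p) * (normal_moment (Suc p) * (noise_trace * (\<Sum>s=1..int T. (a s)\<^sup>2)) ^ Suc p) \<le> ?B"
      if "\<And>s. (a s)\<^sup>2 \<le> 1" for a :: "int \<Rightarrow> real"
    proof -
      have "(\<Sum>s=1..int T. (a s)\<^sup>2) \<le> real T" using sum_mono[of "{1..int T}" "\<lambda>s. (a s)\<^sup>2" "\<lambda>_. 1"] that by simp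
      then show ?thesis using noise_trace_nonneg \<alpha>_nonneg
        by (intro mult_left_mono power_mono) (auto intro!: mult_nonneg_nonneg sum_nonneg)
    qed
    show "expectation (\<lambda>\<omega>. norm (?C \<omega>) ^ (2 * Suc p)) \<le> ?B"
      unfolding cos_transform_def by (rule order_trans[OF linear_combination_moment *]) (auto simp: abs_square_le_1)
    show "expectation (\<lambda>\<omega>. norm (?S \<omega>) ^ (2 * Suc p)) \<le> ?B"
      unfolding sin_transform_def by (rule order_trans[OF linear_combination_moment *]) (auto simp: abs_square_le_1)
  qed
  have pw: "(u + v) ^ Suc p \<le> 2 ^ Suc p * (u ^ Suc p + v ^ Suc p)" if "u \<ge> 0" "v \<ge> 0" for u v :: real
  proof -
    have "(u + v) ^ Suc p \<le> (2 * max u v) ^ Suc p" using that by (intro power_mono) auto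
    also have "\<dots> = 2 ^ Suc p * max u v ^ Suc p" by (simp only: power_mult_distrib)
    also have "\<dots> \<le> 2 ^ Suc p * (u ^ Suc p + v ^ Suc p)" using that by (intro mult_left_mono) (auto simp: max_def)
    finally show ?thesis .
  qed
  let ?k = "2 ^ Suc p / (2 * pi * real T) ^ Suc p"
  have "expectation (\<lambda>\<omega>. periodogram_norm T t (\<lambda>s. X s \<omega>) ^ Suc p) \<le> expectation (\<lambda>\<omega>. ?k * (norm (?C \<omega>) ^ (2 * Suc p) + norm (?S \<omega>) ^ (2 * Suc p)))"
  proof (rule integral_mono)
    show "integrable M (\<lambda>\<omega>. periodogram_norm T t (\<lambda>s. X s \<omega>) ^ Suc p)"
      using all_moments_power[OF am, of "Suc p"] by (simp only: real_norm_def abs_of_nonneg[OF periodogram_norm_nonneg])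
    show "periodogram_norm T t (\<lambda>s. X s \<omega>) ^ Suc p \<le> ?k * (norm (?C \<omega>) ^ (2 * Suc p) + norm (?S \<omega>) ^ (2 * Suc p))" for \<omega>
      using divide_right_mono[OF pw[of "(norm (?C \<omega>))\<^sup>2" "(norm (?S \<omega>))\<^sup>2"], of "(2 * pi * real T) ^ Suc p"]
      unfolding periodogram_norm_def power_divide power_mult by (simp only: zero_le_power2 zero_le_power times_divide_eq_left simp_thms) (simp del: power_Suc)
  qed (intro integrable_mult_right Bochner_Integration.integrable_add i)
  also have "\<dots> = ?k * (expectation (\<lambda>\<omega>. norm (?C \<omega>) ^ (2 * Suc p)) + expectation (\<lambda>\<omega>. norm (?S \<omega>) ^ (2 * Suc p)))"
    by (simp only: integral_mult_right_zero Bochner_Integration.integral_add[OF i])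
  also have "\<dots> \<le> ?k * (?B + ?B)" by (intro mult_left_mono add_mono B) simp
  also have "\<dots> = 2 * normal_moment (Suc p) * (\<alpha>\<^sup>2 * noise_trace / pi) ^ Suc p"
    using T unfolding power_mult_distrib power_divide power_mult by (simp add: field_simps del: power_Suc)
  finally show "expectation (\<lambda>\<omega>. periodogram_norm T t (\<lambda>s. X s \<omega>) ^ Suc p) \<le> 2 * normal_moment (Suc p) * (\<alpha>\<^sup>2 * noise_trace / pi) ^ Suc p" .
qed

text \<open>The argument is shifted: \<open>band_power_bound p\<close> belongs to the moment of
  order \<open>p + 1\<close>. The factor \<open>2 * w\<^sub>0\<close> bounds the total weight of the
  taper.\<close>

definition band_power_bound :: "nat \<Rightarrow> real" where
  "band_power_bound p = (2 * w\<^sub>0) ^ Suc p * (2 * normal_moment (Suc p) * (\<alpha>\<^sup>2 * noise_trace / pi) ^ Suc p)"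

lemma all_moments_band_power: "T > 0 \<Longrightarrow> all_moments (band_power T \<xi>)"
  unfolding band_power_def[abs_def] total_power_def
  by (intro all_moments_sum all_moments_bounded_linear[OF bounded_linear_mult_right] periodogram_moment(1)) auto

lemma band_power_nonneg: "regular T \<Longrightarrow> band_power T \<xi> \<omega> \<ge> 0"
  unfolding band_power_def regular_def by (intro total_power_nonneg) auto

text \<open>Weighted power mean with the taper values as weights, whose total is bounded, so the
  moments are controlled by those of single periodograms.\<close>

lemma expectation_band_power_le:
  assumes r: "regular T"
  shows "expectation (\<lambda>\<omega>. band_power T \<xi> \<omega> ^ Suc p) \<le> band_power_bound p"
proof -
  let ?w = "\<lambda>t. taper W (b T) T \<xi> t" and ?P = "\<lambda>t \<omega>. periodogram_norm T t (\<lambda>s. X s \<omega>)"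
  let ?K = "2 * normal_moment (Suc p) * (\<alpha>\<^sup>2 * noise_trace / pi) ^ Suc p"
  have T: "T > 0" and bp: "b T > 0" using r by (auto simp: regular_def)
  have i: "integrable M (\<lambda>\<omega>. ?P t \<omega> ^ Suc p)" for t
    using all_moments_power[OF periodogram_moment(1)[OF T], of t "Suc p"] by (simp only: real_norm_def abs_of_nonneg[OF periodogram_norm_nonneg])
  have i2: "integrable M (\<lambda>\<omega>. band_power T \<xi> \<omega> ^ Suc p)"
    using all_moments_power[OF all_moments_band_power[OF T], of \<xi> "Suc p"] band_power_nonneg[OF r] by (simp only: real_norm_def abs_of_nonneg)
  have K0: "?K \<ge> 0" using noise_trace_nonneg by (simp del: power_Suc)
  have "expectation (\<lambda>\<omega>. band_power T \<xi> \<omega> ^ Suc p) \<le> expectation (\<lambda>\<omega>. (\<Sum>t\<in>freqs T. ?w t) ^ p * (\<Sum>t\<in>freqs T. ?w t * ?P t \<omega> ^ Suc p))"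
  proof (rule integral_mono[OF i2])
    show "integrable M (\<lambda>\<omega>. (\<Sum>t\<in>freqs T. ?w t) ^ p * (\<Sum>t\<in>freqs T. ?w t * ?P t \<omega> ^ Suc p))"
      by (intro integrable_mult_right Bochner_Integration.integrable_sum i)
    show "band_power T \<xi> \<omega> ^ Suc p \<le> (\<Sum>t\<in>freqs T. ?w t) ^ p * (\<Sum>t\<in>freqs T. ?w t * ?P t \<omega> ^ Suc p)" for \<omega>
      unfolding band_power_def total_power_def by (intro weighted_power_mean taper_nonneg bp periodogram_norm_nonneg) auto
  qed
  also have "\<dots> = (\<Sum>t\<in>freqs T. ?w t) ^ p * (\<Sum>t\<in>freqs T. ?w t * expectation (\<lambda>\<omega>. ?P t \<omega> ^ Suc p))"
    by (simp only: integral_mult_right_zero Bochner_Integration.integral_sum[OF integrable_mult_right[OF i]])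
  also have "\<dots> \<le> (\<Sum>t\<in>freqs T. ?w t) ^ p * (\<Sum>t\<in>freqs T. ?w t * ?K)"
    by (intro mult_left_mono sum_mono periodogram_moment(2) T taper_nonneg bp zero_le_power sum_nonneg)
  also have "\<dots> = (\<Sum>t\<in>freqs T. ?w t) ^ Suc p * ?K" by (simp only: sum_distrib_right[symmetric] power_Suc2 mult.assoc)
  also have "\<dots> \<le> (2 * w\<^sub>0) ^ Suc p * ?K"
    using r by (intro mult_right_mono power_mono sum_taper_le sum_nonneg taper_nonneg K0) (auto simp: regular_def)
  finally show ?thesis unfolding band_power_bound_def .
qed

lemma norm_est_le: "regular T \<Longrightarrow> norm (est T \<xi> \<omega>) \<le> 2 * band_power T \<xi> \<omega>"
  unfolding est_def band_power_def regular_def by (intro norm_estimator_le) auto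

end

section \<open>Integrals over the frequency as random variables\<close>

lemma (in prob_space) measurable_parameter_integral:
  fixes f :: "real \<Rightarrow> 'a \<Rightarrow> real"
  assumes f: "(\<lambda>(\<xi>, \<omega>). f \<xi> \<omega>) \<in> borel_measurable (borel \<Otimes>\<^sub>M M)" and S [measurable]: "S \<in> sets borel"
  shows "(\<lambda>\<omega>. LBINT \<xi>:S. f \<xi> \<omega>) \<in> borel_measurable M"
  unfolding set_lebesgue_integral_def
proof (rule lborel.borel_measurable_lebesgue_integral)
  have [measurable]: "(\<lambda>x. f (snd x) (fst x)) \<in> borel_measurable (M \<Otimes>\<^sub>M lborel)"
    using measurable_compose[OF measurable_pair_swap' f] by (simp add: case_prod_beta cong: measurable_cong_sets)
  have [measurable]: "S \<in> sets lborel" by simp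
  have "(\<lambda>x. indicat_real S (snd x) *\<^sub>R f (snd x) (fst x)) \<in> borel_measurable (M \<Otimes>\<^sub>M lborel)" by measurable
  then show "(\<lambda>(\<omega>, \<xi>). indicat_real S \<xi> *\<^sub>R f \<xi> \<omega>) \<in> borel_measurable (M \<Otimes>\<^sub>M lborel)"
    by (simp add: case_prod_beta)
qed

lemma (in prob_space) measurable_parameter_expectation:
  fixes f :: "real \<Rightarrow> 'a \<Rightarrow> real"
  assumes f: "(\<lambda>(\<xi>, \<omega>). f \<xi> \<omega>) \<in> borel_measurable (borel \<Otimes>\<^sub>M M)"
  shows "(\<lambda>\<xi>. expectation (f \<xi>)) \<in> borel_measurable borel"
proof (rule borel_measurable_lebesgue_integral)
  show "(\<lambda>(\<xi>, \<omega>). f \<xi> \<omega>) \<in> borel_measurable (borel \<Otimes>\<^sub>M M)" by (rule f)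
qed

text \<open>Tonelli. Path by path only an inequality can be claimed, because the integral of a path
  that is not integrable is 0 by convention.\<close>

lemma (in prob_space) nn_integral_parameter_integral_le:
  fixes f :: "real \<Rightarrow> 'a \<Rightarrow> real"
  assumes f: "(\<lambda>(\<xi>, \<omega>). f \<xi> \<omega>) \<in> borel_measurable (borel \<Otimes>\<^sub>M M)" and S [measurable]: "S \<in> sets borel"
    and nonneg: "\<And>\<xi> \<omega>. f \<xi> \<omega> \<ge> 0" and int: "\<And>\<xi>. integrable M (f \<xi>)"
  shows "(\<integral>\<^sup>+\<omega>. ennreal (LBINT \<xi>:S. f \<xi> \<omega>) \<partial>M) \<le> (\<integral>\<^sup>+\<xi>. ennreal (indicator S \<xi> * expectation (f \<xi>)) \<partial>lborel)"
proof -
  interpret pair_sigma_finite lborel M ..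
  have [measurable]: "(\<lambda>x. f (fst x) (snd x)) \<in> borel_measurable (lborel \<Otimes>\<^sub>M M)"
    using f by (simp add: case_prod_beta cong: measurable_cong_sets)
  have [measurable]: "S \<in> sets lborel" by simp
  have m: "(\<lambda>x. ennreal (indicator S (fst x) * f (fst x) (snd x))) \<in> borel_measurable (lborel \<Otimes>\<^sub>M M)" by measurable
  have "(\<integral>\<^sup>+\<omega>. ennreal (LBINT \<xi>:S. f \<xi> \<omega>) \<partial>M) \<le> (\<integral>\<^sup>+\<omega>. (\<integral>\<^sup>+\<xi>. ennreal (indicator S \<xi> * f \<xi> \<omega>) \<partial>lborel) \<partial>M)"
  proof (rule nn_integral_mono)
    fix \<omega>
    show "ennreal (LBINT \<xi>:S. f \<xi> \<omega>) \<le> (\<integral>\<^sup>+\<xi>. ennreal (indicator S \<xi> * f \<xi> \<omega>) \<partial>lborel)"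
    proof (cases "integrable lborel (\<lambda>\<xi>. indicator S \<xi> * f \<xi> \<omega>)")
      case True
      then show ?thesis using nn_integral_eq_integral[OF True] nonneg by (simp add: set_lebesgue_integral_def)
    next
      case False
      then show ?thesis by (simp add: set_lebesgue_integral_def not_integrable_integral_eq)
    qed
  qed
  also have "\<dots> = (\<integral>\<^sup>+\<xi>. (\<integral>\<^sup>+\<omega>. ennreal (indicator S \<xi> * f \<xi> \<omega>) \<partial>M) \<partial>lborel)"
    by (rule Fubini') (use m in \<open>simp add: case_prod_beta\<close>)
  also have "\<dots> = (\<integral>\<^sup>+\<xi>. ennreal (indicator S \<xi> * expectation (f \<xi>)) \<partial>lborel)"
    using nonneg int by (intro nn_integral_cong, subst nn_integral_eq_integral) auto
  finally show ?thesis .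
qed

text \<open>Stated with nonnegative integrals, so that integrability of \<open>Z n\<close> does not
  have to be checked first; negative values count as 0.\<close>

lemma (in prob_space) Markov_tendsto:
  fixes Z :: "nat \<Rightarrow> 'a \<Rightarrow> real"
  assumes Z [measurable]: "\<And>n. Z n \<in> borel_measurable M"
    and lim: "(\<lambda>n. \<integral>\<^sup>+\<omega>. ennreal (Z n \<omega>) \<partial>M) \<longlonglongrightarrow> 0" and \<eta>: "\<eta> > 0"
  shows "(\<lambda>n. prob {\<omega> \<in> space M. Z n \<omega> \<ge> \<eta>}) \<longlonglongrightarrow> 0"
proof -
  have le: "emeasure M {\<omega> \<in> space M. Z n \<omega> \<ge> \<eta>} \<le> ennreal (1 / \<eta>) * (\<integral>\<^sup>+\<omega>. ennreal (Z n \<omega>) \<partial>M)" for n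
  proof -
    have "emeasure M {\<omega> \<in> space M. Z n \<omega> \<ge> \<eta>} \<le> emeasure M ({\<omega> \<in> space M. 1 \<le> ennreal (1 / \<eta>) * ennreal (Z n \<omega>)})"
    proof (rule emeasure_mono)
      show "{\<omega> \<in> space M. \<eta> \<le> Z n \<omega>} \<subseteq> {\<omega> \<in> space M. 1 \<le> ennreal (1 / \<eta>) * ennreal (Z n \<omega>)}"
      proof safe
        fix \<omega> assume "\<eta> \<le> Z n \<omega>"
        then have "1 \<le> 1 / \<eta> * Z n \<omega>" using \<eta> by (simp add: field_simps)
        then have "ennreal 1 \<le> ennreal (1 / \<eta> * Z n \<omega>)" by (rule ennreal_leI)
        also have "\<dots> = ennreal (1 / \<eta>) * ennreal (Z n \<omega>)" using \<eta> by (intro ennreal_mult') simp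
        finally show "1 \<le> ennreal (1 / \<eta>) * ennreal (Z n \<omega>)" by simp
      qed
    qed measurable
    also have "\<dots> \<le> ennreal (1 / \<eta>) * (\<integral>\<^sup>+\<omega>. ennreal (Z n \<omega>) * indicator (space M) \<omega> \<partial>M)"
      using nn_integral_Markov_inequality[of "\<lambda>\<omega>. ennreal (Z n \<omega>)" "space M" M "ennreal (1 / \<eta>)"] by (simp add: Int_absorb2 Int_def)
    also have "\<dots> = ennreal (1 / \<eta>) * (\<integral>\<^sup>+\<omega>. ennreal (Z n \<omega>) \<partial>M)"
      by (intro arg_cong2[where f = "(*)"] nn_integral_cong refl) simp
    finally show ?thesis .
  qed
  have "(\<lambda>n. ennreal (1 / \<eta>) * (\<integral>\<^sup>+\<omega>. ennreal (Z n \<omega>) \<partial>M)) \<longlonglongrightarrow> ennreal (1 / \<eta>) * 0"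
    by (intro ennreal_tendsto_cmult lim) simp
  then have lim': "(\<lambda>n. ennreal (1 / \<eta>) * (\<integral>\<^sup>+\<omega>. ennreal (Z n \<omega>) \<partial>M)) \<longlonglongrightarrow> 0"
    by (simp only: mult_zero_right)
  have "(\<lambda>n. emeasure M {\<omega> \<in> space M. Z n \<omega> \<ge> \<eta>}) \<longlonglongrightarrow> 0"
    by (rule tendsto_sandwich[OF always_eventually always_eventually tendsto_const lim']) (intro allI le zero_le)+
  then have "(\<lambda>n. ennreal (prob {\<omega> \<in> space M. Z n \<omega> \<ge> \<eta>})) \<longlonglongrightarrow> ennreal 0"
    unfolding emeasure_eq_measure ennreal_0 .
  then show ?thesis
  proof (rule tendsto_ennrealD)
    show "\<forall>\<^sub>F n in sequentially. 0 \<le> prob {\<omega> \<in> space M. \<eta> \<le> Z n \<omega>}" by (intro always_eventually allI measure_nonneg)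
  qed simp
qed

context spectral_consistency
begin

lemma measurable_taper [measurable]: "(\<lambda>\<xi>. taper W a T \<xi> t) \<in> borel_measurable borel"
proof -
  have [measurable]: "W \<in> borel_measurable borel" by (intro borel_measurable_continuous_onI continuous_W)
  show ?thesis unfolding taper_def by measurable
qed

text \<open>The estimator is a finite sum of products of a function of \<open>\<xi>\<close> and a
  function of \<open>\<omega>\<close>, hence jointly measurable.\<close>

lemma measurable_est: "(\<lambda>(\<xi>, \<omega>). est T \<xi> \<omega>) \<in> borel_measurable (borel \<Otimes>\<^sub>M M)"
proof -
  have [measurable]: "(\<lambda>\<omega>. rank_one (cos_transform T t (\<lambda>s. X s \<omega>)) (sin_transform T t (\<lambda>s. X s \<omega>))) \<in> borel_measurable M" for t
    unfolding periodogram_rank_one[symmetric]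
    using all_moments_measurable[OF all_moments_quadratic[OF _ all_moments_X, of "{1..int T}" "\<lambda>s u. cis (- fourier_freq T t * of_int (s - u))"]]
    by (simp add: quadratic_def)
  show ?thesis unfolding est_def estimator_eq by measurable
qed

lemma measurable_band_power: "(\<lambda>(\<xi>, \<omega>). band_power T \<xi> \<omega>) \<in> borel_measurable (borel \<Otimes>\<^sub>M M)"
proof -
  have [measurable]: "(\<lambda>\<omega>. periodogram_norm T t (\<lambda>s. X s \<omega>)) \<in> borel_measurable M" for t
    unfolding periodogram_norm_def cos_transform_def sin_transform_def by measurable
  show ?thesis unfolding band_power_def total_power_def by measurable
qed

lemma measurable_err: "(\<lambda>(\<xi>, \<omega>). err T \<xi> \<omega>) \<in> borel_measurable (borel \<Otimes>\<^sub>M M)"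
  using measurable_est[of T] unfolding err_def case_prod_beta by measurable

text \<open>First and fourth power together dominate the powers in between, so one loss controls the
  error of both the squared distance and the fourth power in the studentizing factor.\<close>

definition loss :: "nat \<Rightarrow> real \<Rightarrow> 'w \<Rightarrow> real" where
  "loss T \<xi> \<omega> = err T \<xi> \<omega> + err T \<xi> \<omega> ^ 4"

definition integrated_loss :: "nat \<Rightarrow> 'w \<Rightarrow> real" where
  "integrated_loss T \<omega> = (LBINT \<xi>:{-pi..pi}. loss T \<xi> \<omega>)"

definition integrated_power :: "nat \<Rightarrow> 'w \<Rightarrow> real" where
  "integrated_power T \<omega> = (LBINT \<xi>:{-pi..pi}. (band_power T \<xi> \<omega>)\<^sup>2)"

lemma measurable_loss: "(\<lambda>(\<xi>, \<omega>). loss T \<xi> \<omega>) \<in> borel_measurable (borel \<Otimes>\<^sub>M M)"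
  using measurable_err[of T] unfolding loss_def case_prod_beta by measurable

lemma err_nonneg: "err T \<xi> \<omega> \<ge> 0" by (simp add: err_def)

lemma loss_nonneg: "loss T \<xi> \<omega> \<ge> 0" by (simp add: loss_def err_nonneg)

lemma measurable_integrated_loss [measurable]: "integrated_loss T \<in> borel_measurable M"
  unfolding integrated_loss_def[abs_def] by (intro measurable_parameter_integral measurable_loss) simp

lemma measurable_integrated_power [measurable]: "integrated_power T \<in> borel_measurable M"
  unfolding integrated_power_def[abs_def]
  by (intro measurable_parameter_integral) (use measurable_band_power[of T] in \<open>simp_all add: case_prod_beta\<close>)

lemma integrable_err_power: "integrable M (\<lambda>\<omega>. err T \<xi> \<omega> ^ p)"
  using all_moments_power[OF all_moments_err, of T \<xi> p] by (simp add: abs_of_nonneg err_nonneg)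

lemma integrable_loss: "integrable M (loss T \<xi>)"
  unfolding loss_def[abs_def] using integrable_err_power[of T \<xi> 1] integrable_err_power[of T \<xi> 4] by simp

lemma err_le: "regular T \<Longrightarrow> err T \<xi> \<omega> \<le> 2 * band_power T \<xi> \<omega> + spec_bound"
  unfolding err_def using norm_triangle_ineq4[of "est T \<xi> \<omega>" "spec \<xi>"] norm_est_le[of T \<xi> \<omega>] norm_spec_le[of \<xi>] by linarith

text \<open>From \<open>err \<le> 2 * band_power + spec_bound\<close> and
  \<open>(2 * u + v) ^ 5 \<le> 32 * (32 * u ^ 5 + v ^ 5)\<close>; the index 4 selects the fifth
  moment of the band power.\<close>

definition err_bound :: real where "err_bound = 32 * (32 * band_power_bound 4 + spec_bound ^ 5)"

lemma expectation_err_fifth: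
  assumes r: "regular T" shows "expectation (\<lambda>\<omega>. err T \<xi> \<omega> ^ 5) \<le> err_bound"
proof -
  have T: "T > 0" using r by (simp add: regular_def)
  have i: "integrable M (\<lambda>\<omega>. band_power T \<xi> \<omega> ^ 5)"
    using all_moments_power[OF all_moments_band_power[OF T], of \<xi> 5] band_power_nonneg[OF r] by (simp only: real_norm_def abs_of_nonneg)
  have pw: "(2 * u + v) ^ 5 \<le> 32 * (32 * u ^ 5 + v ^ 5)" if "u \<ge> 0" "v \<ge> 0" for u v :: real
  proof -
    have "(2 * u + v) ^ 5 \<le> (2 * max (2 * u) v) ^ 5" using that by (intro power_mono) auto
    also have "\<dots> = 32 * max (2 * u) v ^ 5" by (simp only: power_mult_distrib) simp
    also have "\<dots> \<le> 32 * ((2 * u) ^ 5 + v ^ 5)" using that by (intro mult_left_mono) (auto simp: max_def)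
    also have "\<dots> = 32 * (32 * u ^ 5 + v ^ 5)" by (simp add: power_mult_distrib)
    finally show ?thesis .
  qed
  have le: "err T \<xi> \<omega> ^ 5 \<le> 32 * (32 * band_power T \<xi> \<omega> ^ 5 + spec_bound ^ 5)" for \<omega>
    by (rule order_trans[OF power_mono[OF err_le[OF r] err_nonneg] pw[OF band_power_nonneg[OF r] spec_bound_nonneg]])
  have "expectation (\<lambda>\<omega>. err T \<xi> \<omega> ^ 5) \<le> expectation (\<lambda>\<omega>. 32 * (32 * band_power T \<xi> \<omega> ^ 5 + spec_bound ^ 5))"
    by (rule integral_mono[OF integrable_err_power _ le]) (use i in simp)
  also have "\<dots> = 32 * (32 * expectation (\<lambda>\<omega>. band_power T \<xi> \<omega> ^ 5) + spec_bound ^ 5)"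
    using i by (simp add: prob_space)
  also have "\<dots> \<le> err_bound"
    unfolding err_bound_def using expectation_band_power_le[OF r, of \<xi> 4] by simp
  finally show ?thesis .
qed

text \<open>Uniform in \<open>\<xi>\<close> and in regular \<open>T\<close>; the constant dominates
  the integrand when the limit is taken under the integral over frequencies.\<close>

lemma expectation_loss_le:
  assumes r: "regular T" shows "expectation (loss T \<xi>) \<le> 2 + 2 * err_bound"
proof -
  have pw: "x + x ^ 4 \<le> 2 + 2 * x ^ 5" if "x \<ge> 0" for x :: real
  proof (cases "x \<le> 1")
    case True
    then have "x ^ 4 \<le> 1" using that by (simp add: power_le_one)
    then show ?thesis using True that by (smt (verit) zero_le_power)
  next
    case False
    then have "x \<le> x ^ 5" "x ^ 4 \<le> x ^ 5" using power_increasing[of 1 5 x] power_increasing[of 4 5 x] by auto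
    then show ?thesis by linarith
  qed
  have "expectation (loss T \<xi>) \<le> expectation (\<lambda>\<omega>. 2 + 2 * err T \<xi> \<omega> ^ 5)"
    by (rule integral_mono[OF integrable_loss]) (use integrable_err_power in \<open>auto simp: loss_def intro!: pw err_nonneg\<close>)
  also have "\<dots> = 2 + 2 * expectation (\<lambda>\<omega>. err T \<xi> \<omega> ^ 5)" using integrable_err_power by (simp add: prob_space)
  finally show ?thesis using expectation_err_fifth[OF r, of \<xi>] by linarith
qed

text \<open>The fourth moment is interpolated between the first and the (bounded) fifth one.\<close>

lemma expectation_loss_tendsto:
  assumes \<xi>: "-pi < \<xi>" "\<xi> < pi"
  shows "(\<lambda>T. expectation (loss T \<xi>)) \<longlonglongrightarrow> 0"
proof (rule LIMSEQ_I)
  fix r :: real assume r: "r > 0"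
  have C0: "err_bound \<ge> 0"
  proof -
    obtain T where "regular T" using eventually_regular by (metis eventually_happens trivial_limit_sequentially)
    then have "expectation (\<lambda>\<omega>. err T 0 \<omega> ^ 5) \<le> err_bound" by (rule expectation_err_fifth)
    moreover have "expectation (\<lambda>\<omega>. err T 0 \<omega> ^ 5) \<ge> 0" by (simp add: err_nonneg)
    ultimately show ?thesis by linarith
  qed
  \<comment> \<open>This choice makes \<open>err_bound / K\<close> smaller than
    \<open>r / 2\<close>; the 1 keeps \<open>K\<close> positive when \<open>err_bound = 0\<close>
    and the inequality strict.\<close>
  define K where "K = 2 * (err_bound + 1) / r"
  have K: "K > 0" using r C0 by (simp add: K_def)
  \<comment> \<open>Below \<open>K\<close> the fourth power is at most \<open>K ^ 3 * x\<close>,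
    above it at most \<open>x ^ 5 / K\<close>.\<close>
  have pw: "x + x ^ 4 \<le> (1 + K ^ 3) * x + x ^ 5 / K" if "x \<ge> 0" for x :: real
  proof (cases "x \<le> K")
    case True
    then have "x ^ 3 * x \<le> K ^ 3 * x" using that by (intro mult_right_mono power_mono)
    moreover have "x ^ 5 / K \<ge> 0" using that K by simp
    moreover have "x ^ 4 = x ^ 3 * x" by (simp add: eval_nat_numeral)
    ultimately show ?thesis by (simp add: algebra_simps)
  next
    case False
    then have "x ^ 4 * K \<le> x ^ 4 * x" using that by (intro mult_left_mono) auto
    then have "x ^ 4 \<le> x ^ 5 / K" using K by (simp add: pos_le_divide_eq eval_nat_numeral mult_ac)
    moreover have "K ^ 3 * x \<ge> 0" using that K by simp
    ultimately show ?thesis by (simp add: algebra_simps)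
  qed
  have b: "expectation (loss T \<xi>) \<le> (1 + K ^ 3) * expectation (err T \<xi>) + err_bound / K" if "regular T" for T
  proof -
    have i1: "integrable M (err T \<xi>)" using integrable_err_power[of T \<xi> 1] by simp
    have "expectation (loss T \<xi>) \<le> expectation (\<lambda>\<omega>. (1 + K ^ 3) * err T \<xi> \<omega> + err T \<xi> \<omega> ^ 5 / K)"
      by (rule integral_mono[OF integrable_loss]) (use integrable_err_power[of T \<xi> 5] i1 in \<open>auto simp: loss_def intro!: pw err_nonneg\<close>)
    also have "\<dots> = (1 + K ^ 3) * expectation (err T \<xi>) + expectation (\<lambda>\<omega>. err T \<xi> \<omega> ^ 5) / K"
      using i1 integrable_err_power[of T \<xi> 5] by simp
    finally show ?thesis using expectation_err_fifth[OF that, of \<xi>] divide_right_mono[of _ err_bound K] K by fastforce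
  qed
  have lt: "err_bound / K < r / 2"
    using r C0 by (simp add: K_def field_simps)
  have "(\<lambda>T. (1 + K ^ 3) * expectation (err T \<xi>)) \<longlonglongrightarrow> (1 + K ^ 3) * 0"
    by (intro tendsto_mult tendsto_const expectation_err_tendsto[OF \<xi>])
  then have "eventually (\<lambda>T. (1 + K ^ 3) * expectation (err T \<xi>) < r / 2) sequentially"
    by (rule order_tendstoD(2)) (use r in simp)
  then have "eventually (\<lambda>T. norm (expectation (loss T \<xi>) - 0) < r) sequentially"
    using eventually_regular
  proof eventually_elim
    case (elim T)
    have "expectation (loss T \<xi>) \<ge> 0" by (simp add: loss_nonneg)
    then show ?case using b[OF elim(2)] elim(1) lt by (simp only: real_norm_def diff_zero abs_of_nonneg)
  qed
  then show "\<exists>no. \<forall>T\<ge>no. norm (expectation (loss T \<xi>) - 0) < r" by (simp add: eventually_sequentially)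
qed

text \<open>Tonelli exchanges expectation and frequency integral; the expected loss tends to 0 for
  every \<open>\<xi>\<close> in the range except the two end points, a null set, and is uniformly
  bounded.\<close>

lemma integrated_loss_tendsto: "(\<lambda>T. \<integral>\<^sup>+\<omega>. ennreal (integrated_loss T \<omega>) \<partial>M) \<longlonglongrightarrow> 0"
proof -
  \<comment> \<open>Setting \<open>g\<close> to 0 for irregular \<open>T\<close> makes the
    domination hold for all \<open>T\<close>, as dominated convergence demands.\<close>
  define g where "g T \<xi> = (if regular T then indicator {-pi..pi} \<xi> * expectation (loss T \<xi>) else 0)" for T \<xi>
  have gm [measurable]: "g T \<in> borel_measurable borel" for T
    using measurable_parameter_expectation[OF measurable_loss, of T] unfolding g_def[abs_def] by simp
  have ib: "integrable lborel (\<lambda>\<xi>::real. indicator {-pi..pi} \<xi> * (2 + 2 * err_bound))"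
    by (intro integrable_mult_left integrable_real_indicator) auto
  have gle: "norm (g T \<xi>) \<le> indicator {-pi..pi} \<xi> * (2 + 2 * err_bound)" for T \<xi>
  proof (cases "regular T")
    case True
    then show ?thesis using expectation_loss_le[OF True, of \<xi>] by (auto simp: g_def indicator_def loss_nonneg)
  next
    case False
    obtain T' where "regular T'" using eventually_regular by (metis eventually_happens trivial_limit_sequentially)
    moreover have "0 \<le> expectation (loss T' \<xi>)" by (simp add: loss_nonneg)
    ultimately have "0 \<le> 2 + 2 * err_bound" using expectation_loss_le[of T' \<xi>] by linarith
    then show ?thesis using False by (simp add: g_def)
  qed
  have ig: "integrable lborel (g T)" for T
    by (rule Bochner_Integration.integrable_bound[OF ib]) (auto intro!: AE_I2 order_trans[OF gle[unfolded real_norm_def]] simp del: abs_mult)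
  have "(\<lambda>T. LINT \<xi>|lborel. g T \<xi>) \<longlonglongrightarrow> integral\<^sup>L lborel (\<lambda>\<xi>::real. 0 :: real)"
  proof (rule integral_dominated_convergence[where w = "\<lambda>\<xi>. indicator {-pi..pi} \<xi> * (2 + 2 * err_bound)"])
    have "AE \<xi> in lborel. \<xi> \<noteq> -pi" "AE \<xi> in lborel. \<xi> \<noteq> pi" by (rule AE_lborel_singleton)+
    then show "AE \<xi> in lborel. (\<lambda>T. g T \<xi>) \<longlonglongrightarrow> 0"
    proof eventually_elim
      case (elim \<xi>)
      show ?case
      proof (cases "\<xi> \<in> {-pi..pi}")
        case True
        then have "(\<lambda>T. expectation (loss T \<xi>)) \<longlonglongrightarrow> 0" using elim by (intro expectation_loss_tendsto) auto
        moreover have "eventually (\<lambda>T. expectation (loss T \<xi>) = g T \<xi>) sequentially"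
          using eventually_regular by eventually_elim (use True in \<open>simp add: g_def\<close>)
        ultimately show ?thesis by (simp add: tendsto_cong)
      next
        case False
        then have "g T \<xi> = 0" for T by (simp add: g_def indicator_def)
        then show ?thesis by simp
      qed
    qed
  qed (use gle ib in auto)
  then have "(\<lambda>T. ennreal (LINT \<xi>|lborel. g T \<xi>)) \<longlonglongrightarrow> ennreal (integral\<^sup>L lborel (\<lambda>\<xi>::real. 0 :: real))"
    by (rule tendsto_ennrealI)
  then have lim: "(\<lambda>T. ennreal (LINT \<xi>|lborel. g T \<xi>)) \<longlonglongrightarrow> 0" by simp
  have "eventually (\<lambda>T. (\<integral>\<^sup>+\<omega>. ennreal (integrated_loss T \<omega>) \<partial>M) \<le> ennreal (LINT \<xi>|lborel. g T \<xi>)) sequentially"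
    using eventually_regular
  proof eventually_elim
    case (elim T)
    have "(\<integral>\<^sup>+\<omega>. ennreal (integrated_loss T \<omega>) \<partial>M) \<le> (\<integral>\<^sup>+\<xi>. ennreal (indicator {-pi..pi} \<xi> * expectation (loss T \<xi>)) \<partial>lborel)"
      unfolding integrated_loss_def by (intro nn_integral_parameter_integral_le measurable_loss loss_nonneg integrable_loss) simp
    also have "\<dots> = (\<integral>\<^sup>+\<xi>. ennreal (g T \<xi>) \<partial>lborel)" using elim by (simp add: g_def)
    also have "\<dots> = ennreal (LINT \<xi>|lborel. g T \<xi>)"
      by (rule nn_integral_eq_integral[OF ig]) (simp add: g_def loss_nonneg)
    finally show ?case .
  qed
  then show ?thesis by (intro tendsto_sandwich[OF _ _ tendsto_const lim]) auto
qed

lemma expectation_integrated_power_le: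
  assumes r: "regular T"
  shows "(\<integral>\<^sup>+\<omega>. ennreal (integrated_power T \<omega>) \<partial>M) \<le> ennreal (2 * pi * band_power_bound 1)"
proof -
  have i: "integrable M (\<lambda>\<omega>. (band_power T \<xi> \<omega>)\<^sup>2)" for \<xi>
    using all_moments_power[OF all_moments_band_power, of T \<xi> 2] r by (simp add: regular_def)
  have le: "expectation (\<lambda>\<omega>. (band_power T \<xi> \<omega>)\<^sup>2) \<le> band_power_bound 1" for \<xi>
    using expectation_band_power_le[OF r, of \<xi> 1] by (simp add: numeral_2_eq_2)
  have 0: "band_power_bound 1 \<ge> 0" by (rule order_trans[OF _ le[of 0]]) simp
  have "(\<integral>\<^sup>+\<omega>. ennreal (integrated_power T \<omega>) \<partial>M) \<le> (\<integral>\<^sup>+\<xi>. ennreal (indicator {-pi..pi} \<xi> * expectation (\<lambda>\<omega>. (band_power T \<xi> \<omega>)\<^sup>2)) \<partial>lborel)"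
    unfolding integrated_power_def using i measurable_band_power[of T]
    by (intro nn_integral_parameter_integral_le) (auto simp: case_prod_beta)
  also have "\<dots> \<le> (\<integral>\<^sup>+\<xi>. ennreal (band_power_bound 1) * indicator {-pi..pi} \<xi> \<partial>lborel)"
    by (intro nn_integral_mono) (use le in \<open>auto simp: indicator_def simp del: One_nat_def intro!: ennreal_leI\<close>)
  also have "\<dots> = ennreal (2 * pi * band_power_bound 1)"
    using 0 by (subst nn_integral_cmult_indicator) (auto simp: ennreal_mult[symmetric] mult_ac simp del: One_nat_def)
  finally show ?thesis .
qed

text \<open>The centering enters the rescaled statistic divided by \<open>b * T\<close>; bounded
  means of the integrated power are therefore enough.\<close>

lemma integrated_power_tendsto: "(\<lambda>T. \<integral>\<^sup>+\<omega>. ennreal (integrated_power T \<omega> / (b T * real T)) \<partial>M) \<longlonglongrightarrow> 0"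
proof -
  have "(\<lambda>T. 2 * pi * band_power_bound 1 / (b T * real T)) \<longlonglongrightarrow> 0"
    by (rule real_tendsto_divide_at_top[OF tendsto_const bT_at_top])
  then have "(\<lambda>T. ennreal (2 * pi * band_power_bound 1 / (b T * real T))) \<longlonglongrightarrow> ennreal 0"
    by (rule tendsto_ennrealI)
  then have lim: "(\<lambda>T. ennreal (2 * pi * band_power_bound 1 / (b T * real T))) \<longlonglongrightarrow> 0"
    by (simp only: ennreal_0)
  have "eventually (\<lambda>T. (\<integral>\<^sup>+\<omega>. ennreal (integrated_power T \<omega> / (b T * real T)) \<partial>M) \<le> ennreal (2 * pi * band_power_bound 1 / (b T * real T))) sequentially"
    using eventually_regular
  proof eventually_elim
    case (elim T)
    have p: "b T * real T > 0" using elim by (simp add: regular_def)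
    have "ennreal (integrated_power T \<omega> / (b T * real T)) = ennreal (1 / (b T * real T)) * ennreal (integrated_power T \<omega>)" for \<omega>
      using p by (subst ennreal_mult'[symmetric]) auto
    then have "(\<integral>\<^sup>+\<omega>. ennreal (integrated_power T \<omega> / (b T * real T)) \<partial>M) = ennreal (1 / (b T * real T)) * (\<integral>\<^sup>+\<omega>. ennreal (integrated_power T \<omega>) \<partial>M)"
      by (simp add: nn_integral_cmult)
    also have "\<dots> \<le> ennreal (1 / (b T * real T)) * ennreal (2 * pi * band_power_bound 1)"
      by (intro mult_left_mono expectation_integrated_power_le elim) simp
    also have "\<dots> = ennreal (2 * pi * band_power_bound 1 / (b T * real T))"
      using p by (subst ennreal_mult'[symmetric]) auto
    finally show ?case .
  qed
  then show ?thesis by (intro tendsto_sandwich[OF _ _ tendsto_const lim]) auto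
qed

text \<open>The constant depends on \<open>T\<close> and on the path; it serves integrability over
  the frequencies, not the limit.\<close>

lemma band_power_bounded:
  assumes r: "regular T"
  shows "\<exists>K. \<forall>\<xi>. band_power T \<xi> \<omega> \<le> K"
proof (intro exI allI)
  fix \<xi>
  show "band_power T \<xi> \<omega> \<le> (\<Sum>t\<in>freqs T. w\<^sub>0 / (b T * real T) * periodogram_norm T t (\<lambda>s. X s \<omega>))"
    unfolding band_power_def total_power_def taper_def
    using r by (intro sum_mono mult_right_mono divide_right_mono W_le periodogram_norm_nonneg) (simp add: regular_def)
qed

lemma err_bounded:
  assumes r: "regular T"
  shows "\<exists>K. \<forall>\<xi>. err T \<xi> \<omega> \<le> K"
proof -
  obtain K where K: "\<forall>\<xi>. band_power T \<xi> \<omega> \<le> K" using band_power_bounded[OF r] by blast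
  have "err T \<xi> \<omega> \<le> 2 * K + spec_bound" for \<xi> using err_le[OF r, of \<xi> \<omega>] K[rule_format, of \<xi>] by linarith
  then show ?thesis by blast
qed

end

section \<open>Processes with jointly measurable point values\<close>

text \<open>In a separable metric space every open set is a countable union of balls with centres in
  a dense set and rational radii, and the preimage of a ball is described by a distance.\<close>

lemma borel_measurable_of_dist:
  fixes f :: "'a \<Rightarrow> 'b::{metric_space, second_countable_topology}"
  assumes d [measurable]: "\<And>y. (\<lambda>x. dist y (f x)) \<in> borel_measurable M"
  shows "f \<in> borel_measurable M"
proof (rule borel_measurableI)
  fix U :: "'b set" assume U: "open U"
  obtain D :: "'b set" where D: "countable D" "\<And>V. open V \<Longrightarrow> V \<noteq> {} \<Longrightarrow> \<exists>d\<in>D. d \<in> V"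
    by (rule countable_dense_setE) blast
  define I where "I = {(d, q). d \<in> D \<and> q \<in> \<rat> \<and> ball d q \<subseteq> U}"
  have "I \<subseteq> D \<times> \<rat>" by (auto simp: I_def)
  then have I: "countable I" by (rule countable_subset) (simp add: D(1) countable_rat)
  have "U = (\<Union>i\<in>I. ball (fst i) (snd i))"
  proof (intro equalityI subsetI)
    fix u assume "u \<in> U"
    then obtain r where r: "r > 0" "ball u r \<subseteq> U" using U open_contains_ball by blast
    obtain d where d: "d \<in> D" "d \<in> ball u (r / 2)" using D(2)[of "ball u (r / 2)"] r by auto
    have "dist u d < r / 2" using d by simp
    then obtain q where q: "q \<in> \<rat>" "dist u d < q" "q < r / 2" by (rule Rats_dense_in_real[elim_format]) auto
    have "ball d q \<subseteq> ball u r"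
    proof
      fix z assume "z \<in> ball d q"
      then show "z \<in> ball u r" using q dist_triangle[of u z d] by simp
    qed
    then have "(d, q) \<in> I" using d q r by (auto simp: I_def)
    moreover have "u \<in> ball d q" using q by (simp add: dist_commute)
    ultimately show "u \<in> (\<Union>i\<in>I. ball (fst i) (snd i))" by force
  qed (auto simp: I_def)
  then have "f -` U \<inter> space M = (\<Union>i\<in>I. {x \<in> space M. dist (fst i) (f x) < snd i})"
    by (intro set_eqI) (simp, blast)
  also have "\<dots> \<in> sets M" by (rule sets.countable_UN''[OF I]) auto
  finally show "f -` U \<inter> space M \<in> sets M" .
qed

text \<open>Passes from point values to random elements: the distance to a fixed element is the root
  of an integral of a jointly measurable function, so \<open>borel_measurable_of_dist\<close>
  applies.\<close>

lemma measurable_abs_L2: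
  fixes f :: "'w \<Rightarrow> real \<Rightarrow> real"
  assumes f [measurable]: "(\<lambda>(\<omega>, \<sigma>). f \<omega> \<sigma>) \<in> borel_measurable (M \<Otimes>\<^sub>M unit_cube)"
    and sq: "\<And>\<omega>. \<omega> \<in> space M \<Longrightarrow> square_integrable (f \<omega>)"
  shows "(\<lambda>\<omega>. abs_L2 (f \<omega>)) \<in> borel_measurable M"
proof (rule borel_measurable_of_dist)
  fix y :: real_L2
  have [measurable]: "(\<lambda>\<omega>. LINT \<sigma>|unit_cube. (norm (rep_L2 y \<sigma> - f \<omega> \<sigma>))\<^sup>2) \<in> borel_measurable M"
    by measurable
  have "dist y (abs_L2 (f \<omega>)) = sqrt (LINT \<sigma>|unit_cube. (norm (rep_L2 y \<sigma> - f \<omega> \<sigma>))\<^sup>2)" if "\<omega> \<in> space M" for \<omega>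
  proof -
    have "y - abs_L2 (f \<omega>) = abs_L2 (\<lambda>\<sigma>. rep_L2 y \<sigma> - f \<omega> \<sigma>)"
      using diff_abs_L2[OF square_integrable_rep[of y] sq[OF that]] by simp
    then have "(dist y (abs_L2 (f \<omega>)))\<^sup>2 = (LINT \<sigma>|unit_cube. (norm (rep_L2 y \<sigma> - f \<omega> \<sigma>))\<^sup>2)"
      using norm_abs_L2[OF square_integrable_diff[OF square_integrable_rep[of y] sq[OF that]]] by (simp add: dist_norm)
    then show ?thesis by (metis real_sqrt_unique zero_le_dist)
  qed
  then show "(\<lambda>\<omega>. dist y (abs_L2 (f \<omega>))) \<in> borel_measurable M"
    by (subst measurable_cong) (assumption, measurable)
qed

text \<open>If \<open>Z\<close> has no second moment, the right-hand side is infinite. In this form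
  the inequality can be used at every point of the square before integrability there is
  known.\<close>

lemma (in prob_space) ennreal_expectation_sq_le:
  assumes Z [measurable]: "Z \<in> borel_measurable M"
  shows "ennreal ((expectation Z)\<^sup>2) \<le> (\<integral>\<^sup>+\<omega>. ennreal ((Z \<omega>)\<^sup>2) \<partial>M)"
proof (cases "integrable M (\<lambda>\<omega>. (Z \<omega>)\<^sup>2)")
  case True
  have i: "integrable M Z" by (rule finite_measure.square_integrable_imp_integrable[OF finite_measure_axioms Z True])
  have "(expectation Z)\<^sup>2 \<le> expectation (\<lambda>\<omega>. (Z \<omega>)\<^sup>2)"
    using variance_eq[OF i True] variance_positive[of Z] by linarith
  then show ?thesis using nn_integral_eq_integral[OF True] by (simp add: ennreal_leI)
next
  case False
  have "(\<integral>\<^sup>+\<omega>. ennreal ((Z \<omega>)\<^sup>2) \<partial>M) = \<top>"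
  proof (rule ccontr)
    assume "(\<integral>\<^sup>+\<omega>. ennreal ((Z \<omega>)\<^sup>2) \<partial>M) \<noteq> \<top>"
    then have "(\<integral>\<^sup>+\<omega>. ennreal (norm ((Z \<omega>)\<^sup>2)) \<partial>M) < \<infinity>" by (simp add: top.not_eq_extremum)
    then have "integrable M (\<lambda>\<omega>. (Z \<omega>)\<^sup>2)" by (rule integrableI_bounded[rotated]) measurable
    with False show False by contradiction
  qed
  then show ?thesis by (simp only: top_greatest)
qed

lemma abs_L2_sum:
  "finite I \<Longrightarrow> (\<And>i. i \<in> I \<Longrightarrow> square_integrable (f i)) \<Longrightarrow>
    square_integrable (\<lambda>x. \<Sum>i\<in>I. f i x) \<and> abs_L2 (\<lambda>x. \<Sum>i\<in>I. f i x) = (\<Sum>i\<in>I. abs_L2 (f i))"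
proof (induction I rule: finite_induct)
  case empty
  then show ?case by (simp add: square_integrable_zero zero_L2.abs_eq)
next
  case (insert i I)
  then show ?case by (simp add: square_integrable_add add_abs_L2[symmetric])
qed

text \<open>Exchanging sums collects the frequencies into the lag weights, which identifies the
  given kernel with a quadratic form in the observations.\<close>

lemma spectral_estimator_kernel_eq:
  "spectral_estimator_kernel W a T x \<xi> = (\<lambda>p. \<Sum>(s, u)\<in>{1..int T} \<times> {1..int T}.
     lag_weight W a T \<xi> (s - u) / of_real (2 * pi * real T) * of_real (x s (fst p) * x u (snd p)))"
proof
  fix p :: "real \<times> real"
  let ?S = "{1..int T}" and ?d = "2 * pi * real T"
  let ?z = "\<lambda>s u. complex_of_real (x s (fst p) * x u (snd p))"
  have "spectral_estimator_kernel W a T x \<xi> p = (\<Sum>t\<in>freqs T. of_real (taper W a T \<xi> t / ?d) * (\<Sum>s\<in>?S. \<Sum>u\<in>?S. ?z s u * cis (- fourier_freq T t * of_int (s - u))))"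
    by (simp add: spectral_estimator_kernel_def periodogram_kernel_def Let_def freqs_def taper_def case_prod_unfold sum_distrib_left mult_ac)
  also have "\<dots> = (\<Sum>t\<in>freqs T. \<Sum>s\<in>?S. \<Sum>u\<in>?S. of_real (taper W a T \<xi> t / ?d) * cis (- fourier_freq T t * of_int (s - u)) * ?z s u)"
    unfolding sum_distrib_left by (simp only: mult_ac)
  also have "\<dots> = (\<Sum>s\<in>?S. \<Sum>t\<in>freqs T. \<Sum>u\<in>?S. of_real (taper W a T \<xi> t / ?d) * cis (- fourier_freq T t * of_int (s - u)) * ?z s u)"
    by (rule sum.swap)
  also have "\<dots> = (\<Sum>s\<in>?S. \<Sum>u\<in>?S. \<Sum>t\<in>freqs T. of_real (taper W a T \<xi> t / ?d) * cis (- fourier_freq T t * of_int (s - u)) * ?z s u)"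
    by (rule sum.cong[OF refl]) (rule sum.swap)
  also have "\<dots> = (\<Sum>s\<in>?S. \<Sum>u\<in>?S. lag_weight W a T \<xi> (s - u) / of_real ?d * ?z s u)"
    unfolding sum_distrib_right[symmetric] lag_weight_def
    by (simp add: scaleR_conv_of_real sum_divide_distrib)
  finally show "spectral_estimator_kernel W a T x \<xi> p = (\<Sum>(s, u)\<in>?S \<times> ?S. lag_weight W a T \<xi> (s - u) / of_real ?d * ?z s u)"
    by (simp only: sum.cartesian_product)
qed

lemma spectral_estimator_kernel_L2:
  assumes x: "\<And>s. square_integrable (x s)"
  shows "square_integrable (spectral_estimator_kernel W a T x \<xi>)"
    and "abs_L2 (spectral_estimator_kernel W a T x \<xi>) = estimator W a T \<xi> (\<lambda>s. abs_L2 (x s))"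
proof -
  let ?S = "{1..int T}" and ?d = "2 * pi * real T"
  let ?f = "\<lambda>(s, u) p. lag_weight W a T \<xi> (s - u) / of_real ?d * complex_of_real (x s (fst p) * x u (snd p))"
  have sq: "square_integrable (?f i)" for i
    by (cases i) (simp only: case_prod_conv, intro square_integrable_cmult square_integrable_product x)
  have eq: "spectral_estimator_kernel W a T x \<xi> = (\<lambda>p. \<Sum>i\<in>?S \<times> ?S. ?f i p)"
    unfolding spectral_estimator_kernel_eq by (simp add: case_prod_unfold)
  have *: "square_integrable (\<lambda>p. \<Sum>i\<in>?S \<times> ?S. ?f i p) \<and> abs_L2 (\<lambda>p. \<Sum>i\<in>?S \<times> ?S. ?f i p) = (\<Sum>i\<in>?S \<times> ?S. abs_L2 (?f i))"
    by (rule abs_L2_sum[OF _ sq]) simp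
  show "square_integrable (spectral_estimator_kernel W a T x \<xi>)" unfolding eq using * by (rule conjunct1)
  have "(\<Sum>i\<in>?S \<times> ?S. abs_L2 (?f i)) = (\<Sum>(s, u)\<in>?S \<times> ?S. cmul (lag_weight W a T \<xi> (s - u) / of_real ?d) (tens (abs_L2 (x s)) (abs_L2 (x u))))"
    by (rule sum.cong[OF refl]) (auto simp only: case_prod_unfold tens_abs_L2[OF x x] cmul_abs_L2[OF square_integrable_product[OF x x]])
  then show "abs_L2 (spectral_estimator_kernel W a T x \<xi>) = estimator W a T \<xi> (\<lambda>s. abs_L2 (x s))"
    unfolding eq conjunct2[OF *] estimator_def quadratic_def by (simp only: sum.cartesian_product)
qed

lemma spectral_estimator_trace:
  assumes x: "\<And>s. square_integrable (x s)"
  shows "((\<lambda>n. cinner (spectral_estimator_op W a T x \<xi> (some_basis n)) (some_basis n)) has_sum of_real (total_power W a T \<xi> (\<lambda>s. abs_L2 (x s)))) UNIV"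
proof -
  let ?S = "{1..int T}" and ?d = "2 * pi * real T"
  have "((\<lambda>n. cinner (integral_op (\<lambda>p. \<Sum>i\<in>?S \<times> ?S. (lag_weight W a T \<xi> (fst i - snd i) / of_real ?d) * of_real (x (fst i) (fst p) * x (snd i) (snd p))) (some_basis n)) (some_basis n))
      has_sum (\<Sum>i\<in>?S \<times> ?S. (lag_weight W a T \<xi> (fst i - snd i) / of_real ?d) * of_real (abs_L2 (x (fst i)) \<bullet> abs_L2 (x (snd i))))) UNIV"
    by (rule op_trace_has_sum) (simp_all add: x orthonormal_basis_some_basis)
  moreover have "(\<Sum>i\<in>?S \<times> ?S. (lag_weight W a T \<xi> (fst i - snd i) / of_real ?d) * of_real (abs_L2 (x (fst i)) \<bullet> abs_L2 (x (snd i))))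
      = of_real (total_power W a T \<xi> (\<lambda>s. abs_L2 (x s)))"
    unfolding estimator_trace[symmetric] by (simp only: sum.cartesian_product case_prod_unfold)
  ultimately show ?thesis
    unfolding spectral_estimator_op_def spectral_estimator_kernel_eq by (simp only: case_prod_unfold)
qed

lemma op_trace_pooled:
  assumes x: "\<And>s. square_integrable (x s)" and y: "\<And>s. square_integrable (y s)"
  shows "op_trace (op_average (spectral_estimator_op W a T x \<xi>) (spectral_estimator_op W a T y \<xi>))
    = of_real ((total_power W a T \<xi> (\<lambda>s. abs_L2 (x s)) + total_power W a T \<xi> (\<lambda>s. abs_L2 (y s))) / 2)"
proof -
  have c: "cinner ((1/2) *\<^sub>R f) g = of_real (1/2) * cinner f g" for f g :: complex_L2
    using cinner_cmul_left[of "of_real (1/2)" f g] by (simp only: cmul_of_real)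
  have "((\<lambda>n. cinner (op_average (spectral_estimator_op W a T x \<xi>) (spectral_estimator_op W a T y \<xi>) (some_basis n)) (some_basis n))
     has_sum (of_real (1/2) * of_real (total_power W a T \<xi> (\<lambda>s. abs_L2 (x s))) + of_real (1/2) * of_real (total_power W a T \<xi> (\<lambda>s. abs_L2 (y s))))) UNIV"
    unfolding op_average_def cinner_add_left c
    by (intro has_sum_add has_sum_cmult_right spectral_estimator_trace x y)
  then show ?thesis unfolding op_trace_def by (subst infsumI) (auto simp: add_divide_distrib)
qed

section \<open>Autocovariance kernels from point values\<close>

locale point_process = prob_space M for M :: "'w measure" +
  fixes X :: "int \<Rightarrow> 'w \<Rightarrow> real \<Rightarrow> real"
  assumes L2_process: "L2_process M X"
begin

lemma X_joint [measurable]: "(\<lambda>x. X t (fst x) (snd x)) \<in> borel_measurable (M \<Otimes>\<^sub>M unit_cube)"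
  using L2_process by (auto simp: L2_process_def case_prod_unfold)

lemma X_sq: "\<omega> \<in> space M \<Longrightarrow> square_integrable (X t \<omega>)"
  using L2_process by (auto simp: L2_process_def)

lemma measurable_X_L2 [measurable]: "(\<lambda>\<omega>. abs_L2 (X t \<omega>)) \<in> borel_measurable M"
  by (rule measurable_abs_L2) (use X_joint[of t] X_sq in \<open>auto simp: case_prod_unfold\<close>)

definition product :: "int \<Rightarrow> 'w \<Rightarrow> real \<times> real \<Rightarrow> real" where
  "product h \<omega> p = X h \<omega> (fst p) * X 0 \<omega> (snd p)"

lemma measurable_product: "(\<lambda>x. product h (fst x) (snd x)) \<in> borel_measurable (M \<Otimes>\<^sub>M unit_cube)"
proof -
  have "(\<lambda>x. (fst x, fst (snd x))) \<in> M \<Otimes>\<^sub>M (unit_cube :: (real \<times> real) measure) \<rightarrow>\<^sub>M M \<Otimes>\<^sub>M (unit_cube :: real measure)" by measurable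
  from measurable_compose[OF this X_joint] have [measurable]: "(\<lambda>x. X t (fst x) (fst (snd x))) \<in> borel_measurable (M \<Otimes>\<^sub>M (unit_cube :: (real \<times> real) measure))" for t by simp
  have "(\<lambda>x. (fst x, snd (snd x))) \<in> M \<Otimes>\<^sub>M (unit_cube :: (real \<times> real) measure) \<rightarrow>\<^sub>M M \<Otimes>\<^sub>M (unit_cube :: real measure)" by measurable
  from measurable_compose[OF this X_joint] have [measurable]: "(\<lambda>x. X t (fst x) (snd (snd x))) \<in> borel_measurable (M \<Otimes>\<^sub>M (unit_cube :: (real \<times> real) measure))" for t by simp
  show ?thesis unfolding product_def by measurable
qed

lemma product_sq:
  assumes "\<omega> \<in> space M"
  shows "integrable unit_cube (\<lambda>p. (product h \<omega> p)\<^sup>2)"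
    and "(LINT p|unit_cube. (product h \<omega> p)\<^sup>2) = (norm (tens (abs_L2 (X h \<omega>)) (abs_L2 (X 0 \<omega>))))\<^sup>2"
proof -
  note sq = square_integrable_product[OF X_sq[OF assms, of h] X_sq[OF assms, of 0]]
  have n: "(norm (complex_of_real (X h \<omega> (fst p) * X 0 \<omega> (snd p))))\<^sup>2 = (product h \<omega> p)\<^sup>2" for p
    by (simp only: norm_of_real power2_abs product_def)
  show "integrable unit_cube (\<lambda>p. (product h \<omega> p)\<^sup>2)" using sq unfolding square_integrable_def n by (rule conjunct2)
  show "(LINT p|unit_cube. (product h \<omega> p)\<^sup>2) = (norm (tens (abs_L2 (X h \<omega>)) (abs_L2 (X 0 \<omega>))))\<^sup>2"
    unfolding tens_abs_L2[OF X_sq[OF assms, of h] X_sq[OF assms, of 0]] norm_abs_L2[OF sq] n ..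
qed

definition mean_product :: "int \<Rightarrow> real \<times> real \<Rightarrow> real" where
  "mean_product h p = expectation (\<lambda>\<omega>. product h \<omega> p)"

lemma measurable_mean_product [measurable]: "mean_product h \<in> borel_measurable unit_cube"
proof -
  have "(\<lambda>x. product h (snd x) (fst x)) \<in> borel_measurable (unit_cube \<Otimes>\<^sub>M M)"
    using measurable_compose[OF measurable_pair_swap' measurable_product[of h]] by (simp add: case_prod_unfold)
  then show ?thesis unfolding mean_product_def[abs_def]
    by (intro borel_measurable_lebesgue_integral) (simp add: case_prod_unfold)
qed

text \<open>Jensen's inequality at each point, followed by Tonelli, bounds the squared norm by the
  second moment of the tensor.\<close>

lemma square_integrable_mean_product:
  assumes moments: "\<And>h. all_moments (\<lambda>\<omega>. tens (abs_L2 (X h \<omega>)) (abs_L2 (X 0 \<omega>)))"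
  shows "square_integrable (\<lambda>p. complex_of_real (mean_product h p))"
proof -
  interpret P: pair_sigma_finite M "unit_cube :: (real \<times> real) measure" ..
  have pm [measurable]: "(\<lambda>x. product h (fst x) (snd x)) \<in> borel_measurable (M \<Otimes>\<^sub>M unit_cube)" by (rule measurable_product)
  have 2: "(\<lambda>\<omega>. product h \<omega> p) \<in> borel_measurable M" if "p \<in> space unit_cube" for p
    using measurable_compose[OF measurable_Pair2'[OF that, of M] pm] by simp
  have "(\<integral>\<^sup>+p. ennreal ((mean_product h p)\<^sup>2) \<partial>unit_cube) \<le> (\<integral>\<^sup>+p. (\<integral>\<^sup>+\<omega>. ennreal ((product h \<omega> p)\<^sup>2) \<partial>M) \<partial>unit_cube)"
    unfolding mean_product_def by (intro nn_integral_mono ennreal_expectation_sq_le 2)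
  also have "\<dots> = (\<integral>\<^sup>+\<omega>. (\<integral>\<^sup>+p. ennreal ((product h \<omega> p)\<^sup>2) \<partial>unit_cube) \<partial>M)"
    by (rule P.Fubini') (simp add: case_prod_unfold)
  also have "\<dots> = (\<integral>\<^sup>+\<omega>. ennreal ((norm (tens (abs_L2 (X h \<omega>)) (abs_L2 (X 0 \<omega>))))\<^sup>2) \<partial>M)"
    by (intro nn_integral_cong) (simp add: nn_integral_eq_integral product_sq)
  also have "\<dots> < \<infinity>"
    using all_moments_power[OF moments, of h 2] by (subst nn_integral_eq_integral) auto
  finally have "integrable unit_cube (\<lambda>p. (mean_product h p)\<^sup>2)"
    by (intro integrableI_bounded) auto
  then show ?thesis by (simp add: square_integrable_def)
qed

text \<open>The kernel formed from expectations of point values is compared with the Bochner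
  expectation in \<open>kernel_L2\<close> by testing against an arbitrary \<open>g\<close> and
  exchanging the integrals.\<close>

lemma abs_L2_mean_product:
  assumes moments: "\<And>h. all_moments (\<lambda>\<omega>. tens (abs_L2 (X h \<omega>)) (abs_L2 (X 0 \<omega>)))"
  shows "abs_L2 (\<lambda>p. complex_of_real (mean_product h p)) = expectation (\<lambda>\<omega>. tens (abs_L2 (X h \<omega>)) (abs_L2 (X 0 \<omega>)))"
proof -
  let ?Z = "\<lambda>\<omega>. tens (abs_L2 (X h \<omega>)) (abs_L2 (X 0 \<omega>))"
  interpret P: pair_sigma_finite M "unit_cube :: (real \<times> real) measure" ..
  have pm [measurable]: "(\<lambda>x. product h (fst x) (snd x)) \<in> borel_measurable (M \<Otimes>\<^sub>M unit_cube)" by (rule measurable_product)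
  have "abs_L2 (\<lambda>p. complex_of_real (mean_product h p)) \<bullet> g = expectation ?Z \<bullet> g" for g
  proof -
    \<comment> \<open>The product of point values is real, so only the real part of \<open>g\<close>
      enters the inner product.\<close>
    let ?f = "\<lambda>\<omega> p. product h \<omega> p * Re (rep_L2 g p)"
    have g2: "integrable unit_cube (\<lambda>p. (Re (rep_L2 g p))\<^sup>2)"
      using square_integrable_rep[of g]
      by (intro Bochner_Integration.integrable_bound[where f = "\<lambda>p. (norm (rep_L2 g p))\<^sup>2" and g = "\<lambda>p. (Re (rep_L2 g p))\<^sup>2"])
        (auto simp: square_integrable_def cmod_power2)
    have am: "\<bar>u * v\<bar> \<le> u\<^sup>2 + v\<^sup>2" for u v :: real
    proof -
      have "2 * (\<bar>u\<bar> * \<bar>v\<bar>) \<le> u\<^sup>2 + v\<^sup>2" "0 \<le> \<bar>u\<bar> * \<bar>v\<bar>" using sum_squares_bound[of "\<bar>u\<bar>" "\<bar>v\<bar>"] by simp_all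
      then show ?thesis unfolding abs_mult by linarith
    qed
    have i1: "integrable unit_cube (?f \<omega>)" if w: "\<omega> \<in> space M" for \<omega>
    proof (rule Bochner_Integration.integrable_bound)
      show "integrable unit_cube (\<lambda>p. (product h \<omega> p)\<^sup>2 + (Re (rep_L2 g p))\<^sup>2)" using g2 product_sq(1)[OF w] by simp
      have "(\<lambda>p. product h \<omega> p) \<in> borel_measurable unit_cube"
        using measurable_compose[OF measurable_Pair1'[OF w] pm] by simp
      then show "?f \<omega> \<in> borel_measurable unit_cube" by measurable
    qed (use am in auto)
    have "integrable (M \<Otimes>\<^sub>M unit_cube) (\<lambda>x. ?f (fst x) (snd x))"
    proof (rule P.Fubini_integrable)
      show "(\<lambda>x. ?f (fst x) (snd x)) \<in> borel_measurable (M \<Otimes>\<^sub>M unit_cube)" by measurable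
      show "AE \<omega> in M. integrable unit_cube (\<lambda>p. ?f (fst (\<omega>, p)) (snd (\<omega>, p)))" using i1 by auto
      show "integrable M (\<lambda>\<omega>. LINT p|unit_cube. norm (?f (fst (\<omega>, p)) (snd (\<omega>, p))))"
      proof (rule Bochner_Integration.integrable_bound)
        show "integrable M (\<lambda>\<omega>. (norm (?Z \<omega>))\<^sup>2 + (LINT p|unit_cube. (Re (rep_L2 g p))\<^sup>2))"
          using all_moments_power[OF moments, of h 2] by simp
        show "(\<lambda>\<omega>. LINT p|unit_cube. norm (?f (fst (\<omega>, p)) (snd (\<omega>, p)))) \<in> borel_measurable M"
          by (intro unit_cube.borel_measurable_lebesgue_integral) (simp add: case_prod_unfold)
        show "AE \<omega> in M. norm (LINT p|unit_cube. norm (?f (fst (\<omega>, p)) (snd (\<omega>, p)))) \<le> norm ((norm (?Z \<omega>))\<^sup>2 + (LINT p|unit_cube. (Re (rep_L2 g p))\<^sup>2))"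
        proof (rule AE_I2)
          fix \<omega> assume w: "\<omega> \<in> space M"
          have "(LINT p|unit_cube. norm (?f \<omega> p)) \<le> (LINT p|unit_cube. (product h \<omega> p)\<^sup>2 + (Re (rep_L2 g p))\<^sup>2)"
            using i1[OF w] g2 product_sq(1)[OF w] am by (intro integral_mono) auto
          also have "\<dots> = (norm (?Z \<omega>))\<^sup>2 + (LINT p|unit_cube. (Re (rep_L2 g p))\<^sup>2)"
            using g2 product_sq[OF w] by simp
          finally show "norm (LINT p|unit_cube. norm (?f (fst (\<omega>, p)) (snd (\<omega>, p)))) \<le> norm ((norm (?Z \<omega>))\<^sup>2 + (LINT p|unit_cube. (Re (rep_L2 g p))\<^sup>2))"
            by (simp only: fst_conv snd_conv real_norm_def) (simp add: abs_of_nonneg)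
        qed
      qed
    qed
    then have I: "integrable (M \<Otimes>\<^sub>M unit_cube) (case_prod ?f)" by (simp add: case_prod_unfold)
    have "abs_L2 (\<lambda>p. complex_of_real (mean_product h p)) \<bullet> g = (LINT p|unit_cube. complex_of_real (mean_product h p) \<bullet> rep_L2 g p)"
      using inner_abs_L2[OF square_integrable_mean_product[OF moments] square_integrable_rep[of g]] by simp
    also have "\<dots> = (LINT p|unit_cube. (LINT \<omega>|M. ?f \<omega> p))"
      by (simp add: inner_complex_def mean_product_def)
    also have "\<dots> = (LINT \<omega>|M. (LINT p|unit_cube. ?f \<omega> p))" by (rule P.Fubini_integral[OF I])
    also have "\<dots> = (LINT \<omega>|M. ?Z \<omega> \<bullet> g)"
    proof (rule Bochner_Integration.integral_cong[OF refl])
      fix \<omega> assume w: "\<omega> \<in> space M"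
      have "?Z \<omega> \<bullet> g = (LINT p|unit_cube. complex_of_real (X h \<omega> (fst p) * X 0 \<omega> (snd p)) \<bullet> rep_L2 g p)"
        using inner_abs_L2[OF square_integrable_product[OF X_sq[OF w] X_sq[OF w]] square_integrable_rep[of g], of h 0]
          tens_abs_L2[OF X_sq[OF w, of h] X_sq[OF w, of 0]] by simp
      also have "\<dots> = (LINT p|unit_cube. ?f \<omega> p)" by (simp add: inner_complex_def product_def)
      finally show "(LINT p|unit_cube. ?f \<omega> p) = ?Z \<omega> \<bullet> g" ..
    qed
    also have "\<dots> = expectation ?Z \<bullet> g" by (rule integral_inner_left) (rule all_moments_integrable[OF moments])
    finally show ?thesis .
  qed
  then have "(abs_L2 (\<lambda>p. complex_of_real (mean_product h p)) - expectation ?Z) \<bullet> g = 0" for g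
    by (simp add: inner_diff_left)
  \<comment> \<open>Testing against the difference itself shows that its norm is 0.\<close>
  from this[of "abs_L2 (\<lambda>p. complex_of_real (mean_product h p)) - expectation ?Z"] show ?thesis by simp
qed

lemma abs_L2_autocov_kernel:
  assumes moments: "\<And>h. all_moments (\<lambda>\<omega>. tens (abs_L2 (X h \<omega>)) (abs_L2 (X 0 \<omega>)))"
  shows "abs_L2 (\<lambda>(\<sigma>, \<tau>). c * of_real (autocov_kernel M X h \<sigma> \<tau>)) = cmul c (expectation (\<lambda>\<omega>. tens (abs_L2 (X h \<omega>)) (abs_L2 (X 0 \<omega>))))"
proof -
  have "(\<lambda>(\<sigma>, \<tau>). c * of_real (autocov_kernel M X h \<sigma> \<tau>)) = (\<lambda>p. c * complex_of_real (mean_product h p))"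
    by (simp add: fun_eq_iff autocov_kernel_def mean_product_def product_def)
  then show ?thesis
    unfolding abs_L2_mean_product[OF moments, symmetric] cmul_abs_L2[OF square_integrable_mean_product[OF moments]] by simp
qed

end

section \<open>Comparison of the integrated functionals\<close>

text \<open>Were the integral 0, the nonnegative integrand would vanish almost everywhere on
  \<open>S\<close>, and \<open>\<Lambda>\<close> would be a null set.\<close>

lemma set_integral_pos:
  fixes g :: "real \<Rightarrow> real"
  assumes S [measurable]: "S \<in> sets borel" and int: "set_integrable lborel S g" and nonneg: "\<And>\<xi>. g \<xi> \<ge> 0"
    and \<Lambda>: "emeasure lebesgue \<Lambda> > 0" and pos: "AE \<xi> in lborel. \<xi> \<in> \<Lambda> \<longrightarrow> \<xi> \<in> S \<and> g \<xi> > 0"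
  shows "(LBINT \<xi>:S. g \<xi>) > 0"
proof (rule ccontr)
  assume "\<not> ?thesis"
  moreover have "(LBINT \<xi>:S. g \<xi>) \<ge> 0" unfolding set_lebesgue_integral_def by (intro integral_nonneg_AE) (simp add: nonneg)
  ultimately have "(LINT \<xi>|lborel. indicator S \<xi> *\<^sub>R g \<xi>) = 0" by (simp add: set_lebesgue_integral_def)
  then have "AE \<xi> in lborel. indicator S \<xi> *\<^sub>R g \<xi> = 0"
    by (subst (asm) integral_nonneg_eq_0_iff_AE) (use int nonneg in \<open>auto simp: set_integrable_def\<close>)
  then have "AE \<xi> in lborel. \<not> (\<xi> \<in> \<Lambda>)" using pos by eventually_elim auto
  then have "AE \<xi> in lebesgue. \<not> (\<xi> \<in> \<Lambda>)" by (rule AE_completion)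
  then have "emeasure lebesgue {\<xi> \<in> space lebesgue. \<xi> \<in> \<Lambda>} = 0" by (rule emeasure_eq_0_AE)
  then show False using \<Lambda> by simp
qed

lemma set_integrable_bounded:
  fixes f :: "real \<Rightarrow> real"
  assumes [measurable]: "f \<in> borel_measurable borel" and K: "\<And>\<xi>. \<bar>f \<xi>\<bar> \<le> K"
  shows "set_integrable lborel {-a..a} f"
proof -
  have K0: "K \<ge> 0" using K[of 0] by linarith
  have "integrable lborel (\<lambda>\<xi>. indicator {-a..a} \<xi> * K)"
    by (intro integrable_mult_left integrable_real_indicator) (simp_all add: emeasure_lborel_Icc_eq)
  then show ?thesis unfolding set_integrable_def
    by (rule Bochner_Integration.integrable_bound) (use K K0 in \<open>auto simp: indicator_def\<close>)
qed

lemma set_integral_diff_le: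
  fixes f g h :: "real \<Rightarrow> real"
  assumes "set_integrable M S f" "set_integrable M S g" "set_integrable M S h" and le: "\<And>\<xi>. \<bar>f \<xi> - g \<xi>\<bar> \<le> h \<xi>"
  shows "\<bar>(LINT \<xi>:S|M. f \<xi>) - (LINT \<xi>:S|M. g \<xi>)\<bar> \<le> (LINT \<xi>:S|M. h \<xi>)"
proof -
  have "f \<xi> - g \<xi> \<le> h \<xi>" "g \<xi> - f \<xi> \<le> h \<xi>" for \<xi> using le[of \<xi>] by auto
  then have "(LINT \<xi>:S|M. f \<xi> - g \<xi>) \<le> (LINT \<xi>:S|M. h \<xi>)" "(LINT \<xi>:S|M. g \<xi> - f \<xi>) \<le> (LINT \<xi>:S|M. h \<xi>)"
    using assms(1-3) by (intro set_integral_mono set_integral_diff; simp)+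
  then show ?thesis using assms(1,2) by (simp add: set_integral_diff abs_le_iff)
qed

lemma pow4_add_le: "u \<ge> 0 \<Longrightarrow> v \<ge> 0 \<Longrightarrow> (u + v) ^ 4 \<le> 16 * (u ^ 4 + v ^ 4)" for u v :: real
proof -
  assume "u \<ge> 0" "v \<ge> 0"
  then have "(u + v) ^ 4 \<le> (2 * max u v) ^ 4" by (intro power_mono) auto
  also have "\<dots> = 16 * max u v ^ 4" by (simp only: power_mult_distrib) simp
  also have "\<dots> \<le> 16 * (u ^ 4 + v ^ 4)" by (intro mult_left_mono) (auto simp: max_def)
  finally show ?thesis .
qed

text \<open>With \<open>a = u + v\<close> the difference is at most \<open>a * (2 * B + a)\<close>;
  then \<open>a\<^sup>2 \<le> a + a ^ 4\<close> and \<open>a ^ 4 \<le> 16 * (u ^ 4 + v ^ 4)\<close>,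
  and 17 is 1 + 16.\<close>

lemma square_diff_le_loss:
  fixes x y u v B :: real
  assumes "x \<ge> 0" "y \<ge> 0" "u \<ge> 0" "v \<ge> 0" "\<bar>x - y\<bar> \<le> u + v" "y \<le> B"
  shows "\<bar>x\<^sup>2 - y\<^sup>2\<bar> \<le> (2 * B + 17) * ((u + u ^ 4) + (v + v ^ 4))"
proof -
  let ?a = "u + v"
  have a0: "?a \<ge> 0" using assms by simp
  have B0: "B \<ge> 0" using assms by simp
  have "\<bar>x\<^sup>2 - y\<^sup>2\<bar> = \<bar>x - y\<bar> * (x + y)" using assms(1,2) by (simp add: power2_eq_square square_diff_square_factored abs_mult mult.commute)
  also have "\<dots> \<le> ?a * (2 * B + ?a)" using assms a0 by (intro mult_mono) auto
  also have "\<dots> = 2 * B * ?a + ?a\<^sup>2" by (simp add: power2_eq_square algebra_simps)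
  also have "?a\<^sup>2 \<le> ?a + ?a ^ 4"
  proof (cases "?a \<le> 1")
    case True
    then have "?a * ?a \<le> ?a * 1" using a0 by (intro mult_left_mono)
    then have "?a * ?a \<le> ?a" by simp
    then show ?thesis using zero_le_power[OF a0, of 4] unfolding power2_eq_square mult_1_right by linarith
  next
    case False
    then have "?a\<^sup>2 \<le> ?a ^ 4" by (intro power_increasing) auto
    then show ?thesis using a0 by linarith
  qed
  also have "2 * B * ?a + (?a + ?a ^ 4) \<le> 2 * B * ?a + (?a + 16 * (u ^ 4 + v ^ 4))"
    using pow4_add_le[of u v] assms by simp
  also have "\<dots> \<le> (2 * B + 17) * ((u + u ^ 4) + (v + v ^ 4))"
  proof -
    have "0 \<le> 2 * B * (u ^ 4 + v ^ 4)" using B0 by simp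
    moreover have "0 \<le> u ^ 4 + v ^ 4" by simp
    ultimately show ?thesis using a0 by (simp add: algebra_simps)
  qed
  finally show ?thesis by simp
qed

text \<open>With \<open>a = u + v\<close> both numbers are at most \<open>B + a\<close>, whence the
  cofactor \<open>4 * (B + a) ^ 3 \<le> 32 * (B ^ 3 + a ^ 3)\<close>; 512 is 32 times the 16 from
  splitting \<open>a ^ 4\<close>.\<close>

lemma fourth_power_diff_le_loss:
  fixes x y u v B :: real
  assumes "x \<ge> 0" "y \<ge> 0" "u \<ge> 0" "v \<ge> 0" "\<bar>x - y\<bar> \<le> u + v" "y \<le> B"
  shows "\<bar>x ^ 4 - y ^ 4\<bar> \<le> (32 * B ^ 3 + 512) * ((u + u ^ 4) + (v + v ^ 4))"
proof -
  let ?a = "u + v"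
  have a0: "?a \<ge> 0" and B0: "B \<ge> 0" using assms by simp_all
  have x: "x \<le> B + ?a" and y: "y \<le> B + ?a" using assms by auto
  have "x ^ 4 - y ^ 4 = (x - y) * (x ^ 3 + x\<^sup>2 * y + x * y\<^sup>2 + y ^ 3)" by (simp add: algebra_simps eval_nat_numeral)
  then have "\<bar>x ^ 4 - y ^ 4\<bar> = \<bar>x - y\<bar> * (x ^ 3 + x\<^sup>2 * y + x * y\<^sup>2 + y ^ 3)" using assms(1,2) by (simp add: abs_mult)
  also have "\<dots> \<le> ?a * ((B + ?a) ^ 3 + (B + ?a)\<^sup>2 * (B + ?a) + (B + ?a) * (B + ?a)\<^sup>2 + (B + ?a) ^ 3)"
    using assms x y a0 B0 by (intro mult_mono add_mono power_mono) auto
  also have "\<dots> = 4 * ?a * (B + ?a) ^ 3" by (simp add: eval_nat_numeral algebra_simps)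
  also have "\<dots> \<le> 4 * ?a * (8 * (B ^ 3 + ?a ^ 3))"
  proof (rule mult_left_mono)
    have "(B + ?a) ^ 3 \<le> (2 * max B ?a) ^ 3" using a0 B0 by (intro power_mono) (auto simp: max_def)
    also have "\<dots> = 8 * max B ?a ^ 3" by (simp only: power_mult_distrib) simp
    also have "\<dots> \<le> 8 * (B ^ 3 + ?a ^ 3)" using a0 B0 by (intro mult_left_mono) (auto simp: max_def)
    finally show "(B + ?a) ^ 3 \<le> 8 * (B ^ 3 + ?a ^ 3)" .
  qed (use a0 in simp)
  also have "\<dots> = 32 * B ^ 3 * ?a + 32 * ?a ^ 4" by (simp add: algebra_simps eval_nat_numeral)
  also have "\<dots> \<le> 32 * B ^ 3 * ?a + 32 * (16 * (u ^ 4 + v ^ 4))"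
    using pow4_add_le[of u v] assms by simp
  also have "\<dots> \<le> (32 * B ^ 3 + 512) * ((u + u ^ 4) + (v + v ^ 4))"
  proof -
    have "0 \<le> 32 * B ^ 3 * (u ^ 4 + v ^ 4)" using B0 by simp
    then show ?thesis using a0 by (simp add: algebra_simps)
  qed
  finally show ?thesis .
qed

context lag_window
begin

section \<open>The autocorrelation of the window\<close>

definition lag_product :: "real \<Rightarrow> real" where "lag_product x = (LBINT u:{-pi..pi}. W u * W (u - x))"

lemma set_integrable_W:
  "set_integrable lborel {-pi..pi} W" "set_integrable lborel {-pi..pi} (\<lambda>u. W u * W (u - x))"
proof -
  show "set_integrable lborel {-pi..pi} W" by (rule borel_integrable_atLeastAtMost'[OF continuous_W])
  have "continuous_on {-pi..pi} (\<lambda>u. W (u - x))"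
    by (rule continuous_on_compose2[OF continuous_W[of UNIV]]) (auto intro!: continuous_intros)
  then show "set_integrable lborel {-pi..pi} (\<lambda>u. W u * W (u - x))"
    by (intro borel_integrable_atLeastAtMost' continuous_on_mult continuous_W)
qed

text \<open>The Lipschitz constant of \<open>W\<close> multiplied by its total mass
  \<open>2 * pi\<close>.\<close>

lemma lag_product_diff: "\<bar>lag_product x - lag_product y\<bar> \<le> 2 * pi * L * \<bar>x - y\<bar>"
proof -
  have "\<bar>lag_product x - lag_product y\<bar> \<le> (LBINT u:{-pi..pi}. W u * (L * \<bar>x - y\<bar>))"
    unfolding lag_product_def
  proof (rule set_integral_diff_le[OF set_integrable_W(2) set_integrable_W(2)])
    show "set_integrable lborel {-pi..pi} (\<lambda>u. W u * (L * \<bar>x - y\<bar>))" using set_integrable_W(1) by simp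
    fix u
    have "\<bar>W (u - x) - W (u - y)\<bar> \<le> L * \<bar>(u - x) - (u - y)\<bar>" by (rule W_diff)
    also have "\<bar>(u - x) - (u - y)\<bar> = \<bar>x - y\<bar>" by simp
    finally have "W u * \<bar>W (u - x) - W (u - y)\<bar> \<le> W u * (L * \<bar>x - y\<bar>)" by (rule mult_left_mono[OF _ W_nonneg])
    then show "\<bar>W u * W (u - x) - W u * W (u - y)\<bar> \<le> W u * (L * \<bar>x - y\<bar>)"
      using W_nonneg[of u] by (simp add: right_diff_distrib[symmetric] abs_mult)
  qed
  also have "\<dots> = 2 * pi * L * \<bar>x - y\<bar>" using W_integral by simp
  finally show ?thesis .
qed

text \<open>Integrating \<open>2 * W u - 1 \<le> (W u)\<^sup>2\<close> over an interval of length
  \<open>2 * pi\<close> gives \<open>4 * pi - 2 * pi\<close>, since \<open>W\<close> has mass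
  \<open>2 * pi\<close>.\<close>

lemma lag_product_0: "lag_product 0 \<ge> 2 * pi"
proof -
  have i: "set_integrable lborel {-pi..pi} (\<lambda>u. 2 * W u)" "set_integrable lborel {-pi..pi} (\<lambda>u. 1 :: real)"
    using set_integrable_W(1) set_integrable_bounded[of "\<lambda>_. 1" 1 pi] by (auto intro: set_integrable_mult_right)
  have "(LBINT u:{-pi..pi}. 2 * W u - 1) \<le> (LBINT u:{-pi..pi}. W u * W (u - 0))"
  proof (rule set_integral_mono[OF set_integral_diff(1)[OF i] set_integrable_W(2)])
    show "2 * W u - 1 \<le> W u * W (u - 0)" for u
      using zero_le_power2[of "W u - 1"] by (simp add: power2_eq_square algebra_simps)
  qed
  also have "(LBINT u:{-pi..pi}. 2 * W u - 1) = 2 * (2 * pi) - 2 * pi"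
    using i W_integral by (simp add: set_integral_diff(2)) (simp add: set_lebesgue_integral_def)
  finally show ?thesis by (simp add: lag_product_def)
qed

text \<open>\<open>lag_product\<close> is at least \<open>2 * pi\<close> at 0 and Lipschitz
  continuous, so it stays positive on an interval; this makes the window factor of the studentizing
  term positive.\<close>

lemma integral_lag_product_pos: "(LBINT x:{-2*pi..2*pi}. (lag_product x)\<^sup>2) > 0"
proof (rule set_integral_pos)
  have c: "continuous_on A lag_product" for A
  proof (rule lipschitz_on_continuous_on)
    show "(2 * pi * L)-lipschitz_on A lag_product"
      using lag_product_diff L_nonneg by (auto simp: lipschitz_on_def dist_real_def)
  qed
  show "set_integrable lborel {-2*pi..2*pi} (\<lambda>x. (lag_product x)\<^sup>2)"
    by (intro borel_integrable_atLeastAtMost' continuous_intros c)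
  \<comment> \<open>Up to this point the function decreases by at most
    \<open>2 * pi * L / (L + 1)\<close>, less than \<open>2 * pi\<close>; the 1 also covers
    \<open>L = 0\<close>.\<close>
  let ?d = "1 / (L + 1)"
  have d: "?d > 0" "?d \<le> 1" using L_nonneg by auto
  show "emeasure lebesgue {0..?d} > 0" using d by simp
  show "AE x in lborel. x \<in> {0..?d} \<longrightarrow> x \<in> {-2*pi..2*pi} \<and> (lag_product x)\<^sup>2 > 0"
  proof (intro AE_I2 impI conjI)
    fix x assume x: "x \<in> {0..?d}"
    then have "x \<le> 2 * pi" using d pi_gt3 by (simp only: atLeastAtMost_iff) linarith
    moreover have "x \<ge> - 2 * pi" using x pi_gt3 by (simp only: atLeastAtMost_iff) linarith
    ultimately show "x \<in> {-2*pi..2*pi}" by simp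
    have "L * x \<le> L * ?d" using x L_nonneg by (intro mult_left_mono) auto
    also have "\<dots> < 1" using L_nonneg by (simp add: field_simps)
    finally have "2 * pi * L * \<bar>0 - x\<bar> < 2 * pi * 1" using x pi_gt_zero by (simp only: mult.assoc) simp
    then have "lag_product x > 0" using lag_product_diff[of 0 x] lag_product_0 by linarith
    then show "(lag_product x)\<^sup>2 > 0" by simp
  qed
qed auto

end

lemma square_mean_le: "((p + q) / 2)\<^sup>2 \<le> p\<^sup>2 + q\<^sup>2" for p q :: real
proof -
  have "((p + q) / 2)\<^sup>2 + ((p - q) / 2)\<^sup>2 = (p\<^sup>2 + q\<^sup>2) / 2"
    by (simp add: power_divide power2_sum power2_diff add_divide_distrib[symmetric])
  then have "((p + q) / 2)\<^sup>2 \<le> (p\<^sup>2 + q\<^sup>2) / 2" using zero_le_power2[of "(p - q) / 2"] by linarith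
  also have "\<dots> \<le> p\<^sup>2 + q\<^sup>2" by simp
  finally show ?thesis .
qed

locale point_spectral = point_process M X + spectral_consistency M \<epsilon> A "\<lambda>t \<omega>. abs_L2 (X t \<omega>)" W w\<^sub>0 L b
  for M :: "'w measure" and \<epsilon> A X W w\<^sub>0 L b
begin

lemma spectral_density_kernel_eq: "spectral_density_kernel M X \<xi> = spec \<xi>"
proof -
  have "all_moments (\<lambda>\<omega>. tens (abs_L2 (X h \<omega>)) (abs_L2 (X 0 \<omega>)))" for h
    by (intro all_moments_bounded_bilinear[OF bounded_bilinear_tens] all_moments_X) measurable
  then show ?thesis
    by (simp only: spectral_density_kernel_def spec_def abs_L2_autocov_kernel autocov_def)
qed

lemma estimator_kernel:
  assumes "\<omega> \<in> space M"
  shows "square_integrable (spectral_estimator_kernel W (b T) T (\<lambda>t. X t \<omega>) \<xi>)"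
    and "abs_L2 (spectral_estimator_kernel W (b T) T (\<lambda>t. X t \<omega>) \<xi>) = est T \<xi> \<omega>"
  using spectral_estimator_kernel_L2[of "\<lambda>t. X t \<omega>"] X_sq[OF assms] by (auto simp: est_def)

lemma measurable_est_slice:
  assumes "\<omega> \<in> space M" shows "(\<lambda>\<xi>. est T \<xi> \<omega>) \<in> borel_measurable borel"
  using measurable_compose[OF measurable_Pair2'[OF assms] measurable_est[of T]] by simp

lemma set_integrable_loss:
  assumes w: "\<omega> \<in> space M" and r: "regular T"
  shows "set_integrable lborel {-pi..pi} (\<lambda>\<xi>. loss T \<xi> \<omega>)"
proof -
  obtain K where K: "\<forall>\<xi>. err T \<xi> \<omega> \<le> K" using err_bounded[OF r] by blast
  show ?thesis
  proof (rule set_integrable_bounded)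
    show "(\<lambda>\<xi>. loss T \<xi> \<omega>) \<in> borel_measurable borel"
      using measurable_est_slice[OF w, of T] unfolding loss_def err_def by measurable
    fix \<xi>
    have "err T \<xi> \<omega> ^ 4 \<le> K ^ 4" using K err_nonneg by (intro power_mono) auto
    then have "loss T \<xi> \<omega> \<le> K + K ^ 4" using K unfolding loss_def by (intro add_mono) auto
    then show "\<bar>loss T \<xi> \<omega>\<bar> \<le> K + K ^ 4" using loss_nonneg[of T \<xi> \<omega>] by simp
  qed
qed

lemma est_bounded:
  assumes r: "regular T"
  shows "\<exists>K. \<forall>\<xi>. norm (est T \<xi> \<omega>) \<le> K"
proof -
  obtain K where K: "\<forall>\<xi>. err T \<xi> \<omega> \<le> K" using err_bounded[OF r] by blast
  have "norm (est T \<xi> \<omega>) \<le> K + spec_bound" for \<xi>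
    using norm_triangle_ineq2[of "est T \<xi> \<omega>" "spec \<xi>"] K[rule_format, of \<xi>] norm_spec_le[of \<xi>] unfolding err_def by linarith
  then show ?thesis by blast
qed

lemma set_integrable_band_power:
  assumes w: "\<omega> \<in> space M" and r: "regular T"
  shows "set_integrable lborel {-pi..pi} (\<lambda>\<xi>. (band_power T \<xi> \<omega>)\<^sup>2)"
proof -
  obtain K where K: "\<forall>\<xi>. band_power T \<xi> \<omega> \<le> K" using band_power_bounded[OF r] by blast
  show ?thesis
  proof (rule set_integrable_bounded)
    have [measurable]: "(\<lambda>\<xi>. band_power T \<xi> \<omega>) \<in> borel_measurable borel"
      using measurable_compose[OF measurable_Pair2'[OF w] measurable_band_power[of T]] by simp
    show "(\<lambda>\<xi>. (band_power T \<xi> \<omega>)\<^sup>2) \<in> borel_measurable borel" by measurable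
    show "\<bar>(band_power T \<xi> \<omega>)\<^sup>2\<bar> \<le> K\<^sup>2" for \<xi>
      using power_mono[OF K[rule_format, of \<xi>] band_power_nonneg[OF r], of 2] by simp
  qed
qed

end

section \<open>Comparison of two processes\<close>

locale spectral_pair = PX: point_spectral M \<epsilon> A X W w\<^sub>0 L b + PY: point_spectral M e B Y W w\<^sub>0 L b
  for M :: "'w measure" and \<epsilon> A X e B Y W w\<^sub>0 L b
begin

definition distance :: "nat \<Rightarrow> 'w \<Rightarrow> real" where
  "distance T \<omega> = (LBINT \<xi>:{-pi..pi}. (norm (PX.est T \<xi> \<omega> - PY.est T \<xi> \<omega>))\<^sup>2)"

definition quartic :: "nat \<Rightarrow> 'w \<Rightarrow> real" where
  "quartic T \<omega> = (LBINT \<xi>:{-pi..pi}. (norm (PX.est T \<xi> \<omega> + PY.est T \<xi> \<omega>) / 2) ^ 4)"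

definition trace_integral :: "nat \<Rightarrow> 'w \<Rightarrow> real" where
  "trace_integral T \<omega> = (LBINT \<xi>:{-pi..pi}. ((PX.band_power T \<xi> \<omega> + PY.band_power T \<xi> \<omega>) / 2)\<^sup>2)"

definition limit_distance :: real where
  "limit_distance = (LBINT \<xi>:{-pi..pi}. (norm (PX.spec \<xi> - PY.spec \<xi>))\<^sup>2)"

definition limit_quartic :: real where
  "limit_quartic = (LBINT \<xi>:{-pi..pi}. (norm (PX.spec \<xi> + PY.spec \<xi>) / 2) ^ 4)"

definition total_loss :: "nat \<Rightarrow> 'w \<Rightarrow> real" where
  "total_loss T \<omega> = PX.integrated_loss T \<omega> + PY.integrated_loss T \<omega>"

text \<open>The window factor of the squared studentizing term, split off because it does not depend
  on the data.\<close>

definition \<kappa> :: real where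
  "\<kappa> = 4 / pi\<^sup>2 * (LBINT x:{-2*pi..2*pi}. (PX.lag_product x)\<^sup>2)"

definition W_energy :: real where "W_energy = (LBINT u:{-pi..pi}. (W u)\<^sup>2)"

lemma \<kappa>_pos: "\<kappa> > 0" unfolding \<kappa>_def using PX.integral_lag_product_pos by simp

lemma hs_norm_est_diff:
  "\<omega> \<in> space M \<Longrightarrow> hs_norm (op_diff (spectral_estimator_op W (b T) T (\<lambda>t. X t \<omega>) \<xi>) (spectral_estimator_op W (b T) T (\<lambda>t. Y t \<omega>) \<xi>))
     = norm (PX.est T \<xi> \<omega> - PY.est T \<xi> \<omega>)"
  unfolding spectral_estimator_op_def
  by (simp add: hs_norm_op_diff PX.estimator_kernel PY.estimator_kernel)

lemma hs_norm_pooled: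
  "\<omega> \<in> space M \<Longrightarrow> hs_norm (op_average (spectral_estimator_op W (b T) T (\<lambda>t. X t \<omega>) \<xi>) (spectral_estimator_op W (b T) T (\<lambda>t. Y t \<omega>) \<xi>))
     = norm (PX.est T \<xi> \<omega> + PY.est T \<xi> \<omega>) / 2"
  unfolding spectral_estimator_op_def
  by (simp add: hs_norm_op_average PX.estimator_kernel PY.estimator_kernel)

lemma trace_pooled:
  "\<omega> \<in> space M \<Longrightarrow> Re (op_trace (op_average (spectral_estimator_op W (b T) T (\<lambda>t. X t \<omega>) \<xi>) (spectral_estimator_op W (b T) T (\<lambda>t. Y t \<omega>) \<xi>)))
     = (PX.band_power T \<xi> \<omega> + PY.band_power T \<xi> \<omega>) / 2"
  by (subst op_trace_pooled) (simp_all add: PX.X_sq PY.X_sq PX.band_power_def PY.band_power_def)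

lemma hs_norm_spec:
  "hs_norm (op_diff (spectral_density_op M X \<xi>) (spectral_density_op M Y \<xi>)) = norm (PX.spec \<xi> - PY.spec \<xi>)"
  "hs_norm (op_average (spectral_density_op M X \<xi>) (spectral_density_op M Y \<xi>)) = norm (PX.spec \<xi> + PY.spec \<xi>) / 2"
  unfolding spectral_density_op_def PX.spectral_density_kernel_eq PY.spectral_density_kernel_eq
  by (simp_all add: hs_norm_op_diff hs_norm_op_average square_integrable_rep)

lemma studentized_statistic_eq:
  assumes "\<omega> \<in> space M"
  shows "studentized_statistic W (b T) T (\<lambda>t. X t \<omega>) (\<lambda>t. Y t \<omega>)
    = (sqrt (b T) * real T * distance T \<omega> - b T powr (-1/2) * (1 / pi * trace_integral T \<omega> * W_energy)) / sqrt (\<kappa> * quartic T \<omega>)"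
  unfolding studentized_statistic_def Let_def test_statistic_def integrated_hs_distance_def centering_def scaling_def
    hs_norm_est_diff[OF assms] hs_norm_pooled[OF assms] trace_pooled[OF assms]
  by (simp only: distance_def quartic_def trace_integral_def \<kappa>_def W_energy_def PX.lag_product_def)

lemma limits_eq:
  "integrated_hs_distance (spectral_density_op M X) (spectral_density_op M Y) = limit_distance"
  "scaling W (\<lambda>\<xi>. op_average (spectral_density_op M X \<xi>) (spectral_density_op M Y \<xi>)) = sqrt (\<kappa> * limit_quartic)"
  unfolding integrated_hs_distance_def scaling_def hs_norm_spec
  by (simp_all only: limit_distance_def limit_quartic_def \<kappa>_def PX.lag_product_def)

lemma measurable_functionals:
  "distance T \<in> borel_measurable M" "quartic T \<in> borel_measurable M" "trace_integral T \<in> borel_measurable M"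
  using PX.measurable_est[of T] PY.measurable_est[of T] PX.measurable_band_power[of T] PY.measurable_band_power[of T]
  unfolding distance_def[abs_def] quartic_def[abs_def] trace_integral_def[abs_def] case_prod_unfold
  by (intro PX.measurable_parameter_integral; simp add: case_prod_unfold)+

text \<open>A pathwise comparison: the triangle inequality reduces both differences to the errors of
  the two estimators, and \<open>square_diff_le_loss\<close> and
  \<open>fourth_power_diff_le_loss\<close> bound them by the loss, with constants that depend only
  on the spectral bounds. The path-dependent \<open>K1\<close> and \<open>K2\<close> serve
  integrability alone.\<close>

lemma distance_error:
  assumes w: "\<omega> \<in> space M" and r: "PX.regular T"
  shows "\<bar>distance T \<omega> - limit_distance\<bar> \<le> (2 * (PX.spec_bound + PY.spec_bound) + 17) * total_loss T \<omega>" (is "_ \<le> ?C * _")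
    and "\<bar>quartic T \<omega> - limit_quartic\<bar> \<le> (32 * (PX.spec_bound + PY.spec_bound) ^ 3 + 512) * total_loss T \<omega>" (is "_ \<le> ?D * _")
proof -
  let ?B = "PX.spec_bound + PY.spec_bound"
  have [measurable]: "(\<lambda>\<xi>. PX.est T \<xi> \<omega>) \<in> borel_measurable borel" "(\<lambda>\<xi>. PY.est T \<xi> \<omega>) \<in> borel_measurable borel"
    using PX.measurable_est_slice[OF w] PY.measurable_est_slice[OF w] by auto
  obtain K1 where K1: "\<forall>\<xi>. norm (PX.est T \<xi> \<omega>) \<le> K1" using PX.est_bounded[OF r] by blast
  obtain K2 where K2: "\<forall>\<xi>. norm (PY.est T \<xi> \<omega>) \<le> K2" using PY.est_bounded[OF r] by blast
  have e: "norm (PX.est T \<xi> \<omega> - PY.est T \<xi> \<omega>) \<le> K1 + K2" "norm (PX.est T \<xi> \<omega> + PY.est T \<xi> \<omega>) / 2 \<le> K1 + K2" for \<xi>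
    using norm_triangle_ineq4[of "PX.est T \<xi> \<omega>" "PY.est T \<xi> \<omega>"] norm_triangle_ineq[of "PX.est T \<xi> \<omega>" "PY.est T \<xi> \<omega>"]
      K1[rule_format, of \<xi>] K2[rule_format, of \<xi>] norm_ge_zero[of "PX.est T \<xi> \<omega>"] norm_ge_zero[of "PY.est T \<xi> \<omega>"] by linarith+
  have s: "norm (PX.spec \<xi> - PY.spec \<xi>) \<le> ?B" "norm (PX.spec \<xi> + PY.spec \<xi>) / 2 \<le> ?B" for \<xi>
    using norm_triangle_ineq4[of "PX.spec \<xi>" "PY.spec \<xi>"] norm_triangle_ineq[of "PX.spec \<xi>" "PY.spec \<xi>"]
      PX.norm_spec_le[of \<xi>] PY.norm_spec_le[of \<xi>] norm_ge_zero[of "PX.spec \<xi>"] norm_ge_zero[of "PY.spec \<xi>"] by linarith+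
  have d1: "\<bar>norm (PX.est T \<xi> \<omega> - PY.est T \<xi> \<omega>) - norm (PX.spec \<xi> - PY.spec \<xi>)\<bar> \<le> PX.err T \<xi> \<omega> + PY.err T \<xi> \<omega>" for \<xi>
  proof -
    have "\<bar>norm (PX.est T \<xi> \<omega> - PY.est T \<xi> \<omega>) - norm (PX.spec \<xi> - PY.spec \<xi>)\<bar> \<le> norm ((PX.est T \<xi> \<omega> - PY.est T \<xi> \<omega>) - (PX.spec \<xi> - PY.spec \<xi>))"
      by (rule norm_triangle_ineq3)
    also have "(PX.est T \<xi> \<omega> - PY.est T \<xi> \<omega>) - (PX.spec \<xi> - PY.spec \<xi>) = (PX.est T \<xi> \<omega> - PX.spec \<xi>) - (PY.est T \<xi> \<omega> - PY.spec \<xi>)" by simp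
    also have "norm \<dots> \<le> PX.err T \<xi> \<omega> + PY.err T \<xi> \<omega>" unfolding PX.err_def PY.err_def by (rule norm_triangle_ineq4)
    finally show ?thesis .
  qed
  have d2: "\<bar>norm (PX.est T \<xi> \<omega> + PY.est T \<xi> \<omega>) / 2 - norm (PX.spec \<xi> + PY.spec \<xi>) / 2\<bar> \<le> PX.err T \<xi> \<omega> + PY.err T \<xi> \<omega>" for \<xi>
  proof -
    have "\<bar>norm (PX.est T \<xi> \<omega> + PY.est T \<xi> \<omega>) - norm (PX.spec \<xi> + PY.spec \<xi>)\<bar> \<le> norm ((PX.est T \<xi> \<omega> + PY.est T \<xi> \<omega>) - (PX.spec \<xi> + PY.spec \<xi>))"
      by (rule norm_triangle_ineq3)
    also have "(PX.est T \<xi> \<omega> + PY.est T \<xi> \<omega>) - (PX.spec \<xi> + PY.spec \<xi>) = (PX.est T \<xi> \<omega> - PX.spec \<xi>) + (PY.est T \<xi> \<omega> - PY.spec \<xi>)" by simp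
    also have "norm \<dots> \<le> PX.err T \<xi> \<omega> + PY.err T \<xi> \<omega>" unfolding PX.err_def PY.err_def by (rule norm_triangle_ineq)
    finally have "\<bar>norm (PX.est T \<xi> \<omega> + PY.est T \<xi> \<omega>) - norm (PX.spec \<xi> + PY.spec \<xi>)\<bar> \<le> PX.err T \<xi> \<omega> + PY.err T \<xi> \<omega>" .
    then show ?thesis using PX.err_nonneg[of T \<xi> \<omega>] PY.err_nonneg[of T \<xi> \<omega>] by (simp only: diff_divide_distrib[symmetric]) simp
  qed
  have li: "set_integrable lborel {-pi..pi} (\<lambda>\<xi>. PX.loss T \<xi> \<omega> + PY.loss T \<xi> \<omega>)"
    by (intro set_integral_add PX.set_integrable_loss PY.set_integrable_loss w r)
  have l: "(LBINT \<xi>:{-pi..pi}. c * (PX.loss T \<xi> \<omega> + PY.loss T \<xi> \<omega>)) = c * total_loss T \<omega>" for c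
    unfolding total_loss_def PX.integrated_loss_def PY.integrated_loss_def
    by (simp add: set_integral_add(2) PX.set_integrable_loss PY.set_integrable_loss w r)
  have "\<bar>distance T \<omega> - limit_distance\<bar> \<le> (LBINT \<xi>:{-pi..pi}. ?C * (PX.loss T \<xi> \<omega> + PY.loss T \<xi> \<omega>))"
    unfolding distance_def limit_distance_def
  proof (rule set_integral_diff_le)
    show "set_integrable lborel {-pi..pi} (\<lambda>\<xi>. (norm (PX.est T \<xi> \<omega> - PY.est T \<xi> \<omega>))\<^sup>2)"
      by (rule set_integrable_bounded[where K = "(K1 + K2)\<^sup>2"], measurable) (use e in \<open>simp add: power_mono\<close>)
    show "set_integrable lborel {-pi..pi} (\<lambda>\<xi>. (norm (PX.spec \<xi> - PY.spec \<xi>))\<^sup>2)"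
      by (rule set_integrable_bounded[where K = "?B\<^sup>2"], measurable) (use s in \<open>simp add: power_mono\<close>)
    show "set_integrable lborel {-pi..pi} (\<lambda>\<xi>. ?C * (PX.loss T \<xi> \<omega> + PY.loss T \<xi> \<omega>))"
      by (intro set_integrable_mult_right impI li)
    show "\<bar>(norm (PX.est T \<xi> \<omega> - PY.est T \<xi> \<omega>))\<^sup>2 - (norm (PX.spec \<xi> - PY.spec \<xi>))\<^sup>2\<bar> \<le> ?C * (PX.loss T \<xi> \<omega> + PY.loss T \<xi> \<omega>)" for \<xi>
      unfolding PX.loss_def PY.loss_def
      by (rule square_diff_le_loss[OF norm_ge_zero norm_ge_zero PX.err_nonneg PY.err_nonneg d1 s(1)])
  qed
  then show "\<bar>distance T \<omega> - limit_distance\<bar> \<le> ?C * total_loss T \<omega>" unfolding l .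
  have "\<bar>quartic T \<omega> - limit_quartic\<bar> \<le> (LBINT \<xi>:{-pi..pi}. ?D * (PX.loss T \<xi> \<omega> + PY.loss T \<xi> \<omega>))"
    unfolding quartic_def limit_quartic_def
  proof (rule set_integral_diff_le)
    show "set_integrable lborel {-pi..pi} (\<lambda>\<xi>. (norm (PX.est T \<xi> \<omega> + PY.est T \<xi> \<omega>) / 2) ^ 4)"
      by (rule set_integrable_bounded[where K = "(K1 + K2) ^ 4"], measurable) (simp only: abs_of_nonneg zero_le_power divide_nonneg_nonneg norm_ge_zero zero_le_numeral power_mono e)
    show "set_integrable lborel {-pi..pi} (\<lambda>\<xi>. (norm (PX.spec \<xi> + PY.spec \<xi>) / 2) ^ 4)"
      by (rule set_integrable_bounded[where K = "?B ^ 4"], measurable) (simp only: abs_of_nonneg zero_le_power divide_nonneg_nonneg norm_ge_zero zero_le_numeral power_mono s)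
    show "set_integrable lborel {-pi..pi} (\<lambda>\<xi>. ?D * (PX.loss T \<xi> \<omega> + PY.loss T \<xi> \<omega>))"
      by (intro set_integrable_mult_right impI li)
    show "\<bar>(norm (PX.est T \<xi> \<omega> + PY.est T \<xi> \<omega>) / 2) ^ 4 - (norm (PX.spec \<xi> + PY.spec \<xi>) / 2) ^ 4\<bar> \<le> ?D * (PX.loss T \<xi> \<omega> + PY.loss T \<xi> \<omega>)" for \<xi>
      unfolding PX.loss_def PY.loss_def
      by (rule fourth_power_diff_le_loss[OF _ _ PX.err_nonneg PY.err_nonneg d2 s(2)]) auto
  qed
  then show "\<bar>quartic T \<omega> - limit_quartic\<bar> \<le> ?D * total_loss T \<omega>" unfolding l .
qed

text \<open>The square of an average is at most the sum of the squares, so no mixed term between the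
  two samples has to be estimated.\<close>

lemma trace_integral_le:
  assumes w: "\<omega> \<in> space M" and r: "PX.regular T"
  shows "0 \<le> trace_integral T \<omega>" "trace_integral T \<omega> \<le> PX.integrated_power T \<omega> + PY.integrated_power T \<omega>"
proof -
  show "0 \<le> trace_integral T \<omega>" unfolding trace_integral_def set_lebesgue_integral_def by (intro integral_nonneg_AE) simp
  have le: "((p + q) / 2)\<^sup>2 \<le> p\<^sup>2 + q\<^sup>2" for p q :: real by (rule square_mean_le)
  have m: "(\<lambda>\<xi>. PX.band_power T \<xi> \<omega>) \<in> borel_measurable borel" "(\<lambda>\<xi>. PY.band_power T \<xi> \<omega>) \<in> borel_measurable borel"
    using measurable_compose[OF measurable_Pair2'[OF w] PX.measurable_band_power[of T]]
      measurable_compose[OF measurable_Pair2'[OF w] PY.measurable_band_power[of T]] by simp_all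
  have i: "set_integrable lborel {-pi..pi} (\<lambda>\<xi>. (PX.band_power T \<xi> \<omega>)\<^sup>2 + (PY.band_power T \<xi> \<omega>)\<^sup>2)"
    by (intro set_integral_add PX.set_integrable_band_power PY.set_integrable_band_power w r)
  have "trace_integral T \<omega> \<le> (LBINT \<xi>:{-pi..pi}. (PX.band_power T \<xi> \<omega>)\<^sup>2 + (PY.band_power T \<xi> \<omega>)\<^sup>2)"
    unfolding trace_integral_def
  proof (rule set_integral_mono[OF _ i le])
    show "set_integrable lborel {-pi..pi} (\<lambda>\<xi>. ((PX.band_power T \<xi> \<omega> + PY.band_power T \<xi> \<omega>) / 2)\<^sup>2)"
      by (rule set_integrable_bound[OF i]) (use m le in \<open>auto simp: set_borel_measurable_def intro!: AE_I2\<close>)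
  qed
  also have "\<dots> = PX.integrated_power T \<omega> + PY.integrated_power T \<omega>"
    unfolding PX.integrated_power_def PY.integrated_power_def
    by (intro set_integral_add PX.set_integrable_band_power PY.set_integrable_band_power w r)
  finally show "trace_integral T \<omega> \<le> PX.integrated_power T \<omega> + PY.integrated_power T \<omega>" .
qed

text \<open>The two estimators are averaged one after the other over separate sample points, so
  nonnegativity holds for the inner product of their means; it then passes to the limit in
  \<open>T\<close>, which is known at interior frequencies.\<close>

lemma inner_spec_nonneg:
  assumes \<xi>: "-pi < \<xi>" "\<xi> < pi" shows "PX.spec \<xi> \<bullet> PY.spec \<xi> \<ge> 0"
proof -
  have eX: "PX.expectation (PX.est T \<xi>) = PX.mean_estimator T \<xi>" for T
    unfolding PX.est_def[abs_def] estimator_def PX.mean_estimator_def by (rule PX.expectation_quadratic_X) simp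
  have eY: "PX.expectation (PY.est T \<xi>) = PY.mean_estimator T \<xi>" for T
    unfolding PY.est_def[abs_def] estimator_def PY.mean_estimator_def by (rule PY.expectation_quadratic_X) simp
  have iX: "integrable M (PX.est T \<xi>)" and iY: "integrable M (PY.est T \<xi>)" for T
    by (rule PX.all_moments_integrable[OF PX.all_moments_est] PX.all_moments_integrable[OF PY.all_moments_est])+
  have "PX.mean_estimator T \<xi> \<bullet> PY.mean_estimator T \<xi> \<ge> 0" if "PX.regular T" for T
  proof -
    have "0 \<le> PX.est T \<xi> \<omega> \<bullet> PY.mean_estimator T \<xi>" for \<omega>
    proof -
      have "0 \<le> PX.expectation (\<lambda>\<omega>'. PX.est T \<xi> \<omega> \<bullet> PY.est T \<xi> \<omega>')"
        unfolding PX.est_def PY.est_def using that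
        by (intro integral_nonneg_AE AE_I2 PX.inner_estimator_nonneg) (simp add: PX.regular_def)
      then show ?thesis using iY by (simp add: eY)
    qed
    then have "0 \<le> PX.expectation (\<lambda>\<omega>. PX.est T \<xi> \<omega> \<bullet> PY.mean_estimator T \<xi>)" by simp
    then show ?thesis using iX by (simp add: eX)
  qed
  then have "eventually (\<lambda>T. 0 \<le> PX.mean_estimator T \<xi> \<bullet> PY.mean_estimator T \<xi>) sequentially"
    using PX.eventually_regular by (auto elim: eventually_mono)
  moreover have "(\<lambda>T. PX.mean_estimator T \<xi> \<bullet> PY.mean_estimator T \<xi>) \<longlonglongrightarrow> PX.spec \<xi> \<bullet> PY.spec \<xi>"
    by (intro tendsto_inner PX.mean_estimator_tendsto PY.mean_estimator_tendsto \<xi>)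
  ultimately show ?thesis by (intro tendsto_lowerbound) auto
qed

context
  fixes \<Lambda> :: "real set"
  assumes \<Lambda>: "\<Lambda> \<subseteq> {0..pi}" "emeasure lebesgue \<Lambda> > 0"
    and ne: "\<And>\<xi>. \<xi> \<in> \<Lambda> \<Longrightarrow> spectral_density_op M X \<xi> \<noteq> spectral_density_op M Y \<xi>"
begin

lemma spec_ne: "\<xi> \<in> \<Lambda> \<Longrightarrow> PX.spec \<xi> \<noteq> PY.spec \<xi>"
  using ne[of \<xi>] by (auto simp: spectral_density_op_def PX.spectral_density_kernel_eq PY.spectral_density_kernel_eq)

lemma limit_distance_pos: "limit_distance > 0"
  unfolding limit_distance_def
proof (rule set_integral_pos[OF _ _ _ \<Lambda>(2)])
  show "set_integrable lborel {-pi..pi} (\<lambda>\<xi>. (norm (PX.spec \<xi> - PY.spec \<xi>))\<^sup>2)"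
  proof (rule set_integrable_bounded)
    show "\<bar>(norm (PX.spec \<xi> - PY.spec \<xi>))\<^sup>2\<bar> \<le> (PX.spec_bound + PY.spec_bound)\<^sup>2" for \<xi>
      using norm_triangle_ineq4[of "PX.spec \<xi>" "PY.spec \<xi>"] PX.norm_spec_le[of \<xi>] PY.norm_spec_le[of \<xi>]
      by (simp add: power_mono)
  qed measurable
  show "AE \<xi> in lborel. \<xi> \<in> \<Lambda> \<longrightarrow> \<xi> \<in> {-pi..pi} \<and> 0 < (norm (PX.spec \<xi> - PY.spec \<xi>))\<^sup>2"
    using \<Lambda>(1) spec_ne pi_gt_zero by (intro AE_I2) (auto intro: order_trans[of _ 0])
qed auto

lemma limit_quartic_pos: "limit_quartic > 0"
  unfolding limit_quartic_def
proof (rule set_integral_pos[OF _ _ _ \<Lambda>(2)])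
  show "set_integrable lborel {-pi..pi} (\<lambda>\<xi>. (norm (PX.spec \<xi> + PY.spec \<xi>) / 2) ^ 4)"
  proof (rule set_integrable_bounded)
    show "\<bar>(norm (PX.spec \<xi> + PY.spec \<xi>) / 2) ^ 4\<bar> \<le> (PX.spec_bound + PY.spec_bound) ^ 4" for \<xi>
    proof -
      have "norm (PX.spec \<xi> + PY.spec \<xi>) / 2 \<le> PX.spec_bound + PY.spec_bound"
        using norm_triangle_ineq[of "PX.spec \<xi>" "PY.spec \<xi>"] PX.norm_spec_le[of \<xi>] PY.norm_spec_le[of \<xi>]
          norm_ge_zero[of "PX.spec \<xi> + PY.spec \<xi>"] by linarith
      then show ?thesis by (subst abs_of_nonneg) (auto intro!: power_mono)
    qed
  qed measurable
  show "AE \<xi> in lborel. \<xi> \<in> \<Lambda> \<longrightarrow> \<xi> \<in> {-pi..pi} \<and> 0 < (norm (PX.spec \<xi> + PY.spec \<xi>) / 2) ^ 4"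
    \<comment> \<open>The end point \<open>pi\<close> is discarded because the sign of the inner
      product is known only at interior frequencies.\<close>
    using AE_lborel_singleton[of pi]
  proof eventually_elim
    case (elim \<xi>)
    show ?case
    proof (intro impI conjI)
      assume x: "\<xi> \<in> \<Lambda>"
      then show "\<xi> \<in> {-pi..pi}" using \<Lambda>(1) pi_gt_zero by (auto intro: order_trans[of _ 0])
      have "\<xi> \<in> {0..pi}" using x \<Lambda>(1) by blast
      then have r: "-pi < \<xi>" "\<xi> < pi" using elim pi_gt_zero by (simp_all add: less_le)
      have "0 < (norm (PX.spec \<xi> - PY.spec \<xi>))\<^sup>2" using spec_ne[OF x] by simp
      also have "\<dots> \<le> (norm (PX.spec \<xi> + PY.spec \<xi>))\<^sup>2"
        using inner_spec_nonneg[OF r]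
        by (simp add: power2_norm_eq_inner inner_add_left inner_add_right inner_diff_left inner_diff_right inner_commute)
      finally show "0 < (norm (PX.spec \<xi> + PY.spec \<xi>) / 2) ^ 4" by simp
    qed
  qed
qed auto

end

end

text \<open>The arguments stand for the distance, the scaled centering and the quartic integral; the
  map is continuous at \<open>(\<Delta>, 0, V\<^sub>0)\<close> because
  \<open>\<kappa> * V\<^sub>0\<close> is positive. Three deviations below \<open>d / 3\<close> keep
  the triple within distance \<open>d\<close>.\<close>

lemma studentized_continuity:
  fixes \<kappa> \<Delta> V\<^sub>0 :: real
  assumes "\<kappa> > 0" "V\<^sub>0 > 0" "\<delta> > 0"
  shows "\<exists>\<eta>>0. \<forall>u r v. \<bar>u - \<Delta>\<bar> < \<eta> \<longrightarrow> \<bar>r\<bar> < \<eta> \<longrightarrow> \<bar>v - V\<^sub>0\<bar> < \<eta> \<longrightarrow>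
    \<bar>(u - r) / sqrt (\<kappa> * v) - \<Delta> / sqrt (\<kappa> * V\<^sub>0)\<bar> < \<delta>"
proof -
  let ?f = "\<lambda>p :: real \<times> real \<times> real. (fst p - fst (snd p)) / sqrt (\<kappa> * snd (snd p))"
  have "isCont ?f (\<Delta>, 0, V\<^sub>0)" using assms by (intro continuous_intros) auto
  then have "\<exists>d>0. \<forall>p. dist p (\<Delta>, 0, V\<^sub>0) < d \<longrightarrow> dist (?f p) (?f (\<Delta>, 0, V\<^sub>0)) < \<delta>"
    unfolding continuous_at_eps_delta using assms(3) by blast
  then obtain d where d: "d > 0" "\<And>p. dist p (\<Delta>, 0, V\<^sub>0) < d \<Longrightarrow> dist (?f p) (?f (\<Delta>, 0, V\<^sub>0)) < \<delta>"
    by blast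
  have "\<bar>(u - r) / sqrt (\<kappa> * v) - \<Delta> / sqrt (\<kappa> * V\<^sub>0)\<bar> < \<delta>"
    if "\<bar>u - \<Delta>\<bar> < d / 3" "\<bar>r\<bar> < d / 3" "\<bar>v - V\<^sub>0\<bar> < d / 3" for u r v
  proof -
    have "dist (u, r, v) (\<Delta>, 0, V\<^sub>0) \<le> dist u \<Delta> + (dist r 0 + dist v V\<^sub>0)"
      unfolding dist_Pair_Pair by (intro order_trans[OF sqrt_sum_squares_le_sum] add_mono order_refl sqrt_sum_squares_le_sum) auto
    also have "\<dots> < d" using that unfolding dist_real_def by (simp only: diff_zero)
    finally show ?thesis using d(2)[of "(u, r, v)"] by (simp add: dist_real_def)
  qed
  then show ?thesis using d(1) by (intro exI[of _ "d / 3"]) auto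
qed

lemma common_upper_bound: "\<exists>c>0. 2 * x \<le> c \<and> 2 * y \<le> c \<and> 2 * z \<le> c" for x y z :: real
  by (rule exI[of _ "max 1 (max (2 * x) (max (2 * y) (2 * z)))"]) auto

context spectral_pair
begin

definition studentized :: "nat \<Rightarrow> 'w \<Rightarrow> real" where
  "studentized T \<omega> = studentized_statistic W (b T) T (\<lambda>t. X t \<omega>) (\<lambda>t. Y t \<omega>)"

definition rate :: "nat \<Rightarrow> real" where "rate T = sqrt (b T) * real T"

definition remainder :: "nat \<Rightarrow> 'w \<Rightarrow> real" where
  "remainder T \<omega> = studentized T \<omega> - rate T * limit_distance / sqrt (\<kappa> * limit_quartic)"

lemma measurable_studentized [measurable]: "studentized T \<in> borel_measurable M"
proof -
  note [measurable] = measurable_functionals[of T]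
  have "(\<lambda>\<omega>. (sqrt (b T) * real T * distance T \<omega> - b T powr (-1/2) * (1 / pi * trace_integral T \<omega> * W_energy)) / sqrt (\<kappa> * quartic T \<omega>)) \<in> borel_measurable M"
    by measurable
  then show ?thesis
    by (rule measurable_cong[THEN iffD2, rotated]) (simp add: studentized_def studentized_statistic_eq)
qed

text \<open>\<open>sqrt (b * T)\<close> is at most \<open>sqrt b * T\<close> once
  \<open>T \<ge> 1\<close>, so the rate inherits divergence from \<open>b * T\<close>.\<close>

lemma rate_at_top: "filterlim rate at_top sequentially"
proof (rule filterlim_at_top_mono)
  show "filterlim (\<lambda>T. sqrt (b T * real T)) at_top sequentially"
    by (rule filterlim_compose[OF sqrt_at_top PX.bT_at_top])
  show "eventually (\<lambda>T. sqrt (b T * real T) \<le> rate T) sequentially"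
    using PX.eventually_regular
  proof eventually_elim
    case (elim T)
    then have "1 \<le> real T" "b T > 0" by (auto simp: PX.regular_def)
    then have "sqrt (real T) \<le> real T" using real_sqrt_le_mono[of "real T" "(real T)\<^sup>2"] by (simp add: power2_eq_square)
    then show ?case using \<open>b T > 0\<close> by (simp add: rate_def real_sqrt_mult mult_left_mono)
  qed
qed

text \<open>Dividing the power -1/2 of \<open>b\<close> by \<open>sqrt b * T\<close> leaves
  \<open>1 / (b * T)\<close>, which shows that the centering is negligible.\<close>

lemma studentized_div_rate:
  assumes w: "\<omega> \<in> space M" and r: "PX.regular T"
  shows "studentized T \<omega> / rate T = (distance T \<omega> - W_energy / pi * (trace_integral T \<omega> / (b T * real T))) / sqrt (\<kappa> * quartic T \<omega>)"
proof -
  have b: "b T > 0" and T: "real T > 0" using r by (auto simp: PX.regular_def)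
  have "b T powr (- (1/2)) = inverse (b T powr (1/2))" by (rule powr_minus)
  also have "\<dots> = 1 / sqrt (b T)" using b by (simp only: powr_half_sqrt less_imp_le inverse_eq_divide)
  finally have p: "b T powr (-1/2) = 1 / sqrt (b T)" by (simp only: minus_divide_left)
  have s: "sqrt (b T) * sqrt (b T) = b T" using b by simp
  have "(sqrt (b T) * real T * d - 1 / sqrt (b T) * (1 / pi * t * e)) / q / (sqrt (b T) * real T) = (d - e / pi * (t / (b T * real T))) / q" for d t e q
  \<comment> \<open>For a vanishing studentizing term both sides are 0, as division by 0 gives
    0.\<close>
  proof (cases "q = 0")
    case False
    have "(sqrt (b T) * real T * d - 1 / sqrt (b T) * (1 / pi * t * e)) / (sqrt (b T) * real T) = d - e / pi * (t / (sqrt (b T) * sqrt (b T) * real T))"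
      using b T by (simp add: field_simps del: real_sqrt_mult_self)
    then show ?thesis unfolding s by (simp only: divide_divide_eq_left mult.commute[of q]) (simp only: divide_divide_eq_left[symmetric])
  qed simp
  then show ?thesis unfolding studentized_def studentized_statistic_eq[OF w] rate_def p .
qed

context
  fixes \<Lambda> :: "real set"
  assumes \<Lambda>: "\<Lambda> \<subseteq> {0..pi}" "emeasure lebesgue \<Lambda> > 0"
    and ne: "\<And>\<xi>. \<xi> \<in> \<Lambda> \<Longrightarrow> spectral_density_op M X \<xi> \<noteq> spectral_density_op M Y \<xi>"
begin

text \<open>Outside four events, where an integrated loss or a scaled integrated power is at least
  \<open>\<eta> / c\<close>, all three arguments of the studentized quotient are within
  \<open>\<eta>\<close> of their limits. Markov's inequality makes the four events
  improbable.\<close>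

lemma remainder_small:
  assumes \<delta>: "\<delta> > 0"
  shows "(\<lambda>T. PX.prob {\<omega> \<in> space M. \<bar>remainder T \<omega> / rate T\<bar> > \<delta>}) \<longlonglongrightarrow> 0"
proof -
  obtain \<eta> where \<eta>: "\<eta> > 0"
    "\<And>u r v. \<bar>u - limit_distance\<bar> < \<eta> \<Longrightarrow> \<bar>r\<bar> < \<eta> \<Longrightarrow> \<bar>v - limit_quartic\<bar> < \<eta> \<Longrightarrow>
       \<bar>(u - r) / sqrt (\<kappa> * v) - limit_distance / sqrt (\<kappa> * limit_quartic)\<bar> < \<delta>"
    using studentized_continuity[OF \<kappa>_pos limit_quartic_pos[OF \<Lambda> ne] \<delta>] by blast
  let ?C = "2 * (PX.spec_bound + PY.spec_bound) + 17" and ?D = "32 * (PX.spec_bound + PY.spec_bound) ^ 3 + 512"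
  have W0: "W_energy \<ge> 0" unfolding W_energy_def set_lebesgue_integral_def by (intro integral_nonneg_AE) simp
  have C0: "?C \<ge> 0" "?D \<ge> 0" using PX.spec_bound_nonneg PY.spec_bound_nonneg by simp_all
  \<comment> \<open>Each of the three error factors, applied to a sum of two terms below
    \<open>\<eta> / c\<close>, then stays below \<open>\<eta>\<close>.\<close>
  obtain c where c: "c > 0" "2 * ?C \<le> c" "2 * ?D \<le> c" "2 * (W_energy / pi) \<le> c"
    using common_upper_bound[of ?C ?D "W_energy / pi"] by blast
  let ?e = "\<eta> / c"
  have e: "?e > 0" using \<eta> c by simp
  define E where "E Z T = {\<omega> \<in> space M. Z T \<omega> \<ge> ?e}" for Z :: "nat \<Rightarrow> 'w \<Rightarrow> real" and T
  let ?Z1 = "PX.integrated_loss" and ?Z2 = "PY.integrated_loss"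
    and ?Z3 = "\<lambda>T \<omega>. PX.integrated_power T \<omega> / (b T * real T)" and ?Z4 = "\<lambda>T \<omega>. PY.integrated_power T \<omega> / (b T * real T)"
  have m: "E ?Z1 T \<in> sets M" "E ?Z2 T \<in> sets M" "E ?Z3 T \<in> sets M" "E ?Z4 T \<in> sets M" for T
    unfolding E_def by measurable
  have lim: "(\<lambda>T. PX.prob (E ?Z1 T)) \<longlonglongrightarrow> 0" "(\<lambda>T. PX.prob (E ?Z2 T)) \<longlonglongrightarrow> 0"
    "(\<lambda>T. PX.prob (E ?Z3 T)) \<longlonglongrightarrow> 0" "(\<lambda>T. PX.prob (E ?Z4 T)) \<longlonglongrightarrow> 0"
    unfolding E_def
    by (rule PX.Markov_tendsto[OF _ _ e]; (rule PX.integrated_loss_tendsto PY.integrated_loss_tendsto PX.integrated_power_tendsto PY.integrated_power_tendsto | measurable))+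
  have sub: "{\<omega> \<in> space M. \<bar>remainder T \<omega> / rate T\<bar> > \<delta>} \<subseteq> (E ?Z1 T \<union> E ?Z2 T) \<union> (E ?Z3 T \<union> E ?Z4 T)" if r: "PX.regular T" for T
  proof (rule subsetI, rule ccontr)
    fix \<omega> assume \<omega>: "\<omega> \<in> {\<omega> \<in> space M. \<bar>remainder T \<omega> / rate T\<bar> > \<delta>}" and "\<omega> \<notin> (E ?Z1 T \<union> E ?Z2 T) \<union> (E ?Z3 T \<union> E ?Z4 T)"
    then have w: "\<omega> \<in> space M" and z: "?Z1 T \<omega> < ?e" "?Z2 T \<omega> < ?e" "?Z3 T \<omega> < ?e" "?Z4 T \<omega> < ?e" by (auto simp: E_def)
    have bT: "b T * real T > 0" and rp: "rate T > 0" using r by (simp_all add: PX.regular_def rate_def)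
    have l0: "total_loss T \<omega> \<ge> 0" unfolding total_loss_def PX.integrated_loss_def PY.integrated_loss_def set_lebesgue_integral_def
      by (intro add_nonneg_nonneg integral_nonneg_AE) (simp_all add: PX.loss_nonneg PY.loss_nonneg)
    have small: "k * x < \<eta>" if "0 \<le> x" "x < 2 * ?e" "0 \<le> k" "2 * k \<le> c" for k x
    proof -
      have "k * x \<le> c / 2 * x" using that by (intro mult_right_mono) auto
      also have "\<dots> < c / 2 * (2 * ?e)" using that c by (intro mult_strict_left_mono) auto
      also have "\<dots> = \<eta>" using c by simp
      finally show ?thesis .
    qed
    have lt: "total_loss T \<omega> < 2 * ?e" unfolding total_loss_def using z by linarith
    have "\<bar>distance T \<omega> - limit_distance\<bar> < \<eta>"
      using distance_error(1)[OF w r] small[OF l0 lt C0(1) c(2)] by linarith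
    moreover have "\<bar>quartic T \<omega> - limit_quartic\<bar> < \<eta>"
      using distance_error(2)[OF w r] small[OF l0 lt C0(2) c(3)] by linarith
    moreover have "\<bar>W_energy / pi * (trace_integral T \<omega> / (b T * real T))\<bar> < \<eta>"
    proof -
      have t0: "0 \<le> trace_integral T \<omega> / (b T * real T)" using trace_integral_le(1)[OF w r] bT by simp
      have "trace_integral T \<omega> / (b T * real T) \<le> (PX.integrated_power T \<omega> + PY.integrated_power T \<omega>) / (b T * real T)"
        using trace_integral_le(2)[OF w r] bT by (intro divide_right_mono) auto
      also have "\<dots> < 2 * ?e" using z(3,4) unfolding add_divide_distrib by linarith
      finally have "W_energy / pi * (trace_integral T \<omega> / (b T * real T)) < \<eta>"
        by (rule small[OF t0 _ _ c(4)]) (use W0 in simp)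
      moreover have "0 \<le> W_energy / pi * (trace_integral T \<omega> / (b T * real T))" using t0 W0 by (intro mult_nonneg_nonneg) auto
      ultimately show ?thesis by (simp only: abs_of_nonneg)
    qed
    ultimately have "\<bar>studentized T \<omega> / rate T - limit_distance / sqrt (\<kappa> * limit_quartic)\<bar> < \<delta>"
      unfolding studentized_div_rate[OF w r] by (intro \<eta>(2))
    moreover have "remainder T \<omega> / rate T = studentized T \<omega> / rate T - limit_distance / sqrt (\<kappa> * limit_quartic)"
      using rp by (simp add: remainder_def diff_divide_distrib)
    ultimately have "\<bar>remainder T \<omega> / rate T\<bar> < \<delta>" by (simp only:)
    with \<omega> show False by (simp only: mem_Collect_eq) linarith
  qed
  have "(\<lambda>T. (PX.prob (E ?Z1 T) + PX.prob (E ?Z2 T)) + (PX.prob (E ?Z3 T) + PX.prob (E ?Z4 T))) \<longlonglongrightarrow> (0 + 0) + (0 + 0)"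
    by (intro tendsto_add lim)
  then have lim0: "(\<lambda>T. (PX.prob (E ?Z1 T) + PX.prob (E ?Z2 T)) + (PX.prob (E ?Z3 T) + PX.prob (E ?Z4 T))) \<longlonglongrightarrow> 0" by simp
  have "eventually (\<lambda>T. PX.prob {\<omega> \<in> space M. \<bar>remainder T \<omega> / rate T\<bar> > \<delta>} \<le> (PX.prob (E ?Z1 T) + PX.prob (E ?Z2 T)) + (PX.prob (E ?Z3 T) + PX.prob (E ?Z4 T))) sequentially"
    using PX.eventually_regular
  proof eventually_elim
    case (elim T)
    have "PX.prob {\<omega> \<in> space M. \<bar>remainder T \<omega> / rate T\<bar> > \<delta>} \<le> PX.prob ((E ?Z1 T \<union> E ?Z2 T) \<union> (E ?Z3 T \<union> E ?Z4 T))"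
      by (rule PX.finite_measure_mono[OF sub[OF elim]]) (intro sets.Un m)
    also have "\<dots> \<le> PX.prob (E ?Z1 T \<union> E ?Z2 T) + PX.prob (E ?Z3 T \<union> E ?Z4 T)"
      by (intro measure_Un_le sets.Un m)
    also have "\<dots> \<le> (PX.prob (E ?Z1 T) + PX.prob (E ?Z2 T)) + (PX.prob (E ?Z3 T) + PX.prob (E ?Z4 T))"
      by (intro add_mono measure_Un_le m)
    finally show ?case .
  qed
  then show ?thesis
    by (rule tendsto_sandwich[OF always_eventually _ tendsto_const lim0, rotated]) (simp add: measure_nonneg)
qed

lemma small_o_remainder: "small_o_prob M remainder rate"
  unfolding small_o_prob_def
  using remainder_small by (auto simp: remainder_def[abs_def])

lemma studentized_tends_to_infinity: "tends_to_infinity_prob M studentized"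
  unfolding tends_to_infinity_prob_def
proof (intro conjI allI measurable_studentized)
  fix K
  let ?\<theta> = "sqrt (\<kappa> * limit_quartic)"
  \<comment> \<open>Half of the limit of the statistic divided by \<open>rate\<close>: if the
    remainder is at most \<open>\<delta> * rate T\<close> in absolute value, the statistic is at
    least \<open>\<delta> * rate T\<close>.\<close>
  define \<delta> where "\<delta> = limit_distance / ?\<theta> / 2"
  have \<theta>: "?\<theta> > 0" using \<kappa>_pos limit_quartic_pos[OF \<Lambda> ne] by simp
  have \<delta>: "\<delta> > 0" using limit_distance_pos[OF \<Lambda> ne] \<theta> by (simp add: \<delta>_def)
  let ?bad = "\<lambda>T. {\<omega> \<in> space M. \<bar>remainder T \<omega> / rate T\<bar> > \<delta>}"
  have rm [measurable]: "remainder T \<in> borel_measurable M" for T unfolding remainder_def[abs_def] by measurable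
  have "filterlim (\<lambda>T. \<delta> * rate T) at_top sequentially"
    by (rule filterlim_tendsto_pos_mult_at_top[OF tendsto_const \<delta> rate_at_top])
  then have big: "eventually (\<lambda>T. K < \<delta> * rate T) sequentially" by (simp add: filterlim_at_top_dense)
  have "(\<lambda>T. 1 - PX.prob (?bad T)) \<longlonglongrightarrow> 1 - 0" by (intro tendsto_diff tendsto_const remainder_small \<delta>)
  then have lim: "(\<lambda>T. 1 - PX.prob (?bad T)) \<longlonglongrightarrow> 1" by simp
  have "eventually (\<lambda>T. 1 - PX.prob (?bad T) \<le> PX.prob {\<omega> \<in> space M. studentized T \<omega> > K}) sequentially"
    using PX.eventually_regular big
  proof eventually_elim
    case (elim T)
    have rp: "rate T > 0" using elim(1) by (simp add: PX.regular_def rate_def)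
    have "space M - ?bad T \<subseteq> {\<omega> \<in> space M. studentized T \<omega> > K}"
    proof
      fix \<omega> assume w: "\<omega> \<in> space M - ?bad T"
      then have "\<bar>remainder T \<omega> / rate T\<bar> \<le> \<delta>" by auto
      then have "\<bar>remainder T \<omega>\<bar> \<le> \<delta> * rate T" using rp by (simp add: abs_divide pos_divide_le_eq)
      moreover have "rate T * limit_distance / ?\<theta> = 2 * (\<delta> * rate T)" by (simp add: \<delta>_def)
      ultimately have "studentized T \<omega> > K" using elim(2) unfolding remainder_def by linarith
      then show "\<omega> \<in> {\<omega> \<in> space M. studentized T \<omega> > K}" using w by simp
    qed
    then have "PX.prob (space M - ?bad T) \<le> PX.prob {\<omega> \<in> space M. studentized T \<omega> > K}"
      by (rule PX.finite_measure_mono) measurable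
    moreover have "PX.prob (space M - ?bad T) = 1 - PX.prob (?bad T)" by (rule PX.prob_compl) measurable
    ultimately show ?case by simp
  qed
  then show "(\<lambda>T. PX.prob {\<omega> \<in> space M. studentized T \<omega> > K}) \<longlonglongrightarrow> 1"
    by (rule tendsto_sandwich[OF _ always_eventually lim tendsto_const]) simp
qed

end

end

text \<open>The ratio of \<open>b\<close> to the power \<open>-\<nu>\<close> of \<open>T\<close>
  tends to 1; for large \<open>T\<close> it exceeds 1/2, which gives positivity of \<open>b\<close>
  and growth of \<open>b * T\<close> at least like the power \<open>1 - \<nu>\<close> of
  \<open>T\<close>.\<close>

lemma bandwidth_limits:
  fixes b :: "nat \<Rightarrow> real"
  assumes b: "b \<sim>[sequentially] (\<lambda>T. real T powr (- \<nu>))" and \<nu>: "0 < \<nu>" "\<nu> < 1"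
  shows "b \<longlonglongrightarrow> 0" and "eventually (\<lambda>T. b T > 0) sequentially"
    and "filterlim (\<lambda>T. b T * real T) at_top sequentially"
proof -
  let ?g = "\<lambda>T. real T powr (- \<nu>)"
  \<comment> \<open>The default value 1 in asymptotic equivalence can matter only at
    \<open>T = 0\<close>, where the comparison function vanishes.\<close>
  have "(\<lambda>T. if b T = 0 \<and> ?g T = 0 then 1 else b T / ?g T) \<longlonglongrightarrow> 1" by (rule asymp_equivD[OF b])
  moreover have "eventually (\<lambda>T. (if b T = 0 \<and> ?g T = 0 then 1 else b T / ?g T) = b T / ?g T) sequentially"
    using eventually_gt_at_top[of 0] by eventually_elim simp
  ultimately have q: "(\<lambda>T. b T / ?g T) \<longlonglongrightarrow> 1" by (simp add: tendsto_cong)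
  have g0: "?g \<longlonglongrightarrow> 0" using \<nu>(1) by (intro tendsto_neg_powr filterlim_real_sequentially) simp
  have "(\<lambda>T. b T / ?g T * ?g T) \<longlonglongrightarrow> 1 * 0" by (rule tendsto_mult[OF q g0])
  moreover have "eventually (\<lambda>T. b T / ?g T * ?g T = b T) sequentially"
    using eventually_gt_at_top[of 0] by eventually_elim simp
  ultimately show "b \<longlonglongrightarrow> 0" by (simp add: tendsto_cong)
  have "eventually (\<lambda>T. 1/2 < b T / ?g T) sequentially" by (rule order_tendstoD(1)[OF q]) simp
  then have half: "eventually (\<lambda>T. ?g T / 2 \<le> b T \<and> T > 0) sequentially"
    using eventually_gt_at_top[of 0]
  proof eventually_elim
    case (elim T)
    then have "?g T > 0" by simp
    then show ?case using elim by (simp add: pos_less_divide_eq)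
  qed
  then show "eventually (\<lambda>T. b T > 0) sequentially"
  proof eventually_elim
    case (elim T)
    then have "0 < ?g T / 2" by simp
    then show ?case using elim by linarith
  qed
  have "filterlim (\<lambda>T. (1/2) * real T powr (1 - \<nu>)) at_top sequentially"
  proof (rule filterlim_tendsto_pos_mult_at_top[OF tendsto_const])
    have "filterlim (\<lambda>T. exp ((1 - \<nu>) * ln (real T))) at_top sequentially"
      using \<nu> by (intro filterlim_compose[OF exp_at_top] filterlim_tendsto_pos_mult_at_top[OF tendsto_const]
        filterlim_compose[OF ln_at_top filterlim_real_sequentially]) simp
    moreover have "eventually (\<lambda>T. exp ((1 - \<nu>) * ln (real T)) = real T powr (1 - \<nu>)) sequentially"
      using eventually_gt_at_top[of 0] by eventually_elim (simp add: powr_def)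
    ultimately show "filterlim (\<lambda>T. real T powr (1 - \<nu>)) at_top sequentially" by (simp add: filterlim_cong)
  qed simp
  then show "filterlim (\<lambda>T. b T * real T) at_top sequentially"
  proof (rule filterlim_at_top_mono)
    show "eventually (\<lambda>T. (1/2) * real T powr (1 - \<nu>) \<le> b T * real T) sequentially"
      using half
    proof eventually_elim
      case (elim T)
      then have "?g T / 2 * real T \<le> b T * real T" by (intro mult_right_mono) auto
      moreover have "real T powr (1 - \<nu>) = ?g T * real T"
        using elim powr_add[of "real T" "- \<nu>" 1] by simp
      ultimately show ?case by simp
    qed
  qed
qed

text \<open>The weight \<open>\<bar>j\<bar>\<close> is at least 1 except at \<open>j = 0\<close>,
  whose term is added separately.\<close>

lemma weighted_summable_imp_summable:
  fixes f g :: "int \<Rightarrow> real"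
  assumes "(\<lambda>j. \<bar>real_of_int j\<bar> * g j) summable_on UNIV" and fg: "\<And>j. 0 \<le> f j" "\<And>j. f j \<le> g j"
  shows "f summable_on UNIV"
proof (rule summable_on_comparison_test)
  have "(\<lambda>j::int. if j = 0 then g 0 else 0) summable_on UNIV"
    by (rule finite_nonzero_values_imp_summable_on) (rule finite_subset[of _ "{0}"], auto)
  then show "(\<lambda>j. \<bar>real_of_int j\<bar> * g j + (if j = 0 then g 0 else 0)) summable_on UNIV"
    by (intro summable_on_add assms(1))
  show "f j \<le> \<bar>real_of_int j\<bar> * g j + (if j = 0 then g 0 else 0)" for j
  proof (cases "j = 0")
    case False
    then have "1 \<le> \<bar>real_of_int j\<bar>" by linarith
    then have "1 * g j \<le> \<bar>real_of_int j\<bar> * g j" using order_trans[OF fg] by (rule mult_right_mono)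
    then show ?thesis using False fg(2)[of j] by simp
  qed (use fg in simp)
qed (rule fg)

lemma point_spectralI:
  assumes M: "prob_space M" and noise: "gaussian_white_noise M \<epsilon> C c" and X: "linear_process M A \<epsilon> X"
    and A: "(\<lambda>j. norm (A j)) summable_on UNIV" and W: "lag_window W w\<^sub>0 L"
    and b: "b \<longlonglongrightarrow> 0" "eventually (\<lambda>T. b T > 0) sequentially" "filterlim (\<lambda>T. b T * real T) at_top sequentially"
  shows "point_spectral M \<epsilon> A X W w\<^sub>0 L b"
proof -
  interpret point_process M X
    using M X by (simp add: point_process_def point_process_axioms_def linear_process_def)
  have "gaussian_noise M \<epsilon>"
    using M noise by (simp add: gaussian_noise_def gaussian_noise_axioms_def gaussian_white_noise_def)
  then have "linear_gaussian M \<epsilon> A (\<lambda>t \<omega>. abs_L2 (X t \<omega>))"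
    using X A measurable_X_L2 by (simp add: linear_gaussian_def linear_gaussian_axioms_def linear_process_def)
  then show ?thesis
    using W b point_process_axioms
    by (simp add: point_spectral_def spectral_consistency_def spectral_consistency_axioms_def)
qed

theorem proposition1:
  fixes M :: "'w measure"
    and \<epsilon> e :: "int \<Rightarrow> 'w \<Rightarrow> real_L2"
    and C\<^sub>\<epsilon> C\<^sub>e :: "real_L2 \<Rightarrow>\<^sub>L real_L2"
    and c\<^sub>\<epsilon> c\<^sub>e :: "real \<times> real \<Rightarrow> real"
    and A B :: "int \<Rightarrow> real_L2 \<Rightarrow>\<^sub>L real_L2"
    and X Y :: "int \<Rightarrow> 'w \<Rightarrow> real \<Rightarrow> real"
    and W :: "real \<Rightarrow> real"
    and b :: "nat \<Rightarrow> real"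
    and \<nu> :: real
    and \<Lambda> :: "real set"
  assumes "prob_space M"
    and "gaussian_white_noise M \<epsilon> C\<^sub>\<epsilon> c\<^sub>\<epsilon>"
    and "gaussian_white_noise M e C\<^sub>e c\<^sub>e"
    and "linear_process M A \<epsilon> X"
    and "linear_process M B e Y"
    and "independent_processes M X Y"
    and "A 0 = id_blinfun" and "B 0 = id_blinfun"
    and "(\<lambda>j::int. \<bar>real_of_int j\<bar> * (norm (A j) + norm (B j))) summable_on UNIV"
    and "1/4 < \<nu>" and "\<nu> < 1/2"
    and "b \<sim>[sequentially] (\<lambda>T. real T powr (- \<nu>))"
    and "bounded (range W)"
    and "\<forall>x. W (- x) = W x"
    and "\<forall>x. W x \<ge> 0"
    and "\<exists>L. L-lipschitz_on UNIV W"
    and "\<forall>x. x \<notin> {-pi<..pi} \<longrightarrow> W x = 0"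
    and "(LBINT x:{-pi..pi}. W x) = 2 * pi"
    and "\<Lambda> \<in> sets lebesgue" and "\<Lambda> \<subseteq> {0..pi}" and "emeasure lebesgue \<Lambda> > 0"
    and "\<forall>\<xi>\<in>\<Lambda>. spectral_density_op M X \<xi> \<noteq> spectral_density_op M Y \<xi>"
  defines "\<theta>\<^sub>0 \<equiv> scaling W (\<lambda>\<xi>. op_average (spectral_density_op M X \<xi>) (spectral_density_op M Y \<xi>))"
    and "t\<^sub>U \<equiv> \<lambda>T \<omega>. studentized_statistic W (b T) T (\<lambda>t. X t \<omega>) (\<lambda>t. Y t \<omega>)"
    and "drift \<equiv> \<lambda>T. sqrt (b T) * real T *
           integrated_hs_distance (spectral_density_op M X) (spectral_density_op M Y)"
  shows "small_o_prob M (\<lambda>T \<omega>. t\<^sub>U T \<omega> - drift T / \<theta>\<^sub>0) (\<lambda>T. sqrt (b T) * real T)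
       \<and> tends_to_infinity_prob M t\<^sub>U"
proof -
  note M = assms(1) and b = assms(12) and \<nu> = assms(10,11) and W = assms(13-18)
  obtain L where L: "L-lipschitz_on UNIV W" using W(4) by blast
  obtain w\<^sub>0 where w0: "\<And>x. norm (W x) \<le> w\<^sub>0" using W(1) by (auto simp: bounded_iff)
  have win: "lag_window W w\<^sub>0 L"
  proof
    show "W x \<le> w\<^sub>0" for x using w0[of x] by simp
  qed (use W L in auto)
  have lim: "b \<longlonglongrightarrow> 0" "eventually (\<lambda>T. b T > 0) sequentially" "filterlim (\<lambda>T. b T * real T) at_top sequentially"
    using bandwidth_limits[OF b] \<nu> by auto
  have A: "(\<lambda>j. norm (A j)) summable_on UNIV" and B: "(\<lambda>j. norm (B j)) summable_on UNIV"
    by (rule weighted_summable_imp_summable[OF assms(9)]; simp)+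
  interpret spectral_pair M \<epsilon> A X e B Y W w\<^sub>0 L b
    unfolding spectral_pair_def
    using point_spectralI[OF M assms(2) assms(4) A win lim] point_spectralI[OF M assms(3) assms(5) B win lim] by (rule conjI)
  have \<Lambda>: "\<Lambda> \<subseteq> {0..pi}" "emeasure lebesgue \<Lambda> > 0" and ne: "\<And>\<xi>. \<xi> \<in> \<Lambda> \<Longrightarrow> spectral_density_op M X \<xi> \<noteq> spectral_density_op M Y \<xi>"
    using assms(20-22) by auto
  have t: "t\<^sub>U = studentized" by (simp add: t\<^sub>U_def studentized_def fun_eq_iff)
  have r: "(\<lambda>T. sqrt (b T) * real T) = rate" by (simp add: rate_def fun_eq_iff)
  have d: "(\<lambda>T \<omega>. t\<^sub>U T \<omega> - drift T / \<theta>\<^sub>0) = remainder"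
    unfolding t drift_def \<theta>\<^sub>0_def limits_eq by (simp add: remainder_def rate_def fun_eq_iff)
  show ?thesis
    unfolding d r unfolding t
    using small_o_remainder[OF \<Lambda> ne] studentized_tends_to_infinity[OF \<Lambda> ne] by (rule conjI)
qed

end
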